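(* Let $c\ge0$, $s\in(0,1)$, $T>0$, and let $L$ be the generator of the nonlocal Ornstein–Uhlenbeck semigroup $P_t$ on $C_b(L^2(0,1))$ described in the context. For every $f\in C_b(L^2(0,1))$, $g\in C_b([0,T]\times L^2(0,1))$, let $v$ be the mild solution to $$v_t(t,x)=Lv(t,x)+g(t,x),\quad t\in[0,T],\ x\in L^2(0,1);\qquad v(0,\cdot)=f.$$ (i) If $f\in Z^2_b(L^2(0,1))$ and $g\in C_b([0,T]\times L^2(0,1))$, then $v\in Z^{0,2}_b([0,T]\times L^2(0,1))$, and there exists $C=C(T)>0$, independent of $f$ and $g$, such that $\|v\|_{Z^{0,2}_b([0,T]\times L^2(0,1))}\le C(\|f\|_{Z^2_b(L^2(0,1))}+\|g\|_\infty)$. (ii) If $\alpha\in(0,1)$ and $f\in C^{2+\alpha}_b(L^2(0,1))$, $g\in C^{0,\alpha}_b([0,T]\times L^2(0,1))$, then $v\in C^{0,2+\alpha}_b([0,T]\times L^2(0,1))$, and there exists $C=C(T,\alpha)>0$, independent of $f$ and $g$, such that $\|v\|_{C^{0,2+\alpha}_b([0,T]\times L^2(0,1))}\le C(\|f\|_{C^{2+\alpha}_b(L^2(0,1))}+\|g\|_{C^{0,\alpha}_b([0,T]\times L^2(0,1))})$.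
   Context: The semigroup. $X=L^2(0,1)$ (real, Lebesgue measure), $\Delta$ is the Laplace operator on $L^2(0,1)$ with Dirichlet boundary conditions and $e^{t\Delta}$ its semigroup. For $t\ge0$, $\mu_t$ is the Borel probability measure on $X$ with Fourier transform $$\hat\mu_t(x)=\int_Xe^{i\langle x,y\rangle}\mu_t(dy)=\exp\Big\{-\int_0^t\big(\|e^{r\Delta}x\|^2+c\|e^{r\Delta}x\|^{2s}\big)\,dr\Big\},\quad x\in X$$ (these measures exist, $\mu_0=\delta_0$, and $t\mapsto\mu_t$ is weakly continuous). The semigroup is $P_tf(x)=\int_Xf(e^{t\Delta}x+y)\,\mu_t(dy)$, and its generator $L$ is the unique closed operator in $C_b(X)$ with $R(\lambda,L)f(x)=\int_0^\infty e^{-\lambda t}P_tf(x)\,dt$, $\lambda>0$. The mild solution of the Cauchy problem is by definition $v(t,x)=P_tf(x)+\int_0^tP_{t-r}g(r,\cdot)(x)\,dr$. Function spaces. $C_b$: bounded continuous real functions, sup norm. $\mathcal{L}^n(X)$: continuous $n$-linear forms on $X^n$ with the usual norm. $C^n_b(X)$: $f\in C_b(X)$ that are $n$ times Gateaux differentiable at every point ($D^kf:X\to\mathcal{L}^k(X)$ being the Gateaux derivative of $D^{k-1}f:X\to\mathcal{L}^{k-1}(X)$) with $x\mapsto D^kf(x)(h_1,\dots,h_k)$ continuous and bounded for all $k\le n$, $h_i\in X$; norm $\|f\|_\infty+\sum_{k=1}^n\sup_x\|D^kf(x)\|_{\mathcal{L}^k(X)}$. For $\alpha\in(0,1)$ and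 $F$ from $X$ to a Banach space, $[F]_\alpha=\sup_{x,\,h\ne0}\|F(x+h)-F(x)\|/\|h\|^\alpha$; $C^\alpha_b(X)=\{f\in C_b(X):[f]_\alpha<\infty\}$ with norm $\|f\|_\infty+[f]_\alpha$; $C^{2+\alpha}_b(X)=\{f\in C^2_b(X):[D^2f]_\alpha<\infty\}$ with norm $\|f\|_{C^2_b}+[D^2f]_\alpha$. $Z^2_b(X)=\{f\in C^1_b(X):[Df]_{Z^1}<\infty\}$, where $[F]_{Z^1}=\sup_{x,\,h\ne0}\|F(x+2h)-2F(x+h)+F(x)\|/\|h\|$, with norm $\|f\|_{C^1_b}+[Df]_{Z^1}$. For $\gamma>0$, $C^{0,\gamma}_b([0,T]\times X)$: bounded continuous $g:[0,T]\times X\to\mathbb{R}$ with $g(t,\cdot)\in C^\gamma_b(X)$ for all $t$, norm $\sup_t\|g(t,\cdot)\|_{C^\gamma_b(X)}<\infty$, and, if $\gamma\ge1$, $(t,x)\mapsto\frac{\partial^kg}{\partial h_1\cdots\partial h_k}(t,x)$ continuous on $[0,T]\times X$ for all $k\le[\gamma]$, $h_i\in X$. $Z^{0,2}_b([0,T]\times X)$: $g\in C^{0,1}_b([0,T]\times X)$ with $g(t,\cdot)\in Z^2_b(X)$ for all $t$ and norm $\sup_t\|g(t,\cdot)\|_{Z^2_b(X)}<\infty$. *)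

theory Defs
  imports "HOL-Probability.Probability"
begin

section \<open>The Hilbert space of square integrable functions on the unit interval\<close>

abbreviation unit_leb :: "real measure" where
  "unit_leb \<equiv> lebesgue_on {0<..<1}"

definition square_integrable :: "(real \<Rightarrow> real) \<Rightarrow> bool" where
  "square_integrable f \<longleftrightarrow>
     f \<in> borel_measurable unit_leb \<and> integrable unit_leb (\<lambda>x. (f x)\<^sup>2)"

definition L2_eq :: "(real \<Rightarrow> real) \<Rightarrow> (real \<Rightarrow> real) \<Rightarrow> bool" where
  "L2_eq f g \<longleftrightarrow>
     square_integrable f \<and> square_integrable g \<and> (AE x in unit_leb. f x = g x)"

lemma square_integrable_measurable:
  "square_integrable f \<Longrightarrow> f \<in> borel_measurable unit_leb"
  by (simp add: square_integrable_def)

lemma square_integrable_zero: "square_integrable (\<lambda>x. 0)"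
  by (simp add: square_integrable_def)

lemma square_integrable_mult:
  assumes "square_integrable f" "square_integrable g"
  shows "integrable unit_leb (\<lambda>x. f x * g x)"
proof (rule Bochner_Integration.integrable_bound)
  show "integrable unit_leb (\<lambda>x. (f x)\<^sup>2 + (g x)\<^sup>2)"
    using assms by (simp add: square_integrable_def)
  show "(\<lambda>x. f x * g x) \<in> borel_measurable unit_leb"
    using assms unfolding square_integrable_def
    by (intro borel_measurable_times borel_measurable_add borel_measurable_const) auto
  show "AE x in unit_leb. norm (f x * g x) \<le> norm ((f x)\<^sup>2 + (g x)\<^sup>2)"
  proof (rule AE_I2)
    fix x
    have "2 * \<bar>f x\<bar> * \<bar>g x\<bar> \<le> (f x)\<^sup>2 + (g x)\<^sup>2"
      using sum_squares_bound[of "\<bar>f x\<bar>" "\<bar>g x\<bar>"] by simp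
    moreover have "0 \<le> \<bar>f x\<bar> * \<bar>g x\<bar>" by simp
    ultimately have "\<bar>f x\<bar> * \<bar>g x\<bar> \<le> (f x)\<^sup>2 + (g x)\<^sup>2"
      unfolding mult.assoc by linarith
    then show "norm (f x * g x) \<le> norm ((f x)\<^sup>2 + (g x)\<^sup>2)"
      by (simp add: abs_mult)
  qed
qed

lemma square_integrable_add:
  assumes "square_integrable f" "square_integrable g"
  shows "square_integrable (\<lambda>x. f x + g x)"
proof -
  have "integrable unit_leb (\<lambda>x. (f x)\<^sup>2 + (g x)\<^sup>2 + 2 * (f x * g x))"
    using assms square_integrable_mult[OF assms] by (simp add: square_integrable_def)
  moreover have "(\<lambda>x. f x + g x) \<in> borel_measurable unit_leb"
    using assms unfolding square_integrable_def
    by (intro borel_measurable_times borel_measurable_add borel_measurable_const) auto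
  ultimately show ?thesis
    by (simp add: square_integrable_def power2_sum algebra_simps)
qed

lemma square_integrable_scale:
  assumes "square_integrable f"
  shows "square_integrable (\<lambda>x. a * f x)"
proof -
  have "(\<lambda>x. a * f x) \<in> borel_measurable unit_leb"
    using assms unfolding square_integrable_def
    by (intro borel_measurable_times borel_measurable_add borel_measurable_const) auto
  then show ?thesis
    using assms by (simp add: square_integrable_def power_mult_distrib)
qed

lemma square_integrable_uminus:
  "square_integrable f \<Longrightarrow> square_integrable (\<lambda>x. - f x)"
  using square_integrable_scale[of f "-1"] by simp

lemma square_integrable_diff:
  "square_integrable f \<Longrightarrow> square_integrable g \<Longrightarrow> square_integrable (\<lambda>x. f x - g x)"
  using square_integrable_add[of f "\<lambda>x. - g x"] square_integrable_uminus[of g] by simp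

lemma part_equivp_L2_eq: "part_equivp L2_eq"
proof (rule part_equivpI)
  show "\<exists>f. L2_eq f f"
    using square_integrable_zero by (auto simp: L2_eq_def)
  show "symp L2_eq"
    by (rule sympI) (auto simp: L2_eq_def)
  show "transp L2_eq"
    by (rule transpI) (auto simp: L2_eq_def elim: AE_mp)
qed

quotient_type L2 = "real \<Rightarrow> real" / partial: L2_eq
  by (rule part_equivp_L2_eq)

instantiation L2 :: real_vector
begin

lift_definition zero_L2 :: L2 is "\<lambda>x. 0"
  by (simp add: L2_eq_def square_integrable_zero)

lift_definition plus_L2 :: "L2 \<Rightarrow> L2 \<Rightarrow> L2" is "\<lambda>f g x. f x + g x"
  by (auto simp: L2_eq_def square_integrable_add)

lift_definition uminus_L2 :: "L2 \<Rightarrow> L2" is "\<lambda>f x. - f x"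
  by (auto simp: L2_eq_def square_integrable_uminus)

lift_definition minus_L2 :: "L2 \<Rightarrow> L2 \<Rightarrow> L2" is "\<lambda>f g x. f x - g x"
  by (auto simp: L2_eq_def square_integrable_diff)

lift_definition scaleR_L2 :: "real \<Rightarrow> L2 \<Rightarrow> L2" is "\<lambda>a f x. a * f x"
  by (auto simp: L2_eq_def square_integrable_scale)

instance
proof
  fix a b :: real and x y z :: L2
  show "x + y + z = x + (y + z)"
    by transfer (auto simp: L2_eq_def algebra_simps intro!: square_integrable_add)
  show "x + y = y + x"
    by transfer (auto simp: L2_eq_def algebra_simps intro!: square_integrable_add)
  show "0 + x = x"
    by transfer (auto simp: L2_eq_def)
  show "- x + x = 0"
    by transfer (auto simp: L2_eq_def square_integrable_zero)
  show "x - y = x + - y"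
    by transfer (auto simp: L2_eq_def square_integrable_diff)
  show "a *\<^sub>R (x + y) = a *\<^sub>R x + a *\<^sub>R y"
    by transfer (auto simp: L2_eq_def algebra_simps
        intro!: square_integrable_add square_integrable_scale)
  show "(a + b) *\<^sub>R x = a *\<^sub>R x + b *\<^sub>R x"
    by transfer (auto simp: L2_eq_def distrib_right
        intro!: square_integrable_add square_integrable_scale)
  show "a *\<^sub>R b *\<^sub>R x = (a * b) *\<^sub>R x"
    by transfer (auto simp: L2_eq_def mult.assoc intro!: square_integrable_scale)
  show "1 *\<^sub>R x = x"
    by transfer (auto simp: L2_eq_def)
qed

end

instantiation L2 :: real_inner
begin

lift_definition inner_L2 :: "L2 \<Rightarrow> L2 \<Rightarrow> real" is "\<lambda>f g. \<integral>x. f x * g x \<partial>unit_leb"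
proof -
  fix f f' g g' assume "L2_eq f f'" "L2_eq g g'"
  then show "(\<integral>x. f x * g x \<partial>unit_leb) = (\<integral>x. f' x * g' x \<partial>unit_leb)"
    by (intro integral_cong_AE)
      (auto simp: L2_eq_def square_integrable_def)
qed

definition norm_L2 :: "L2 \<Rightarrow> real" where "norm_L2 x = sqrt (inner x x)"
definition dist_L2 :: "L2 \<Rightarrow> L2 \<Rightarrow> real" where "dist_L2 x y = norm (x - y)"
definition sgn_L2 :: "L2 \<Rightarrow> L2" where "sgn_L2 x = x /\<^sub>R norm x"
definition uniformity_L2 :: "(L2 \<times> L2) filter" where
  "uniformity_L2 = (INF e\<in>{0<..}. principal {(x, y). dist x y < e})"
definition open_L2 :: "L2 set \<Rightarrow> bool" where
  "open_L2 U \<longleftrightarrow> (\<forall>x\<in>U. eventually (\<lambda>(x', y). x' = x \<longrightarrow> y \<in> U) uniformity)"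

instance
proof
  fix a :: real and x y z :: L2 and U :: "L2 set"
  show "sgn x = x /\<^sub>R norm x" by (simp add: sgn_L2_def)
  show "dist x y = norm (x - y)" by (simp add: dist_L2_def)
  show "uniformity = (INF e\<in>{0<..}. principal {(x::L2, y). dist x y < e})"
    by (simp add: uniformity_L2_def)
  show "open U = (\<forall>x\<in>U. eventually (\<lambda>(x', y). x' = x \<longrightarrow> y \<in> U) uniformity)"
    by (simp add: open_L2_def)
  show "norm x = sqrt (inner x x)" by (simp add: norm_L2_def)
  show "inner x y = inner y x"
    by transfer (simp add: mult.commute)
  show "inner (x + y) z = inner x z + inner y z"
    by transfer (simp add: L2_eq_def distrib_right square_integrable_mult)
  show "inner (a *\<^sub>R x) y = a * inner x y"
    by transfer (simp add: mult.assoc)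
  show "0 \<le> inner x x"
    by transfer simp
  show "inner x x = 0 \<longleftrightarrow> x = 0"
  proof transfer
    fix f assume f: "L2_eq f f"
    then have int: "integrable unit_leb (\<lambda>x. f x * f x)"
      by (simp add: L2_eq_def square_integrable_mult)
    have "(\<integral>x. f x * f x \<partial>unit_leb) = 0 \<longleftrightarrow> (AE x in unit_leb. f x * f x = 0)"
      by (rule integral_nonneg_eq_0_iff_AE[OF int]) simp
    then show "(\<integral>x. f x * f x \<partial>unit_leb) = 0 \<longleftrightarrow> L2_eq f (\<lambda>x. 0)"
      using f by (simp add: L2_eq_def square_integrable_zero)
  qed
qed

end


lemma L2_cases: obtains f where "square_integrable f" "x = abs_L2 f"
proof -
  have "L2_eq (rep_L2 x) (rep_L2 x)" "abs_L2 (rep_L2 x) = x"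
    using Quotient3_rep_reflp[OF Quotient3_L2] Quotient3_abs_rep[OF Quotient3_L2] by auto
  then show ?thesis
    using that[of "rep_L2 x"] by (simp add: L2_eq_def)
qed

lemma norm_diff_abs_L2:
  assumes "square_integrable f" "square_integrable g"
  shows "(norm (abs_L2 f - abs_L2 g))\<^sup>2 = (\<integral>x. (f x - g x)\<^sup>2 \<partial>unit_leb)"
proof -
  have *: "L2_eq f f" "L2_eq g g" "L2_eq (\<lambda>x. f x - g x) (\<lambda>x. f x - g x)"
    using assms square_integrable_diff[OF assms] by (auto simp: L2_eq_def)
  have "(norm (abs_L2 f - abs_L2 g))\<^sup>2 = inner (abs_L2 f - abs_L2 g) (abs_L2 f - abs_L2 g)"
    by (simp add: power2_norm_eq_inner)
  also have "\<dots> = (\<integral>x. (f x - g x) * (f x - g x) \<partial>unit_leb)"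
    using * by (simp add: minus_L2.abs_eq inner_L2.abs_eq)
  finally show ?thesis by (simp add: power2_eq_square)
qed

lemma nn_integral_diff_abs_L2:
  assumes "square_integrable f" "square_integrable g"
  shows "(\<integral>\<^sup>+x. ennreal ((f x - g x)\<^sup>2) \<partial>unit_leb) = ennreal ((norm (abs_L2 f - abs_L2 g))\<^sup>2)"
  unfolding norm_diff_abs_L2[OF assms]
  by (rule nn_integral_eq_integral) (use square_integrable_diff[OF assms] in \<open>auto simp: square_integrable_def\<close>)

instance L2 :: complete_space
proof
  fix X :: "nat \<Rightarrow> L2" assume X: "Cauchy X"
  interpret finite_measure unit_leb
    by (rule finite_measureI, subst emeasure_restrict_space) auto
  have "\<exists>f. square_integrable f \<and> X n = abs_L2 f" for n
    by (rule L2_cases[of "X n"]) blast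
  then obtain f where f: "\<And>n. square_integrable (f n)" and Xf: "\<And>n. X n = abs_L2 (f n)"
    by metis
  have fm: "f n \<in> borel_measurable unit_leb" for n
    by (rule square_integrable_measurable[OF f])
  have sq_int: "integrable unit_leb g" if "square_integrable g" for g
    using that unfolding square_integrable_def
    by (elim conjE) (rule square_integrable_imp_integrable)
  have L1: "(\<integral>x. norm (g x) \<partial>unit_leb) \<le> e / 2 + (\<integral>x. (g x)\<^sup>2 \<partial>unit_leb) / (2 * e)"
    if g: "square_integrable g" and e: "0 < e" for g :: "real \<Rightarrow> real" and e
  proof -
    have "\<bar>g x\<bar> \<le> e / 2 + (g x)\<^sup>2 / (2 * e)" for x
    proof -
      have "2 * e * \<bar>g x\<bar> \<le> e\<^sup>2 + (g x)\<^sup>2"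
        using sum_squares_bound[of e "\<bar>g x\<bar>"] by simp
      then show ?thesis using e by (simp add: field_simps power2_eq_square)
    qed
    then have "(\<integral>x. norm (g x) \<partial>unit_leb) \<le> (\<integral>x. e / 2 + (g x)\<^sup>2 / (2 * e) \<partial>unit_leb)"
      using sq_int[OF g] g by (intro integral_mono) (auto simp: square_integrable_def)
    also have "\<dots> = e / 2 + (\<integral>x. (g x)\<^sup>2 \<partial>unit_leb) / (2 * e)"
      using g by (subst Bochner_Integration.integral_add)
        (auto simp: square_integrable_def measure_restrict_space)
    finally show ?thesis .
  qed
  have "\<exists>N. \<forall>i\<ge>N. \<forall>j\<ge>N. (LINT x|unit_leb. norm (f i x - f j x)) < e" if e: "0 < e" for e
  proof -
    obtain N where N: "\<And>i j. i \<ge> N \<Longrightarrow> j \<ge> N \<Longrightarrow> norm (X i - X j) < e"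
      using CauchyD[OF X e] by blast
    have "(LINT x|unit_leb. norm (f i x - f j x)) < e" if ij: "i \<ge> N" "j \<ge> N" for i j
    proof -
      have "(\<integral>x. (f i x - f j x)\<^sup>2 \<partial>unit_leb) = (norm (X i - X j))\<^sup>2"
        unfolding Xf by (rule norm_diff_abs_L2[OF f f, symmetric])
      also have "\<dots> < e\<^sup>2" using N[OF ij] by (intro power_strict_mono) auto
      finally have "(\<integral>x. (f i x - f j x)\<^sup>2 \<partial>unit_leb) / (2 * e) < e\<^sup>2 / (2 * e)"
        using e by (intro divide_strict_right_mono) auto
      also have "e\<^sup>2 / (2 * e) = e / 2" using e by (simp add: power2_eq_square)
      finally show ?thesis
        using L1[OF square_integrable_diff[OF f[of i] f[of j]] e] by simp
    qed
    then show ?thesis by blast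
  qed
  then obtain r :: "nat \<Rightarrow> nat" where r: "strict_mono r" and AEr: "AE x in unit_leb. Cauchy (\<lambda>i. f (r i) x)"
    by (rule cauchy_L1_AE_cauchy_subseq[of unit_leb f, OF sq_int[OF f]])
  define F where "F x = lim (\<lambda>i. f (r i) x)" for x
  have Fm: "F \<in> borel_measurable unit_leb"
    unfolding F_def by (rule borel_measurable_lim_metric) (rule fm)
  have bound: "\<exists>N. \<forall>n\<ge>N. (\<integral>\<^sup>+x. ennreal ((f n x - F x)\<^sup>2) \<partial>unit_leb) \<le> ennreal (e\<^sup>2)"
    if e: "0 < e" for e :: real
  proof -
    obtain N where N: "\<And>i j. i \<ge> N \<Longrightarrow> j \<ge> N \<Longrightarrow> norm (X i - X j) < e"
      using CauchyD[OF X e] by blast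
    have "(\<integral>\<^sup>+x. ennreal ((f n x - F x)\<^sup>2) \<partial>unit_leb) \<le> ennreal (e\<^sup>2)" if n: "n \<ge> N" for n
    proof -
      have "(\<integral>\<^sup>+x. ennreal ((f n x - F x)\<^sup>2) \<partial>unit_leb)
          = (\<integral>\<^sup>+x. liminf (\<lambda>i. ennreal ((f n x - f (r i) x)\<^sup>2)) \<partial>unit_leb)"
      proof (rule nn_integral_cong_AE, use AEr in eventually_elim)
        fix x assume "Cauchy (\<lambda>i. f (r i) x)"
        then have "(\<lambda>i. f (r i) x) \<longlonglongrightarrow> F x"
          unfolding F_def using Cauchy_convergent convergent_LIMSEQ_iff by blast
        then have "(\<lambda>i. ennreal ((f n x - f (r i) x)\<^sup>2)) \<longlonglongrightarrow> ennreal ((f n x - F x)\<^sup>2)"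
          by (intro tendsto_intros)
        then show "ennreal ((f n x - F x)\<^sup>2) = liminf (\<lambda>i. ennreal ((f n x - f (r i) x)\<^sup>2))"
          by (rule lim_imp_Liminf[OF sequentially_bot, symmetric])
      qed
      also have "\<dots> \<le> liminf (\<lambda>i. \<integral>\<^sup>+x. ennreal ((f n x - f (r i) x)\<^sup>2) \<partial>unit_leb)"
        using square_integrable_diff[OF f f]
        by (intro nn_integral_liminf) (auto simp: square_integrable_def)
      also have "\<dots> = liminf (\<lambda>i. ennreal ((norm (X n - X (r i)))\<^sup>2))"
        unfolding nn_integral_diff_abs_L2[OF f f] Xf ..
      also have "\<dots> \<le> liminf (\<lambda>i::nat. ennreal (e\<^sup>2))"
      proof (rule Liminf_mono, rule eventually_sequentiallyI[of N])
        fix i assume "N \<le> i"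
        then have "N \<le> r i" using seq_suble[OF r, of i] by simp
        then show "ennreal ((norm (X n - X (r i)))\<^sup>2) \<le> ennreal (e\<^sup>2)"
          using N[OF n] by (intro ennreal_leI power_mono) (auto simp: less_imp_le)
      qed
      also have "\<dots> = ennreal (e\<^sup>2)" by (simp add: Liminf_const)
      finally show ?thesis .
    qed
    then show ?thesis by blast
  qed
  have F: "square_integrable F"
  proof -
    obtain N where "(\<integral>\<^sup>+x. ennreal ((f N x - F x)\<^sup>2) \<partial>unit_leb) \<le> ennreal (1\<^sup>2)"
      using bound[of 1] by auto
    then have "(\<integral>\<^sup>+x. ennreal ((f N x - F x)\<^sup>2) \<partial>unit_leb) < \<infinity>"
      using le_less_trans ennreal_less_top by fastforce
    then have "square_integrable (\<lambda>x. f N x - F x)"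
      unfolding square_integrable_def using fm[of N] Fm
      by (auto intro!: integrableI_nonneg borel_measurable_diff borel_measurable_power)
    then have "square_integrable (\<lambda>x. f N x - (f N x - F x))"
      by (rule square_integrable_diff[OF f])
    moreover have "(\<lambda>x. f N x - (f N x - F x)) = F"
      by (rule ext) linarith
    ultimately show ?thesis by (simp only:)
  qed
  have "X \<longlonglongrightarrow> abs_L2 F"
  proof (rule LIMSEQ_I)
    fix e :: real assume e: "0 < e"
    then obtain N where N: "\<forall>n\<ge>N. (\<integral>\<^sup>+x. ennreal ((f n x - F x)\<^sup>2) \<partial>unit_leb) \<le> ennreal ((e / 2)\<^sup>2)"
      using bound[of "e / 2"] by auto
    have "norm (X n - abs_L2 F) < e" if "n \<ge> N" for n
    proof -
      have "(norm (X n - abs_L2 F))\<^sup>2 \<le> (e / 2)\<^sup>2"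
        using N that unfolding nn_integral_diff_abs_L2[OF f F] Xf
        by (simp add: ennreal_le_iff)
      then have "norm (X n - abs_L2 F) \<le> e / 2"
        by (rule power2_le_imp_le) (use e in simp)
      then show ?thesis using e by simp
    qed
    then show "\<exists>N. \<forall>n\<ge>N. norm (X n - abs_L2 F) < e" by blast
  qed
  then show "convergent X" by (rule convergentI)
qed

instance L2 :: banach ..


section \<open>The heat semigroup\<close>

definition C0_semigroup :: "(real \<Rightarrow> 'a::real_normed_vector \<Rightarrow>\<^sub>L 'a) \<Rightarrow> bool" where
  "C0_semigroup S \<longleftrightarrow>
     S 0 = id_blinfun \<and>
     (\<forall>t\<ge>0. \<forall>r\<ge>0. S (t + r) = S t o\<^sub>L S r) \<and>
     (\<forall>x. ((\<lambda>t. S t x) \<longlongrightarrow> x) (at_right 0))"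

text \<open>Unbounded operators are represented by their graphs.\<close>

definition semigroup_generator ::
    "(real \<Rightarrow> 'a::real_normed_vector \<Rightarrow>\<^sub>L 'a) \<Rightarrow> ('a \<times> 'a) set" where
  "semigroup_generator S = {(x, y). ((\<lambda>t. (S t x - x) /\<^sub>R t) \<longlongrightarrow> y) (at_right 0)}"

text \<open>
  In dimension one, \<open>u\<close> belongs to \<open>H\<^sup>2(0,1)\<close> with \<open>u'' = w\<close> iff it has a representative \<open>U\<close>
  that is continuously differentiable on \<open>[0,1]\<close> and whose derivative is a primitive of \<open>w\<close>;
  then \<open>u\<close> belongs to \<open>H\<^sup>1\<^sub>0(0,1)\<close> iff \<open>U\<close> vanishes at \<open>0\<close> and \<open>1\<close>. The domain below is thus
  \<open>H\<^sup>2(0,1) \<inter> H\<^sup>1\<^sub>0(0,1)\<close>.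
\<close>

definition dirichlet_laplacian :: "(L2 \<times> L2) set" where
  "dirichlet_laplacian = {(u, w). \<exists>U U'.
     (AE x in unit_leb. rep_L2 u x = U x) \<and>
     (\<forall>x\<in>{0..1}. (U has_real_derivative U' x) (at x within {0..1})) \<and>
     (\<forall>x\<in>{0..1}. U' x = U' 0 + (LINT y:{0<..<x}|lebesgue. rep_L2 w y)) \<and>
     U 0 = 0 \<and> U 1 = 0}"


section \<open>Transition semigroup, generator and mild solutions\<close>

definition mehler ::
    "(real \<Rightarrow> 'a \<Rightarrow>\<^sub>L 'a) \<Rightarrow> (real \<Rightarrow> 'a measure) \<Rightarrow> real \<Rightarrow> ('a \<Rightarrow> real) \<Rightarrow>
     'a::real_normed_vector \<Rightarrow> real" where
  "mehler S \<mu> t f x = (\<integral>y. f (S t x + y) \<partial>\<mu> t)"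

text \<open>
  \<open>L\<close> is the graph of a closed linear operator in the Banach space of bounded continuous
  functions such that, for every \<open>\<rho> > 0\<close>, the operator \<open>\<rho> - L\<close> is surjective and has the
  Laplace transform of \<open>P\<close> at \<open>\<rho>\<close> as left inverse, i.e. \<open>R(\<rho>, L)\<close> is this Laplace transform.
\<close>

definition is_generator ::
    "(real \<Rightarrow> ('a \<Rightarrow> real) \<Rightarrow> 'a \<Rightarrow> real) \<Rightarrow>
     (('a::topological_space \<Rightarrow>\<^sub>C real) \<times> ('a \<Rightarrow>\<^sub>C real)) set \<Rightarrow> bool" where
  "is_generator P L \<longleftrightarrow>
     subspace L \<and> single_valued L \<and> closed L \<and>
     (\<forall>\<rho>>0. (\<forall>f. \<exists>(u, w)\<in>L. \<rho> *\<^sub>R u - w = f) \<and>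
            (\<forall>(u, w)\<in>L. \<forall>x.
               apply_bcontfun u x = (LINT t:{0..}|lborel. exp (- \<rho> * t) * P t (apply_bcontfun (\<rho> *\<^sub>R u - w)) x)))"

definition mild_solution ::
    "(real \<Rightarrow> ('a \<Rightarrow> real) \<Rightarrow> 'a \<Rightarrow> real) \<Rightarrow> real \<Rightarrow> ('a \<Rightarrow> real) \<Rightarrow>
     (real \<Rightarrow> 'a \<Rightarrow> real) \<Rightarrow> (real \<Rightarrow> 'a \<Rightarrow> real) \<Rightarrow> bool" where
  "mild_solution P T f g v \<longleftrightarrow>
     (\<forall>t\<in>{0..T}. \<forall>x. v t x = P t f x + (LINT r:{0..t}|lborel. P (t - r) (g r) x))"


section \<open>Function spaces\<close>

definition has_gateaux_derivative ::
    "('a::real_normed_vector \<Rightarrow> 'b::real_normed_vector) \<Rightarrow> ('a \<Rightarrow>\<^sub>L 'b) \<Rightarrow> 'a \<Rightarrow> bool" where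
  "has_gateaux_derivative F A x \<longleftrightarrow>
     (\<forall>h. ((\<lambda>t. F (x + t *\<^sub>R h)) has_vector_derivative A h) (at 0))"

definition gateaux_differentiable ::
    "('a::real_normed_vector \<Rightarrow> 'b::real_normed_vector) \<Rightarrow> 'a \<Rightarrow> bool" where
  "gateaux_differentiable F x \<longleftrightarrow> (\<exists>A. has_gateaux_derivative F A x)"

definition gateaux_deriv ::
    "('a::real_normed_vector \<Rightarrow> 'b::real_normed_vector) \<Rightarrow> 'a \<Rightarrow> ('a \<Rightarrow>\<^sub>L 'b)" where
  "gateaux_deriv F x = (THE A. has_gateaux_derivative F A x)"

text \<open>
  The second derivative takes values in \<open>'a \<Rightarrow>\<^sub>L ('a \<Rightarrow>\<^sub>L real)\<close>, which is isometric to the space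
  of continuous bilinear forms.
\<close>

abbreviation gateaux_deriv2 ::
    "('a::real_normed_vector \<Rightarrow> real) \<Rightarrow> 'a \<Rightarrow> ('a \<Rightarrow>\<^sub>L ('a \<Rightarrow>\<^sub>L real))" where
  "gateaux_deriv2 f \<equiv> gateaux_deriv (gateaux_deriv f)"

text \<open>
  Norms and seminorms take values in the extended nonnegative reals, so that they are meaningful
  for arbitrary functions and finiteness is an explicit condition.
\<close>

definition sup_norm :: "('a \<Rightarrow> 'b::real_normed_vector) \<Rightarrow> ennreal" where
  "sup_norm F = (SUP x. ennreal (norm (F x)))"

definition holder_seminorm ::
    "real \<Rightarrow> ('a::real_normed_vector \<Rightarrow> 'b::real_normed_vector) \<Rightarrow> ennreal" where
  "holder_seminorm \<alpha> F =
     (SUP x. SUP h\<in>- {0}. ennreal (norm (F (x + h) - F x) / norm h powr \<alpha>))"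

definition zygmund_seminorm ::
    "('a::real_normed_vector \<Rightarrow> 'b::real_normed_vector) \<Rightarrow> ennreal" where
  "zygmund_seminorm F =
     (SUP x. SUP h\<in>- {0}.
        ennreal (norm (F (x + 2 *\<^sub>R h) - 2 *\<^sub>R F (x + h) + F x) / norm h))"

definition C1b :: "('a::real_normed_vector \<Rightarrow> real) set" where
  "C1b = {f \<in> bcontfun. (\<forall>x. gateaux_differentiable f x) \<and>
            (\<forall>h. (\<lambda>x. gateaux_deriv f x h) \<in> bcontfun)}"

definition norm_C1b :: "('a::real_normed_vector \<Rightarrow> real) \<Rightarrow> ennreal" where
  "norm_C1b f = sup_norm f + sup_norm (gateaux_deriv f)"

definition C2b :: "('a::real_normed_vector \<Rightarrow> real) set" where
  "C2b = {f \<in> C1b. (\<forall>x. gateaux_differentiable (gateaux_deriv f) x) \<and>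
            (\<forall>h k. (\<lambda>x. gateaux_deriv2 f x h k) \<in> bcontfun)}"

definition norm_C2b :: "('a::real_normed_vector \<Rightarrow> real) \<Rightarrow> ennreal" where
  "norm_C2b f = sup_norm f + sup_norm (gateaux_deriv f) + sup_norm (gateaux_deriv2 f)"

definition holder_space :: "real \<Rightarrow> ('a::real_normed_vector \<Rightarrow> real) set" where
  "holder_space \<alpha> = {f \<in> bcontfun. holder_seminorm \<alpha> f < \<infinity>}"

definition norm_holder :: "real \<Rightarrow> ('a::real_normed_vector \<Rightarrow> real) \<Rightarrow> ennreal" where
  "norm_holder \<alpha> f = sup_norm f + holder_seminorm \<alpha> f"

definition C2_holder_space :: "real \<Rightarrow> ('a::real_normed_vector \<Rightarrow> real) set" where
  "C2_holder_space \<alpha> = {f \<in> C2b. holder_seminorm \<alpha> (gateaux_deriv2 f) < \<infinity>}"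

definition norm_C2_holder :: "real \<Rightarrow> ('a::real_normed_vector \<Rightarrow> real) \<Rightarrow> ennreal" where
  "norm_C2_holder \<alpha> f = norm_C2b f + holder_seminorm \<alpha> (gateaux_deriv2 f)"

definition Z2b :: "('a::real_normed_vector \<Rightarrow> real) set" where
  "Z2b = {f \<in> C1b. zygmund_seminorm (gateaux_deriv f) < \<infinity>}"

definition norm_Z2b :: "('a::real_normed_vector \<Rightarrow> real) \<Rightarrow> ennreal" where
  "norm_Z2b f = norm_C1b f + zygmund_seminorm (gateaux_deriv f)"

text \<open>
  Functions on \<open>[0,T] \<times> X\<close> are curried and defined for all real times; only their values at times
  in \<open>[0,T]\<close> are relevant.
\<close>

definition Cb_time :: "real \<Rightarrow> (real \<Rightarrow> 'a::real_normed_vector \<Rightarrow> real) set" where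
  "Cb_time T = {g. continuous_on ({0..T} \<times> UNIV) (\<lambda>(t, x). g t x) \<and>
                   bounded ((\<lambda>(t, x). g t x) ` ({0..T} \<times> UNIV))}"

definition time_sup_norm :: "(('a \<Rightarrow> real) \<Rightarrow> ennreal) \<Rightarrow> real \<Rightarrow> (real \<Rightarrow> 'a \<Rightarrow> real) \<Rightarrow> ennreal" where
  "time_sup_norm N T g = (SUP t\<in>{0..T}. N (g t))"

definition holder_time :: "real \<Rightarrow> real \<Rightarrow> (real \<Rightarrow> 'a::real_normed_vector \<Rightarrow> real) set" where
  "holder_time \<alpha> T = {g \<in> Cb_time T. (\<forall>t\<in>{0..T}. g t \<in> holder_space \<alpha>) \<and>
     time_sup_norm (norm_holder \<alpha>) T g < \<infinity>}"

definition C1b_time :: "real \<Rightarrow> (real \<Rightarrow> 'a::real_normed_vector \<Rightarrow> real) set" where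
  "C1b_time T = {g \<in> Cb_time T. (\<forall>t\<in>{0..T}. g t \<in> C1b) \<and>
     time_sup_norm norm_C1b T g < \<infinity> \<and>
     (\<forall>h. continuous_on ({0..T} \<times> UNIV) (\<lambda>(t, x). gateaux_deriv (g t) x h))}"

definition C2_holder_time :: "real \<Rightarrow> real \<Rightarrow> (real \<Rightarrow> 'a::real_normed_vector \<Rightarrow> real) set" where
  "C2_holder_time \<alpha> T = {g \<in> Cb_time T. (\<forall>t\<in>{0..T}. g t \<in> C2_holder_space \<alpha>) \<and>
     time_sup_norm (norm_C2_holder \<alpha>) T g < \<infinity> \<and>
     (\<forall>h. continuous_on ({0..T} \<times> UNIV) (\<lambda>(t, x). gateaux_deriv (g t) x h)) \<and>
     (\<forall>h k. continuous_on ({0..T} \<times> UNIV) (\<lambda>(t, x). gateaux_deriv2 (g t) x h k))}"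

definition Z2b_time :: "real \<Rightarrow> (real \<Rightarrow> 'a::real_normed_vector \<Rightarrow> real) set" where
  "Z2b_time T = {g \<in> C1b_time T. (\<forall>t\<in>{0..T}. g t \<in> Z2b) \<and>
     time_sup_norm norm_Z2b T g < \<infinity>}"

end

theory Submission
  imports Defs
begin

text \<open>
  The idea is to replace Gateaux derivatives by difference operators. Since \<open>S t\<close> is a symmetric
  contraction semigroup, \<open>S t h\<close> lies in the Cameron-Martin space of the Gaussian part of
  \<open>\<mu> t\<close> with norm of order \<open>norm h / sqrt t\<close>. No Gaussian factorisation of \<open>\<mu> t\<close> is needed: the
  Cauchy-Schwarz inequality for the positive definite function \<open>\<phi> t\<close>, applied after splitting off a
  Gaussian kernel in the direction \<open>S t h\<close>, bounds the shift by \<open>S t h\<close> on trigonometric polynomials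
  in \<open>L\<^sup>2(\<mu> t)\<close>, and these are dense. Hence first differences of \<open>P t f\<close> are at most a constant times
  \<open>norm h / sqrt t * sup \<bar>f\<bar>\<close>. The semigroup law iterates this to second and third differences (with
  factors \<open>1 / t\<close> and \<open>t powr (- 3 / 2)\<close>), averaging over translates gains \<open>t powr (\<alpha> / 2)\<close> for
  \<open>\<alpha>\<close>-Hoelder \<open>f\<close>, and bounds on differences of one order higher produce the derivatives. In the
  Duhamel integral the derivative estimates are integrated in time, the integral being split at time
  \<open>(norm h)\<^sup>2\<close> for the Zygmund and Hoelder seminorms.
\<close>

section \<open>Positive semidefinite kernels\<close>

text \<open>The measures enter only through their transform \<open>\<phi>\<close>; the convolution
  law and the continuity in time are derived from it. In infinite dimension pointwise convergence of
  \<open>\<phi>\<close> does not imply weak convergence, so a separate tightness argument is needed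
  before anything can be said about continuity in time. Separability of \<open>L2\<close> enters
  there, in the density of trigonometric polynomials and in the product Borel sets. Bounded and
  Hoelder sources are the cases \<alpha> = 0 and \<alpha> > 0 of one hypothesis,
  \<open>smoothing\<close>, with rate t powr ((\<alpha> - 1) / 2) for first differences; each
  further difference costs a factor 1 / sqrt t. Second derivatives of the Duhamel integrand are then
  of order \<tau> powr ((\<alpha> - 2) / 2), integrable at 0 exactly for \<alpha> > 0, which is why
  (i) stops at the Zygmund class. Derivatives under an integral are integrated direction by
  direction, since a map into the dual space need not be strongly measurable. The constants are not
  optimised: 3 for one difference of bounded data, 8 for the Hoelder averaging, 96 and 3072 from
  composing such bounds over half times.\<close>

definition psd_on :: "'i set \<Rightarrow> ('i \<Rightarrow> 'i \<Rightarrow> real) \<Rightarrow> bool" where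
  "psd_on I A \<longleftrightarrow> (\<forall>i\<in>I. \<forall>j\<in>I. A i j = A j i) \<and> (\<forall>c. 0 \<le> (\<Sum>i\<in>I. \<Sum>j\<in>I. c i * c j * A i j))"

lemma psd_onD:
  assumes "psd_on I A"
  shows "i \<in> I \<Longrightarrow> j \<in> I \<Longrightarrow> A i j = A j i" "0 \<le> (\<Sum>i\<in>I. \<Sum>j\<in>I. c i * c j * A i j)"
  using assms by (auto simp: psd_on_def)

text \<open>The form is expanded with the value t at the extra index, which leaves a quadratic
  polynomial in t. Its sign for all t yields both the elimination step of the Gram factorisation and
  the Cauchy-Schwarz inequality below.\<close>

lemma psd_on_insert_quadratic:
  fixes A :: "'i \<Rightarrow> 'i \<Rightarrow> real"
  assumes I: "finite I" "a \<notin> I" and A: "psd_on (insert a I) A"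
  shows "0 \<le> t\<^sup>2 * A a a + 2 * t * (\<Sum>j\<in>I. c j * A a j) + (\<Sum>i\<in>I. \<Sum>j\<in>I. c i * c j * A i j)"
proof -
  define d where "d = c(a := t)"
  have d: "d i = c i" if "i \<in> I" for i using that I by (auto simp: d_def)
  have da: "d a = t" by (simp add: d_def)
  have sym: "A j a = A a j" if "j \<in> I" for j using psd_onD(1)[OF A] that by auto
  have "0 \<le> (\<Sum>i\<in>insert a I. \<Sum>j\<in>insert a I. d i * d j * A i j)" by (rule psd_onD(2)[OF A])
  also have "\<dots> = (d a * d a * A a a + (\<Sum>j\<in>I. d a * d j * A a j))
      + (\<Sum>i\<in>I. (d i * d a * A i a + (\<Sum>j\<in>I. d i * d j * A i j)))"
    using I by simp
  also have "\<dots> = (t * t * A a a + (\<Sum>j\<in>I. t * c j * A a j))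
      + (\<Sum>i\<in>I. (t * c i * A a i + (\<Sum>j\<in>I. c i * c j * A i j)))"
    using d da sym by (simp add: mult.commute)
  also have "\<dots> = t\<^sup>2 * A a a + 2 * t * (\<Sum>j\<in>I. c j * A a j) + (\<Sum>i\<in>I. \<Sum>j\<in>I. c i * c j * A i j)"
    by (simp add: sum.distrib sum_distrib_left power2_eq_square algebra_simps)
  finally show ?thesis .
qed

lemma psd_on_subset_insert:
  assumes I: "finite I" "a \<notin> I" and A: "psd_on (insert a I) A"
  shows "psd_on I A"
  unfolding psd_on_def
proof (intro conjI allI ballI)
  fix c show "0 \<le> (\<Sum>i\<in>I. \<Sum>j\<in>I. c i * c j * A i j)"
    using psd_on_insert_quadratic[OF assms, of 0 c] by simp
qed (use psd_onD(1)[OF A] in auto)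

text \<open>Cholesky elimination: each induction step splits off the rank one kernel of the pivot a,
  and the Schur complement stays positive semidefinite. A vanishing pivot forces its whole row to
  vanish. The factorisation serves to prove the Schur product theorem.\<close>

lemma psd_on_gram:
  assumes "finite I" "psd_on I A"
  shows "\<exists>m v. \<forall>i\<in>I. \<forall>j\<in>I. A i j = (\<Sum>l<(m::nat). v l i * v l j)"
  using assms
proof (induction I arbitrary: A rule: finite_induct)
  case empty
  then show ?case by auto
next
  case (insert a I)
  note q = psd_on_insert_quadratic[OF insert.hyps(1,2) insert.prems]
  note psdI = psd_on_subset_insert[OF insert.hyps(1,2) insert.prems]
  have sym: "A i j = A j i" if "i \<in> insert a I" "j \<in> insert a I" for i j
    using psd_onD(1)[OF insert.prems] that by blast
  have Aaa: "0 \<le> A a a" using q[of 1 "\<lambda>_. 0"] by simp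
  have zero: "A a j = 0" if 0: "A a a = 0" and j: "j \<in> I" for j
  proof (rule ccontr)
    assume nz: "A a j \<noteq> 0"
    have "0 \<le> 2 * t * A a j + A j j" for t
    proof -
      have e: "(\<Sum>k\<in>I. (if k = j then 1 else 0) * f k) = f j" for f :: "_ \<Rightarrow> real"
        using j insert.hyps(1) by (simp add: if_distrib[of "\<lambda>x. x * _"] cong: if_cong)
      show ?thesis
        using q[of t "\<lambda>i. if i = j then 1 else 0"] unfolding mult.assoc sum_distrib_left[symmetric] e
        by (simp add: 0)
    qed
    \<comment> \<open>An affine function of t with nonzero slope cannot be nonnegative everywhere;
      at this t it equals -1.\<close>
    from this[of "- (A j j + 1) / (2 * A a j)"] nz show False by (simp add: field_simps)
  qed
  \<comment> \<open>Schur complement of the pivot. If the pivot is zero, division by zero makes the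
    correction vanish and B is A.\<close>
  define B where "B i j = A i j - A a i * A a j / A a a" for i j
  have "psd_on I B"
    unfolding psd_on_def
  proof (intro conjI allI ballI)
    fix i j assume "i \<in> I" "j \<in> I" then show "B i j = B j i" using sym by (simp add: B_def mult.commute)
  next
    fix c
    show "0 \<le> (\<Sum>i\<in>I. \<Sum>j\<in>I. c i * c j * B i j)"
    proof (cases "A a a = 0")
      case True
      then show ?thesis using psd_onD(2)[OF psdI, of c] by (simp add: B_def)
    next
      case False
      define s where "s = (\<Sum>j\<in>I. c j * A a j)"
      have ss: "(\<Sum>i\<in>I. \<Sum>j\<in>I. c i * c j * (A a i * A a j / A a a)) = s * s / A a a"
        unfolding s_def sum_product sum_divide_distrib by (simp add: algebra_simps)
      \<comment> \<open>The quadratic polynomial is evaluated at its minimiser t = - s / A a a,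
        where it equals the form of B.\<close>
      have "0 \<le> (- s / A a a)\<^sup>2 * A a a + 2 * (- s / A a a) * s + (\<Sum>i\<in>I. \<Sum>j\<in>I. c i * c j * A i j)"
        unfolding s_def by (rule q)
      also have "(- s / A a a)\<^sup>2 * A a a + 2 * (- s / A a a) * s = - (s * s / A a a)"
        using False by (simp add: field_simps power2_eq_square)
      finally show ?thesis
        using ss by (simp add: B_def right_diff_distrib sum_subtractf)
    qed
  qed
  from insert.IH[OF this] obtain m :: nat and v where v: "\<And>i j. i \<in> I \<Longrightarrow> j \<in> I \<Longrightarrow> B i j = (\<Sum>l<m. v l i * v l j)"
    by blast
  \<comment> \<open>The old vectors are extended by 0 at a, and one new vector carries the row of
    the pivot. For a zero pivot the new vector is zero, again by division by zero.\<close>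
  define w where "w l i = (if l < m then if i = a then 0 else v l i else A a i / sqrt (A a a))" for l i
  have w: "(\<Sum>l<Suc m. w l i * w l j) = (\<Sum>l<m. w l i * w l j) + A a i * A a j / A a a" for i j
    using Aaa by (simp add: w_def)
  have "A i j = (\<Sum>l<Suc m. w l i * w l j)" if ij: "i \<in> insert a I" "j \<in> insert a I" for i j
  proof (cases "i = a \<or> j = a")
    case True
    then have "(\<Sum>l<m. w l i * w l j) = 0" by (auto simp: w_def)
    moreover have "A i j = A a i * A a j / A a a"
    proof (cases "A a a = 0")
      case t: True
      then have "A i j = 0" using zero[OF t] True ij sym by (metis insertE)
      then show ?thesis using t by simp
    next
      case False
      then show ?thesis using True ij sym[of i j] by (auto simp: mult.commute)
    qed
    ultimately show ?thesis unfolding w by simp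
  next
    case False
    then have "i \<in> I" "j \<in> I" using ij by auto
    from v[OF this] have "(\<Sum>l<m. w l i * w l j) = B i j" using False by (simp add: w_def)
    then show ?thesis unfolding w B_def by simp
  qed
  then show ?case by blast
qed

lemma psd_on_gramI: "psd_on I (\<lambda>i j. \<Sum>l<(m::nat). v l i * v l j)"
proof -
  have "(\<Sum>i\<in>I. \<Sum>j\<in>I. c i * c j * (\<Sum>l<m. v l i * v l j)) = (\<Sum>l<m. (\<Sum>i\<in>I. c i * v l i)\<^sup>2)" for c
  proof -
    have "(\<Sum>i\<in>I. \<Sum>j\<in>I. c i * c j * (\<Sum>l<m. v l i * v l j))
      = (\<Sum>i\<in>I. \<Sum>j\<in>I. \<Sum>l<m. (c i * v l i) * (c j * v l j))"
      by (simp add: sum_distrib_left algebra_simps)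
    also have "\<dots> = (\<Sum>l<m. \<Sum>i\<in>I. \<Sum>j\<in>I. (c i * v l i) * (c j * v l j))"
      by (subst (2) sum.swap, subst sum.swap) (rule refl)
    finally show ?thesis by (simp add: power2_eq_square sum_product)
  qed
  then show ?thesis unfolding psd_on_def by (auto simp: mult.commute sum_nonneg)
qed

text \<open>Schur product theorem. With A written as a Gram kernel, the form of the product at c is
  the sum over l of the forms of B at the coefficients c i * v l i.\<close>

lemma psd_on_mult:
  assumes I: "finite I" and A: "psd_on I A" and B: "psd_on I B"
  shows "psd_on I (\<lambda>i j. A i j * B i j)"
  unfolding psd_on_def
proof (intro conjI allI ballI)
  fix i j assume "i \<in> I" "j \<in> I"
  then show "A i j * B i j = A j i * B j i" using psd_onD(1)[OF A] psd_onD(1)[OF B] by metis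
next
  fix c
  obtain m :: nat and v where v: "\<And>i j. i \<in> I \<Longrightarrow> j \<in> I \<Longrightarrow> A i j = (\<Sum>l<m. v l i * v l j)"
    using psd_on_gram[OF I A] by blast
  have "(\<Sum>i\<in>I. \<Sum>j\<in>I. c i * c j * (A i j * B i j))
     = (\<Sum>i\<in>I. \<Sum>j\<in>I. \<Sum>l<m. (c i * v l i) * (c j * v l j) * B i j)"
    by (intro sum.cong refl) (simp add: v sum_distrib_left sum_distrib_right algebra_simps)
  also have "\<dots> = (\<Sum>l<m. \<Sum>i\<in>I. \<Sum>j\<in>I. (c i * v l i) * (c j * v l j) * B i j)"
    by (subst (2) sum.swap, subst sum.swap) (rule refl)
  also have "0 \<le> \<dots>" by (intro sum_nonneg psd_onD(2)[OF B])
  finally show "0 \<le> (\<Sum>i\<in>I. \<Sum>j\<in>I. c i * c j * (A i j * B i j))" .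
qed

lemma psd_on_rank1: "psd_on I (\<lambda>i j. f i * f j)"
  using psd_on_gramI[of I "\<lambda>_::nat. f" 1] by simp

lemma psd_on_power: "finite I \<Longrightarrow> psd_on I A \<Longrightarrow> psd_on I (\<lambda>i j. A i j ^ n)"
proof (induction n)
  case 0 then show ?case using psd_on_rank1[of I "\<lambda>_. 1"] by simp
next
  case (Suc n) then show ?case by (simp add: psd_on_mult)
qed

lemma psd_on_cmult: "0 \<le> a \<Longrightarrow> psd_on I A \<Longrightarrow> psd_on I (\<lambda>i j. a * A i j)"
  unfolding psd_on_def
  by (auto simp: mult.left_commute[of _ a] sum_distrib_left[symmetric])

lemma psd_on_sum: "(\<And>l. l \<in> L \<Longrightarrow> psd_on I (A l)) \<Longrightarrow> psd_on I (\<lambda>i j. \<Sum>l\<in>L. A l i j)"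
  unfolding psd_on_def
proof (intro conjI allI ballI, goal_cases)
  case (1 i j) then show ?case by (intro sum.cong) auto
next
  case (2 c)
  have "(\<Sum>i\<in>I. \<Sum>j\<in>I. c i * c j * (\<Sum>l\<in>L. A l i j)) = (\<Sum>l\<in>L. \<Sum>i\<in>I. \<Sum>j\<in>I. c i * c j * A l i j)"
    unfolding sum_distrib_left by (subst (2) sum.swap, subst sum.swap) (rule refl)
  moreover have "0 \<le> (\<Sum>i\<in>I. \<Sum>j\<in>I. c i * c j * A l i j)" if "l \<in> L" for l
    using 2[OF that] by blast
  ultimately show ?case by (simp add: sum_nonneg)
qed

text \<open>The exponential series has nonnegative coefficients and its powers are Schur products,
  so the partial sums are positive semidefinite, and the form depends continuously on the entries of
  the kernel.\<close>

lemma psd_on_exp: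
  assumes I: "finite I" and A: "psd_on I A"
  shows "psd_on I (\<lambda>i j. exp (A i j))"
  unfolding psd_on_def
proof (intro conjI allI ballI)
  fix i j assume "i \<in> I" "j \<in> I" then show "exp (A i j) = exp (A j i)" using psd_onD(1)[OF A] by metis
next
  fix c
  have "(\<lambda>N. \<Sum>i\<in>I. \<Sum>j\<in>I. c i * c j * (\<Sum>n<N. (1 / fact n) * A i j ^ n)) \<longlonglongrightarrow> (\<Sum>i\<in>I. \<Sum>j\<in>I. c i * c j * exp (A i j))"
    using exp_converges[where 'a=real]
    by (intro tendsto_sum tendsto_mult tendsto_const) (simp add: sums_def divide_inverse)
  moreover have "0 \<le> (\<Sum>i\<in>I. \<Sum>j\<in>I. c i * c j * (\<Sum>n<N. (1 / fact n) * A i j ^ n))" for N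
    by (rule psd_onD(2), rule psd_on_sum, rule psd_on_cmult) (auto intro: psd_on_power I A)
  ultimately show "0 \<le> (\<Sum>i\<in>I. \<Sum>j\<in>I. c i * c j * exp (A i j))"
    by (intro LIMSEQ_le_const) auto
qed

text \<open>The quadratic polynomial is evaluated at minus its linear coefficient, which is the
  minimiser because the diagonal entry at a is 1. The index a will stand for the origin.\<close>

lemma psd_on_insert_Cauchy_Schwarz:
  assumes I: "finite I" "a \<notin> I" and A: "psd_on (insert a I) A" and "A a a = 1"
  shows "(\<Sum>j\<in>I. c j * A a j)\<^sup>2 \<le> (\<Sum>i\<in>I. \<Sum>j\<in>I. c i * c j * A i j)"
  using psd_on_insert_quadratic[OF I A, of "- (\<Sum>j\<in>I. c j * A a j)" c] assms(4)
  by (simp add: power2_eq_square)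

section \<open>Density of trigonometric polynomials\<close>

text \<open>Real trigonometric polynomials as lists of cosine coefficient, sine coefficient and
  frequency. Repeated frequencies are allowed, so that sums are concatenations.\<close>

definition trig :: "(real \<times> real \<times> 'a::real_inner) list \<Rightarrow> 'a \<Rightarrow> real" where
  "trig ts y = (\<Sum>(a, b, x)\<leftarrow>ts. a * cos (x \<bullet> y) + b * sin (x \<bullet> y))"

lemma trig_simps [simp]:
  "trig [] y = 0" "trig ((a, b, x) # ts) y = a * cos (x \<bullet> y) + b * sin (x \<bullet> y) + trig ts y"
  "trig (ts @ us) y = trig ts y + trig us y"
  by (simp_all add: trig_def)

lemma trig_scale: "\<exists>us. trig us = (\<lambda>y. r * trig ts y)"
proof (induction ts)
  case Nil then show ?case by (intro exI[of _ "[]"]) auto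
next
  case (Cons t ts)
  obtain a b x where t: "t = (a, b, x)" by (cases t) auto
  from Cons obtain us where "trig us = (\<lambda>y. r * trig ts y)" by blast
  then have "trig ((r * a, r * b, x) # us) = (\<lambda>y. r * trig (t # ts) y)" by (auto simp: t algebra_simps)
  then show ?case by blast
qed

text \<open>The product-to-sum formulas as an identity in the values of cosine and sine, with T
  standing for the rest of the second polynomial. Clearing the factors 1/2 first leaves an identity
  of commutative rings.\<close>

lemma trig_product_identity:
  fixes a b a' b' c s c' s' T :: real
  shows "(a*a' + b*b')/2 * (c * c' + s * s') + (b*a' - a*b')/2 * (s * c' - c * s') +
    ((a*a' - b*b')/2 * (c * c' - s * s') + (b*a' + a*b')/2 * (s * c' + c * s') + (a * c + b * s) * T)
    = (a * c + b * s) * (a' * c' + b' * s' + T)"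
proof -
  have "2 * ((a*a' + b*b')/2 * (c * c' + s * s') + (b*a' - a*b')/2 * (s * c' - c * s') +
    ((a*a' - b*b')/2 * (c * c' - s * s') + (b*a' + a*b')/2 * (s * c' + c * s') + (a * c + b * s) * T))
    = (a*a' + b*b') * (c * c' + s * s') + (b*a' - a*b') * (s * c' - c * s') +
    ((a*a' - b*b') * (c * c' - s * s') + (b*a' + a*b') * (s * c' + c * s') + 2 * ((a * c + b * s) * T))"
    by (simp only: distrib_left times_divide_eq_left nonzero_mult_div_cancel_left)
  also have "\<dots> = 2 * ((a * c + b * s) * (a' * c' + b' * s' + T))"
    by (simp add: algebra_simps)
  finally show ?thesis by simp
qed

lemma trig_mult: "\<exists>vs. trig vs = (\<lambda>y. trig ts y * trig us y)"
proof (induction ts)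
  case Nil then show ?case by (intro exI[of _ "[]"]) auto
next
  case (Cons t ts)
  obtain a b x where t: "t = (a, b, x)" by (cases t) auto
  have "\<exists>ws. trig ws = (\<lambda>y. (a * cos (x \<bullet> y) + b * sin (x \<bullet> y)) * trig us y)"
  proof (induction us)
    case Nil then show ?case by (intro exI[of _ "[]"]) auto
  next
    case (Cons u us)
    obtain a' b' x' where u: "u = (a', b', x')" by (cases u) auto
    from Cons obtain ws where ws: "trig ws = (\<lambda>y. (a * cos (x \<bullet> y) + b * sin (x \<bullet> y)) * trig us y)" by blast
    have "trig (((a*a' + b*b')/2, (b*a' - a*b')/2, x - x') # ((a*a' - b*b')/2, (b*a' + a*b')/2, x + x') # ws)
       = (\<lambda>y. (a * cos (x \<bullet> y) + b * sin (x \<bullet> y)) * trig (u # us) y)"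
    proof
      fix y
      show "trig (((a*a' + b*b')/2, (b*a' - a*b')/2, x - x') # ((a*a' - b*b')/2, (b*a' + a*b')/2, x + x') # ws) y
       = (a * cos (x \<bullet> y) + b * sin (x \<bullet> y)) * trig (u # us) y"
        using trig_product_identity[of a a' b b' "cos (x \<bullet> y)" "cos (x' \<bullet> y)" "sin (x \<bullet> y)" "sin (x' \<bullet> y)" "trig us y"]
        by (simp only: u trig_simps ws inner_add_left inner_diff_left cos_add cos_diff sin_add sin_diff)
    qed
    then show ?case by blast
  qed
  then obtain ws where ws: "trig ws = (\<lambda>y. (a * cos (x \<bullet> y) + b * sin (x \<bullet> y)) * trig us y)" by blast
  from Cons obtain vs where vs: "trig vs = (\<lambda>y. trig ts y * trig us y)" by blast
  have "trig (ws @ vs) = (\<lambda>y. trig (t # ts) y * trig us y)"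
    by (rule ext) (simp only: t ws vs trig_simps distrib_right)
  then show ?case by blast
qed

lemma trig_continuous: "continuous_on UNIV (trig ts)"
proof (induction ts)
  case (Cons t ts)
  obtain a b x where t: "t = (a, b, x)" by (cases t) auto
  show ?case unfolding t trig_simps(2)[abs_def] by (intro continuous_intros Cons)
qed (simp add: trig_def[abs_def])

lemma trig_measurable [measurable]: "trig ts \<in> borel_measurable borel"
  by (rule borel_measurable_continuous_onI[OF trig_continuous])

lemma trig_bounded: "\<exists>K. \<forall>y. \<bar>trig ts y\<bar> \<le> K"
proof (induction ts)
  case Nil then show ?case by (intro exI[of _ 0]) auto
next
  case (Cons t ts)
  obtain a b x where t: "t = (a, b, x)" by (cases t) auto
  from Cons obtain K where K: "\<And>y. \<bar>trig ts y\<bar> \<le> K" by blast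
  have "\<bar>trig (t # ts) y\<bar> \<le> \<bar>a\<bar> + \<bar>b\<bar> + K" for y
  proof -
    have "\<bar>a * cos (x \<bullet> y)\<bar> \<le> \<bar>a\<bar>" "\<bar>b * sin (x \<bullet> y)\<bar> \<le> \<bar>b\<bar>"
      by (auto simp: abs_mult mult_left_le)
    then show ?thesis using K[of y] by (simp add: t)
  qed
  then show ?case by blast
qed

text \<open>One trigonometric polynomial must approximate under several measures at once: under a
  measure and its two translates, or under two measures to be compared. Hence the finite set
  F.\<close>

locale finite_borel_measures =
  fixes F :: "'a::{real_inner, second_countable_topology} measure set"
  assumes finF: "finite F" and fm: "\<And>M. M \<in> F \<Longrightarrow> finite_measure M"
    and sets_borel: "\<And>M. M \<in> F \<Longrightarrow> sets M = sets borel"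
begin

lemma integrable_bounded:
  fixes f :: "'a \<Rightarrow> real"
  assumes "M \<in> F" "f \<in> borel_measurable borel" "\<And>y. \<bar>f y\<bar> \<le> K"
  shows "integrable M f"
proof (rule finite_measure.integrable_const_bound[OF fm[OF assms(1)], of f K])
  have "measurable M borel = (measurable borel borel :: ('a \<Rightarrow> real) set)"
    by (rule measurable_cong_sets[OF sets_borel[OF assms(1)] refl])
  then show "f \<in> borel_measurable M" using assms(2) by simp
qed (use assms(3) in auto)

text \<open>Bounded Borel functions in the common L2 closure of the trigonometric polynomials.
  Boundedness belongs to the class so that products stay in it.\<close>

definition tapprox :: "('a \<Rightarrow> real) set" where
  "tapprox = {f. f \<in> borel_measurable borel \<and> (\<exists>K. \<forall>y. \<bar>f y\<bar> \<le> K) \<and>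
     (\<forall>e>0. \<exists>ts. \<forall>M\<in>F. (\<integral>y. (f y - trig ts y)\<^sup>2 \<partial>M) < e)}"

lemma sq_integrable:
  fixes f g :: "'a \<Rightarrow> real"
  assumes "M \<in> F" "f \<in> borel_measurable borel" "\<And>y. \<bar>f y\<bar> \<le> K"
     "g \<in> borel_measurable borel" "\<And>y. \<bar>g y\<bar> \<le> L"
  shows "integrable M (\<lambda>y. (f y - g y)\<^sup>2)"
proof (rule integrable_bounded[OF assms(1), where K="(K + L)\<^sup>2"])
  show "(\<lambda>y. (f y - g y)\<^sup>2) \<in> borel_measurable borel" using assms by measurable
  fix y
  have "\<bar>f y - g y\<bar> \<le> K + L" using assms(3,5)[of y] by linarith
  from power_mono[OF this, of 2] show "\<bar>(f y - g y)\<^sup>2\<bar> \<le> (K + L)\<^sup>2" by (simp only: power2_abs abs_power2 abs_ge_zero)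
qed

lemma tapproxD:
  assumes "f \<in> tapprox"
  shows "f \<in> borel_measurable borel" "\<exists>K. \<forall>y. \<bar>f y\<bar> \<le> K"
     "e > 0 \<Longrightarrow> \<exists>ts. \<forall>M\<in>F. (\<integral>y. (f y - trig ts y)\<^sup>2 \<partial>M) < e"
  using assms by (auto simp: tapprox_def)

text \<open>The closure is idempotent; the tolerance e / 4 pays for the factor 2 in the bound of a
  squared sum by the sum of squares.\<close>

lemma tapprox_closed:
  assumes f: "f \<in> borel_measurable borel" "\<And>y. \<bar>f y\<bar> \<le> K"
    and g: "\<And>e. e > 0 \<Longrightarrow> \<exists>g\<in>tapprox. \<forall>M\<in>F. (\<integral>y. (f y - g y)\<^sup>2 \<partial>M) < e"
  shows "f \<in> tapprox"
  unfolding tapprox_def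
proof (intro CollectI conjI allI impI)
  show "\<exists>K. \<forall>y. \<bar>f y\<bar> \<le> K" using f by blast
  fix e :: real assume e: "e > 0"
  obtain h where h: "h \<in> tapprox" "\<And>M. M \<in> F \<Longrightarrow> (\<integral>y. (f y - h y)\<^sup>2 \<partial>M) < e / 4" using g[of "e/4"] e by auto
  obtain L where L: "\<And>y. \<bar>h y\<bar> \<le> L" using h(1) by (auto simp: tapprox_def)
  have hm: "h \<in> borel_measurable borel" using h(1) by (auto simp: tapprox_def)
  obtain ts where ts: "\<And>M. M \<in> F \<Longrightarrow> (\<integral>y. (h y - trig ts y)\<^sup>2 \<partial>M) < e / 4"
    using tapproxD(3)[OF h(1), of "e/4"] e by auto
  obtain K' where K': "\<And>y. \<bar>trig ts y\<bar> \<le> K'" using trig_bounded by blast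
  have "(\<integral>y. (f y - trig ts y)\<^sup>2 \<partial>M) < e" if M: "M \<in> F" for M
  proof -
    note i1 = sq_integrable[OF M f hm L] and i2 = sq_integrable[OF M hm L trig_measurable K']
    have "(\<integral>y. (f y - trig ts y)\<^sup>2 \<partial>M) \<le> (\<integral>y. 2 * (f y - h y)\<^sup>2 + 2 * (h y - trig ts y)\<^sup>2 \<partial>M)"
    proof (rule integral_mono)
      show "integrable M (\<lambda>y. (f y - trig ts y)\<^sup>2)" by (rule sq_integrable[OF M f trig_measurable K'])
      show "integrable M (\<lambda>y. 2 * (f y - h y)\<^sup>2 + 2 * (h y - trig ts y)\<^sup>2)" using i1 i2 by simp
      fix y
      have "0 \<le> ((f y - h y) - (h y - trig ts y))\<^sup>2" by simp
      then show "(f y - trig ts y)\<^sup>2 \<le> 2 * (f y - h y)\<^sup>2 + 2 * (h y - trig ts y)\<^sup>2"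
        by (simp add: power2_eq_square algebra_simps)
    qed
    also have "\<dots> = 2 * (\<integral>y. (f y - h y)\<^sup>2 \<partial>M) + 2 * (\<integral>y. (h y - trig ts y)\<^sup>2 \<partial>M)" using i1 i2 by simp
    also have "\<dots> < e" using h(2)[OF M] ts[OF M] by simp
    finally show ?thesis .
  qed
  then show "\<exists>ts. \<forall>M\<in>F. (\<integral>y. (f y - trig ts y)\<^sup>2 \<partial>M) < e" by blast
qed (rule f)

lemma trig_tapprox: "trig ts \<in> tapprox"
  unfolding tapprox_def using trig_bounded[of ts] by (auto intro!: exI[of _ ts])

text \<open>Common core of the algebraic closure properties: an operation R with a pointwise
  Lipschitz bound preserves the class at f as soon as it maps trigonometric polynomials into the
  class.\<close>

lemma tapprox_lipschitz:
  assumes f: "f \<in> tapprox" and R: "R f \<in> borel_measurable borel" "\<And>y. \<bar>R f y\<bar> \<le> B"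
    and RT: "\<And>ts. R (trig ts) \<in> tapprox"
    and L: "\<And>ts y. (R f y - R (trig ts) y)\<^sup>2 \<le> K * (f y - trig ts y)\<^sup>2"
  shows "R f \<in> tapprox"
proof (rule tapprox_closed[OF R])
  fix e :: real assume e: "e > 0"
  define K' where "K' = max 1 K"
  obtain ts where ts: "\<And>M. M \<in> F \<Longrightarrow> (\<integral>y. (f y - trig ts y)\<^sup>2 \<partial>M) < e / K'"
    using tapproxD(3)[OF f, of "e / K'"] e by (auto simp: K'_def)
  obtain L where L': "\<And>y. \<bar>f y\<bar> \<le> L" using tapproxD(2)[OF f] by blast
  obtain L2 where L2: "\<And>y. \<bar>trig ts y\<bar> \<le> L2" using trig_bounded by blast
  obtain L3 where L3: "\<And>y. \<bar>R (trig ts) y\<bar> \<le> L3" using tapproxD(2)[OF RT] by blast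
  have "(\<integral>y. (R f y - R (trig ts) y)\<^sup>2 \<partial>M) < e" if M: "M \<in> F" for M
  proof -
    note i = sq_integrable[OF M tapproxD(1)[OF f] L' trig_measurable L2]
    have "(\<integral>y. (R f y - R (trig ts) y)\<^sup>2 \<partial>M) \<le> (\<integral>y. K' * (f y - trig ts y)\<^sup>2 \<partial>M)"
    proof (rule integral_mono)
      show "integrable M (\<lambda>y. (R f y - R (trig ts) y)\<^sup>2)"
        by (rule sq_integrable[OF M R tapproxD(1)[OF RT] L3])
      show "integrable M (\<lambda>y. K' * (f y - trig ts y)\<^sup>2)" using i by simp
      fix y
      have "K * (f y - trig ts y)\<^sup>2 \<le> K' * (f y - trig ts y)\<^sup>2" by (intro mult_right_mono) (auto simp: K'_def)
      then show "(R f y - R (trig ts) y)\<^sup>2 \<le> K' * (f y - trig ts y)\<^sup>2" using L[of y ts] by linarith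
    qed
    also have "\<dots> = K' * (\<integral>y. (f y - trig ts y)\<^sup>2 \<partial>M)" by simp
    also have "\<dots> < K' * (e / K')" using ts[OF M] by (intro mult_strict_left_mono) (auto simp: K'_def)
    finally show ?thesis by (simp add: K'_def)
  qed
  then show "\<exists>g\<in>tapprox. \<forall>M\<in>F. (\<integral>y. (R f y - g y)\<^sup>2 \<partial>M) < e" using RT by blast
qed

lemma tapprox_scale: assumes f: "f \<in> tapprox" shows "(\<lambda>y. r * f y) \<in> tapprox"
proof -
  obtain L where L: "\<And>y. \<bar>f y\<bar> \<le> L" using tapproxD(2)[OF f] by blast
  note tapproxD(1)[OF f, measurable]
  show ?thesis
  proof (rule tapprox_lipschitz[OF f, of "\<lambda>f y. r * f y" "\<bar>r\<bar> * L" "r\<^sup>2"])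
    show "\<bar>r * f y\<bar> \<le> \<bar>r\<bar> * L" for y using L by (simp add: abs_mult mult_left_mono)
    show "(\<lambda>y. r * trig ts y) \<in> tapprox" for ts using trig_scale[of r ts] trig_tapprox by metis
    show "(r * f y - r * trig ts y)\<^sup>2 \<le> r\<^sup>2 * (f y - trig ts y)\<^sup>2" for ts y
      by (simp add: power_mult_distrib flip: right_diff_distrib)
  qed measurable
qed

lemma tapprox_add:
  assumes f: "f \<in> tapprox" and g: "g \<in> tapprox"
  shows "(\<lambda>y. f y + g y) \<in> tapprox"
proof -
  obtain L where L: "\<And>y. \<bar>f y\<bar> \<le> L" using tapproxD(2)[OF f] by blast
  obtain L2 where L2: "\<And>y. \<bar>g y\<bar> \<le> L2" using tapproxD(2)[OF g] by blast
  note [measurable] = tapproxD(1)[OF f] tapproxD(1)[OF g]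
  have 1: "(\<lambda>y. trig ts y + g y) \<in> tapprox" for ts
  proof -
    obtain L3 where L3: "\<And>y. \<bar>trig ts y\<bar> \<le> L3" using trig_bounded by blast
    show ?thesis
    proof (rule tapprox_lipschitz[OF g, of "\<lambda>g y. trig ts y + g y" "L3 + L2" 1])
      show "\<bar>trig ts y + g y\<bar> \<le> L3 + L2" for y using L2[of y] L3[of y] by linarith
      show "(\<lambda>y. trig ts y + trig us y) \<in> tapprox" for us
      proof -
        have "trig (ts @ us) = (\<lambda>y. trig ts y + trig us y)" by (rule ext) simp
        then show ?thesis by (metis trig_tapprox)
      qed
    qed auto
  qed
  show ?thesis
  proof (rule tapprox_lipschitz[OF f, of "\<lambda>f y. f y + g y" "L + L2" 1])
    show "\<bar>f y + g y\<bar> \<le> L + L2" for y using L2[of y] L[of y] by linarith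
  qed (use 1 in auto)
qed

text \<open>A product is Lipschitz in each bounded factor separately, so the density argument runs
  twice: first against a fixed trigonometric polynomial, then with the second factor fixed.\<close>

lemma tapprox_mult:
  assumes f: "f \<in> tapprox" and g: "g \<in> tapprox"
  shows "(\<lambda>y. f y * g y) \<in> tapprox"
proof -
  obtain L where L: "\<And>y. \<bar>f y\<bar> \<le> L" using tapproxD(2)[OF f] by blast
  obtain L2 where L2: "\<And>y. \<bar>g y\<bar> \<le> L2" using tapproxD(2)[OF g] by blast
  note [measurable] = tapproxD(1)[OF f] tapproxD(1)[OF g]
  have *: "(a * c - b * c)\<^sup>2 \<le> L\<^sup>2 * (a - b)\<^sup>2" if "\<bar>c\<bar> \<le> L" for a b c L :: real
  proof -
    have "c\<^sup>2 \<le> L\<^sup>2" using power_mono[OF that, of 2] by simp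
    then have "c\<^sup>2 * (a - b)\<^sup>2 \<le> L\<^sup>2 * (a - b)\<^sup>2" by (intro mult_right_mono) auto
    then show ?thesis by (simp add: power2_eq_square algebra_simps)
  qed
  have 1: "(\<lambda>y. trig ts y * g y) \<in> tapprox" for ts
  proof -
    obtain L3 where L3: "\<And>y. \<bar>trig ts y\<bar> \<le> L3" using trig_bounded by blast
    show ?thesis
    proof (rule tapprox_lipschitz[OF g, of "\<lambda>g y. trig ts y * g y" "L3 * L2" "L3\<^sup>2"])
      show "\<bar>trig ts y * g y\<bar> \<le> L3 * L2" for y using mult_mono[OF L3[of y] L2[of y]] order_trans[OF abs_ge_zero L3[of y]] by (simp add: abs_mult)
      show "(\<lambda>y. trig ts y * trig us y) \<in> tapprox" for us
        using trig_mult[of ts us] trig_tapprox by metis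
      show "(trig ts y * g y - trig ts y * trig us y)\<^sup>2 \<le> L3\<^sup>2 * (g y - trig us y)\<^sup>2" for us y
        using *[OF L3, of "g y" y "trig us y"] by (simp add: mult.commute)
    qed measurable
  qed
  show ?thesis
  proof (rule tapprox_lipschitz[OF f, of "\<lambda>f y. f y * g y" "L * L2" "L2\<^sup>2"])
    show "\<bar>f y * g y\<bar> \<le> L * L2" for y using mult_mono[OF L[of y] L2[of y]] order_trans[OF abs_ge_zero L[of y]] by (simp add: abs_mult)
    show "(f y * g y - trig ts y * g y)\<^sup>2 \<le> L2\<^sup>2 * (f y - trig ts y)\<^sup>2" for ts y by (rule *[OF L2])
  qed (use 1 in measurable)
qed

lemma tapprox_const: "(\<lambda>y. r) \<in> tapprox"
proof -
  have "trig [(r, 0, 0 :: 'a)] = (\<lambda>y. r)" by (rule ext) simp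
  then show ?thesis by (metis trig_tapprox)
qed

text \<open>Dominated convergence holds under each measure, and finiteness of F provides one index
  that serves all of them.\<close>

lemma tapprox_lim:
  assumes f: "\<And>n::nat. f n \<in> tapprox" and K: "\<And>n y. \<bar>f n y\<bar> \<le> K" and lim: "\<And>y. (\<lambda>n. f n y) \<longlonglongrightarrow> g y"
  shows "g \<in> tapprox"
proof -
  have gm: "g \<in> borel_measurable borel"
    by (rule borel_measurable_LIMSEQ_real[OF lim]) (use tapproxD(1)[OF f] in auto)
  have gK: "\<bar>g y\<bar> \<le> K" for y
    by (rule LIMSEQ_le_const2[OF tendsto_rabs[OF lim]]) (use K in auto)
  show ?thesis
  proof (rule tapprox_closed[OF gm gK])
    fix e :: real assume e: "e > 0"
    have "eventually (\<lambda>n. (\<integral>y. (g y - f n y)\<^sup>2 \<partial>M) < e) sequentially" if M: "M \<in> F" for M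
    proof -
      note [measurable_cong] = sets_borel[OF M]
      note [measurable] = gm tapproxD(1)[OF f]
      have "(\<lambda>n. \<integral>y. (g y - f n y)\<^sup>2 \<partial>M) \<longlonglongrightarrow> (\<integral>y. 0 \<partial>M)"
      proof (rule integral_dominated_convergence[where w="\<lambda>y. (2 * K)\<^sup>2"])
        show "integrable M (\<lambda>y. (2 * K)\<^sup>2)" using fm[OF M] by (simp add: finite_measure.integrable_const)
        show "AE y in M. (\<lambda>n. (g y - f n y)\<^sup>2) \<longlonglongrightarrow> 0"
        proof (rule AE_I2)
          fix y
          have "(\<lambda>n. (g y - f n y)\<^sup>2) \<longlonglongrightarrow> (g y - g y)\<^sup>2" by (intro tendsto_intros lim)
          then show "(\<lambda>n. (g y - f n y)\<^sup>2) \<longlonglongrightarrow> 0" by simp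
        qed
        fix n
        have b: "\<bar>g y - f n y\<bar> \<le> 2 * K" for y using gK[of y] K[of n y] by linarith
        have "(g y - f n y)\<^sup>2 \<le> (2 * K)\<^sup>2" for y
          using power_mono[OF b abs_ge_zero, of y 2] by simp
        then show "AE y in M. norm ((g y - f n y)\<^sup>2) \<le> (2 * K)\<^sup>2" by simp
      qed measurable
      then show ?thesis by (rule order_tendstoD) (use e in auto)
    qed
    then have "eventually (\<lambda>n. \<forall>M\<in>F. (\<integral>y. (g y - f n y)\<^sup>2 \<partial>M) < e) sequentially"
      using finF by (simp add: eventually_ball_finite)
    then obtain n where "\<forall>M\<in>F. (\<integral>y. (g y - f n y)\<^sup>2 \<partial>M) < e" by (auto simp: eventually_sequentially)
    then show "\<exists>h\<in>tapprox. \<forall>M\<in>F. (\<integral>y. (g y - h y)\<^sup>2 \<partial>M) < e" using f by blast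
  qed
qed

lemma tapprox_uniform_lim:
  assumes f: "\<And>e. e > 0 \<Longrightarrow> \<exists>f\<in>tapprox. \<forall>y. \<bar>g y - f y\<bar> \<le> e"
  shows "g \<in> tapprox"
proof -
  have "\<exists>f\<in>tapprox. \<forall>y. \<bar>g y - f y\<bar> \<le> 1 / real (Suc n)" for n using f by simp
  then obtain f where fT: "\<And>n. f n \<in> tapprox" and fg: "\<And>n y. \<bar>g y - f n y\<bar> \<le> 1 / real (Suc n)" by metis
  obtain K where K: "\<And>y. \<bar>f 0 y\<bar> \<le> K" using tapproxD(2)[OF fT] by blast
  show ?thesis
  proof (rule tapprox_lim[OF fT])
    \<comment> \<open>Each f n is within 1 of g, and g is within 1 of f 0.\<close>
    show "\<bar>f n y\<bar> \<le> K + 2" for n y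
    proof -
      have "1 / real (Suc n) \<le> 1" by simp
      moreover have "1 / real (Suc 0) = 1" by simp
      ultimately show ?thesis using fg[of y n] fg[of y 0] K[of y] unfolding abs_le_iff by linarith
    qed
    show "(\<lambda>n. f n y) \<longlonglongrightarrow> g y" for y
    proof (rule LIM_zero_cancel, rule Lim_null_comparison)
      show "\<forall>\<^sub>F n in sequentially. norm (f n y - g y) \<le> 1 / real (Suc n)"
        using fg[of y] by (simp add: abs_minus_commute)
      show "(\<lambda>n. 1 / real (Suc n)) \<longlonglongrightarrow> 0" by (rule LIMSEQ_Suc[OF lim_const_over_n])
    qed
  qed
qed

text \<open>The class is an algebra, so it contains the polynomials in f; Weierstrass approximation
  on the range interval [-K, K] does the rest.\<close>

lemma tapprox_continuous_comp:
  assumes f: "f \<in> tapprox" and \<phi>: "continuous_on UNIV (\<phi> :: real \<Rightarrow> real)"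
  shows "(\<lambda>y. \<phi> (f y)) \<in> tapprox"
proof (rule tapprox_uniform_lim)
  fix e :: real assume e: "e > 0"
  obtain K where K: "\<And>y. \<bar>f y\<bar> \<le> K" using tapproxD(2)[OF f] by blast
  obtain p where p: "real_polynomial_function p" "\<And>u. u \<in> {-K..K} \<Longrightarrow> \<bar>\<phi> u - p u\<bar> < e"
    using Stone_Weierstrass_real_polynomial_function[of "{-K..K}" \<phi> e] e continuous_on_subset[OF \<phi>] by auto
  have "(\<lambda>y. p (f y)) \<in> tapprox"
    using p(1)
  proof (induction p rule: real_polynomial_function.induct)
    case (linear q)
    then have "q = (\<lambda>u. q 1 * u)"
      by (metis linear_simps(5) mult.commute mult.right_neutral real_scaleR_def)
    then have "(\<lambda>y. q (f y)) = (\<lambda>y. q 1 * f y)" by metis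
    then show ?case using tapprox_scale[OF f] by simp
  qed (auto intro: tapprox_const tapprox_add tapprox_mult)
  moreover have "\<bar>\<phi> (f y) - p (f y)\<bar> \<le> e" for y
    using p(2)[of "f y"] K[of y] by (auto simp: abs_le_iff)
  ultimately show "\<exists>g\<in>tapprox. \<forall>y. \<bar>\<phi> (f y) - g y\<bar> \<le> e"
    by (intro bexI[of _ "\<lambda>y. p (f y)"]) auto
qed

text \<open>A linear functional is not in the class itself, but it is the pointwise limit of n * sin
  ((x \<bullet> y) / n). Boundedness of \<open>\<phi>\<close> keeps the compositions uniformly
  bounded although their arguments are not.\<close>

lemma tapprox_inner:
  assumes \<phi>: "continuous_on UNIV (\<phi> :: real \<Rightarrow> real)" and K: "\<And>u. \<bar>\<phi> u\<bar> \<le> K"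
  shows "(\<lambda>y. \<phi> (x \<bullet> y)) \<in> tapprox"
proof (rule tapprox_lim)
  fix n :: nat
  have "(\<lambda>y. sin ((x /\<^sub>R real (Suc n)) \<bullet> y)) \<in> tapprox"
  proof -
    have "trig [(0, 1, x /\<^sub>R real (Suc n))] = (\<lambda>y. sin ((x /\<^sub>R real (Suc n)) \<bullet> y))" by (rule ext) simp
    then show ?thesis by (metis trig_tapprox)
  qed
  then have "(\<lambda>y. \<phi> (real (Suc n) * sin ((x /\<^sub>R real (Suc n)) \<bullet> y))) \<in> tapprox"
    by (rule tapprox_continuous_comp[OF tapprox_scale \<phi>])
  then show "(\<lambda>y. \<phi> (real (Suc n) * sin ((x \<bullet> y) / real (Suc n)))) \<in> tapprox"
    by (simp add: divide_inverse mult.commute)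
next
  fix y
  have 1: "((\<lambda>t::real. sin (t * (x \<bullet> y)) / t) \<longlongrightarrow> x \<bullet> y) (at 0)"
  proof -
    have "((\<lambda>t. sin (t * (x \<bullet> y))) has_real_derivative (x \<bullet> y)) (at 0)"
      by (auto intro!: derivative_eq_intros)
    then show ?thesis by (simp add: DERIV_def)
  qed
  have "filterlim (\<lambda>n. 1 / real (Suc n)) (at 0) sequentially"
    unfolding filterlim_at by (intro conjI LIMSEQ_Suc[OF lim_const_over_n]) auto
  from filterlim_compose[OF 1 this]
  have "(\<lambda>n. real (Suc n) * sin ((x \<bullet> y) / real (Suc n))) \<longlonglongrightarrow> x \<bullet> y"
    by (simp add: mult.commute)
  then show "(\<lambda>n. \<phi> (real (Suc n) * sin ((x \<bullet> y) / real (Suc n)))) \<longlonglongrightarrow> \<phi> (x \<bullet> y)"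
    using \<phi> by (intro isCont_tendsto_compose[of _ \<phi>]) (simp_all add: continuous_on_eq_continuous_at)
qed (rule K)

text \<open>Complements and finite unions are polynomial operations on indicators, and countable
  unions are bounded pointwise limits.\<close>

lemma tapprox_sigma_algebra: "sigma_algebra UNIV {A. indicator A \<in> tapprox}"
proof (rule sigma_algebra_iff2[THEN iffD2], intro conjI ballI allI impI)
  show "{A. indicator A \<in> tapprox} \<subseteq> Pow UNIV" by simp
  show "{} \<in> {A. indicator A \<in> tapprox}" using tapprox_const[of 0] by (simp add: indicator_def[abs_def])
  fix A assume "A \<in> {A. indicator A \<in> tapprox}"
  then have "(\<lambda>y. 1 + (-1) * indicator A y) \<in> tapprox" by (intro tapprox_add tapprox_const tapprox_scale) auto
  moreover have "(\<lambda>y. 1 + (-1) * indicator A y :: real) = indicator (UNIV - A)" by (auto simp: indicator_def)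
  ultimately show "UNIV - A \<in> {A. indicator A \<in> tapprox}" by simp
next
  fix A :: "nat \<Rightarrow> 'a set" assume A: "range A \<subseteq> {A. indicator A \<in> tapprox}"
  have "indicator (\<Union>i<n. A i) \<in> tapprox" for n
  proof (induction n)
    case 0 then show ?case using tapprox_const[of 0] by (simp add: indicator_def[abs_def])
  next
    case (Suc n)
    have "indicator (A n) \<in> tapprox" using A by auto
    with Suc have "(\<lambda>y. indicator (A n) y + (indicator (\<Union>i<n. A i) y + (-1) * (indicator (A n) y * indicator (\<Union>i<n. A i) y))) \<in> tapprox"
      by (intro tapprox_add tapprox_scale tapprox_mult)
    moreover have "(\<lambda>y. indicator (A n) y + (indicator (\<Union>i<n. A i) y + (-1) * (indicator (A n) y * indicator (\<Union>i<n. A i) y))) = (indicator (\<Union>i<Suc n. A i) :: _ \<Rightarrow> real)"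
      by (auto simp: indicator_def lessThan_Suc)
    ultimately show ?case by simp
  qed
  then have "indicator (\<Union>i. A i) \<in> tapprox"
  proof (rule tapprox_lim[where K=1])
    show "(\<lambda>n. indicator (\<Union>i<n. A i) y :: real) \<longlonglongrightarrow> indicator (\<Union>i. A i) y" for y
      by (rule LIMSEQ_indicator_UN)
  qed (auto simp: indicator_def)
  then show "(\<Union>i. A i) \<in> {A. indicator A \<in> tapprox}" by simp
qed

text \<open>Continuous ramps of slope n that start at a converge to the indicator of the open half
  space.\<close>

lemma tapprox_halfspace: "indicator {y. a < x \<bullet> y} \<in> tapprox"
proof (rule tapprox_lim[where K=1])
  show "(\<lambda>y. max 0 (min 1 (real n * (x \<bullet> y - a)))) \<in> tapprox" for n
    by (rule tapprox_inner[where \<phi>="\<lambda>u. max 0 (min 1 (real n * (u - a)))" and K=1]) (auto intro!: continuous_intros)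
  fix y
  show "(\<lambda>n. max 0 (min 1 (real n * (x \<bullet> y - a)))) \<longlonglongrightarrow> indicator {y. a < x \<bullet> y} y"
  proof (cases "a < x \<bullet> y")
    case True
    obtain N :: nat where N: "1 / (x \<bullet> y - a) \<le> N" using real_arch_simple by blast
    have "max 0 (min 1 (real n * (x \<bullet> y - a))) = 1" if "n \<ge> N" for n
    proof -
      have "1 / (x \<bullet> y - a) \<le> n" using N that by linarith
      then have "1 \<le> real n * (x \<bullet> y - a)" using True by (simp add: pos_divide_le_eq)
      then show ?thesis by simp
    qed
    then show ?thesis using True by (intro tendsto_eventually eventually_sequentiallyI[of N]) auto
  next
    case False
    then have "max 0 (min 1 (real n * (x \<bullet> y - a))) = 0" for n
    proof -
      have "real n * (x \<bullet> y - a) \<le> 0" using False by (intro mult_nonneg_nonpos) auto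
      then show ?thesis by simp
    qed
    then show ?thesis using False by simp
  qed
qed auto

text \<open>Separability reduces open sets to half spaces: a closed ball is the intersection of
  countably many supporting half spaces with directions in a dense set D, and an open set is a
  countable union of balls centred in D.\<close>

lemma tapprox_borel:
  assumes "A \<in> sets borel"
  shows "indicator A \<in> tapprox"
proof -
  interpret sigma_algebra UNIV "{A. indicator A \<in> tapprox}" by (rule tapprox_sigma_algebra)
  obtain B :: "'a set set" where B: "countable B" "topological_basis B" using ex_countable_basis by blast
  define D where "D = (\<lambda>b. SOME d. d \<in> b) ` (B - {{}})"
  have Dc: "countable D" unfolding D_def using B by auto
  have Dd: "\<exists>d\<in>D. d \<in> U" if U: "open U" "U \<noteq> {}" for U
  proof -
    obtain x where x: "x \<in> U" using U(2) by blast
    obtain b where b: "b \<in> B" "x \<in> b" "b \<subseteq> U" using topological_basisE[OF B(2) U(1) x] by blast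
    then have "(SOME d. d \<in> b) \<in> b" by (metis someI)
    then show ?thesis using b by (auto simp: D_def)
  qed
  have cb: "cball z r \<in> {A. indicator A \<in> tapprox}" if r: "0 \<le> r" for z :: 'a and r
  proof -
    have "cball z r = UNIV - (\<Union>d\<in>D. {y. r * norm d + d \<bullet> z < d \<bullet> y})"
    proof (intro equalityI subsetI)
      fix y assume y: "y \<in> cball z r"
      have "\<not> r * norm d + d \<bullet> z < d \<bullet> y" for d
      proof -
        have "d \<bullet> (y - z) \<le> norm d * norm (y - z)" by (rule norm_cauchy_schwarz)
        also have "\<dots> \<le> norm d * r" using y by (intro mult_left_mono) (auto simp: dist_norm norm_minus_commute)
        finally show ?thesis by (simp add: inner_diff_right mult.commute)
      qed
      then show "y \<in> UNIV - (\<Union>d\<in>D. {y. r * norm d + d \<bullet> z < d \<bullet> y})" by auto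
    next
      fix y assume y: "y \<in> UNIV - (\<Union>d\<in>D. {y. r * norm d + d \<bullet> z < d \<bullet> y})"
      show "y \<in> cball z r"
      proof (rule ccontr)
        assume "y \<notin> cball z r"
        then have "r < norm (y - z)" by (simp add: dist_norm norm_minus_commute)
        then have "r * norm (y - z) < norm (y - z) * norm (y - z)"
          using r by (intro mult_strict_right_mono) linarith+
        then have "r * norm (y - z) < (y - z) \<bullet> (y - z)"
          by (simp add: power2_norm_eq_inner[symmetric] power2_eq_square)
        \<comment> \<open>The direction y - z separates y strictly from the ball. Strict separation
          is an open condition on the direction, so some member of D separates as well.\<close>
        then have "y - z \<in> {d. r * norm d < d \<bullet> (y - z)}" by simp
        moreover have "open {d. r * norm d < d \<bullet> (y - z)}" by (intro open_Collect_less continuous_intros)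
        ultimately obtain d where "d \<in> D" "r * norm d < d \<bullet> (y - z)" using Dd by blast
        then show False using y by (auto simp: inner_diff_right)
      qed
    qed
    also have "\<dots> \<in> {A. indicator A \<in> tapprox}"
      by (intro compl_sets countable_UN'' Dc) (use tapprox_halfspace in auto)
    finally show ?thesis .
  qed
  have op: "U \<in> {A. indicator A \<in> tapprox}" if U: "open U" for U :: "'a set"
  proof -
    have "U = (\<Union>(d, n)\<in>{(d, n::nat). d \<in> D \<and> cball d (1 / real (Suc n)) \<subseteq> U}. cball d (1 / real (Suc n)))" (is "_ = ?R")
    proof (intro equalityI subsetI)
      fix x assume x: "x \<in> U"
      then obtain e where e: "e > 0" "cball x e \<subseteq> U" using U open_contains_cball by blast
      obtain n where n: "1 / real (Suc n) < e / 2" using nat_approx_posE[of "e/2"] e by auto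
      obtain d where d: "d \<in> D" "d \<in> ball x (1 / real (Suc n))" using Dd[of "ball x (1 / real (Suc n))"] by auto
      have "cball d (1 / real (Suc n)) \<subseteq> cball x e"
      proof
        fix y assume "y \<in> cball d (1 / real (Suc n))"
        then show "y \<in> cball x e" using dist_triangle[of x y d] d n by auto
      qed
      moreover have "x \<in> cball d (1 / real (Suc n))" using d by (simp add: dist_commute)
      ultimately show "x \<in> ?R" using d e by blast
    qed auto
    also have "?R \<in> {A. indicator A \<in> tapprox}"
    proof (rule countable_UN'')
      show "countable {(d, n::nat). d \<in> D \<and> cball d (1 / real (Suc n)) \<subseteq> U}"
        by (rule countable_subset[of _ "D \<times> UNIV"]) (use Dc in auto)
    qed (use cb in auto)
    finally show ?thesis .
  qed
  have "sigma_sets UNIV (Collect open) \<subseteq> {A. indicator A \<in> tapprox}"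
    by (rule sigma_sets_subset) (use op in auto)
  then show ?thesis using assms by (auto simp: borel_def)
qed

lemma bounded_measurable_tapprox:
  assumes f: "f \<in> borel_measurable borel" and K: "\<And>y. \<bar>f y\<bar> \<le> K"
  shows "f \<in> tapprox"
proof -
  obtain s where s: "\<And>i. simple_function borel (s i)" "\<And>y. (\<lambda>i. s i y) \<longlonglongrightarrow> f y" "\<And>i y. norm (s i y) \<le> 2 * norm (f y)"
    using borel_measurable_implies_sequence_metric[OF f, of 0] by auto
  show ?thesis
  proof (rule tapprox_lim[OF _ _ s(2)])
    show "\<bar>s i y\<bar> \<le> 2 * K" for i y using s(3)[of i y] K[of y] by simp
    fix i
    have S: "(\<lambda>y. \<Sum>u\<in>U. u * indicator (s i -` {u} \<inter> space borel) y) \<in> tapprox" if "finite U" for U :: "real set"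
      using that
    proof (induction U rule: finite_induct)
      case empty then show ?case using tapprox_const[of 0] by simp
    next
      case (insert u U)
      have "s i -` {u} \<inter> space borel \<in> sets borel" using s(1)[of i] by (rule simple_functionD(2))
      then have "(\<lambda>y. u * indicator (s i -` {u} \<inter> space borel) y) \<in> tapprox"
        by (rule tapprox_scale[OF tapprox_borel])
      from tapprox_add[OF this insert.IH] show ?case by (simp only: sum.insert[OF insert.hyps])
    qed
    have "s i = (\<lambda>y. \<Sum>u\<in>s i ` space borel. u * indicator (s i -` {u} \<inter> space borel) y)"
    proof
      fix y
      have "(\<Sum>u\<in>s i ` space borel. u * indicator (s i -` {u} \<inter> space borel) y)
        = (\<Sum>u\<in>s i ` space borel. if u = s i y then u else 0)"
        by (intro sum.cong) auto
      also have "\<dots> = s i y" using simple_functionD(1)[OF s(1)[of i]] by (simp add: sum.delta)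
      finally show "s i y = (\<Sum>u\<in>s i ` space borel. u * indicator (s i -` {u} \<inter> space borel) y)" ..
    qed
    then show "s i \<in> tapprox" using S[OF simple_functionD(1)[OF s(1)[of i]]] by simp
  qed
qed

end

lemma (in prob_space) expectation_power2_le:
  fixes Z :: "'a \<Rightarrow> real"
  assumes "integrable M Z" "integrable M (\<lambda>y. (Z y)\<^sup>2)"
  shows "(expectation Z)\<^sup>2 \<le> expectation (\<lambda>y. (Z y)\<^sup>2)"
  using variance_eq[OF assms] variance_positive[of Z] by linarith

text \<open>Under a probability measure closeness in mean square implies closeness of the means, so
  a single approximation delivers both.\<close>

lemma trig_approx_prob:
  fixes F :: "'a::{real_inner, second_countable_topology} measure set" and f :: "'a \<Rightarrow> real"
  assumes F: "finite F" "\<And>M. M \<in> F \<Longrightarrow> prob_space M" "\<And>M. M \<in> F \<Longrightarrow> sets M = sets borel"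
    and f: "f \<in> borel_measurable borel" "\<And>y. \<bar>f y\<bar> \<le> K" and e: "0 < e"
  shows "\<exists>ts. \<forall>M\<in>F. \<bar>(\<integral>y. f y \<partial>M) - (\<integral>y. trig ts y \<partial>M)\<bar> < e \<and> (\<integral>y. (f y - trig ts y)\<^sup>2 \<partial>M) < e"
proof -
  interpret finite_borel_measures F
    by (rule finite_borel_measures.intro[OF F(1) prob_space.finite_measure[OF F(2)] F(3)])
  \<comment> \<open>The bound by the square of e controls the means through Jensen's inequality, the
    bound by e is the mean square claim.\<close>
  have e': "0 < min e (e\<^sup>2)" using e by simp
  obtain ts where ts: "\<forall>M\<in>F. (\<integral>y. (f y - trig ts y)\<^sup>2 \<partial>M) < min e (e\<^sup>2)"
    using tapproxD(3)[OF bounded_measurable_tapprox[OF f] e'] by blast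
  obtain L where L: "\<And>y. \<bar>trig ts y\<bar> \<le> L" using trig_bounded by blast
  have "\<bar>(\<integral>y. f y \<partial>M) - (\<integral>y. trig ts y \<partial>M)\<bar> < e" if M: "M \<in> F" for M
  proof -
    interpret prob_space M by (rule F(2)[OF M])
    have i: "integrable M f" "integrable M (trig ts)"
      by (rule integrable_bounded[OF M f], rule integrable_bounded[OF M trig_measurable L])
    have "((\<integral>y. f y \<partial>M) - (\<integral>y. trig ts y \<partial>M))\<^sup>2 = (\<integral>y. f y - trig ts y \<partial>M)\<^sup>2" using i by simp
    also have "\<dots> \<le> (\<integral>y. (f y - trig ts y)\<^sup>2 \<partial>M)"
      by (rule expectation_power2_le) (use i sq_integrable[OF M f trig_measurable L] in auto)
    also have "\<dots> < e\<^sup>2" using ts M by simp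
    finally have "\<bar>(\<integral>y. f y \<partial>M) - (\<integral>y. trig ts y \<partial>M)\<bar>\<^sup>2 < e\<^sup>2" by (simp only: power2_abs)
    then show ?thesis by (rule power2_less_imp_less) (use e in simp)
  qed
  then show ?thesis using ts by auto
qed

lemma trig_integral:
  fixes M :: "'a::{real_inner, second_countable_topology} measure"
  assumes M: "prob_space M" "sets M = sets borel"
  shows "(\<integral>y. trig ts y \<partial>M) = (\<Sum>(a, b, x)\<leftarrow>ts. a * (\<integral>y. cos (x \<bullet> y) \<partial>M) + b * (\<integral>y. sin (x \<bullet> y) \<partial>M))"
    "integrable M (trig ts)" "integrable M (\<lambda>y. cos (x \<bullet> y))" "integrable M (\<lambda>y. sin (x \<bullet> y))"
proof -
  interpret prob_space M by fact
  note [measurable_cong] = M(2)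
  show c: "integrable M (\<lambda>y. cos (x \<bullet> y))" for x by (rule integrable_const_bound[where B=1]) auto
  show s: "integrable M (\<lambda>y. sin (x \<bullet> y))" for x by (rule integrable_const_bound[where B=1]) auto
  have "integrable M (trig ts) \<and> (\<integral>y. trig ts y \<partial>M) = (\<Sum>(a, b, x)\<leftarrow>ts. a * (\<integral>y. cos (x \<bullet> y) \<partial>M) + b * (\<integral>y. sin (x \<bullet> y) \<partial>M))"
  proof (induction ts)
    case Nil then show ?case by (simp add: trig_def[abs_def])
  next
    case (Cons t ts)
    obtain a b x where t: "t = (a, b, x)" by (cases t) auto
    have "trig (t # ts) = (\<lambda>y. a * cos (x \<bullet> y) + b * sin (x \<bullet> y) + trig ts y)" by (rule ext) (simp add: t)
    then show ?case using Cons c[of x] s[of x] by (simp add: t)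
  qed
  then show "integrable M (trig ts)" "(\<integral>y. trig ts y \<partial>M) = (\<Sum>(a, b, x)\<leftarrow>ts. a * (\<integral>y. cos (x \<bullet> y) \<partial>M) + b * (\<integral>y. sin (x \<bullet> y) \<partial>M))"
    by auto
qed

text \<open>Trigonometric polynomials have equal integrals under both measures, and the indicator of
  a Borel set is approximated by one of them under both measures at once.\<close>

theorem char_determines_measure:
  fixes M N :: "'a::{real_inner, second_countable_topology} measure"
  assumes M: "prob_space M" "sets M = sets borel" and N: "prob_space N" "sets N = sets borel"
    and c: "\<And>x. (\<integral>y. cos (x \<bullet> y) \<partial>M) = (\<integral>y. cos (x \<bullet> y) \<partial>N)"
    and s: "\<And>x. (\<integral>y. sin (x \<bullet> y) \<partial>M) = (\<integral>y. sin (x \<bullet> y) \<partial>N)"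
  shows "M = N"
proof (rule measure_eqI)
  show "sets M = sets N" using M N by simp
  fix A assume "A \<in> sets M"
  then have A: "A \<in> sets borel" using M by simp
  interpret M: prob_space M by fact
  interpret N: prob_space N by fact
  have "\<bar>measure M A - measure N A\<bar> \<le> e" if e: "e > 0" for e
  proof -
    obtain ts where ts: "\<And>Q. Q \<in> {M, N} \<Longrightarrow> \<bar>(\<integral>y. indicator A y \<partial>Q) - (\<integral>y. trig ts y \<partial>Q)\<bar> < e / 2"
      using trig_approx_prob[of "{M, N}" "indicator A" 1 "e / 2"] e A M N by (auto simp: indicator_def)
    have "(\<integral>y. trig ts y \<partial>M) = (\<integral>y. trig ts y \<partial>N)"
      unfolding trig_integral(1)[OF M] trig_integral(1)[OF N] c s ..
    moreover have "space M = UNIV" "space N = UNIV" using M N by (metis sets_eq_imp_space_eq space_borel)+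
    ultimately show ?thesis using ts[of M] ts[of N] unfolding abs_le_iff abs_less_iff by simp
  qed
  then have "measure M A = measure N A"
    by (metis abs_le_zero_iff field_le_epsilon add_0 eq_iff_diff_eq_0)
  then show "emeasure M A = emeasure N A" by (simp add: M.emeasure_eq_measure N.emeasure_eq_measure)
qed

section \<open>Separability of L2\<close>

lemma borel_measurable_unit_leb:
  assumes "f \<in> borel_measurable borel" shows "f \<in> borel_measurable unit_leb"
  using assms by (intro measurable_restrict_space1 measurable_completion) simp

lemma clip_measurable: "f \<in> borel_measurable unit_leb \<Longrightarrow> (\<lambda>x. max (- K) (min K (f x))) \<in> borel_measurable unit_leb" for K :: real
  by (intro borel_measurable_max borel_measurable_min borel_measurable_const)

lemma bounded_square_integrable:
  fixes K :: real
  assumes f: "f \<in> borel_measurable unit_leb" and b: "\<And>x. \<bar>f x\<bar> \<le> K"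
  shows "square_integrable f"
proof -
  interpret finite_measure unit_leb
    by (rule finite_measureI, subst emeasure_restrict_space) auto
  have "(f x)\<^sup>2 \<le> K\<^sup>2" for x
    using power_mono[OF b[of x] abs_ge_zero, of 2] by simp
  then have "integrable unit_leb (\<lambda>x. (f x)\<^sup>2)"
    by (intro integrable_const_bound[of _ "K\<^sup>2"] borel_measurable_power f) auto
  then show ?thesis using f by (simp add: square_integrable_def)
qed

text \<open>The function is truncated first. The continuous functions that converge to it almost
  everywhere are truncated at the same level, so dominated convergence applies in both
  steps.\<close>

lemma continuous_square_integrable_dense:
  assumes f: "square_integrable f" and e: "0 < e"
  obtains g :: "real \<Rightarrow> real" where "continuous_on UNIV g" "square_integrable g"
    "norm (abs_L2 f - abs_L2 g) < e"
proof -
  interpret finite_measure unit_leb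
    by (rule finite_measureI, subst emeasure_restrict_space) auto
  note fm = square_integrable_measurable[OF f]
  define c where "c K x = max (- K) (min K x)" for K x :: real
  have cm: "(\<lambda>x. c K (h x)) \<in> borel_measurable unit_leb" if "h \<in> borel_measurable unit_leb" for K h
    unfolding c_def by (rule clip_measurable[OF that])
  have cb: "\<bar>c K x\<bar> \<le> \<bar>K\<bar>" for K x by (auto simp: c_def)
  have csq: "square_integrable (\<lambda>x. c K (h x))" if "h \<in> borel_measurable unit_leb" for K h
    by (rule bounded_square_integrable[OF cm[OF that] cb])
  have "(\<lambda>n. \<integral>x. (f x - c (real n) (f x))\<^sup>2 \<partial>unit_leb) \<longlonglongrightarrow> (\<integral>x. 0 \<partial>unit_leb)"
  proof (rule integral_dominated_convergence[where w="\<lambda>x. (f x)\<^sup>2"])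
    show "integrable unit_leb (\<lambda>x. (f x)\<^sup>2)" using f by (simp add: square_integrable_def)
    show "AE x in unit_leb. (\<lambda>n. (f x - c (real n) (f x))\<^sup>2) \<longlonglongrightarrow> 0"
    proof (rule AE_I2)
      fix x
      obtain N :: nat where N: "\<bar>f x\<bar> \<le> real N" using real_arch_simple by blast
      have "(f x - c (real n) (f x))\<^sup>2 = 0" if "n \<ge> N" for n
        using N that by (auto simp: c_def)
      then show "(\<lambda>n. (f x - c (real n) (f x))\<^sup>2) \<longlonglongrightarrow> 0"
        by (intro tendsto_eventually eventually_sequentiallyI[of N]) auto
    qed
    fix n
    have "\<bar>y - c (real n) y\<bar> \<le> \<bar>y\<bar>" for y by (auto simp: c_def)
    then show "AE x in unit_leb. norm ((f x - c (real n) (f x))\<^sup>2) \<le> (f x)\<^sup>2"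
      using abs_le_square_iff by auto
  qed (use fm cm in \<open>auto intro!: borel_measurable_power borel_measurable_diff\<close>)
  then have "eventually (\<lambda>n. (\<integral>x. (f x - c (real n) (f x))\<^sup>2 \<partial>unit_leb) < (e/2)\<^sup>2) sequentially"
    by (rule order_tendstoD) (use e in auto)
  then obtain K where K: "(\<integral>x. (f x - c (real K) (f x))\<^sup>2 \<partial>unit_leb) < (e/2)\<^sup>2"
    by (auto simp: eventually_sequentially)
  have "(\<lambda>x. if x \<in> {0<..<1} then f x else 0) \<in> borel_measurable lebesgue"
    using fm by (subst (asm) borel_measurable_if[symmetric]) auto
  \<comment> \<open>This form of measurability supplies continuous functions that converge off a
    null set.\<close>
  then have "(\<lambda>x. if x \<in> {0<..<1} then f x else 0) measurable_on {0<..<1}"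
    by (rule lebesgue_measurable_imp_measurable_on) auto
  then obtain N g where N: "negligible N" and gc: "\<And>n. continuous_on UNIV (g n :: real \<Rightarrow> real)"
    and gl: "\<And>x. x \<notin> N \<Longrightarrow> (\<lambda>n. g n x) \<longlonglongrightarrow> (if x \<in> {0<..<1::real} then if x \<in> {0<..<1} then f x else 0 else 0)"
    unfolding measurable_on_def by blast
  have gm: "g n \<in> borel_measurable unit_leb" for n
    by (rule borel_measurable_unit_leb[OF borel_measurable_continuous_onI[OF gc]])
  have "(\<lambda>n. \<integral>x. (c (real K) (f x) - c (real K) (g n x))\<^sup>2 \<partial>unit_leb) \<longlonglongrightarrow> (\<integral>x. 0 \<partial>unit_leb)"
  proof (rule integral_dominated_convergence[where w="\<lambda>x. (2 * real K)\<^sup>2"])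
    show "AE x in unit_leb. (\<lambda>n. (c (real K) (f x) - c (real K) (g n x))\<^sup>2) \<longlonglongrightarrow> 0"
    proof -
      have "N \<in> null_sets lebesgue" using N by (simp add: negligible_iff_null_sets)
      then have "AE x in lebesgue. x \<notin> N" by (rule AE_not_in)
      then have "AE x in unit_leb. x \<notin> N" by (subst AE_restrict_space_iff) auto
      moreover have "AE x in unit_leb. x \<in> {0<..<1}" by (rule AE_I2) auto
      ultimately show ?thesis
      proof eventually_elim
        case (elim x)
        then have "(\<lambda>n. g n x) \<longlonglongrightarrow> f x" using gl[of x] by simp
        then have "(\<lambda>n. (c (real K) (f x) - c (real K) (g n x))\<^sup>2) \<longlonglongrightarrow> (c (real K) (f x) - c (real K) (f x))\<^sup>2"
          unfolding c_def by (intro tendsto_intros)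
        then show ?case by simp
      qed
    qed
    fix n
    have "\<bar>c (real K) y - c (real K) z\<bar> \<le> 2 * real K" for y z
      using cb[of "real K" y] cb[of "real K" z] by (auto simp: abs_real_def split: if_splits)
    then have "(c (real K) y - c (real K) z)\<^sup>2 \<le> (2 * real K)\<^sup>2" for y z
      using power_mono[of "\<bar>c (real K) y - c (real K) z\<bar>" "2 * real K" 2] by simp
    then show "AE x in unit_leb. norm ((c (real K) (f x) - c (real K) (g n x))\<^sup>2) \<le> (2 * real K)\<^sup>2"
      by auto
  qed (use fm gm cm in \<open>auto intro!: borel_measurable_power borel_measurable_diff\<close>)
  then have "eventually (\<lambda>n. (\<integral>x. (c (real K) (f x) - c (real K) (g n x))\<^sup>2 \<partial>unit_leb) < (e/2)\<^sup>2) sequentially"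
    by (rule order_tendstoD) (use e in auto)
  then obtain n where n: "(\<integral>x. (c (real K) (f x) - c (real K) (g n x))\<^sup>2 \<partial>unit_leb) < (e/2)\<^sup>2"
    by (auto simp: eventually_sequentially)
  define G where "G x = c (real K) (g n x)" for x
  have "(norm (abs_L2 f - abs_L2 (\<lambda>x. c (real K) (f x))))\<^sup>2 < (e/2)\<^sup>2"
    using K by (subst norm_diff_abs_L2[OF f csq[OF fm]])
  then have 1: "norm (abs_L2 f - abs_L2 (\<lambda>x. c (real K) (f x))) < e/2"
    by (rule power2_less_imp_less) (use e in auto)
  have "(norm (abs_L2 (\<lambda>x. c (real K) (f x)) - abs_L2 G))\<^sup>2 < (e/2)\<^sup>2"
    using n unfolding G_def by (subst norm_diff_abs_L2[OF csq[OF fm] csq[OF gm]])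
  then have 2: "norm (abs_L2 (\<lambda>x. c (real K) (f x)) - abs_L2 G) < e/2"
    by (rule power2_less_imp_less) (use e in auto)
  show ?thesis
  proof (rule that[of G])
    show "continuous_on UNIV G" unfolding G_def c_def by (intro continuous_intros gc)
    show "square_integrable G" unfolding G_def by (rule csq[OF gm])
    show "norm (abs_L2 f - abs_L2 G) < e"
      using 1 2 norm_triangle_ineq[of "abs_L2 f - abs_L2 (\<lambda>x. c (real K) (f x))" "abs_L2 (\<lambda>x. c (real K) (f x)) - abs_L2 G"]
      by simp
  qed
qed

text \<open>Step functions with rational values on the uniform grid of mesh 1 / length qs. Indexing
  them by lists makes the family countable; the guard gives the value 0 to the right of the
  grid.\<close>

definition rat_step :: "rat list \<Rightarrow> real \<Rightarrow> real" where
  "rat_step qs x = (if nat \<lfloor>x * length qs\<rfloor> < length qs then of_rat (qs ! nat \<lfloor>x * length qs\<rfloor>) else 0)"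

text \<open>A continuous function within e / 2 is sampled at grid points: uniform continuity and
  rational rounding cost e / 8 each, and a sup bound is an L2 bound because the interval has measure
  1.\<close>

lemma rat_step_dense:
  assumes e: "0 < e"
  shows "\<exists>qs. norm (x - abs_L2 (rat_step qs)) < e"
proof -
  obtain f where f: "square_integrable f" "x = abs_L2 f" by (rule L2_cases)
  obtain g :: "real \<Rightarrow> real" where gc: "continuous_on UNIV g" and gs: "square_integrable g"
    and fg: "norm (abs_L2 f - abs_L2 g) < e / 2"
    using continuous_square_integrable_dense[OF f(1), of "e/2"] e by auto
  have "uniformly_continuous_on {0..1} g"
    by (rule compact_uniformly_continuous) (auto intro: continuous_on_subset[OF gc])
  then obtain d where d: "d > 0" and gd: "\<And>x y. x \<in> {0..1} \<Longrightarrow> y \<in> {0..1} \<Longrightarrow> dist y x < d \<Longrightarrow> dist (g y) (g x) < e / 8"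
    unfolding uniformly_continuous_on_def using e by (metis divide_pos_pos zero_less_numeral)
  obtain N :: nat where N: "N > 0" "1 / real N < d"
    using nat_approx_posE[OF d] by (metis of_nat_Suc zero_less_Suc)
  have "\<exists>q::rat. dist (g (real j / N)) (of_rat q) < e / 8" for j
  proof -
    obtain q where "q \<in> \<rat>" "g (real j / N) - e / 8 < q" "q < g (real j / N)"
      using Rats_dense_in_real[of "g (real j / N) - e / 8" "g (real j / N)"] e by auto
    then obtain p where "q = of_rat p" "\<bar>g (real j / N) - of_rat p\<bar> < e / 8" by (auto simp: Rats_def)
    then show ?thesis by (auto simp: dist_real_def)
  qed
  then obtain q :: "nat \<Rightarrow> rat" where q: "\<And>j. dist (g (real j / N)) (of_rat (q j)) < e / 8" by metis
  define qs where "qs = map q [0..<N]"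
  have st: "rat_step qs x = (if nat \<lfloor>x * N\<rfloor> < N then of_rat (q (nat \<lfloor>x * N\<rfloor>)) else 0)" for x
    by (simp add: rat_step_def qs_def)
  have near: "\<bar>g x - rat_step qs x\<bar> \<le> e / 4" if x: "x \<in> {0<..<1}" for x
  proof -
    define j where "j = nat \<lfloor>x * N\<rfloor>"
    have fl: "real j = of_int \<lfloor>x * N\<rfloor>" using x by (simp add: j_def)
    have j1: "real j \<le> x * N" "x * N < real j + 1" unfolding fl by linarith+
    have "x * N < N" using x N by simp
    with j1 have jN: "j < N" by linarith
    have a: "real j / N \<le> x" "x - real j / N < d"
    proof -
      show "real j / N \<le> x" using j1 N by (simp add: field_simps)
      have "x < (real j + 1) / N" using j1 N by (simp add: pos_less_divide_eq)
      then have "x - real j / N < 1 / N" by (simp add: add_divide_distrib)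
      then show "x - real j / N < d" using N by linarith
    qed
    then have "dist (g x) (g (real j / N)) < e / 8" using gd[of "real j / N" x] x by (auto simp: dist_real_def)
    moreover have "rat_step qs x = of_rat (q j)" using jN unfolding st j_def[symmetric] by simp
    ultimately show ?thesis using q[of j] unfolding dist_real_def by linarith
  qed
  interpret finite_measure unit_leb
    by (rule finite_measureI, subst emeasure_restrict_space) auto
  have stm: "rat_step qs \<in> borel_measurable unit_leb"
  proof -
    have "rat_step qs \<in> borel_measurable borel" unfolding rat_step_def by measurable
    then show ?thesis by (rule borel_measurable_unit_leb)
  qed
  have sts: "square_integrable (rat_step qs)"
  proof (rule bounded_square_integrable[OF stm])
    fix x show "\<bar>rat_step qs x\<bar> \<le> (\<Sum>j<N. \<bar>of_rat (q j)\<bar>)"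
    proof (cases "nat \<lfloor>x * N\<rfloor> < N")
      case True
      then have "\<bar>rat_step qs x\<bar> = \<bar>of_rat (q (nat \<lfloor>x * N\<rfloor>))\<bar>" by (simp only: st if_True)
      also have "\<dots> \<le> (\<Sum>j<N. \<bar>of_rat (q j)\<bar>)"
        using True by (intro member_le_sum[where f="\<lambda>j. \<bar>of_rat (q j)\<bar>"]) auto
      finally show ?thesis .
    qed (simp add: st sum_nonneg)
  qed
  have "(norm (abs_L2 g - abs_L2 (rat_step qs)))\<^sup>2 = (\<integral>x. (g x - rat_step qs x)\<^sup>2 \<partial>unit_leb)"
    by (rule norm_diff_abs_L2[OF gs sts])
  also have "\<dots> \<le> (\<integral>x. (e / 4)\<^sup>2 \<partial>unit_leb)"
  proof (rule integral_mono)
    show "integrable unit_leb (\<lambda>x. (g x - rat_step qs x)\<^sup>2)"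
      using square_integrable_diff[OF gs sts] by (simp add: square_integrable_def)
    fix x assume "x \<in> space unit_leb"
    then show "(g x - rat_step qs x)\<^sup>2 \<le> (e / 4)\<^sup>2"
      using power_mono[OF near[of x] abs_ge_zero, of 2] by simp
  qed auto
  also have "\<dots> = (e / 4)\<^sup>2" by (simp add: measure_restrict_space)
  finally have "norm (abs_L2 g - abs_L2 (rat_step qs)) \<le> e / 4"
    by (rule power2_le_imp_le) (use e in auto)
  then have "norm (x - abs_L2 (rat_step qs)) < e"
    using fg norm_triangle_ineq[of "abs_L2 f - abs_L2 g" "abs_L2 g - abs_L2 (rat_step qs)"] f(2) e by simp
  then show ?thesis ..
qed

text \<open>Separability makes addition measurable for product sigma algebras, which the convolution
  of the measures relies on, and it underlies the density and tightness arguments.\<close>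

instance L2 :: second_countable_topology
proof
  define D where "D = range (\<lambda>qs. abs_L2 (rat_step qs))"
  define B where "B = (\<lambda>(d, n). ball d (1 / real (Suc n))) ` (D \<times> UNIV)"
  have "countable B" unfolding B_def D_def by (intro countable_image countable_SIGMA) auto
  moreover have "topological_basis B"
  proof (rule topological_basisI)
    fix b assume "b \<in> B" then show "open b" by (auto simp: B_def)
  next
    fix U and x :: L2 assume "open U" "x \<in> U"
    then obtain e where e: "e > 0" "ball x e \<subseteq> U" using open_contains_ball by blast
    obtain n where n: "1 / real (Suc n) < e / 2" using nat_approx_posE[of "e/2"] e by auto
    obtain d where d: "d \<in> D" "dist x d < 1 / real (Suc n)"
      using rat_step_dense[of "1 / real (Suc n)" x] by (auto simp: D_def dist_norm)
    have "ball d (1 / real (Suc n)) \<subseteq> ball x e"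
    proof
      fix y assume "y \<in> ball d (1 / real (Suc n))"
      then show "y \<in> ball x e" using dist_triangle[of x y d] d n by auto
    qed
    moreover have "x \<in> ball d (1 / real (Suc n))" using d by (simp add: dist_commute)
    ultimately show "\<exists>B'\<in>B. x \<in> B' \<and> B' \<subseteq> U" using d e by (force simp: B_def)
  qed
  ultimately show "\<exists>B::L2 set set. countable B \<and> open = generate_topology B"
    using topological_basis_imp_subbasis by metis
qed

section \<open>The Dirichlet heat semigroup\<close>

text \<open>Banach-Steinhaus by the Baire category theorem. Besides the local boundedness of
  semigroups, it turns directional bounds on Gateaux derivatives into operator norm bounds.\<close>

theorem uniform_boundedness:
  fixes F :: "'i \<Rightarrow> 'a::banach \<Rightarrow>\<^sub>L 'b::real_normed_vector"
  assumes pw: "\<And>x. \<exists>B. \<forall>i\<in>I. norm (F i x) \<le> B"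
  shows "\<exists>B. \<forall>i\<in>I. norm (F i) \<le> B"
proof -
  define A where "A n = (\<Inter>i\<in>I. {x. norm (F i x) \<le> real n})" for n :: nat
  have cl: "closed (A n)" for n
    unfolding A_def by (intro closed_INT ballI closed_Collect_le continuous_intros)
  have un: "(\<Union>n. A n) = UNIV"
  proof -
    have "\<exists>n. x \<in> A n" for x
    proof -
      obtain B where B: "\<forall>i\<in>I. norm (F i x) \<le> B" using pw by blast
      obtain n :: nat where "B \<le> n" using real_arch_simple by blast
      then show ?thesis using B unfolding A_def by (intro exI[of _ n]) force
    qed
    then show ?thesis by auto
  qed
  have "\<exists>n. interior (A n) \<noteq> {}"
  proof (rule ccontr)
    assume "\<not> ?thesis"
    then have "euclidean interior_of \<Union>(range A) = {}"
      using cl by (intro Baire_category_alt) (auto simp: completely_metrizable_space_euclidean)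
    then show False using un by simp
  qed
  then obtain n x0 r where r: "r > 0" "cball x0 r \<subseteq> A n"
    by (meson all_not_in_conv mem_interior_cball)
  have "norm (F i) \<le> 2 * real n / r" if i: "i \<in> I" for i
  proof (rule norm_blinfun_bound)
    fix x
    show "norm (F i x) \<le> 2 * real n / r * norm x"
    proof (cases "x = 0")
      case False
      define t where "t = r / norm x"
      have t: "t > 0" using r False by (simp add: t_def)
      have "x0 + t *\<^sub>R x \<in> cball x0 r" "x0 \<in> cball x0 r" using r False by (auto simp: t_def dist_norm)
      then have "x0 + t *\<^sub>R x \<in> A n" "x0 \<in> A n" using r(2) by blast+
      then have "norm (F i (x0 + t *\<^sub>R x)) \<le> n" "norm (F i x0) \<le> n" using i by (auto simp: A_def)
      moreover have "t *\<^sub>R F i x = F i (x0 + t *\<^sub>R x) - F i x0" by (simp add: blinfun.bilinear_simps)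
      ultimately have "norm (t *\<^sub>R F i x) \<le> 2 * n"
        using norm_triangle_ineq4[of "F i (x0 + t *\<^sub>R x)" "F i x0"] by simp
      then have "t * norm (F i x) \<le> 2 * n" using t by simp
      then show ?thesis using False r by (simp add: t_def field_simps)
    qed simp
  qed (use r in simp)
  then show ?thesis by blast
qed

lemma has_vector_derivative_iff_quotient:
  "(f has_vector_derivative D) (at x within A) \<longleftrightarrow>
     ((\<lambda>y. (f y - f x) /\<^sub>R (y - x)) \<longlongrightarrow> D) (at x within A)"
proof -
  have eq: "norm (f y - f x - (y - x) *\<^sub>R D) / norm (y - x) = norm ((f y - f x) /\<^sub>R (y - x) - D)" if "y \<noteq> x" for y
  proof -
    have "(f y - f x) /\<^sub>R (y - x) - D = (f y - f x - (y - x) *\<^sub>R D) /\<^sub>R (y - x)"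
      using that by (simp add: scaleR_diff_right)
    then show ?thesis by (simp add: divide_inverse mult.commute)
  qed
  have "(f has_vector_derivative D) (at x within A) \<longleftrightarrow>
     ((\<lambda>y. norm (f y - f x - (y - x) *\<^sub>R D) / norm (y - x)) \<longlongrightarrow> 0) (at x within A)"
    unfolding has_vector_derivative_def has_derivative_iff_norm by (simp add: bounded_linear_scaleR_left)
  also have "\<dots> \<longleftrightarrow> ((\<lambda>y. norm ((f y - f x) /\<^sub>R (y - x) - D)) \<longlongrightarrow> 0) (at x within A)"
    by (rule tendsto_cong) (use eq in \<open>auto simp: eventually_at_filter\<close>)
  also have "\<dots> \<longleftrightarrow> ((\<lambda>y. (f y - f x) /\<^sub>R (y - x)) \<longlongrightarrow> D) (at x within A)"
    by (simp add: tendsto_norm_zero_iff LIM_zero_iff)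
  finally show ?thesis .
qed

section \<open>Strongly continuous semigroups and their generators\<close>

locale c0_semigroup =
  fixes S :: "real \<Rightarrow> 'a::banach \<Rightarrow>\<^sub>L 'a"
  assumes C0: "C0_semigroup S"
begin

lemma S0: "S 0 = id_blinfun" using C0 by (simp add: C0_semigroup_def)

lemma S_add: "0 \<le> t \<Longrightarrow> 0 \<le> r \<Longrightarrow> S (t + r) x = S t (S r x)"
  using C0 by (auto simp: C0_semigroup_def)

lemma S_tendsto_0: "((\<lambda>t. S t x) \<longlongrightarrow> x) (at_right 0)" using C0 by (simp add: C0_semigroup_def)

text \<open>Otherwise there would be times t n tending to 0 with norm (S (t n)) > n, while strong
  continuity at 0 bounds every orbit along t n, against the uniform boundedness principle.\<close>

lemma S_bounded_near_0: "\<exists>B d. d > 0 \<and> (\<forall>t\<in>{0..d}. norm (S t) \<le> B)"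
proof (rule ccontr)
  assume neg: "\<not> ?thesis"
  have "\<exists>t. t \<in> {0..1 / real (Suc n)} \<and> real n < norm (S t)" for n
    using neg by (metis not_less zero_less_divide_1_iff of_nat_0_less_iff zero_less_Suc)
  then obtain t where t: "\<And>n. t n \<in> {0..1 / real (Suc n)}" "\<And>n. real n < norm (S (t n))" by metis
  have t0: "t \<longlonglongrightarrow> 0"
  proof (rule tendsto_sandwich[OF _ _ tendsto_const LIMSEQ_Suc[OF lim_const_over_n]])
    show "\<forall>\<^sub>F n in sequentially. 0 \<le> t n" "\<forall>\<^sub>F n in sequentially. t n \<le> 1 / real (Suc n)" using t(1) by auto
  qed
  have "\<exists>B. \<forall>n\<in>UNIV. norm (S (t n) x) \<le> B" for x
  proof -
    have "continuous (at 0 within {0..}) (\<lambda>t. S t x)"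
      unfolding continuous_within using S_tendsto_0[of x] by (simp add: S0 at_within_Ici_at_right)
    then have "(\<lambda>n. S (t n) x) \<longlonglongrightarrow> S 0 x"
      using t0 t(1) unfolding continuous_within_sequentially by (auto simp: o_def)
    then have "bounded (range (\<lambda>n. S (t n) x))" by (rule convergent_imp_bounded)
    then show ?thesis by (auto simp: bounded_iff)
  qed
  from uniform_boundedness[OF this] obtain B where B: "\<And>n. norm (S (t n)) \<le> B" by blast
  obtain n :: nat where "B \<le> n" using real_arch_simple by blast
  then show False using B[of n] t(2)[of n] by simp
qed

lemma S_bounded: "\<exists>B. \<forall>t\<in>{0..T}. norm (S t) \<le> B"
proof -
  obtain B d where B: "d > 0" "\<And>t. t \<in> {0..d} \<Longrightarrow> norm (S t) \<le> B" using S_bounded_near_0 by blast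
  have "norm (S t) \<le> max 1 B ^ n" if "t \<in> {0..real n * d}" for n t
    using that
  proof (induction n arbitrary: t)
    case 0
    then show ?case using norm_blinfun_id_le by (auto simp: S0)
  next
    case (Suc n)
    define r where "r = min t d"
    have r: "r \<in> {0..d}" "t - r \<in> {0..real n * d}" using Suc.prems B(1) by (auto simp: r_def min_def algebra_simps)
    have "S t = S r o\<^sub>L S (t - r)" using C0 r unfolding C0_semigroup_def
      by (metis add_diff_cancel_left' atLeastAtMost_iff diff_add_cancel add.commute)
    then have "norm (S t) \<le> norm (S r) * norm (S (t - r))" using norm_blinfun_compose by metis
    also have "\<dots> \<le> max 1 B * max 1 B ^ n"
      using B(2)[OF r(1)] Suc.IH[OF r(2)] by (intro mult_mono) auto
    finally show ?case by simp
  qed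
  moreover obtain n :: nat where "T / d \<le> n" using real_arch_simple by blast
  ultimately have "\<forall>t\<in>{0..T}. norm (S t) \<le> max 1 B ^ n" using B(1) by (auto simp: pos_divide_le_eq)
  then show ?thesis by blast
qed

text \<open>Strong continuity is given only from the right at 0. For two times the smaller one is
  factored out and its operator norm is bounded locally, which covers limits from the left as
  well.\<close>

lemma S_continuous: "continuous_on {0..} (\<lambda>t. S t x)"
  unfolding continuous_on_iff
proof (intro ballI allI impI)
  fix t e :: real assume t: "t \<in> {0..}" and e: "0 < e"
  obtain B where B: "\<And>r. r \<in> {0..t+1} \<Longrightarrow> norm (S r) \<le> B" using S_bounded[of "t+1"] by blast
  have B0: "0 \<le> B" using order_trans[OF norm_ge_zero B[of 0]] t by simp
  have "\<forall>\<^sub>F h in at_right 0. dist (S h x) x < e / (B + 1)"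
    using tendstoD[OF S_tendsto_0[of x], of "e / (B + 1)"] e B0 by simp
  then obtain d where d: "d > 0" "\<And>h. 0 < h \<Longrightarrow> h < d \<Longrightarrow> norm (S h x - x) < e / (B + 1)"
    unfolding eventually_at_right_field dist_norm by auto
  have "dist (S r x) (S t x) < e" if r: "r \<in> {0..}" "dist r t < min d 1" for r
  proof (cases "r = t")
    case False
    define m h where "m = min r t" and "h = \<bar>r - t\<bar>"
    have mh: "m \<in> {0..t+1}" "0 < h" "h < d" using r t False by (auto simp: m_def h_def dist_real_def)
    have "norm (S m (S h x - x)) \<le> norm (S m) * norm (S h x - x)" by (rule norm_blinfun)
    also have "\<dots> \<le> B * (e / (B + 1))" using B[OF mh(1)] d(2)[OF mh(2,3)] B0 by (intro mult_mono) auto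
    also have "\<dots> < e" using B0 e by (simp add: field_simps)
    finally have "norm (S m (S h x) - S m x) < e" by (simp add: blinfun.diff_right)
    moreover have "S m (S h x) = S (max r t) x"
      using S_add[of m h x] mh by (simp add: m_def h_def max_def min_def split: if_splits)
    ultimately show ?thesis by (auto simp: m_def dist_norm max_def min_def norm_minus_commute split: if_splits)
  qed (use e in simp)
  then show "\<exists>d>0. \<forall>r\<in>{0..}. dist r t < d \<longrightarrow> dist (S r x) (S t x) < e"
    using d(1) by (intro exI[of _ "min d 1"]) auto
qed

lemma S_continuous_subset: "A \<subseteq> {0..} \<Longrightarrow> continuous_on A (\<lambda>t. S t x)"
  by (rule continuous_on_subset[OF S_continuous])

lemma generator_semigroup:
  assumes "(u, w) \<in> semigroup_generator S" "0 \<le> t"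
  shows "(S t u, S t w) \<in> semigroup_generator S"
proof -
  have "((\<lambda>h. (S h u - u) /\<^sub>R h) \<longlongrightarrow> w) (at_right 0)" using assms by (simp add: semigroup_generator_def)
  then have "((\<lambda>h. S t ((S h u - u) /\<^sub>R h)) \<longlongrightarrow> S t w) (at_right 0)" by (intro tendsto_intros)
  moreover have "\<forall>\<^sub>F h in at_right 0. S t ((S h u - u) /\<^sub>R h) = (S h (S t u) - S t u) /\<^sub>R h"
    using eventually_at_right_less[of 0]
  proof eventually_elim
    case (elim h)
    then show ?case using S_add[of t h u] S_add[of h t u] assms(2)
      by (simp add: blinfun.bilinear_simps add.commute)
  qed
  ultimately show ?thesis by (auto simp: semigroup_generator_def intro: Lim_transform_eventually)
qed

text \<open>The generator only provides the right derivative at 0. On either side of t the quotient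
  is S m applied to the quotient with step h, where m is the smaller time and h the distance;
  continuity of the orbit of w then moves the base point from m to t.\<close>

lemma generator_derivative:
  assumes g: "(u, w) \<in> semigroup_generator S" and t: "0 \<le> t"
  shows "((\<lambda>r. S r u) has_vector_derivative S t w) (at t within {0..})"
  unfolding has_vector_derivative_def has_derivative_within'
proof (intro conjI allI impI bounded_linear_scaleR_left)
  fix e :: real assume e: "0 < e"
  obtain B where B: "\<And>r. r \<in> {0..t+1} \<Longrightarrow> norm (S r) \<le> B" using S_bounded[of "t+1"] by blast
  have B0: "0 \<le> B" using order_trans[OF norm_ge_zero B[of 0]] t by simp
  have "((\<lambda>h. (S h u - u) /\<^sub>R h) \<longlongrightarrow> w) (at_right 0)" using g by (simp add: semigroup_generator_def)
  from tendstoD[OF this, of "e / (2 * (B + 1))"] e B0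
  have "\<forall>\<^sub>F h in at_right 0. dist ((S h u - u) /\<^sub>R h) w < e / (2 * (B + 1))" by simp
  then obtain d where d: "d > 0" "\<And>h. 0 < h \<Longrightarrow> h < d \<Longrightarrow> norm ((S h u - u) /\<^sub>R h - w) < e / (2 * (B + 1))"
    unfolding eventually_at_right_field dist_norm by auto
  obtain d' where d': "d' > 0" "\<And>r. r \<in> {0..} \<Longrightarrow> dist r t < d' \<Longrightarrow> dist (S r w) (S t w) < e / 2"
    using S_continuous[of w] t e unfolding continuous_on_iff by (metis atLeast_iff half_gt_zero)
  have "norm (S r u - S t u - (r - t) *\<^sub>R S t w) / norm (r - t) < e"
    if r: "r \<in> {0..}" "0 < norm (r - t)" "norm (r - t) < min (min d 1) d'" for r
  proof -
    define m h where "m = min r t" and "h = \<bar>r - t\<bar>"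
    have mh: "m \<in> {0..t+1}" "0 < h" "h < d" "dist m t < d'" using r t d' by (auto simp: m_def h_def dist_real_def)
    have Smax: "S m (S h u) = S (max r t) u"
      using S_add[of m h u] mh by (simp add: m_def h_def max_def min_def split: if_splits)
    have "norm (S m ((S h u - u) /\<^sub>R h - w)) \<le> norm (S m) * norm ((S h u - u) /\<^sub>R h - w)" by (rule norm_blinfun)
    also have "\<dots> \<le> B * (e / (2 * (B + 1)))" using B[OF mh(1)] d(2)[OF mh(2,3)] B0 by (intro mult_mono) auto
    also have "\<dots> < e / 2" using B0 e by (simp add: field_simps)
    finally have 1: "norm (S m ((S h u - u) /\<^sub>R h - w)) < e / 2" .
    have 2: "norm (S m w - S t w) < e / 2" using d'(2)[of m] mh by (auto simp: dist_norm)
    have "(S r u - S t u - (r - t) *\<^sub>R S t w) /\<^sub>R (r - t) = S m ((S h u - u) /\<^sub>R h - w) + (S m w - S t w)"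
    proof (cases "t < r")
      case True
      then have "m = t" "h = r - t" "max r t = r" by (auto simp: m_def h_def)
      then show ?thesis using Smax r by (simp add: blinfun.bilinear_simps scaleR_diff_right)
    next
      case False
      then have *: "m = r" "h = t - r" "max r t = t" using r by (auto simp: m_def h_def)
      have "(S r u - S t u - (r - t) *\<^sub>R S t w) /\<^sub>R (r - t) = (S t u - S r u) /\<^sub>R (t - r) - S t w"
      proof -
        have "inverse (r - t) = - inverse (t - r)" by (metis inverse_minus_eq minus_diff_eq)
        moreover have "inverse (t - r) * (r - t) = -1" using r by (simp add: field_simps)
        ultimately show ?thesis using r by (simp add: scaleR_diff_right)
      qed
      then show ?thesis using Smax * by (simp add: blinfun.bilinear_simps)
    qed
    then have "norm ((S r u - S t u - (r - t) *\<^sub>R S t w) /\<^sub>R (r - t)) < e"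
      using 1 2 norm_triangle_ineq[of "S m ((S h u - u) /\<^sub>R h - w)" "S m w - S t w"] by simp
    then show ?thesis by (simp add: divide_inverse mult.commute)
  qed
  then show "\<exists>d>0. \<forall>r\<in>{0..}. 0 < norm (r - t) \<and> norm (r - t) < d \<longrightarrow>
      norm (S r u - S t u - (r - t) *\<^sub>R S t w) / norm (r - t) < e"
    using d(1) d'(1) by (intro exI[of _ "min (min d 1) d'"]) auto
qed

text \<open>Applying S h to the integral shifts the interval of integration, so the difference
  quotient reduces to averages of the orbit near the two end points.\<close>

lemma integral_in_generator:
  assumes a: "0 \<le> a"
  shows "(integral {0..a} (\<lambda>r. S r x), S a x - x) \<in> semigroup_generator S"
proof -
  define J where "J b = integral {0..b} (\<lambda>r. S r x)" for b
  have int: "(\<lambda>r. S r x) integrable_on {b..c}" if "0 \<le> b" for b c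
    by (rule integrable_continuous_real) (use that in \<open>auto intro: S_continuous_subset\<close>)
  have J: "(J has_vector_derivative S b x) (at b within {0..a+1})" if "b \<in> {0..a+1}" for b
    unfolding J_def by (rule integral_has_vector_derivative[OF S_continuous_subset that]) auto
  have lim: "((\<lambda>h. (J (b + h) - J b) /\<^sub>R h) \<longlongrightarrow> S b x) (at_right 0)" if b: "0 \<le> b" "b \<le> a" for b
  proof -
    have "((\<lambda>y. (J y - J b) /\<^sub>R (y - b)) \<longlongrightarrow> S b x) (at b within {0..a+1})"
      using J[of b] b by (simp add: has_vector_derivative_iff_quotient)
    then have "((\<lambda>y. (J y - J b) /\<^sub>R (y - b)) \<longlongrightarrow> S b x) (at b within {b..a+1})"
      by (rule tendsto_within_subset) (use b in auto)
    then have "((\<lambda>y. (J y - J b) /\<^sub>R (y - b)) \<longlongrightarrow> S b x) (at_right b)"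
      using b by (simp add: at_within_Icc_at_right)
    then show ?thesis by (subst (asm) at_right_to_0) (simp add: filterlim_filtermap add.commute)
  qed
  have "((\<lambda>h. (J (a + h) - J a) /\<^sub>R h - (J (0 + h) - J 0) /\<^sub>R h) \<longlongrightarrow> S a x - S 0 x) (at_right 0)"
    by (intro tendsto_diff lim) (use a in auto)
  moreover have "\<forall>\<^sub>F h in at_right 0. (J (a + h) - J a) /\<^sub>R h - (J (0 + h) - J 0) /\<^sub>R h = (S h (J a) - J a) /\<^sub>R h"
    using eventually_at_right_less[of 0]
  proof eventually_elim
    case (elim h)
    have "S h (J a) = integral {0..a} (\<lambda>r. S h (S r x))"
      unfolding J_def using integral_linear[OF int blinfun.bounded_linear_right, of 0 a "S h"] by (simp add: o_def)
    also have "\<dots> = integral {0..a} ((\<lambda>r. S r x) \<circ> (+) h)"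
      using elim by (intro integral_cong) (auto simp: S_add)
    also have "\<dots> = integral {0 + h..a + h} (\<lambda>r. S r x)"
      by (rule integral_shift_Icc_real)
    also have "\<dots> = J (a + h) - J h"
      using Henstock_Kurzweil_Integration.integral_combine[of 0 h "a + h" "\<lambda>r. S r x"] elim a int by (simp add: J_def algebra_simps)
    finally have "(J (a + h) - J a) - J h = S h (J a) - J a" by simp
    then have "((J (a + h) - J a) - J h) /\<^sub>R h = (S h (J a) - J a) /\<^sub>R h" by simp
    then show ?case by (simp add: J_def scaleR_diff_right)
  qed
  ultimately have "((\<lambda>h. (S h (J a) - J a) /\<^sub>R h) \<longlongrightarrow> S a x - S 0 x) (at_right 0)"
    by (rule Lim_transform_eventually)
  then show ?thesis by (simp add: semigroup_generator_def J_def S0)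
qed

lemma generator_scale: "(u, w) \<in> semigroup_generator S \<Longrightarrow> (r *\<^sub>R u, r *\<^sub>R w) \<in> semigroup_generator S"
proof -
  assume "(u, w) \<in> semigroup_generator S"
  then have "((\<lambda>t. r *\<^sub>R ((S t u - u) /\<^sub>R t)) \<longlongrightarrow> r *\<^sub>R w) (at_right 0)"
    by (intro tendsto_scaleR tendsto_const) (simp add: semigroup_generator_def)
  moreover have "r *\<^sub>R ((S t u - u) /\<^sub>R t) = (S t (r *\<^sub>R u) - r *\<^sub>R u) /\<^sub>R t" for t
    by (simp add: blinfun.bilinear_simps scaleR_diff_right mult.commute)
  ultimately show ?thesis by (simp add: semigroup_generator_def)
qed

text \<open>The averages of the orbit over [0, y] lie in the domain and tend to x as y tends to
  0.\<close>

lemma generator_dense: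
  assumes e: "0 < e"
  shows "\<exists>(u, w)\<in>semigroup_generator S. norm (u - x) < e"
proof -
  have "((\<lambda>u. integral {0..u} (\<lambda>r. S r x)) has_vector_derivative S 0 x) (at 0 within {0..1})"
    by (rule integral_has_vector_derivative[OF S_continuous_subset]) auto
  then have "((\<lambda>y. (integral {0..y} (\<lambda>r. S r x) - integral {0..0} (\<lambda>r. S r x)) /\<^sub>R (y - 0)) \<longlongrightarrow> S 0 x) (at 0 within {0..1})"
    by (simp add: has_vector_derivative_iff_quotient)
  then have "((\<lambda>y. integral {0..y} (\<lambda>r. S r x) /\<^sub>R y) \<longlongrightarrow> x) (at 0 within {0..1})" by (simp add: S0)
  then have "((\<lambda>y. integral {0..y} (\<lambda>r. S r x) /\<^sub>R y) \<longlongrightarrow> x) (at_right 0)"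
    by (simp add: at_within_Icc_at_right)
  from tendstoD[OF this e] eventually_at_right_less[of 0]
  have "\<forall>\<^sub>F y in at_right 0. 0 < y \<and> norm (integral {0..y} (\<lambda>r. S r x) /\<^sub>R y - x) < e"
    by eventually_elim (simp add: dist_norm)
  then obtain y where y: "0 < y" "norm (integral {0..y} (\<lambda>r. S r x) /\<^sub>R y - x) < e"
    using eventually_happens'[OF trivial_limit_at_right_real] by blast
  moreover have "(integral {0..y} (\<lambda>r. S r x) /\<^sub>R y, (S y x - x) /\<^sub>R y) \<in> semigroup_generator S"
    by (rule generator_scale[OF integral_in_generator]) (use y in simp)
  ultimately show ?thesis by blast
qed

end

section \<open>Integration by parts for the Dirichlet Laplacian\<close>

lemma id_measurable_unit_leb: "(\<lambda>x. x) \<in> borel_measurable unit_leb"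
  by (intro measurable_restrict_space1 measurable_completion) simp

lemma finite_measure_unit_leb: "finite_measure unit_leb"
  by (rule finite_measureI, subst emeasure_restrict_space) auto

lemma rep_L2_square_integrable: "square_integrable (rep_L2 x)"
  using Quotient3_rep_reflp[OF Quotient3_L2, of x] by (simp add: L2_eq_def)

lemma rep_L2_integrable: "integrable unit_leb (rep_L2 x)"
proof -
  interpret finite_measure unit_leb by (rule finite_measure_unit_leb)
  show ?thesis using rep_L2_square_integrable[of x] unfolding square_integrable_def
    by (elim conjE) (rule square_integrable_imp_integrable)
qed

lemma inner_L2_rep: "x \<bullet> y = (\<integral>t. rep_L2 x t * rep_L2 y t \<partial>unit_leb)"
proof -
  have "abs_L2 (rep_L2 z) = z" "L2_eq (rep_L2 z) (rep_L2 z)" for z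
    using Quotient3_rep_reflp[OF Quotient3_L2] Quotient3_abs_rep[OF Quotient3_L2] by auto
  then show ?thesis by (metis inner_L2.abs_eq)
qed

lemma AE_unit_leb_neq: "AE y in unit_leb. y \<noteq> a"
proof -
  have "AE y in lebesgue. y \<notin> {a}" by (rule AE_not_in) auto
  then show ?thesis by (subst AE_restrict_space_iff) auto
qed

lemma set_integral_eq_unit_leb:
  fixes w :: "real \<Rightarrow> real"
  assumes "0 \<le> x" "x \<le> (1::real)"
  shows "(LINT y:{0<..<x}|lebesgue. w y) = (\<integral>y. indicator {..<x} y * w y \<partial>unit_leb)"
proof -
  have "(\<integral>y. indicator {..<x} y * w y \<partial>unit_leb) = (\<integral>y. indicator {0<..<1} y *\<^sub>R (indicator {..<x} y * w y) \<partial>lebesgue)"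
    by (rule integral_restrict_space) simp
  also have "\<dots> = (LINT y:{0<..<x}|lebesgue. w y)"
    unfolding set_lebesgue_integral_def using assms by (intro Bochner_Integration.integral_cong refl) (auto simp: indicator_def)
  finally show ?thesis ..
qed

lemma integrable_indicator_mult_unit_leb:
  fixes w :: "real \<Rightarrow> real"
  assumes "integrable unit_leb w"
  shows "integrable unit_leb (\<lambda>y. indicator {..<x} y * w y)"
proof (rule Bochner_Integration.integrable_bound[OF assms])
  note [measurable] = id_measurable_unit_leb borel_measurable_integrable[OF assms]
  have "(\<lambda>y. (if y < x then 1 else 0) * w y) \<in> borel_measurable unit_leb" by measurable
  then show "(\<lambda>y. indicator {..<x} y * w y) \<in> borel_measurable unit_leb" by (simp add: indicator_def of_bool_def)
qed (auto simp: indicator_def)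

text \<open>For y different from x the indicator is eventually constant as the end point tends to x,
  so dominated convergence applies off a null set.\<close>

lemma primitive_continuous:
  fixes w :: "real \<Rightarrow> real"
  assumes w: "integrable unit_leb w"
  shows "continuous_on UNIV (\<lambda>x. \<integral>y. indicator {..<x} y * w y \<partial>unit_leb)"
proof -
  have "(\<lambda>n. \<integral>y. indicator {..<u n} y * w y \<partial>unit_leb) \<longlonglongrightarrow> (\<integral>y. indicator {..<x} y * w y \<partial>unit_leb)"
    if u: "u \<longlonglongrightarrow> x" for u and x :: real
  proof (rule integral_dominated_convergence[where w="\<lambda>y. norm (w y)"])
    show "AE y in unit_leb. (\<lambda>n. indicator {..<u n} y * w y) \<longlonglongrightarrow> indicator {..<x} y * w y"
      using AE_unit_leb_neq[of x]
    proof eventually_elim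
      case (elim y)
      have "\<forall>\<^sub>F n in sequentially. (y < u n) = (y < x)"
      proof (cases "y < x")
        case True
        then show ?thesis using order_tendstoD(1)[OF u True] by simp
      next
        case False
        then have "x < y" using elim by simp
        from order_tendstoD(2)[OF u this] False show ?thesis by (auto elim: eventually_mono)
      qed
      then show ?case by (intro tendsto_eventually) (auto elim!: eventually_mono simp: indicator_def)
    qed
  qed (use integrable_indicator_mult_unit_leb[OF w] w in \<open>auto simp: indicator_def\<close>)
  then show ?thesis unfolding continuous_on_sequentially by (auto simp: o_def)
qed

text \<open>w is merely square integrable and U' only a primitive of it, so integration by parts
  goes through Fubini: v is written as the primitive of V', and exchanging the integrals turns w
  \<bullet> v into the integral of V' y * (U' 1 - U' y). The conclusion lists the pairs from which
  symmetry and dissipativity are read off.\<close>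

lemma dirichlet_form:
  assumes u: "(u, w) \<in> dirichlet_laplacian" and v: "(v, z) \<in> dirichlet_laplacian"
  obtains U' V' where "w \<bullet> v = - (\<integral>x. U' x * V' x \<partial>unit_leb)" "z \<bullet> u = - (\<integral>x. V' x * U' x \<partial>unit_leb)"
    "w \<bullet> u = - (\<integral>x. U' x * U' x \<partial>unit_leb)"
proof -
  interpret M: finite_measure unit_leb by (rule finite_measure_unit_leb)
  interpret P: pair_sigma_finite unit_leb unit_leb by (intro pair_sigma_finite.intro M.sigma_finite_measure_axioms)
  have *: "w \<bullet> v = - (\<integral>x. U' x * V' x \<partial>unit_leb)"
    if U: "AE x in unit_leb. rep_L2 u x = U x" "\<forall>x\<in>{0..1}. (U has_real_derivative U' x) (at x within {0..1})"
      "\<forall>x\<in>{0..1}. U' x = U' 0 + (LINT y:{0<..<x}|lebesgue. rep_L2 w y)" "U 0 = 0" "U 1 = 0"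
    and V: "AE x in unit_leb. rep_L2 v x = V x" "\<forall>x\<in>{0..1}. (V has_real_derivative V' x) (at x within {0..1})"
      "\<forall>x\<in>{0..1}. V' x = V' 0 + (LINT y:{0<..<x}|lebesgue. rep_L2 z y)" "V 0 = 0" "V 1 = 0"
    for u w v z :: L2 and U U' V V'
  proof -
    define W where "W x = (\<integral>y. indicator {..<x} y * rep_L2 w y \<partial>unit_leb)" for x
    have U'W: "U' x = U' 0 + W x" if "x \<in> {0..1}" for x
      using bspec[OF U(3) that] set_integral_eq_unit_leb[of x "rep_L2 w"] that unfolding W_def by (metis atLeastAtMost_iff)
    have Wc: "continuous_on UNIV W" unfolding W_def by (rule primitive_continuous[OF rep_L2_integrable])
    define Z where "Z x = (\<integral>y. indicator {..<x} y * rep_L2 z y \<partial>unit_leb)" for x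
    have V'Z: "V' x = V' 0 + Z x" if "x \<in> {0..1}" for x
      using bspec[OF V(3) that] set_integral_eq_unit_leb[of x "rep_L2 z"] that unfolding Z_def by (metis atLeastAtMost_iff)
    have Zc: "continuous_on UNIV Z" unfolding Z_def by (rule primitive_continuous[OF rep_L2_integrable])
    \<comment> \<open>A continuous function on the whole line that agrees with V' on [0, 1]. Outside
      this interval nothing is known about V', not even measurability.\<close>
    define Y where "Y x = V' 0 + Z x" for x
    have YV: "Y x = V' x" if "x \<in> {0..1}" for x unfolding Y_def by (rule V'Z[OF that, symmetric])
    have Yc: "continuous_on UNIV Y" unfolding Y_def by (intro continuous_intros Zc)
    have Ym [measurable]: "Y \<in> borel_measurable borel" by (rule borel_measurable_continuous_onI[OF Yc])
    have ind: "(\<lambda>y. indicator A y *\<^sub>R Y y) \<in> borel_measurable lebesgue"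
      "(\<lambda>y. indicator A y *\<^sub>R Y y) \<in> borel_measurable lborel"
      "(\<lambda>y. indicator A y *\<^sub>R (indicator B y * Y y)) \<in> borel_measurable lebesgue"
      if "A \<in> sets borel" "B \<in> sets borel" for A B :: "real set"
    proof -
      have 1: "(\<lambda>y. indicator A y *\<^sub>R Y y) \<in> borel_measurable borel"
        "(\<lambda>y. indicator A y *\<^sub>R (indicator B y * Y y)) \<in> borel_measurable borel"
        using that by measurable
      then show "(\<lambda>y. indicator A y *\<^sub>R Y y) \<in> borel_measurable lborel" by simp
      show "(\<lambda>y. indicator A y *\<^sub>R Y y) \<in> borel_measurable lebesgue"
       "(\<lambda>y. indicator A y *\<^sub>R (indicator B y * Y y)) \<in> borel_measurable lebesgue"
        by (rule measurable_completion; use 1 in simp)+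
    qed
    note [measurable] = borel_measurable_unit_leb[OF Ym] id_measurable_unit_leb
      borel_measurable_integrable[OF rep_L2_integrable[of w]]
    have "compact (Y ` {0..1})" by (rule compact_continuous_image) (auto intro: continuous_on_subset[OF Yc])
    then obtain K where K: "\<And>y. y \<in> {0..1} \<Longrightarrow> \<bar>Y y\<bar> \<le> K" using compact_imp_bounded bounded_iff by (metis image_eqI real_norm_def)
    have VY: "V x = (\<integral>y. indicator {..x} y * Y y \<partial>unit_leb)" if x: "x \<in> {0<..<1}" for x
    proof -
      have "(\<integral>y. indicator {..x} y * Y y \<partial>unit_leb) = (\<integral>y. indicator {0<..<1} y *\<^sub>R (indicator {..x} y * Y y) \<partial>lebesgue)"
        by (rule integral_restrict_space) simp
      also have "\<dots> = (\<integral>y. indicator {0..x} y *\<^sub>R Y y \<partial>lebesgue)"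
      proof (rule integral_cong_AE)
        show "(\<lambda>y. indicator {0<..<1} y *\<^sub>R (indicator {..x} y * Y y)) \<in> borel_measurable lebesgue"
          by (rule ind(1)[where B="{}"] ind(3); simp)
        show "(\<lambda>y. indicator {0..x} y *\<^sub>R Y y) \<in> borel_measurable lebesgue"
          by (rule ind(1)[where B="{}"] ind(3); simp)
        have "AE y in lebesgue. y \<notin> {0::real}" by (rule AE_not_in) auto
        then show "AE y in lebesgue. indicator {0<..<1} y *\<^sub>R (indicator {..x} y * Y y) = indicator {0..x} y *\<^sub>R Y y"
          by eventually_elim (use x in \<open>auto simp: indicator_def\<close>)
      qed
      also have "\<dots> = (\<integral>y. indicator {0..x} y *\<^sub>R Y y \<partial>lborel)"
        by (rule integral_completion, rule ind[where B="{}"]) auto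
      also have "\<dots> = V x - V 0"
      proof (rule integral_FTC_atLeastAtMost)
        fix y assume y: "0 \<le> y" "y \<le> x"
        then have "(V has_real_derivative V' y) (at y within {0..1})" using V(2) x by auto
        then have "(V has_real_derivative V' y) (at y within {0..x})" by (rule DERIV_subset) (use x in auto)
        then show "(V has_vector_derivative Y y) (at y within {0..x})"
          using YV[of y] x y by (simp add: has_real_derivative_iff_has_vector_derivative)
      qed (use x Yc continuous_on_subset in auto)
      finally show ?thesis using V(4) by simp
    qed
    \<comment> \<open>Triangular kernel of the Fubini exchange: integrating over y first gives w
      times v at x, integrating over x first gives V' y * (U' 1 - U' y).\<close>
    define f where "f x y = rep_L2 w x * (indicator {..x} y * Y y)" for x y
    have "integrable (unit_leb \<Otimes>\<^sub>M unit_leb) (case_prod f)"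
    proof (rule P.Fubini_integrable)
      have "(\<lambda>(x, y). rep_L2 w x * ((if y \<le> x then 1 else 0) * Y y)) \<in> borel_measurable (unit_leb \<Otimes>\<^sub>M unit_leb)"
        by measurable
      then show m: "case_prod f \<in> borel_measurable (unit_leb \<Otimes>\<^sub>M unit_leb)"
        by (simp add: f_def[abs_def] indicator_def of_bool_def)
      have i2: "integrable unit_leb (f x)" for x
      proof (rule M.integrable_const_bound[where B="\<bar>rep_L2 w x\<bar> * K"])
        show "AE y in unit_leb. norm (f x y) \<le> \<bar>rep_L2 w x\<bar> * K"
          using K by (intro AE_I2) (auto simp: f_def abs_mult indicator_def intro!: mult_left_mono mult_nonneg_nonneg order_trans[OF abs_ge_zero K[of 0]])
        have "(\<lambda>y. rep_L2 w x * ((if y \<le> x then 1 else 0) * Y y)) \<in> borel_measurable unit_leb"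
          by measurable
        then show "f x \<in> borel_measurable unit_leb"
          by (simp add: f_def[abs_def] indicator_def of_bool_def)
      qed
      then show "AE x in unit_leb. integrable unit_leb (\<lambda>y. case_prod f (x, y))" by simp
      show "integrable unit_leb (\<lambda>x. \<integral>y. norm (case_prod f (x, y)) \<partial>unit_leb)"
      proof (rule Bochner_Integration.integrable_bound)
        show "integrable unit_leb (\<lambda>x. rep_L2 w x * K)" using rep_L2_integrable by simp
        show "(\<lambda>x. \<integral>y. norm (case_prod f (x, y)) \<partial>unit_leb) \<in> borel_measurable unit_leb"
          by (intro M.borel_measurable_lebesgue_integral) (use m in \<open>auto intro!: borel_measurable_norm simp: case_prod_beta'\<close>)
        show "AE x in unit_leb. norm (\<integral>y. norm (case_prod f (x, y)) \<partial>unit_leb) \<le> norm (rep_L2 w x * K)"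
        proof (rule AE_I2)
          fix x
          have "(\<integral>y. norm (f x y) \<partial>unit_leb) \<le> (\<integral>y. \<bar>rep_L2 w x\<bar> * K \<partial>unit_leb)"
          proof (rule integral_mono)
            show "integrable unit_leb (\<lambda>y. norm (f x y))" using i2 by (rule integrable_norm)
            fix y assume "y \<in> space unit_leb"
            then show "norm (f x y) \<le> \<bar>rep_L2 w x\<bar> * K" using K
              by (auto simp: f_def abs_mult indicator_def intro!: mult_left_mono mult_nonneg_nonneg order_trans[OF abs_ge_zero K[of 0]])
          qed auto
          also have "\<dots> = \<bar>rep_L2 w x\<bar> * K" by (simp add: measure_restrict_space)
          finally show "norm (\<integral>y. norm (case_prod f (x, y)) \<partial>unit_leb) \<le> norm (rep_L2 w x * K)"
            using order_trans[OF abs_ge_zero K[of 0]] by (simp add: abs_mult)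
        qed
      qed
    qed
    from P.Fubini_integral[OF this]
    have fub: "(\<integral>y. (\<integral>x. f x y \<partial>unit_leb) \<partial>unit_leb) = (\<integral>x. (\<integral>y. f x y \<partial>unit_leb) \<partial>unit_leb)" .
    have "w \<bullet> v = (\<integral>x. rep_L2 w x * rep_L2 v x \<partial>unit_leb)" by (rule inner_L2_rep)
    also have "\<dots> = (\<integral>x. (\<integral>y. f x y \<partial>unit_leb) \<partial>unit_leb)"
    proof (rule integral_cong_AE)
      show "(\<lambda>x. rep_L2 w x * rep_L2 v x) \<in> borel_measurable unit_leb"
        using borel_measurable_integrable[OF rep_L2_integrable[of w]] borel_measurable_integrable[OF rep_L2_integrable[of v]]
        by (rule borel_measurable_times)
      show "(\<lambda>x. \<integral>y. f x y \<partial>unit_leb) \<in> borel_measurable unit_leb"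
        by (intro M.borel_measurable_lebesgue_integral) (rule borel_measurable_integrable[OF \<open>integrable _ (case_prod f)\<close>])
      show "AE x in unit_leb. rep_L2 w x * rep_L2 v x = (\<integral>y. f x y \<partial>unit_leb)"
        using V(1) AE_space
      proof eventually_elim
        case (elim x)
        then show ?case using VY[of x] by (simp add: f_def)
      qed
    qed
    also have "\<dots> = (\<integral>y. Y y * (U' 1 - U' y) \<partial>unit_leb)"
      unfolding fub[symmetric]
    proof (rule Bochner_Integration.integral_cong[OF refl])
      fix y assume "y \<in> space unit_leb"
      then have y: "y \<in> {0<..<1}" by simp
      have "(\<integral>x. f x y \<partial>unit_leb) = (\<integral>x. Y y * (indicator {..<1} x * rep_L2 w x - indicator {..<y} x * rep_L2 w x) \<partial>unit_leb)"
        by (intro Bochner_Integration.integral_cong refl) (auto simp: f_def indicator_def)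
      also have "\<dots> = Y y * (W 1 - W y)"
        using integrable_indicator_mult_unit_leb[OF rep_L2_integrable[of w]] by (simp add: W_def)
      also have "W 1 - W y = U' 1 - U' y" using U'W[of 1] U'W[of y] y by simp
      finally show "(\<integral>x. f x y \<partial>unit_leb) = Y y * (U' 1 - U' y)" .
    qed
    also have "\<dots> = (\<integral>y. U' 1 * Y y - U' y * V' y \<partial>unit_leb)"
      by (intro Bochner_Integration.integral_cong refl) (use YV in \<open>auto simp: algebra_simps\<close>)
    also have "\<dots> = U' 1 * (\<integral>y. Y y \<partial>unit_leb) - (\<integral>y. U' y * V' y \<partial>unit_leb)"
    proof -
      have Yi: "integrable unit_leb Y"
        by (rule M.integrable_const_bound[where B=K]) (use K in auto)
      have "integrable unit_leb (\<lambda>y. (U' 0 + W y) * Y y)"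
      proof -
        have Wm: "W \<in> borel_measurable unit_leb" by (rule borel_measurable_unit_leb[OF borel_measurable_continuous_onI[OF Wc]])
        have "compact ((\<lambda>y. (U' 0 + W y) * Y y) ` {0..1})"
          by (rule compact_continuous_image) (auto intro!: continuous_intros continuous_on_subset[OF Yc] continuous_on_subset[OF Wc])
        then obtain B where "\<And>y. y \<in> {0..1} \<Longrightarrow> \<bar>(U' 0 + W y) * Y y\<bar> \<le> B"
          using compact_imp_bounded bounded_iff by (metis (mono_tags, lifting) image_eqI real_norm_def)
        then show ?thesis by (intro M.integrable_const_bound[where B=B]) (use Wm in auto)
      qed
      moreover have "integrable unit_leb (\<lambda>y. (U' 0 + W y) * Y y) \<longleftrightarrow> integrable unit_leb (\<lambda>y. U' y * V' y)"
        by (rule Bochner_Integration.integrable_cong[OF refl]) (use U'W[symmetric] YV in auto)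
      ultimately show ?thesis using Yi by simp
    qed
    \<comment> \<open>The boundary values of V remove the term with U' 1.\<close>
    also have "(\<integral>y. Y y \<partial>unit_leb) = 0"
    proof -
      have "(\<integral>y. Y y \<partial>unit_leb) = (\<integral>y. indicator {0<..<1} y *\<^sub>R Y y \<partial>lebesgue)"
        by (rule integral_restrict_space) simp
      also have "\<dots> = (\<integral>y. indicator {0..1} y *\<^sub>R Y y \<partial>lebesgue)"
      proof (rule integral_cong_AE)
        show "(\<lambda>y. indicator {0<..<1} y *\<^sub>R Y y) \<in> borel_measurable lebesgue"
          by (rule ind(1)[where B="{}"] ind(3); simp)
        show "(\<lambda>y. indicator {0..1} y *\<^sub>R Y y) \<in> borel_measurable lebesgue"
          by (rule ind(1)[where B="{}"] ind(3); simp)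
        have "AE y in lebesgue. y \<notin> {0::real}" "AE y in lebesgue. y \<notin> {1::real}" by (rule AE_not_in; auto)+
        then show "AE y in lebesgue. indicator {0<..<1} y *\<^sub>R Y y = indicator {0..1} y *\<^sub>R Y y"
          by eventually_elim (auto simp: indicator_def)
      qed
      also have "\<dots> = (\<integral>y. indicator {0..1} y *\<^sub>R Y y \<partial>lborel)"
        by (rule integral_completion, rule ind[where B="{}"]) auto
      also have "\<dots> = V 1 - V 0"
      proof (rule integral_FTC_atLeastAtMost)
        fix y :: real assume y: "0 \<le> y" "y \<le> 1"
        then show "(V has_vector_derivative Y y) (at y within {0..1})"
          using y YV[of y] V(2) by (simp add: has_real_derivative_iff_has_vector_derivative)
      qed (use Yc continuous_on_subset in auto)
      finally show ?thesis using V(4,5) by simp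
    qed
    finally show ?thesis by simp
  qed
  from u obtain U U' where U: "AE x in unit_leb. rep_L2 u x = U x" "\<forall>x\<in>{0..1}. (U has_real_derivative U' x) (at x within {0..1})"
      "\<forall>x\<in>{0..1}. U' x = U' 0 + (LINT y:{0<..<x}|lebesgue. rep_L2 w y)" "U 0 = 0" "U 1 = 0"
    unfolding dirichlet_laplacian_def by blast
  from v obtain V V' where V: "AE x in unit_leb. rep_L2 v x = V x" "\<forall>x\<in>{0..1}. (V has_real_derivative V' x) (at x within {0..1})"
      "\<forall>x\<in>{0..1}. V' x = V' 0 + (LINT y:{0<..<x}|lebesgue. rep_L2 z y)" "V 0 = 0" "V 1 = 0"
    unfolding dirichlet_laplacian_def by blast
  show ?thesis by (rule that[OF *[OF U V] *[OF V U] *[OF U U]])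
qed

lemma dirichlet_laplacian_symmetric:
  assumes "(u, w) \<in> dirichlet_laplacian" "(v, z) \<in> dirichlet_laplacian"
  shows "w \<bullet> v = u \<bullet> z"
  by (rule dirichlet_form[OF assms]) (simp add: inner_commute mult.commute)

lemma dirichlet_laplacian_dissipative:
  assumes "(u, w) \<in> dirichlet_laplacian"
  shows "w \<bullet> u \<le> 0"
proof -
  obtain U' where "w \<bullet> u = - (\<integral>x. U' x * U' x \<partial>unit_leb)" by (rule dirichlet_form[OF assms assms])
  then show ?thesis by (simp add: Bochner_Integration.integral_nonneg)
qed

text \<open>Separates the Laplacian from the probabilistic part: a symmetric generator with
  nonpositive form on a real Hilbert space yields a semigroup of symmetric contractions.\<close>

locale heat_semigroup =
  fixes S :: "real \<Rightarrow> 'a::{real_inner, banach} \<Rightarrow>\<^sub>L 'a"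
  assumes C0': "C0_semigroup S"
    and symmetric: "\<And>u w v z. (u, w) \<in> semigroup_generator S \<Longrightarrow> (v, z) \<in> semigroup_generator S \<Longrightarrow> w \<bullet> v = u \<bullet> z"
    and dissipative: "\<And>u w. (u, w) \<in> semigroup_generator S \<Longrightarrow> w \<bullet> u \<le> 0"
begin

sublocale c0_semigroup S by unfold_locales (rule C0')

lemma generator_derivative_at:
  assumes "(u, w) \<in> semigroup_generator S" "0 < t"
  shows "((\<lambda>r. S r u) has_vector_derivative S t w) (at t)"
  using generator_derivative[OF assms(1), of t] assms(2)
  by (simp add: at_within_interior[of t "{0..}"])

text \<open>On the domain the squared norm of an orbit has derivative 2 * (S r w \<bullet> S r u),
  which is not positive; density extends the bound to all vectors.\<close>

lemma S_contraction: assumes t: "0 \<le> t" shows "norm (S t x) \<le> norm x"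
proof -
  have D: "norm (S t u) \<le> norm u" if g: "(u, w) \<in> semigroup_generator S" for u w
  proof -
    have "(\<lambda>r. S r u \<bullet> S r u) t \<le> (\<lambda>r. S r u \<bullet> S r u) 0"
    proof (rule DERIV_nonpos_imp_decreasing_open[OF t])
      fix r assume r: "0 < r" "r < t"
      have "((\<lambda>r. S r u \<bullet> S r u) has_vector_derivative (S r u \<bullet> S r w + S r w \<bullet> S r u)) (at r)"
        by (rule bounded_bilinear.has_vector_derivative[OF bounded_bilinear_inner]; rule generator_derivative_at[OF g r(1)])
      moreover have "S r w \<bullet> S r u \<le> 0" using dissipative[OF generator_semigroup[OF g]] r by simp
      ultimately show "\<exists>y. ((\<lambda>r. S r u \<bullet> S r u) has_real_derivative y) (at r) \<and> y \<le> 0"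
        by (intro exI[of _ "S r u \<bullet> S r w + S r w \<bullet> S r u"])
          (simp add: has_real_derivative_iff_has_vector_derivative inner_commute)
    qed (intro continuous_on_inner S_continuous_subset; auto)
    then show ?thesis by (simp add: S0 norm_le)
  qed
  show ?thesis
  proof (rule field_le_epsilon)
    fix e :: real assume e: "0 < e"
    \<comment> \<open>At this point the operator norm of S t is only known to be finite, so the
      approximation is chosen relative to it.\<close>
    define d where "d = e / (norm (S t) + 1)"
    have d: "d > 0" unfolding d_def using e by (intro divide_pos_pos) (auto intro: add_nonneg_pos)
    obtain u w where u: "(u, w) \<in> semigroup_generator S" "norm (u - x) < d" using generator_dense[OF d] by blast
    have "norm (S t x) \<le> norm (S t u) + norm (S t (x - u))"
      using norm_triangle_ineq[of "S t u" "S t (x - u)"] by (simp add: blinfun.diff_right)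
    also have "norm (S t u) \<le> norm u" by (rule D[OF u(1)])
    also have "norm (S t (x - u)) \<le> norm (S t) * norm (x - u)" by (rule norm_blinfun)
    also have "norm u \<le> norm x + norm (x - u)" using norm_triangle_ineq4[of x "x - u"] by simp
    also have "norm x + norm (x - u) + norm (S t) * norm (x - u) = norm x + (norm (S t) + 1) * norm (x - u)"
      by (simp add: algebra_simps)
    also have "(norm (S t) + 1) * norm (x - u) \<le> (norm (S t) + 1) * d"
      using u(2) by (intro mult_left_mono) (auto simp: norm_minus_commute)
    also have "\<dots> = e" unfolding d_def using add_nonneg_pos[of "norm (S t)" 1] by (simp add: less_imp_neq[symmetric])
    finally show "norm (S t x) \<le> norm x + e" by simp
  qed
qed

text \<open>For u and v in the domain, S (t - r) u \<bullet> S r v has derivative 0 in r by the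
  symmetry of the generator, and its values at r = 0 and r = t are the two sides.\<close>

lemma S_symmetric: assumes t: "0 \<le> t" shows "S t x \<bullet> y = x \<bullet> S t y"
proof -
  have D: "S t u \<bullet> v = u \<bullet> S t v"
    if g: "(u, w) \<in> semigroup_generator S" and h: "(v, z) \<in> semigroup_generator S" for u w v z
  proof (cases "t = 0")
    case False
    then have t0: "0 < t" using t by simp
    have "(\<lambda>r. S (t - r) u \<bullet> S r v) t = (\<lambda>r. S (t - r) u \<bullet> S r v) 0"
    proof (rule DERIV_isconst_end[OF t0])
      show "continuous_on {0..t} (\<lambda>r. S (t - r) u \<bullet> S r v)"
      proof (rule continuous_on_inner)
        show "continuous_on {0..t} (\<lambda>r. S (t - r) u)"
          by (rule continuous_on_compose2[OF S_continuous]) (auto intro!: continuous_intros)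
      qed (auto intro: S_continuous_subset)
      fix r assume r: "0 < r" "r < t"
      have "((\<lambda>r. S r u) \<circ> (\<lambda>r. t - r) has_vector_derivative ((-1) *\<^sub>R S (t - r) w)) (at r)"
        by (rule vector_diff_chain_at) (use generator_derivative_at[OF g, of "t - r"] r in \<open>auto intro!: derivative_eq_intros\<close>)
      then have 1: "((\<lambda>r. S (t - r) u) has_vector_derivative - S (t - r) w) (at r)" by (simp add: o_def)
      have "((\<lambda>r. S (t - r) u \<bullet> S r v) has_vector_derivative (S (t - r) u \<bullet> S r z + (- S (t - r) w) \<bullet> S r v)) (at r)"
        by (rule bounded_bilinear.has_vector_derivative[OF bounded_bilinear_inner 1 generator_derivative_at[OF h r(1)]])
      moreover have "S (t - r) w \<bullet> S r v = S (t - r) u \<bullet> S r z"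
        using symmetric[OF generator_semigroup[OF g, of "t - r"] generator_semigroup[OF h, of r]] r by simp
      ultimately show "((\<lambda>r. S (t - r) u \<bullet> S r v) has_real_derivative 0) (at r)"
        by (simp add: has_real_derivative_iff_has_vector_derivative)
    qed
    then show ?thesis by (simp add: S0)
  qed (simp add: S0)
  have cl: "\<exists>f. (\<forall>n. f n \<in> fst ` semigroup_generator S) \<and> f \<longlonglongrightarrow> a" for a
  proof -
    have "a \<in> closure (fst ` semigroup_generator S)"
      unfolding closure_approachable dist_norm using generator_dense by (metis (no_types, lifting) case_prodE fst_conv image_eqI)
    then show ?thesis by (simp add: closure_sequential)
  qed
  obtain f where f: "\<And>n. f n \<in> fst ` semigroup_generator S" "f \<longlonglongrightarrow> x" using cl by blast
  obtain g where g: "\<And>n. g n \<in> fst ` semigroup_generator S" "g \<longlonglongrightarrow> y" using cl by blast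
  have "(\<lambda>n. S t (f n) \<bullet> g n) \<longlonglongrightarrow> S t x \<bullet> y" by (intro tendsto_intros f g)
  moreover have "(\<lambda>n. f n \<bullet> S t (g n)) \<longlonglongrightarrow> x \<bullet> S t y" by (intro tendsto_intros f g)
  moreover have "S t (f n) \<bullet> g n = f n \<bullet> S t (g n)" for n using D f(1)[of n] g(1)[of n] by force
  ultimately show ?thesis using LIMSEQ_unique by simp
qed

end

section \<open>Shifts of the measures\<close>

text \<open>Expanding \<open>exp (2 * \<beta> * u i * u j)\<close> writes the Gaussian kernel as a sum of rank one kernels;
  the sine series is then controlled termwise.\<close>

lemma gaussian_kernel_bound:
  fixes c u l :: "'i \<Rightarrow> real" and K :: "'i \<Rightarrow> 'i \<Rightarrow> real"
  assumes CS: "\<And>c. (\<Sum>i\<in>I. c i * l i)\<^sup>2 \<le> (\<Sum>i\<in>I. \<Sum>j\<in>I. c i * c j * K i j)" and \<beta>: "0 < \<beta>"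
  shows "(\<Sum>i\<in>I. c i * sin (u i) * (exp (- \<beta> * (u i)\<^sup>2) * l i))\<^sup>2
    \<le> (exp (1 / (2 * \<beta>)) - 1) * (\<Sum>i\<in>I. \<Sum>j\<in>I. c i * c j * (exp (- \<beta> * (u i - u j)\<^sup>2) * K i j))"
proof -
  define d where "d i = c i * exp (- \<beta> * (u i)\<^sup>2)" for i
  define L where "L m = (\<Sum>i\<in>I. (d i * u i ^ m) * l i)" for m
  define Q where "Q m = (\<Sum>i\<in>I. \<Sum>j\<in>I. (d i * u i ^ m) * (d j * u j ^ m) * K i j)" for m
  \<comment> \<open>Taylor coefficients of exp (2 * \<beta> * u i * u j) in the powers of u i * u j;
    each power is a rank one factor, which L m and Q m absorb into their coefficients.\<close>
  define w where "w m = (2 * \<beta>) ^ m / fact m" for m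
  define R where "R = (\<Sum>i\<in>I. \<Sum>j\<in>I. c i * c j * (exp (- \<beta> * (u i - u j)\<^sup>2) * K i j))"
  define X where "X = (\<Sum>i\<in>I. c i * sin (u i) * (exp (- \<beta> * (u i)\<^sup>2) * l i))"
  have w0: "0 < w m" for m using \<beta> by (simp add: w_def)
  have LQ: "(L m)\<^sup>2 \<le> Q m" for m unfolding L_def Q_def by (rule CS)
  have "(\<lambda>m. \<Sum>i\<in>I. \<Sum>j\<in>I. d i * d j * K i j * ((2 * \<beta> * u i * u j) ^ m /\<^sub>R fact m))
    sums (\<Sum>i\<in>I. \<Sum>j\<in>I. d i * d j * K i j * exp (2 * \<beta> * u i * u j))"
    by (intro sums_sum sums_mult exp_converges)
  moreover have "(\<Sum>i\<in>I. \<Sum>j\<in>I. d i * d j * K i j * ((2 * \<beta> * u i * u j) ^ m /\<^sub>R fact m)) = w m * Q m" for m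
    unfolding Q_def w_def sum_distrib_left
    by (intro sum.cong refl) (simp add: power_mult_distrib divide_inverse mult_ac)
  moreover have "(\<Sum>i\<in>I. \<Sum>j\<in>I. d i * d j * K i j * exp (2 * \<beta> * u i * u j)) = R"
    unfolding R_def
  proof (intro sum.cong refl)
    fix i j
    have "exp (- \<beta> * (u i - u j)\<^sup>2) = exp (- \<beta> * (u i)\<^sup>2) * exp (- \<beta> * (u j)\<^sup>2) * exp (2 * \<beta> * u i * u j)"
      unfolding exp_add[symmetric] by (rule arg_cong[where f=exp]) (simp add: power2_eq_square algebra_simps)
    then show "d i * d j * K i j * exp (2 * \<beta> * u i * u j) = c i * c j * (exp (- \<beta> * (u i - u j)\<^sup>2) * K i j)"
      by (simp add: d_def mult_ac)
  qed
  ultimately have R: "(\<lambda>m. w m * Q m) sums R" by simp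
  have "(\<lambda>m. \<Sum>i\<in>I. d i * l i * (sin_coeff m *\<^sub>R u i ^ m)) sums (\<Sum>i\<in>I. d i * l i * sin (u i))"
    by (intro sums_sum sums_mult sin_converges)
  moreover have "(\<Sum>i\<in>I. d i * l i * (sin_coeff m *\<^sub>R u i ^ m)) = sin_coeff m * L m" for m
    unfolding L_def sum_distrib_left by (intro sum.cong refl) (simp add: mult_ac)
  moreover have "(\<Sum>i\<in>I. d i * l i * sin (u i)) = X"
    unfolding X_def d_def by (intro sum.cong refl) (simp add: mult_ac)
  ultimately have X: "(\<lambda>m. sin_coeff m * L m) sums X" by simp
  have part: "(\<Sum>m<N. sin_coeff m * L m)\<^sup>2 \<le> (exp (1 / (2 * \<beta>)) - 1) * (\<Sum>m<N. w m * Q m)" for N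
  proof -
    \<comment> \<open>Cauchy-Schwarz with weights w m. The weighted squares of the sine coefficients
      are dominated by the exponential series of 1 / (2 * \<beta>) without its constant term, since
      the sine has none. This is the source of the - 1, which makes the bound small for large
      \<beta>.\<close>
    have "(\<Sum>m<N. sin_coeff m * L m)\<^sup>2 = (\<Sum>m<N. (sin_coeff m / sqrt (w m)) * (sqrt (w m) * L m))\<^sup>2"
      using w0 by (intro arg_cong[where f="\<lambda>x. x\<^sup>2"] sum.cong refl) (simp add: less_imp_neq[symmetric])
    also have "\<dots> \<le> (\<Sum>m<N. (sin_coeff m / sqrt (w m))\<^sup>2) * (\<Sum>m<N. (sqrt (w m) * L m)\<^sup>2)"
      by (rule Cauchy_Schwarz_ineq_sum)
    also have "\<dots> \<le> (exp (1 / (2 * \<beta>)) - 1) * (\<Sum>m<N. w m * Q m)"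
    proof (rule mult_mono)
      have t: "(sin_coeff m / sqrt (w m))\<^sup>2 \<le> (1 / (2 * \<beta>)) ^ m /\<^sub>R fact m - (if m = 0 then 1 else 0)" for m
      proof (cases "m = 0")
        case False
        have "\<bar>sin_coeff m\<bar> \<le> 1 / fact m" by (simp add: sin_coeff_def power_abs)
        from power_mono[OF this, of 2] have "(sin_coeff m)\<^sup>2 \<le> (1 / fact m)\<^sup>2" by simp
        then have "(sin_coeff m)\<^sup>2 / w m \<le> (1 / fact m)\<^sup>2 / w m"
          using w0[of m] by (intro divide_right_mono) auto
        also have "\<dots> = (1 / (2 * \<beta>)) ^ m /\<^sub>R fact m"
          using \<beta> by (simp add: w_def power2_eq_square power_one_over field_simps)
        finally show ?thesis using False w0[of m] by (simp add: power_divide)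
      qed (simp add: sin_coeff_def)
      have "(\<Sum>m<N. (sin_coeff m / sqrt (w m))\<^sup>2) \<le> (\<Sum>m<N. (1 / (2 * \<beta>)) ^ m /\<^sub>R fact m - (if m = 0 then 1 else 0))"
        by (intro sum_mono t)
      also have "\<dots> = (\<Sum>m<N. (1 / (2 * \<beta>)) ^ m /\<^sub>R fact m) - (if N = 0 then 0 else 1)"
        by (simp add: sum_subtractf)
      also have "\<dots> \<le> exp (1 / (2 * \<beta>)) - 1"
      proof (cases "N = 0")
        case False
        have "(\<Sum>m<N. (1 / (2 * \<beta>)) ^ m /\<^sub>R fact m) \<le> exp (1 / (2 * \<beta>))"
          using exp_converges[of "1 / (2 * \<beta>)"] \<beta>
          by (subst sums_unique[OF exp_converges]) (intro sum_le_suminf, auto simp: sums_iff)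
        then show ?thesis using False by simp
      qed (use \<beta> in simp)
      finally show "(\<Sum>m<N. (sin_coeff m / sqrt (w m))\<^sup>2) \<le> exp (1 / (2 * \<beta>)) - 1" .
      show "(\<Sum>m<N. (sqrt (w m) * L m)\<^sup>2) \<le> (\<Sum>m<N. w m * Q m)"
        using LQ w0 by (intro sum_mono) (simp add: power_mult_distrib less_imp_le mult_left_mono)
    qed (use \<beta> in \<open>auto intro: sum_nonneg\<close>)
    finally show ?thesis .
  qed
  have "X\<^sup>2 \<le> (exp (1 / (2 * \<beta>)) - 1) * R"
  proof (rule LIMSEQ_le)
    show "(\<lambda>N. (\<Sum>m<N. sin_coeff m * L m)\<^sup>2) \<longlonglongrightarrow> X\<^sup>2"
      using X unfolding sums_def by (intro tendsto_intros)
    show "(\<lambda>N. (exp (1 / (2 * \<beta>)) - 1) * (\<Sum>m<N. w m * Q m)) \<longlonglongrightarrow> (exp (1 / (2 * \<beta>)) - 1) * R"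
      using R unfolding sums_def by (intro tendsto_intros)
  qed (use part in blast)
  then show ?thesis by (simp add: X_def R_def)
qed

locale ou_semigroup = heat_semigroup S
  for S :: "real \<Rightarrow> 'a::{real_inner, banach, second_countable_topology} \<Rightarrow>\<^sub>L 'a" +
  fixes \<mu> :: "real \<Rightarrow> 'a measure" and c s :: real
  assumes c: "0 \<le> c" and s: "0 < s" "s < 1"
    and prob: "0 \<le> t \<Longrightarrow> prob_space (\<mu> t)" and sets_\<mu>: "0 \<le> t \<Longrightarrow> sets (\<mu> t) = sets borel"
    and char_\<mu>: "0 \<le> t \<Longrightarrow> (\<integral>y. iexp (x \<bullet> y) \<partial>\<mu> t) =
      of_real (exp (- (LINT r:{0..t}|lborel. (norm (S r x))\<^sup>2 + c * norm (S r x) powr (2 * s))))"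
begin

section \<open>The characteristic exponent and its positive definiteness\<close>

definition q :: "real \<Rightarrow> 'a \<Rightarrow> real" where "q t x = (LINT r:{0..t}|lborel. (norm (S r x))\<^sup>2)"
definition \<psi> :: "real \<Rightarrow> 'a \<Rightarrow> real" where "\<psi> t x = (LINT r:{0..t}|lborel. norm (S r x) powr (2 * s))"
definition \<phi> :: "real \<Rightarrow> 'a \<Rightarrow> real" where "\<phi> t x = exp (- (q t x + c * \<psi> t x))"

lemma set_integrable_continuous:
  fixes f :: "real \<Rightarrow> real"
  assumes "continuous_on {0..t} f" shows "set_integrable lborel {0..t} f"
  by (rule borel_integrable_atLeastAtMost'[OF assms])

lemma S_cont: "continuous_on {0..t} (\<lambda>r. S r x)"
  by (rule S_continuous_subset) auto

lemma integrable_q: "set_integrable lborel {0..t} (\<lambda>r. (norm (S r x))\<^sup>2)"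
  by (intro set_integrable_continuous continuous_intros S_cont)

lemma powr_S_cont: "continuous_on {0..t} (\<lambda>r. norm (S r x) powr (2 * s))"
  using s by (intro continuous_on_powr' continuous_intros S_cont) auto

lemma integrable_\<psi>: "set_integrable lborel {0..t} (\<lambda>r. norm (S r x) powr (2 * s))"
  by (intro set_integrable_continuous powr_S_cont)

lemma char_\<phi>: "0 \<le> t \<Longrightarrow> (\<integral>y. iexp (x \<bullet> y) \<partial>\<mu> t) = of_real (\<phi> t x)"
  using char_\<mu>[of t x] integrable_q[of t x] integrable_\<psi>[of t x]
  by (simp add: \<phi>_def q_def \<psi>_def set_integral_add set_integrable_mult_right)

lemma integral_cos_sin:
  assumes t: "0 \<le> t"
  shows "(\<integral>y. cos (x \<bullet> y) \<partial>\<mu> t) = \<phi> t x" "(\<integral>y. sin (x \<bullet> y) \<partial>\<mu> t) = 0"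
proof -
  interpret prob_space "\<mu> t" by (rule prob[OF t])
  note [measurable_cong] = sets_\<mu>[OF t]
  have i: "integrable (\<mu> t) (\<lambda>y. iexp (x \<bullet> y))"
    by (rule integrable_const_bound[where B=1]) auto
  have "(\<integral>y. Re (iexp (x \<bullet> y)) \<partial>\<mu> t) = Re (of_real (\<phi> t x))" "(\<integral>y. Im (iexp (x \<bullet> y)) \<partial>\<mu> t) = Im (of_real (\<phi> t x))"
    using integral_Re[OF i] integral_Im[OF i] char_\<phi>[OF t, of x] by simp_all
  then show "(\<integral>y. cos (x \<bullet> y) \<partial>\<mu> t) = \<phi> t x" "(\<integral>y. sin (x \<bullet> y) \<partial>\<mu> t) = 0"
    by (simp_all add: cis_conv_exp[symmetric])
qed

lemma integral_prods:
  assumes t: "0 \<le> t"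
  shows "(\<integral>y. sin (x \<bullet> y) * sin (z \<bullet> y) \<partial>\<mu> t) = (\<phi> t (x - z) - \<phi> t (x + z)) / 2"
    "(\<integral>y. cos (x \<bullet> y) * cos (z \<bullet> y) + sin (x \<bullet> y) * sin (z \<bullet> y) \<partial>\<mu> t) = \<phi> t (x - z)"
    "(\<integral>y. cos (x \<bullet> y) * sin (z \<bullet> y) \<partial>\<mu> t) = 0"
proof -
  note i = trig_integral(3,4)[OF prob[OF t] sets_\<mu>[OF t]]
  have "(\<integral>y. sin (x \<bullet> y) * sin (z \<bullet> y) \<partial>\<mu> t) = (\<integral>y. (cos ((x - z) \<bullet> y) - cos ((x + z) \<bullet> y)) / 2 \<partial>\<mu> t)"
    by (simp add: sin_times_sin inner_diff_left inner_add_left)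
  also have "\<dots> = (\<phi> t (x - z) - \<phi> t (x + z)) / 2"
    using i by (simp add: integral_cos_sin[OF t] diff_divide_distrib)
  finally show "(\<integral>y. sin (x \<bullet> y) * sin (z \<bullet> y) \<partial>\<mu> t) = (\<phi> t (x - z) - \<phi> t (x + z)) / 2" .
  show "(\<integral>y. cos (x \<bullet> y) * cos (z \<bullet> y) + sin (x \<bullet> y) * sin (z \<bullet> y) \<partial>\<mu> t) = \<phi> t (x - z)"
    by (simp add: integral_cos_sin(1)[OF t, symmetric] inner_diff_left cos_diff)
  have "(\<integral>y. cos (x \<bullet> y) * sin (z \<bullet> y) \<partial>\<mu> t) = (\<integral>y. (sin ((x + z) \<bullet> y) - sin ((x - z) \<bullet> y)) / 2 \<partial>\<mu> t)"
    by (simp add: cos_times_sin inner_diff_left inner_add_left)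
  also have "\<dots> = 0" using i by (simp add: integral_cos_sin[OF t] diff_divide_distrib)
  finally show "(\<integral>y. cos (x \<bullet> y) * sin (z \<bullet> y) \<partial>\<mu> t) = 0" .
qed

lemma \<phi>_minus: "\<phi> t (- x) = \<phi> t x"
  by (simp add: \<phi>_def q_def \<psi>_def blinfun.minus_right)

lemma \<phi>_0: "\<phi> t 0 = 1"
  using s by (simp add: \<phi>_def q_def \<psi>_def)

text \<open>The easy half of Bochner's theorem: the form is the integral of the squared modulus of
  the exponential sum with coefficients d, written with cosines and sines.\<close>

lemma psd_\<phi>: "0 \<le> t \<Longrightarrow> psd_on I (\<lambda>i j. \<phi> t (x i - x j))" if "finite I" for x :: "'i \<Rightarrow> 'a"
proof -
  assume t: "0 \<le> t"
  note i = trig_integral(3,4)[OF prob[OF t] sets_\<mu>[OF t]]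
  interpret prob_space "\<mu> t" by (rule prob[OF t])
  note [measurable_cong] = sets_\<mu>[OF t]
  have b: "integrable (\<mu> t) (\<lambda>y. cos (a \<bullet> y) * cos (b \<bullet> y) + sin (a \<bullet> y) * sin (b \<bullet> y))" for a b
    using i(1)[of "a - b"] by (simp add: inner_diff_left cos_diff)
  show ?thesis
    unfolding psd_on_def
  proof (intro conjI ballI allI)
    fix i j show "\<phi> t (x i - x j) = \<phi> t (x j - x i)" using \<phi>_minus[of t "x i - x j"] by simp
  next
    fix d :: "'i \<Rightarrow> real"
    have "(\<Sum>i\<in>I. \<Sum>j\<in>I. d i * d j * \<phi> t (x i - x j))
      = (\<integral>y. (\<Sum>i\<in>I. \<Sum>j\<in>I. d i * d j * (cos (x i \<bullet> y) * cos (x j \<bullet> y) + sin (x i \<bullet> y) * sin (x j \<bullet> y))) \<partial>\<mu> t)"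
      using b by (simp add: integral_prods(2)[OF t, symmetric])
    also have "\<dots> = (\<integral>y. (\<Sum>i\<in>I. d i * cos (x i \<bullet> y))\<^sup>2 + (\<Sum>i\<in>I. d i * sin (x i \<bullet> y))\<^sup>2 \<partial>\<mu> t)"
      unfolding power2_eq_square sum_product sum.distrib[symmetric]
      by (intro Bochner_Integration.integral_cong sum.cong refl) (simp add: algebra_simps)
    also have "0 \<le> \<dots>" by (intro Bochner_Integration.integral_nonneg) simp
    finally show "0 \<le> (\<Sum>i\<in>I. \<Sum>j\<in>I. d i * d j * \<phi> t (x i - x j))" .
  qed
qed

text \<open>Polarisation of \<open>q\<close>: \<open>exp (- q t (x - y))\<close> splits into a rank
  one kernel and \<open>exp (2 * qb t x y)\<close>.\<close>

definition qb :: "real \<Rightarrow> 'a \<Rightarrow> 'a \<Rightarrow> real" where "qb t x y = (LINT r:{0..t}|lborel. S r x \<bullet> S r y)"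

lemma integrable_qb: "set_integrable lborel {0..t} (\<lambda>r. S r x \<bullet> S r y)"
  by (intro set_integrable_continuous continuous_intros S_cont)

lemma q_diff: "q t (x - y) = q t x + q t y - 2 * qb t x y"
proof -
  have "q t (x - y) = (LINT r:{0..t}|lborel. (norm (S r x))\<^sup>2 + (norm (S r y))\<^sup>2 - 2 * (S r x \<bullet> S r y))"
    unfolding q_def by (intro set_lebesgue_integral_cong)
      (auto simp: blinfun.diff_right power2_norm_eq_inner inner_diff inner_commute algebra_simps)
  also have "\<dots> = q t x + q t y - 2 * qb t x y"
    using integrable_q integrable_qb
    by (simp add: set_integral_add set_integral_diff set_integrable_mult_right q_def qb_def)
  finally show ?thesis .
qed

lemma qb_sum: "(\<Sum>i\<in>I. \<Sum>j\<in>I. d i * d j * qb t (x i) (x j)) = q t (\<Sum>i\<in>I. d i *\<^sub>R x i)" if "finite I"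
proof -
  have "(\<Sum>i\<in>I. \<Sum>j\<in>I. d i * d j * qb t (x i) (x j))
    = (\<integral>r. (\<Sum>i\<in>I. \<Sum>j\<in>I. d i * d j * (indicator {0..t} r *\<^sub>R (S r (x i) \<bullet> S r (x j)))) \<partial>lborel)"
    unfolding qb_def set_lebesgue_integral_def using integrable_qb[unfolded set_integrable_def]
    by (simp add: Bochner_Integration.integral_sum)
  also have "\<dots> = q t (\<Sum>i\<in>I. d i *\<^sub>R x i)"
    unfolding q_def set_lebesgue_integral_def
    by (intro Bochner_Integration.integral_cong refl)
      (simp add: blinfun.sum_right blinfun.scaleR_right power2_norm_eq_inner inner_sum_left inner_sum_right sum_distrib_left mult_ac inner_commute)
  finally show ?thesis .
qed

text \<open>Since \<open>S t = S (t - r) S r\<close> for every \<open>r\<close>, the direction \<open>S t h\<close> has finite Cameron-Martin norm,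
  of order \<open>norm h / sqrt t\<close>.\<close>

lemma q_lower_bound:
  assumes t: "0 < t" and h: "h \<noteq> 0"
  shows "t / (norm h)\<^sup>2 * (S t h \<bullet> x)\<^sup>2 \<le> q t x"
proof -
  have "(S t h \<bullet> x)\<^sup>2 / (norm h)\<^sup>2 \<le> (norm (S r x))\<^sup>2" if r: "r \<in> {0..t}" for r
  proof -
    have "S t h \<bullet> x = S r (S (t - r) h) \<bullet> x" using S_add[of r "t - r" h] r by simp
    also have "\<dots> = S (t - r) h \<bullet> S r x" by (rule S_symmetric) (use r in simp)
    finally have "\<bar>S t h \<bullet> x\<bar> \<le> norm (S (t - r) h) * norm (S r x)" using Cauchy_Schwarz_ineq2 by metis
    also have "\<dots> \<le> norm h * norm (S r x)" using S_contraction[of "t - r" h] r by (intro mult_right_mono) auto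
    finally have "(S t h \<bullet> x)\<^sup>2 \<le> (norm h * norm (S r x))\<^sup>2" by (metis abs_ge_zero power2_abs power_mono)
    then show ?thesis using h by (simp add: power_mult_distrib pos_divide_le_eq mult.commute)
  qed
  then have "(LINT r:{0..t}|lborel. (S t h \<bullet> x)\<^sup>2 / (norm h)\<^sup>2) \<le> q t x"
    unfolding q_def by (intro set_integral_mono integrable_q set_integrable_continuous) auto
  then show ?thesis using t by (simp add: set_lebesgue_integral_def)
qed

text \<open>Scaling by \<open>\<theta>\<close> and convolving \<open>n\<close> times keeps the stable part of the exponent (when
  \<open>n * \<theta> powr (2 * s) = 1\<close>) but shrinks the quadratic part, because \<open>s < 1\<close>. This exhibits the stable
  part together with half of the Gaussian part as a positive definite function.\<close>

lemma \<phi>_scaled_power: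
  obtains n :: nat and \<theta> \<eta> :: real where "0 \<le> \<eta>" "\<eta> \<le> 1 / 2"
    "\<And>t x. \<phi> t (\<theta> *\<^sub>R x) ^ n = exp (- (\<eta> * q t x + c * \<psi> t x))"
proof -
  have "1 - 1 / s < 0" using s by simp
  then have "((\<lambda>n. real n powr (1 - 1 / s)) \<longlongrightarrow> 0) sequentially"
    by (intro tendsto_neg_powr filterlim_real_sequentially)
  then have "eventually (\<lambda>n. real n powr (1 - 1 / s) < 1 / 2) sequentially" by (rule order_tendstoD) simp
  then obtain n :: nat where n: "n \<ge> 1" "real n powr (1 - 1 / s) < 1 / 2"
    unfolding eventually_sequentially by (metis le_max_iff_disj order_refl)
  \<comment> \<open>Solves n * \<theta> powr (2 * s) = 1. The quadratic part is then multiplied by n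
    * \<theta>^2 = n powr (1 - 1 / s), which the choice of n makes smaller than 1/2.\<close>
  define \<theta> where "\<theta> = real n powr (- 1 / (2 * s))"
  have \<theta>0: "\<theta> > 0" using n by (simp add: \<theta>_def)
  have 1: "real n * \<theta> powr (2 * s) = 1"
  proof -
    have "\<theta> powr (2 * s) = real n powr (- 1)" unfolding \<theta>_def powr_powr using s by simp
    then show ?thesis using n by (simp add: powr_minus)
  qed
  have 2: "real n * \<theta>\<^sup>2 = real n powr (1 - 1 / s)"
  proof -
    have "\<theta>\<^sup>2 = real n powr (- 1 / s)" using n s by (simp add: \<theta>_def powr_powr flip: powr_numeral)
    moreover have "real n powr (1 + (- 1 / s)) = real n * real n powr (- 1 / s)"
      unfolding powr_add using n by simp
    ultimately show ?thesis by simp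
  qed
  have sc: "q t (\<theta> *\<^sub>R x) = \<theta>\<^sup>2 * q t x" "\<psi> t (\<theta> *\<^sub>R x) = \<theta> powr (2 * s) * \<psi> t x" for t x
    using \<theta>0 by (simp_all add: q_def \<psi>_def blinfun.scaleR_right power_mult_distrib powr_mult)
  have "\<phi> t (\<theta> *\<^sub>R x) ^ n = exp (- (real n powr (1 - 1 / s) * q t x + c * \<psi> t x))" for t x
  proof -
    have "\<phi> t (\<theta> *\<^sub>R x) ^ n = exp (- ((real n * \<theta>\<^sup>2) * q t x + c * ((real n * \<theta> powr (2 * s)) * \<psi> t x)))"
      unfolding \<phi>_def exp_of_nat_mult[symmetric] sc by (simp add: algebra_simps)
    then show ?thesis by (simp add: 1 2)
  qed
  then show ?thesis using n that[of "real n powr (1 - 1 / s)" \<theta> n] by simp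
qed

text \<open>The quadratic exponent has total weight 1, of which \<eta> stays with the stable part.
  From the remaining weight 1 - \<eta> a Gaussian of strength \<beta> in the direction
  \<open>S t h\<close> is split off; by \<open>q_lower_bound\<close> the cofactor
  \<open>\<kappa>\<close> is still positive definite, so \<open>gaussian_kernel_bound\<close>
  applies to it.\<close>

lemma \<phi>_sine_bound:
  fixes x :: "nat \<Rightarrow> 'a"
  assumes t: "0 < t" and h: "h \<noteq> 0" and I: "finite I" and ht: "(norm h)\<^sup>2 \<le> t"
  shows "(\<Sum>i\<in>I. d i * sin (S t h \<bullet> x i) * \<phi> t (x i))\<^sup>2
    \<le> (2 * (norm h)\<^sup>2 / t) * (\<Sum>i\<in>I. \<Sum>j\<in>I. d i * d j * \<phi> t (x i - x j))"
proof -
  obtain \<eta> \<theta> :: real and n :: nat where \<eta>: "0 \<le> \<eta>" "\<eta> \<le> 1 / 2"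
    and pow: "\<And>t x. \<phi> t (\<theta> *\<^sub>R x) ^ n = exp (- (\<eta> * q t x + c * \<psi> t x))" using \<phi>_scaled_power by metis
  define b where "b = t / (norm h)\<^sup>2"
  define \<beta> where "\<beta> = (1 - \<eta>) * b"
  have b: "b > 0" "1 \<le> b" using t h ht by (simp_all add: b_def)
  have \<beta>0: "\<beta> > 0" using b \<eta> by (simp add: \<beta>_def)
  define u where "u y = S t h \<bullet> y" for y
  define \<kappa> where "\<kappa> y = exp (- (1 - \<eta>) * (q t y - b * (u y)\<^sup>2)) * \<phi> t (\<theta> *\<^sub>R y) ^ n" for y
  have \<phi>\<kappa>: "\<phi> t y = exp (- \<beta> * (u y)\<^sup>2) * \<kappa> y" for y
    unfolding \<kappa>_def pow \<beta>_def unfolding \<phi>_def exp_add[symmetric] by (rule arg_cong[where f=exp]) (simp add: algebra_simps)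
  have psd: "psd_on J (\<lambda>i j. \<kappa> (z i - z j))" if J: "finite J" for J and z :: "nat \<Rightarrow> 'a"
  proof -
    \<comment> \<open>Cross term of (1 - \<eta>) times the nonnegative form q - b * u^2 at z i - z
      j. Its exponential, multiplied by a rank one kernel, is the exponential of minus the full
      form.\<close>
    have "psd_on J (\<lambda>i j. 2 * (1 - \<eta>) * (qb t (z i) (z j) - b * (u (z i) * u (z j))))"
    proof (rule psd_on_cmult)
      show "psd_on J (\<lambda>i j. qb t (z i) (z j) - b * (u (z i) * u (z j)))"
        unfolding psd_on_def
      proof (intro conjI ballI allI)
        fix i j show "qb t (z i) (z j) - b * (u (z i) * u (z j)) = qb t (z j) (z i) - b * (u (z j) * u (z i))"
          by (simp add: qb_def inner_commute mult.commute)
      next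
        fix e :: "nat \<Rightarrow> real"
        have "(\<Sum>i\<in>J. \<Sum>j\<in>J. e i * e j * (qb t (z i) (z j) - b * (u (z i) * u (z j))))
          = (\<Sum>i\<in>J. \<Sum>j\<in>J. e i * e j * qb t (z i) (z j)) - b * (\<Sum>i\<in>J. e i * u (z i))\<^sup>2"
        proof -
          have "b * (\<Sum>i\<in>J. e i * u (z i))\<^sup>2 = (\<Sum>i\<in>J. \<Sum>j\<in>J. e i * e j * (b * (u (z i) * u (z j))))"
            by (simp add: power2_eq_square sum_product sum_distrib_left mult_ac)
          then show ?thesis by (simp only: right_diff_distrib sum_subtractf)
        qed
        also have "\<dots> = q t (\<Sum>i\<in>J. e i *\<^sub>R z i) - b * (S t h \<bullet> (\<Sum>i\<in>J. e i *\<^sub>R z i))\<^sup>2"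
          unfolding qb_sum[OF J] by (simp add: inner_sum_right u_def)
        also have "0 \<le> \<dots>" using q_lower_bound[OF t h] by (simp add: b_def)
        finally show "0 \<le> (\<Sum>i\<in>J. \<Sum>j\<in>J. e i * e j * (qb t (z i) (z j) - b * (u (z i) * u (z j))))" .
      qed
    qed (use \<eta> in simp)
    from psd_on_exp[OF J this]
    have "psd_on J (\<lambda>i j. (exp (- (1 - \<eta>) * (q t (z i) - b * (u (z i))\<^sup>2)) * exp (- (1 - \<eta>) * (q t (z j) - b * (u (z j))\<^sup>2)))
        * exp (2 * (1 - \<eta>) * (qb t (z i) (z j) - b * (u (z i) * u (z j)))))"
      by (intro psd_on_mult[OF J] psd_on_rank1)
    moreover have "psd_on J (\<lambda>i j. \<phi> t (\<theta> *\<^sub>R z i - \<theta> *\<^sub>R z j) ^ n)"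
      using t by (intro psd_on_power J psd_\<phi>) auto
    ultimately have "psd_on J (\<lambda>i j. (exp (- (1 - \<eta>) * (q t (z i) - b * (u (z i))\<^sup>2)) * exp (- (1 - \<eta>) * (q t (z j) - b * (u (z j))\<^sup>2)))
        * exp (2 * (1 - \<eta>) * (qb t (z i) (z j) - b * (u (z i) * u (z j)))) * \<phi> t (\<theta> *\<^sub>R z i - \<theta> *\<^sub>R z j) ^ n)"
      by (rule psd_on_mult[OF J])
    moreover have "(exp (- (1 - \<eta>) * (q t (z i) - b * (u (z i))\<^sup>2)) * exp (- (1 - \<eta>) * (q t (z j) - b * (u (z j))\<^sup>2)))
        * exp (2 * (1 - \<eta>) * (qb t (z i) (z j) - b * (u (z i) * u (z j)))) * \<phi> t (\<theta> *\<^sub>R z i - \<theta> *\<^sub>R z j) ^ n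
        = \<kappa> (z i - z j)" for i j
      unfolding \<kappa>_def exp_add[symmetric] q_diff scaleR_diff_right[symmetric]
      by (rule arg_cong[where f="\<lambda>a. exp a * _"]) (simp add: u_def inner_diff_right power2_eq_square algebra_simps)
    ultimately show ?thesis by simp
  qed
  have \<kappa>0: "\<kappa> 0 = 1" by (simp add: \<kappa>_def u_def \<phi>_0 q_def)
  have CS: "(\<Sum>i\<in>I. e i * \<kappa> (x i))\<^sup>2 \<le> (\<Sum>i\<in>I. \<Sum>j\<in>I. e i * e j * \<kappa> (x i - x j))" for e
  proof -
    obtain a where a: "a \<notin> I" using ex_new_if_finite[OF infinite_UNIV_nat I] by blast
    \<comment> \<open>The origin is adjoined as an extra point: there \<kappa> equals 1, and the row
      of this point consists of the values \<kappa> (x i).\<close>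
    define z where "z = x(a := 0)"
    have \<kappa>m: "\<kappa> (- y) = \<kappa> y" for y
      unfolding \<kappa>_def u_def scaleR_minus_right \<phi>_minus by (simp add: q_def blinfun.minus_right)
    have z: "z i = x i" if "i \<in> I" for i using that a by (auto simp: z_def)
    have "(\<Sum>i\<in>I. e i * \<kappa> (z a - z i))\<^sup>2 \<le> (\<Sum>i\<in>I. \<Sum>j\<in>I. e i * e j * \<kappa> (z i - z j))"
      by (rule psd_on_insert_Cauchy_Schwarz[OF I a psd]) (use I \<kappa>0 in auto)
    moreover have "\<kappa> (z a - z i) = \<kappa> (x i)" if "i \<in> I" for i using \<kappa>m[of "x i"] z[OF that] by (simp add: z_def)
    ultimately show ?thesis using z by simp
  qed
  have "(\<Sum>i\<in>I. d i * sin (u (x i)) * (exp (- \<beta> * (u (x i))\<^sup>2) * \<kappa> (x i)))\<^sup>2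
    \<le> (exp (1 / (2 * \<beta>)) - 1) * (\<Sum>i\<in>I. \<Sum>j\<in>I. d i * d j * (exp (- \<beta> * (u (x i) - u (x j))\<^sup>2) * \<kappa> (x i - x j)))"
    by (rule gaussian_kernel_bound[OF CS \<beta>0])
  also have "(\<Sum>i\<in>I. \<Sum>j\<in>I. d i * d j * (exp (- \<beta> * (u (x i) - u (x j))\<^sup>2) * \<kappa> (x i - x j)))
     = (\<Sum>i\<in>I. \<Sum>j\<in>I. d i * d j * \<phi> t (x i - x j))"
    unfolding \<phi>\<kappa> by (simp add: u_def inner_diff_right)
  also have "(\<Sum>i\<in>I. d i * sin (u (x i)) * (exp (- \<beta> * (u (x i))\<^sup>2) * \<kappa> (x i))) = (\<Sum>i\<in>I. d i * sin (S t h \<bullet> x i) * \<phi> t (x i))"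
    unfolding \<phi>\<kappa> by (simp add: u_def)
  also have "(exp (1 / (2 * \<beta>)) - 1) * (\<Sum>i\<in>I. \<Sum>j\<in>I. d i * d j * \<phi> t (x i - x j))
    \<le> (2 * (norm h)\<^sup>2 / t) * (\<Sum>i\<in>I. \<Sum>j\<in>I. d i * d j * \<phi> t (x i - x j))"
  proof (rule mult_right_mono)
    \<comment> \<open>With z = 1 / (2 * \<beta>) \<le> (norm h)^2 / t \<le> 1 the factor exp z - 1
      is at most z + z^2 \<le> 2 * z; this is the constant 2.\<close>
    have "b / 2 \<le> \<beta>" using mult_right_mono[of "1/2" "1 - \<eta>" b] \<eta> b by (simp add: \<beta>_def)
    then have "1 / (2 * \<beta>) \<le> 1 / b" using b by (intro divide_left_mono) (auto intro!: mult_pos_pos \<beta>0)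
    then have z: "1 / (2 * \<beta>) \<le> (norm h)\<^sup>2 / t" by (simp add: b_def)
    moreover have "(norm h)\<^sup>2 / t \<le> 1" using ht t by simp
    ultimately have z1: "1 / (2 * \<beta>) \<le> 1" by linarith
    have "exp (1 / (2 * \<beta>)) \<le> 1 + 1 / (2 * \<beta>) + (1 / (2 * \<beta>))\<^sup>2" using z1 \<beta>0 by (intro exp_bound) auto
    also have "(1 / (2 * \<beta>))\<^sup>2 \<le> 1 / (2 * \<beta>)"
    proof -
      have "1 / (2 * \<beta>) * (1 / (2 * \<beta>)) \<le> 1 / (2 * \<beta>) * 1" by (rule mult_left_mono[OF z1]) (use \<beta>0 in simp)
      then show ?thesis by (simp only: power2_eq_square mult_1_right)
    qed
    finally show "exp (1 / (2 * \<beta>)) - 1 \<le> 2 * (norm h)\<^sup>2 / t" using z by simp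
    show "0 \<le> (\<Sum>i\<in>I. \<Sum>j\<in>I. d i * d j * \<phi> t (x i - x j))" using psd_onD(2)[OF psd_\<phi>[OF I]] t by simp
  qed
  finally show ?thesis .
qed

end

lemma trig_nth:
  "\<exists>(n::nat) a b x. \<forall>y. trig ts y = (\<Sum>i<n. a i * cos (x i \<bullet> y) + b i * sin (x i \<bullet> y))"
proof (intro exI allI)
  show "trig ts y = (\<Sum>i<length ts. fst (ts ! i) * cos (snd (snd (ts ! i)) \<bullet> y) + fst (snd (ts ! i)) * sin (snd (snd (ts ! i)) \<bullet> y))" for y
    unfolding trig_def sum_list_sum_nth by (simp add: case_prod_beta' atLeast0LessThan)
qed

context ou_semigroup begin

lemma measurable_\<mu>: "0 \<le> t \<Longrightarrow> f \<in> borel_measurable (\<mu> t) \<longleftrightarrow> f \<in> borel_measurable borel"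
  using measurable_cong_sets[OF sets_\<mu> refl] by metis

text \<open>Shifting symmetrically by plus and minus \<open>S t h\<close> cancels the cosine
  coefficients and leaves twice the sum of b i * sin (S t h \<bullet> x i) * \<phi> t (x i). Only
  the odd part of the polynomial matters, and its L2 norm does not exceed that of the whole.\<close>

lemma trig_shift_bound:
  assumes t: "0 < t" and h: "h \<noteq> 0" and ht: "(norm h)\<^sup>2 \<le> t"
  shows "((\<integral>y. trig ts (y + S t h) \<partial>\<mu> t) - (\<integral>y. trig ts (y - S t h) \<partial>\<mu> t))\<^sup>2
    \<le> 8 * (norm h)\<^sup>2 / t * (\<integral>y. (trig ts y)\<^sup>2 \<partial>\<mu> t)"
proof -
  have t0: "0 \<le> t" using t by simp
  interpret prob_space "\<mu> t" by (rule prob[OF t0])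
  note [measurable_cong] = sets_\<mu>[OF t0]
  note i = trig_integral(3,4)[OF prob[OF t0] sets_\<mu>[OF t0]]
  obtain n :: nat and a b x where ts: "\<And>y. trig ts y = (\<Sum>i<n. a i * cos (x i \<bullet> y) + b i * sin (x i \<bullet> y))"
    using trig_nth[of ts] by blast
  define k where "k = S t h"
  have sh: "(\<integral>y. cos (z \<bullet> (y + w)) \<partial>\<mu> t) = cos (z \<bullet> w) * \<phi> t z" "(\<integral>y. sin (z \<bullet> (y + w)) \<partial>\<mu> t) = sin (z \<bullet> w) * \<phi> t z"
    "integrable (\<mu> t) (\<lambda>y. cos (z \<bullet> (y + w)))" "integrable (\<mu> t) (\<lambda>y. sin (z \<bullet> (y + w)))" for z w
    using i by (simp_all add: inner_add_right cos_add sin_add integral_cos_sin[OF t0])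
  have "(\<integral>y. trig ts (y + w) \<partial>\<mu> t) = (\<Sum>i<n. a i * (cos (x i \<bullet> w) * \<phi> t (x i)) + b i * (sin (x i \<bullet> w) * \<phi> t (x i)))" for w
    unfolding ts using sh by simp
  from this[of k] this[of "- k"]
  have "(\<integral>y. trig ts (y + k) \<partial>\<mu> t) - (\<integral>y. trig ts (y - k) \<partial>\<mu> t) = 2 * (\<Sum>i<n. b i * sin (k \<bullet> x i) * \<phi> t (x i))"
    by (simp add: sum_subtractf[symmetric] sum_distrib_left inner_commute algebra_simps)
  then have 1: "((\<integral>y. trig ts (y + k) \<partial>\<mu> t) - (\<integral>y. trig ts (y - k) \<partial>\<mu> t))\<^sup>2 = 4 * (\<Sum>i<n. b i * sin (k \<bullet> x i) * \<phi> t (x i))\<^sup>2"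
    by (simp add: power_mult_distrib)
  define Od where "Od = (\<Sum>i<n. \<Sum>j<n. b i * b j * ((\<phi> t (x i - x j) - \<phi> t (x i + x j)) / 2))"
  have 2: "(\<Sum>i<n. b i * sin (k \<bullet> x i) * \<phi> t (x i))\<^sup>2 \<le> 2 * (norm h)\<^sup>2 / t * Od"
  proof -
    \<comment> \<open>Each frequency is doubled to x i and - x i with coefficients b i / 2 and - b i
      / 2. This antisymmetrisation keeps the sine sum and turns the quadratic form into Od.\<close>
    define z where "z i = (if i < n then x i else - x (i - n))" for i
    define d where "d i = (if i < n then b i / 2 else - b (i - n) / 2)" for i
    have split: "(\<Sum>i<n+n. f i) = (\<Sum>i<n. f i) + (\<Sum>i<n. f (n + i))" for f :: "nat \<Rightarrow> real"
      by (simp add: sum_up_index_split lessThan_atLeast0 sum.atLeastLessThan_concat[symmetric] sum.shift_bounds_nat_ivl[of f 0 n n, simplified, symmetric] add.commute)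
    have zd: "z i = x i" "z (n + i) = - x i" "d i = b i / 2" "d (n + i) = - b i / 2" if "i < n" for i
      using that by (auto simp: z_def d_def)
    have "(\<Sum>i<n+n. d i * sin (S t h \<bullet> z i) * \<phi> t (z i))\<^sup>2
      \<le> (2 * (norm h)\<^sup>2 / t) * (\<Sum>i<n+n. \<Sum>j<n+n. d i * d j * \<phi> t (z i - z j))"
      by (rule \<phi>_sine_bound[OF t h _ ht]) simp
    also have "(\<Sum>i<n+n. d i * sin (S t h \<bullet> z i) * \<phi> t (z i)) = (\<Sum>i<n. b i * sin (k \<bullet> x i) * \<phi> t (x i))"
      unfolding split sum.distrib[symmetric] by (intro sum.cong refl) (simp add: zd \<phi>_minus k_def)
    also have "(\<Sum>i<n+n. \<Sum>j<n+n. d i * d j * \<phi> t (z i - z j)) = Od"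
    proof -
      have m: "\<phi> t (- u - v) = \<phi> t (u + v)" "\<phi> t (v - u) = \<phi> t (u - v)" for u v
        using \<phi>_minus[of t "u + v"] \<phi>_minus[of t "u - v"] by simp_all
      show ?thesis
        unfolding split Od_def sum.distrib[symmetric]
      proof (intro sum.cong refl)
        fix i j assume "i \<in> {..<n}" "j \<in> {..<n}"
        then have ij: "i < n" "j < n" by auto
        have "- x i - - x j = x j - x i" by simp
        with m[of "x i" "x j"] have m': "\<phi> t (- x i - - x j) = \<phi> t (x i - x j)" "\<phi> t (x i - - x j) = \<phi> t (x i + x j)" by simp_all
        show "d i * d j * \<phi> t (z i - z j) + d i * d (n + j) * \<phi> t (z i - z (n + j)) +
          (d (n + i) * d j * \<phi> t (z (n + i) - z j) + d (n + i) * d (n + j) * \<phi> t (z (n + i) - z (n + j)))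
          = b i * b j * ((\<phi> t (x i - x j) - \<phi> t (x i + x j)) / 2)"
          unfolding zd[OF ij(1)] zd[OF ij(2)] m(1) m' by (simp add: field_simps)
      qed
    qed
    finally show ?thesis .
  qed
  \<comment> \<open>Od is the squared norm of the odd part D, which is orthogonal to the even part E
    because the measure is symmetric.\<close>
  have 3: "Od \<le> (\<integral>y. (trig ts y)\<^sup>2 \<partial>\<mu> t)"
  proof -
    define E where "E y = (\<Sum>i<n. a i * cos (x i \<bullet> y))" for y
    define D where "D y = (\<Sum>i<n. b i * sin (x i \<bullet> y))" for y
    have bc: "integrable (\<mu> t) (\<lambda>y. f y * g y)" if "f \<in> borel_measurable borel" "g \<in> borel_measurable borel" "\<And>y. \<bar>f y\<bar> \<le> 1" "\<And>y. \<bar>g y\<bar> \<le> 1" for f g :: "'a \<Rightarrow> real"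
    proof (rule integrable_const_bound[where B=1])
      show "AE y in \<mu> t. norm (f y * g y) \<le> 1" using mult_mono[OF that(3) that(4)] by (simp add: abs_mult)
      show "(\<lambda>y. f y * g y) \<in> borel_measurable (\<mu> t)" using that by measurable
    qed
    have ss: "integrable (\<mu> t) (\<lambda>y. sin (u \<bullet> y) * sin (v \<bullet> y))" "integrable (\<mu> t) (\<lambda>y. cos (u \<bullet> y) * sin (v \<bullet> y))"
      "integrable (\<mu> t) (\<lambda>y. cos (u \<bullet> y) * cos (v \<bullet> y))" for u v
      by (rule bc; simp)+
    have D2: "(\<lambda>y. (D y)\<^sup>2) = (\<lambda>y. \<Sum>i<n. \<Sum>j<n. b i * b j * (sin (x i \<bullet> y) * sin (x j \<bullet> y)))"
      by (rule ext) (simp add: D_def power2_eq_square sum_product mult_ac)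
    have E2: "(\<lambda>y. (E y)\<^sup>2) = (\<lambda>y. \<Sum>i<n. \<Sum>j<n. a i * a j * (cos (x i \<bullet> y) * cos (x j \<bullet> y)))"
      by (rule ext) (simp add: E_def power2_eq_square sum_product mult_ac)
    have ED: "(\<lambda>y. E y * D y) = (\<lambda>y. \<Sum>i<n. \<Sum>j<n. a i * b j * (cos (x i \<bullet> y) * sin (x j \<bullet> y)))"
      by (rule ext) (simp add: E_def D_def sum_product mult_ac)
    have iD: "integrable (\<mu> t) (\<lambda>y. (D y)\<^sup>2)" and iE: "integrable (\<mu> t) (\<lambda>y. (E y)\<^sup>2)" and iED: "integrable (\<mu> t) (\<lambda>y. E y * D y)"
      unfolding D2 E2 ED using ss by (auto intro!: Bochner_Integration.integrable_sum integrable_mult_right)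
    have "(\<integral>y. (D y)\<^sup>2 \<partial>\<mu> t) = Od" unfolding D2 Od_def using ss by (simp add: integral_prods[OF t0])
    moreover have "(\<integral>y. E y * D y \<partial>\<mu> t) = 0" unfolding ED using ss by (simp add: integral_prods[OF t0])
    moreover have "(\<lambda>y. (trig ts y)\<^sup>2) = (\<lambda>y. (E y)\<^sup>2 + (D y)\<^sup>2 + 2 * (E y * D y))"
      unfolding ts by (rule ext) (simp add: E_def D_def sum.distrib power2_sum)
    moreover have "0 \<le> (\<integral>y. (E y)\<^sup>2 \<partial>\<mu> t)" by simp
    ultimately show ?thesis using iD iE iED by simp
  qed
  have "4 * (\<Sum>i<n. b i * sin (k \<bullet> x i) * \<phi> t (x i))\<^sup>2 \<le> 4 * (2 * (norm h)\<^sup>2 / t * (\<integral>y. (trig ts y)\<^sup>2 \<partial>\<mu> t))"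
    using order_trans[OF 2 mult_left_mono[OF 3]] t by simp
  then show ?thesis using 1 by (simp add: k_def)
qed

text \<open>f is replaced by a trigonometric polynomial close to it in mean under both translates
  and close in mean square under \<mu> t, so that its L2 norm is at most 2 * M. The constant 6 is
  above sqrt (8 * 4). For (norm h)^2 > t the trivial bound 2 * M is already small enough.\<close>

lemma shift_bound:
  assumes t: "0 < t" and f: "f \<in> borel_measurable borel" "\<And>y. \<bar>f y\<bar> \<le> M" and M: "0 < M"
  shows "\<bar>(\<integral>y. f (y + S t h) \<partial>\<mu> t) - (\<integral>y. f (y - S t h) \<partial>\<mu> t)\<bar> \<le> 6 * norm h / sqrt t * M"
proof -
  have t0: "0 \<le> t" using t by simp
  interpret prob_space "\<mu> t" by (rule prob[OF t0])
  note [measurable_cong] = sets_\<mu>[OF t0]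
  note [measurable] = f(1)
  define k where "k = S t h"
  show ?thesis
  proof (cases "h \<noteq> 0 \<and> (norm h)\<^sup>2 \<le> t")
    case True
    define N where "N w = distr (\<mu> t) borel (\<lambda>y. y + w)" for w
    have N: "prob_space (N w)" "sets (N w) = sets borel" for w
      unfolding N_def by (auto intro!: prob_space_distr)
    have Ni: "(\<integral>y. g y \<partial>N w) = (\<integral>y. g (y + w) \<partial>\<mu> t)" if "g \<in> borel_measurable borel" for g :: "'a \<Rightarrow> real" and w
      unfolding N_def using that by (intro integral_distr) auto
    have N0: "N 0 = \<mu> t" unfolding N_def using distr_id2[OF sets_\<mu>[OF t0, symmetric]] by simp
    define D where "D = (\<integral>y. f (y + k) \<partial>\<mu> t) - (\<integral>y. f (y - k) \<partial>\<mu> t)"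
    have "\<bar>D\<bar> \<le> 6 * norm h / sqrt t * M + 2 * e" if e: "0 < e" "e < M\<^sup>2" for e
    proof -
      obtain ts where ts: "\<And>Q. Q \<in> {N 0, N k, N (- k)} \<Longrightarrow> \<bar>(\<integral>y. f y \<partial>Q) - (\<integral>y. trig ts y \<partial>Q)\<bar> < e \<and> (\<integral>y. (f y - trig ts y)\<^sup>2 \<partial>Q) < e"
        using trig_approx_prob[of "{N 0, N k, N (- k)}" f M e] N f e by auto
      obtain B where B: "\<And>y. \<bar>trig ts y\<bar> \<le> B" using trig_bounded by blast
      have bi: "integrable (\<mu> t) g" if "g \<in> borel_measurable borel" "\<And>y. \<bar>g y\<bar> \<le> C" for g :: "'a \<Rightarrow> real" and C
        using that by (intro integrable_const_bound[where B=C]) auto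
      have "(\<integral>y. (trig ts y)\<^sup>2 \<partial>\<mu> t) \<le> (\<integral>y. 2 * M\<^sup>2 + 2 * (f y - trig ts y)\<^sup>2 \<partial>\<mu> t)"
      proof (rule integral_mono)
        show "integrable (\<mu> t) (\<lambda>y. (trig ts y)\<^sup>2)"
        proof (rule bi)
          show "\<bar>(trig ts y)\<^sup>2\<bar> \<le> B\<^sup>2" for y using power_mono[OF B[of y] abs_ge_zero, of 2] by simp
        qed measurable
        have "integrable (\<mu> t) (\<lambda>y. (f y - trig ts y)\<^sup>2)"
        proof (rule bi)
          have b: "\<bar>f y - trig ts y\<bar> \<le> M + B" for y using B[of y] f(2)[of y] by linarith
          show "\<bar>(f y - trig ts y)\<^sup>2\<bar> \<le> (M + B)\<^sup>2" for y using power_mono[OF b[of y] abs_ge_zero, of 2] by simp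
        qed measurable
        then show "integrable (\<mu> t) (\<lambda>y. 2 * M\<^sup>2 + 2 * (f y - trig ts y)\<^sup>2)" by simp
        fix y
        \<comment> \<open>With g the polynomial, this square equals 2 * f^2 + 2 * (f - g)^2 -
          g^2.\<close>
        have "0 \<le> (2 * f y - trig ts y)\<^sup>2" by simp
        moreover have "(f y)\<^sup>2 \<le> M\<^sup>2" using power_mono[OF f(2)[of y] abs_ge_zero, of 2] by simp
        ultimately show "(trig ts y)\<^sup>2 \<le> 2 * M\<^sup>2 + 2 * (f y - trig ts y)\<^sup>2"
          by (simp add: power2_eq_square algebra_simps)
      qed
      also have "\<dots> = 2 * M\<^sup>2 + 2 * (\<integral>y. (f y - trig ts y)\<^sup>2 \<partial>\<mu> t)"
      proof -
        have "integrable (\<mu> t) (\<lambda>y. (f y - trig ts y)\<^sup>2)"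
        proof (rule bi)
          have b: "\<bar>f y - trig ts y\<bar> \<le> M + B" for y using B[of y] f(2)[of y] by linarith
          show "\<bar>(f y - trig ts y)\<^sup>2\<bar> \<le> (M + B)\<^sup>2" for y using power_mono[OF b[of y] abs_ge_zero, of 2] by simp
        qed measurable
        then show ?thesis by (simp add: prob_space)
      qed
      also have "\<dots> \<le> 4 * M\<^sup>2" using ts[of "N 0"] e by (simp add: N0)
      finally have sq: "(\<integral>y. (trig ts y)\<^sup>2 \<partial>\<mu> t) \<le> 4 * M\<^sup>2" .
      define D' where "D' = (\<integral>y. trig ts (y + k) \<partial>\<mu> t) - (\<integral>y. trig ts (y - k) \<partial>\<mu> t)"
      have "D'\<^sup>2 \<le> 8 * (norm h)\<^sup>2 / t * (4 * M\<^sup>2)"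
        unfolding D'_def k_def using trig_shift_bound[OF t, of h ts] True
          mult_left_mono[OF sq, of "8 * (norm h)\<^sup>2 / t"] t by simp
      also have "\<dots> \<le> (6 * norm h / sqrt t * M)\<^sup>2"
        using t by (simp add: power_mult_distrib power_divide field_simps)
      finally have "\<bar>D'\<bar> \<le> 6 * norm h / sqrt t * M"
        by (rule abs_le_square_iff[THEN iffD2, THEN order_trans]) (use M t in simp)
      moreover have "\<bar>D - D'\<bar> < 2 * e"
        using ts[of "N k"] ts[of "N (- k)"] Ni[OF f(1)] Ni[OF trig_measurable[of ts]]
        unfolding D_def D'_def by auto
      ultimately show ?thesis by linarith
    qed
    then have "\<bar>D\<bar> \<le> 6 * norm h / sqrt t * M + e" if "0 < e" for e
    proof -
      have e': "0 < min (e / 2) (M\<^sup>2 / 2)" "min (e / 2) (M\<^sup>2 / 2) < M\<^sup>2" using that M by (auto simp: min_def)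
      from \<open>\<And>e. 0 < e \<Longrightarrow> e < M\<^sup>2 \<Longrightarrow> \<bar>D\<bar> \<le> 6 * norm h / sqrt t * M + 2 * e\<close>[OF e'] show ?thesis by (simp add: min_def split: if_splits)
    qed
    then have "\<bar>D\<bar> \<le> 6 * norm h / sqrt t * M" by (rule field_le_epsilon)
    then show ?thesis by (simp add: D_def k_def)
  next
    case False
    show ?thesis
    proof (cases "h = 0")
      case h: False
      then have "t < (norm h)\<^sup>2" using False by simp
      then have 1: "sqrt t < norm h" using t real_sqrt_less_mono by fastforce
      have b: "\<bar>\<integral>y. f (y + w) \<partial>\<mu> t\<bar> \<le> M" for w
      proof -
        have "\<bar>\<integral>y. f (y + w) \<partial>\<mu> t\<bar> \<le> (\<integral>y. M \<partial>\<mu> t)"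
          using f(2) by (intro integral_abs_bound[THEN order_trans] integral_mono integrable_abs integrable_const_bound[where B=M]) (use M in auto)
        then show ?thesis by (simp add: prob_space)
      qed
      have "\<bar>(\<integral>y. f (y + k) \<partial>\<mu> t) - (\<integral>y. f (y - k) \<partial>\<mu> t)\<bar> \<le> 2 * M" using b[of k] b[of "- k"] by simp
      also have "\<dots> \<le> 6 * norm h / sqrt t * M"
      proof (rule mult_right_mono)
        have "2 * sqrt t \<le> 6 * norm h" using 1 norm_ge_zero[of h] by linarith
        then show "2 \<le> 6 * norm h / sqrt t" using t by (simp add: pos_le_divide_eq)
      qed (use M in simp)
      finally show ?thesis by (simp add: k_def)
    qed (use M t in simp)
  qed
qed

end

section \<open>Joint continuity in time and space\<close>

context ou_semigroup begin

section \<open>The cocycle identity and the convolution law\<close>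

lemma set_integral_shift_split:
  fixes f :: "real \<Rightarrow> real"
  assumes f: "continuous_on {0..} f" and t: "0 \<le> t" and r: "0 \<le> r"
  shows "(LINT u:{0..t + r}|lborel. f u) = (LINT u:{0..t}|lborel. f u) + (LINT u:{0..r}|lborel. f (t + u))"
proof -
  have c: "continuous_on {a..b} f" if "0 \<le> a" for a b
    by (rule continuous_on_subset[OF f]) (use that in auto)
  have c': "continuous_on {0..r} (\<lambda>u. f (t + u))"
    by (rule continuous_on_compose2[OF f]) (use t in \<open>auto intro!: continuous_intros\<close>)
  have e: "(LINT u:{0..a}|lborel. g u) = integral {0..a} g" if "continuous_on {0..a} g" for a and g :: "real \<Rightarrow> real"
    by (rule set_borel_integral_eq_integral(2)[OF set_integrable_continuous[OF that]])
  have "integral {0..t + r} f = integral {0..t} f + integral {t..t + r} f"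
    using t r by (intro Henstock_Kurzweil_Integration.integral_combine[symmetric] integrable_continuous_real c) auto
  also have "integral {t..t + r} f = integral {0..r} (\<lambda>u. f (t + u))"
    using integral_shift_Icc_real[of 0 r f t] by (simp add: o_def add.commute)
  finally show ?thesis using e[OF c] e[OF c'] by simp
qed

text \<open>The exponent is an integral along the orbit of x, and its part after time t is the
  exponent of the orbit that starts at S t x.\<close>

lemma \<phi>_add: assumes t: "0 \<le> t" and r: "0 \<le> r" shows "\<phi> (t + r) x = \<phi> t x * \<phi> r (S t x)"
proof -
  have "q (t + r) x = q t x + q r (S t x)"
    unfolding q_def
    by (subst set_integral_shift_split[OF _ t r])
      (use t in \<open>auto intro!: continuous_intros S_continuous set_lebesgue_integral_cong simp: S_add[symmetric] add.commute\<close>)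
  moreover have "\<psi> (t + r) x = \<psi> t x + \<psi> r (S t x)"
  proof -
    have "continuous_on {0..} (\<lambda>r. norm (S r x) powr (2 * s))"
      using s by (intro continuous_on_powr' continuous_intros S_continuous) auto
    then show ?thesis unfolding \<psi>_def
      by (subst set_integral_shift_split[OF _ t r])
        (use t in \<open>auto intro!: set_lebesgue_integral_cong simp: S_add[symmetric] add.commute\<close>)
  qed
  ultimately show ?thesis by (simp add: \<phi>_def exp_add[symmetric] algebra_simps)
qed

lemma measurable_S [measurable]: "(\<lambda>y. S t y) \<in> borel_measurable borel"
  by (intro borel_measurable_continuous_onI continuous_intros)

lemma pair_\<mu>: "0 \<le> t \<Longrightarrow> 0 \<le> r \<Longrightarrow> pair_prob_space (\<mu> t) (\<mu> r)"
  by (intro pair_prob_space.intro pair_sigma_finite.intro prob prob_space_imp_sigma_finite)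

lemma measurable_pair_sum:
  assumes "0 \<le> t" "0 \<le> r"
  shows "(\<lambda>(y, z). y + \<sigma> *\<^sub>R S t z) \<in> borel_measurable (\<mu> t \<Otimes>\<^sub>M \<mu> r)"
proof -
  note [measurable_cong] = sets_\<mu>[OF assms(1)] sets_\<mu>[OF assms(2)]
  show ?thesis by measurable
qed

text \<open>The cocycle identity in terms of laws; the sign \<sigma> is free because \<phi> is even.
  The plus sign gives the semigroup law of \<open>mehler\<close>, the minus sign serves the
  tightness argument.\<close>

lemma \<mu>_convolution:
  assumes t: "0 \<le> t" and r: "0 \<le> r" and \<sigma>: "\<bar>\<sigma>\<bar> = 1"
  shows "distr (\<mu> t \<Otimes>\<^sub>M \<mu> r) borel (\<lambda>(y, z). y + \<sigma> *\<^sub>R S t z) = \<mu> (t + r)"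
proof (rule char_determines_measure)
  note [measurable_cong] = sets_\<mu>[OF t] sets_\<mu>[OF r]
  note ms = measurable_pair_sum[OF t r, of \<sigma>]
  interpret pair_prob_space "\<mu> t" "\<mu> r" by (rule pair_\<mu>[OF t r])
  interpret R: prob_space "\<mu> r" by (rule prob[OF r])
  have \<sigma>': "\<sigma> = 1 \<or> \<sigma> = -1" using \<sigma> by auto
  show "prob_space (distr (\<mu> t \<Otimes>\<^sub>M \<mu> r) borel (\<lambda>(y, z). y + \<sigma> *\<^sub>R S t z))"
    by (rule prob_space_distr[OF ms])
  show "prob_space (\<mu> (t + r))" "sets (\<mu> (t + r)) = sets borel" using prob sets_\<mu> t r by simp_all
  fix x
  have inn: "x \<bullet> (\<sigma> *\<^sub>R S t z) = (\<sigma> *\<^sub>R S t x) \<bullet> z" for z using S_symmetric[OF t, of x z] by simp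
  have \<phi>\<sigma>: "\<phi> r (\<sigma> *\<^sub>R S t x) = \<phi> r (S t x)" using \<sigma>' \<phi>_minus by auto
  note i = trig_integral(3,4)[OF prob[OF r] sets_\<mu>[OF r]] trig_integral(3,4)[OF prob[OF t] sets_\<mu>[OF t]]
  have ic: "integrable (\<mu> t \<Otimes>\<^sub>M \<mu> r) (\<lambda>p. cos (x \<bullet> (case p of (y, z) \<Rightarrow> y + \<sigma> *\<^sub>R S t z)))"
    by (rule P.integrable_const_bound[where B=1]) auto
  have "(\<integral>y. cos (x \<bullet> y) \<partial>distr (\<mu> t \<Otimes>\<^sub>M \<mu> r) borel (\<lambda>(y, z). y + \<sigma> *\<^sub>R S t z))
    = (\<integral>p. cos (x \<bullet> (case p of (y, z) \<Rightarrow> y + \<sigma> *\<^sub>R S t z)) \<partial>(\<mu> t \<Otimes>\<^sub>M \<mu> r))"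
    by (rule integral_distr[OF ms]) simp
  also have "\<dots> = (\<integral>y. \<integral>z. cos (x \<bullet> (y + \<sigma> *\<^sub>R S t z)) \<partial>\<mu> r \<partial>\<mu> t)"
    using integral_fst'[OF ic] by simp
  also have "\<dots> = (\<integral>y. cos (x \<bullet> y) * \<phi> r (S t x) \<partial>\<mu> t)"
    using i(1,2) \<phi>\<sigma> unfolding inner_add_right inn cos_add by (simp add: integral_cos_sin[OF r] del: inner_scaleR_left)
  also have "\<dots> = (\<integral>y. cos (x \<bullet> y) \<partial>\<mu> (t + r))" using t r by (simp add: integral_cos_sin \<phi>_add)
  finally show "(\<integral>y. cos (x \<bullet> y) \<partial>distr (\<mu> t \<Otimes>\<^sub>M \<mu> r) borel (\<lambda>(y, z). y + \<sigma> *\<^sub>R S t z)) = (\<integral>y. cos (x \<bullet> y) \<partial>\<mu> (t + r))" .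
  have isn: "integrable (\<mu> t \<Otimes>\<^sub>M \<mu> r) (\<lambda>p. sin (x \<bullet> (case p of (y, z) \<Rightarrow> y + \<sigma> *\<^sub>R S t z)))"
    by (rule P.integrable_const_bound[where B=1]) auto
  have "(\<integral>y. sin (x \<bullet> y) \<partial>distr (\<mu> t \<Otimes>\<^sub>M \<mu> r) borel (\<lambda>(y, z). y + \<sigma> *\<^sub>R S t z))
    = (\<integral>p. sin (x \<bullet> (case p of (y, z) \<Rightarrow> y + \<sigma> *\<^sub>R S t z)) \<partial>(\<mu> t \<Otimes>\<^sub>M \<mu> r))"
    by (rule integral_distr[OF ms]) simp
  also have "\<dots> = (\<integral>y. \<integral>z. sin (x \<bullet> (y + \<sigma> *\<^sub>R S t z)) \<partial>\<mu> r \<partial>\<mu> t)"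
    using integral_fst'[OF isn] by simp
  also have "\<dots> = (\<integral>y. sin (x \<bullet> y) * \<phi> r (S t x) \<partial>\<mu> t)"
    using i(1,2) \<phi>\<sigma> unfolding inner_add_right inn sin_add by (simp add: integral_cos_sin[OF r] del: inner_scaleR_left)
  also have "\<dots> = (\<integral>y. sin (x \<bullet> y) \<partial>\<mu> (t + r))" using t r by (simp add: integral_cos_sin)
  finally show "(\<integral>y. sin (x \<bullet> y) \<partial>distr (\<mu> t \<Otimes>\<^sub>M \<mu> r) borel (\<lambda>(y, z). y + \<sigma> *\<^sub>R S t z)) = (\<integral>y. sin (x \<bullet> y) \<partial>\<mu> (t + r))" .
qed simp

lemma integrable_\<mu>:
  fixes f :: "'a \<Rightarrow> real"
  assumes t: "0 \<le> t" and f: "f \<in> borel_measurable borel" "\<And>y. \<bar>f y\<bar> \<le> M"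
  shows "integrable (\<mu> t) f"
proof -
  interpret prob_space "\<mu> t" by (rule prob[OF t])
  show ?thesis by (rule integrable_const_bound[where B=M]) (use f measurable_\<mu>[OF t] in auto)
qed

lemma integral_\<mu>_add:
  fixes f :: "'a \<Rightarrow> real"
  assumes t: "0 \<le> t" and r: "0 \<le> r" and f: "f \<in> borel_measurable borel" "\<And>y. \<bar>f y\<bar> \<le> M"
  shows "(\<integral>y. f y \<partial>\<mu> (t + r)) = (\<integral>y. \<integral>z. f (y + S t z) \<partial>\<mu> r \<partial>\<mu> t)"
    "(\<integral>y. f y \<partial>\<mu> (t + r)) = (\<integral>z. \<integral>y. f (y + S t z) \<partial>\<mu> t \<partial>\<mu> r)"
    "integrable (\<mu> r) (\<lambda>z. \<integral>y. f (y + S t z) \<partial>\<mu> t)"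
proof -
  note [measurable_cong] = sets_\<mu>[OF t] sets_\<mu>[OF r]
  have ms: "(\<lambda>(y, z). y + S t z) \<in> borel_measurable (\<mu> t \<Otimes>\<^sub>M \<mu> r)" by measurable
  interpret pair_prob_space "\<mu> t" "\<mu> r" by (rule pair_\<mu>[OF t r])
  note [measurable] = f(1)
  have i: "integrable (\<mu> t \<Otimes>\<^sub>M \<mu> r) (\<lambda>p. f (case p of (y, z) \<Rightarrow> y + S t z))"
    by (rule P.integrable_const_bound[where B=M]) (use f(2) in auto)
  have e: "(\<integral>y. f y \<partial>\<mu> (t + r)) = (\<integral>p. f (case p of (y, z) \<Rightarrow> y + S t z) \<partial>(\<mu> t \<Otimes>\<^sub>M \<mu> r))"
    unfolding \<mu>_convolution[OF t r, of 1, symmetric, simplified]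
    by (rule integral_distr[OF ms f(1)])
  show "(\<integral>y. f y \<partial>\<mu> (t + r)) = (\<integral>y. \<integral>z. f (y + S t z) \<partial>\<mu> r \<partial>\<mu> t)"
    unfolding e using integral_fst'[OF i] by simp
  have i': "integrable (\<mu> t \<Otimes>\<^sub>M \<mu> r) (case_prod (\<lambda>y z. f (y + S t z)))"
    using i by (simp add: case_prod_beta')
  show "(\<integral>y. f y \<partial>\<mu> (t + r)) = (\<integral>z. \<integral>y. f (y + S t z) \<partial>\<mu> t \<partial>\<mu> r)"
    unfolding e integral_snd[OF i'] by (simp add: case_prod_beta')
  show "integrable (\<mu> r) (\<lambda>z. \<integral>y. f (y + S t z) \<partial>\<mu> t)"
    by (rule integrable_snd[OF i'])
qed

section \<open>Concentration at the origin for small times\<close>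

lemma \<phi>_tendsto_1: "((\<lambda>r. \<phi> r x) \<longlongrightarrow> 1) (at_right 0)"
proof -
  have b: "\<bar>q r x + c * \<psi> r x\<bar> \<le> r * ((norm x)\<^sup>2 + c * norm x powr (2 * s))" if r: "0 \<le> r" for r
  proof -
    have 1: "q r x + c * \<psi> r x = (LINT u:{0..r}|lborel. (norm (S u x))\<^sup>2 + c * norm (S u x) powr (2 * s))"
      using integrable_q[of r x] integrable_\<psi>[of r x] by (simp add: q_def \<psi>_def set_integral_add set_integrable_mult_right)
    have "\<dots> \<le> (LINT u:{0..r}|lborel. (norm x)\<^sup>2 + c * norm x powr (2 * s))"
    proof (rule set_integral_mono)
      show "set_integrable lborel {0..r} (\<lambda>u. (norm (S u x))\<^sup>2 + c * norm (S u x) powr (2 * s))"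
        using integrable_q[of r x] integrable_\<psi>[of r x] by (simp add: set_integrable_mult_right)
      show "set_integrable lborel {0..r} (\<lambda>u. (norm x)\<^sup>2 + c * norm x powr (2 * s))"
        by (intro set_integrable_continuous continuous_intros)
      fix u assume "u \<in> {0..r}"
      then have "norm (S u x) \<le> norm x" using S_contraction by simp
      then show "(norm (S u x))\<^sup>2 + c * norm (S u x) powr (2 * s) \<le> (norm x)\<^sup>2 + c * norm x powr (2 * s)"
        using c s by (intro add_mono power_mono mult_left_mono powr_mono2) auto
    qed
    also have "\<dots> = r * ((norm x)\<^sup>2 + c * norm x powr (2 * s))"
      using r by (simp add: set_lebesgue_integral_def)
    finally have "q r x + c * \<psi> r x \<le> r * ((norm x)\<^sup>2 + c * norm x powr (2 * s))" unfolding 1 .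
    moreover have "0 \<le> q r x + c * \<psi> r x" unfolding 1 set_lebesgue_integral_def using c by (intro Bochner_Integration.integral_nonneg) (simp add: indicator_def)
    ultimately show ?thesis by simp
  qed
  have "((\<lambda>r. q r x + c * \<psi> r x) \<longlongrightarrow> 0) (at_right 0)"
  proof (rule Lim_null_comparison)
    show "\<forall>\<^sub>F r in at_right 0. norm (q r x + c * \<psi> r x) \<le> r * ((norm x)\<^sup>2 + c * norm x powr (2 * s))"
      using eventually_at_right_less[of 0] by eventually_elim (use b in simp)
    show "((\<lambda>r. r * ((norm x)\<^sup>2 + c * norm x powr (2 * s))) \<longlongrightarrow> 0) (at_right 0)"
      by (rule tendsto_eq_intros | simp)+
  qed
  then have "((\<lambda>r. exp (- (q r x + c * \<psi> r x))) \<longlongrightarrow> exp (- 0)) (at_right 0)" by (intro tendsto_intros)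
  then show ?thesis by (simp add: \<phi>_def)
qed

text \<open>Levy continuity for the marginals: the characteristic function of x \<bullet> y at u is
  \<phi> r at the point u times x, which tends to 1, so the marginals tend to the point mass at
  0.\<close>

lemma proj_concentration: "((\<lambda>r. \<integral>y. min \<bar>x \<bullet> y\<bar> 1 \<partial>\<mu> r) \<longlongrightarrow> 0) (at_right 0)"
proof (rule tendsto_at_right_sequentially[of 0 1])
  fix R :: "nat \<Rightarrow> real" assume R: "\<And>n. 0 < R n" "R \<longlonglongrightarrow> 0"
  have R0: "0 \<le> R n" and Rn: "R n \<noteq> 0" for n using R(1)[of n] by simp_all
  define N where "N n = distr (\<mu> (R n)) borel (\<lambda>y. x \<bullet> y)" for n
  have m: "(\<lambda>y. x \<bullet> y) \<in> borel_measurable (\<mu> (R n))" for n by (simp add: measurable_\<mu>[OF R0])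
  have w: "weak_conv_m N (return borel 0)"
  proof (rule levy_continuity)
    show "real_distribution (N n)" for n
      unfolding N_def by (intro prob_space.real_distribution_distr prob R0 m)
    show "real_distribution (return borel (0::real))"
      by (intro real_distribution.intro real_distribution_axioms.intro prob_space_return) auto
    fix u
    have "char (N n) u = of_real (\<phi> (R n) (u *\<^sub>R x))" for n
    proof -
      have "char (N n) u = (\<integral>y. iexp (u * (x \<bullet> y)) \<partial>\<mu> (R n))"
        unfolding char_def N_def by (rule integral_distr[OF m]) simp
      also have "\<dots> = of_real (\<phi> (R n) (u *\<^sub>R x))" using char_\<phi>[OF R0, of n "u *\<^sub>R x"] by simp
      finally show ?thesis .
    qed
    moreover have "(\<lambda>n. \<phi> (R n) (u *\<^sub>R x)) \<longlonglongrightarrow> 1"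
      by (rule filterlim_compose[OF \<phi>_tendsto_1]) (use R Rn in \<open>auto simp: filterlim_at\<close>)
    moreover have "char (return borel 0) u = 1" by (simp add: char_def integral_return)
    ultimately show "(\<lambda>n. char (N n) u) \<longlonglongrightarrow> char (return borel 0) u"
      using tendsto_of_real[of "\<lambda>n. \<phi> (R n) (u *\<^sub>R x)" 1 sequentially, where 'a=complex] by simp
  qed
  have "(\<lambda>n. \<integral>v. min \<bar>v\<bar> 1 \<partial>N n) \<longlonglongrightarrow> (\<integral>v. min \<bar>v\<bar> 1 \<partial>return borel (0::real))"
  proof (rule weak_conv_imp_integral_bdd_continuous_conv[OF _ _ w])
    show "real_distribution (N n)" for n
      unfolding N_def by (intro prob_space.real_distribution_distr prob R0 m)
    show "real_distribution (return borel (0::real))"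
      by (intro real_distribution.intro real_distribution_axioms.intro prob_space_return) auto
    show "isCont (\<lambda>v. min \<bar>v\<bar> 1 :: real) v" for v by (intro continuous_intros)
    show "norm (min \<bar>v\<bar> 1) \<le> 1" for v :: real by simp
  qed
  moreover have "(\<integral>v. min \<bar>v\<bar> 1 \<partial>N n) = (\<integral>y. min \<bar>x \<bullet> y\<bar> 1 \<partial>\<mu> (R n))" for n
    unfolding N_def by (rule integral_distr[OF m]) measurable
  ultimately show "(\<lambda>n. \<integral>y. min \<bar>x \<bullet> y\<bar> 1 \<partial>\<mu> (R n)) \<longlonglongrightarrow> 0" by (simp add: integral_return)
qed simp

end

text \<open>A substitute for a compact set of large measure: finitely many points of a dense
  sequence whose closed e-balls miss mass less than e, by continuity from above.\<close>

lemma tight_finite_net: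
  fixes M :: "'a::{real_normed_vector, second_countable_topology} measure"
  assumes M: "prob_space M" "sets M = sets borel" and e: "0 < e"
  shows "\<exists>F. finite F \<and> measure M {y. \<forall>f\<in>F. e < norm (y - f)} < e"
proof -
  interpret prob_space M by fact
  have sp: "space M = UNIV" using M(2) by (metis sets_eq_imp_space_eq space_borel)
  obtain D :: "'a set" where D: "countable D" "\<And>X. open X \<Longrightarrow> X \<noteq> {} \<Longrightarrow> \<exists>d\<in>D. d \<in> X"
    using countable_dense_exists by blast
  have "D \<noteq> {}" using D(2)[of UNIV] by auto
  then obtain d :: "nat \<Rightarrow> 'a" where d: "range d = D" using D(1) by (metis uncountable_def)
  define B where "B n = {y. \<forall>f\<in>d ` {..<n}. e < norm (y - f)}" for n
  have Bs: "B n \<in> sets M" for n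
  proof -
    have "B n = (\<Inter>f\<in>d ` {..<n}. {y. e < norm (y - f)})" by (auto simp: B_def)
    moreover have "open (\<Inter>f\<in>d ` {..<n}. {y. e < norm (y - f)})"
      by (intro open_INT finite_imageI) (auto intro!: open_Collect_less continuous_intros)
    ultimately show ?thesis using M(2) by simp
  qed
  have "(\<lambda>n. measure M (B n)) \<longlonglongrightarrow> measure M (\<Inter>n. B n)"
    by (rule finite_Lim_measure_decseq) (use Bs in \<open>auto simp: decseq_def B_def\<close>)
  moreover have "(\<Inter>n. B n) = {}"
  proof -
    have "\<exists>n. y \<notin> B n" for y
    proof -
      obtain x where "x \<in> D" "x \<in> ball y e" using D(2)[of "ball y e"] e by auto
      then obtain i where "norm (y - d i) < e" using d by (metis dist_norm mem_ball rangeE)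
      then have "y \<notin> B (Suc i)" by (auto simp: B_def not_less less_imp_le intro!: bexI[of _ i])
      then show ?thesis by blast
    qed
    then show ?thesis by blast
  qed
  ultimately have "(\<lambda>n. measure M (B n)) \<longlonglongrightarrow> 0" by simp
  from order_tendstoD(2)[OF this e] obtain n where "measure M (B n) < e" by (auto simp: eventually_sequentially)
  then show ?thesis by (intro exI[of _ "d ` {..<n}"]) (simp add: B_def)
qed

text \<open>Lipschitz regularisation by infimal convolution with k * dist. For Lipschitz functions
  the dependence of the measures on time can be estimated directly.\<close>

lemma inf_convolution_exists:
  fixes G :: "'b::metric_space \<Rightarrow> real"
  assumes G: "continuous_on UNIV G" "\<And>p. \<bar>G p\<bar> \<le> M"
  obtains H :: "nat \<Rightarrow> 'b \<Rightarrow> real" where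
    "\<And>k p. \<bar>H k p\<bar> \<le> M" "\<And>k p. H k p \<le> G p" "\<And>k p p'. \<bar>H k p - H k p'\<bar> \<le> real k * dist p p'" "\<And>p. (\<lambda>k. H k p) \<longlonglongrightarrow> G p"
proof -
  define H where "H k p = (INF z. G z + real k * dist p z)" for k :: nat and p
  have low: "- M \<le> G z + real k * dist p z" for k p z
  proof -
    have "0 \<le> real k * dist p z" by simp
    then show ?thesis using G(2)[of z] unfolding abs_le_iff by linarith
  qed
  have bdd: "bdd_below (range (\<lambda>z. G z + real k * dist p z))" for k p by (rule bdd_belowI2[OF low])
  have le: "H k p \<le> G z + real k * dist p z" for k p z unfolding H_def by (rule cINF_lower[OF bdd]) simp
  have ge: "a \<le> H k p" if "\<And>z. a \<le> G z + real k * dist p z" for a k p unfolding H_def by (rule cINF_greatest) (use that in auto)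
  have HG: "H k p \<le> G p" for k p using le[of k p p] by simp
  have HM: "- M \<le> H k p" for k p by (rule ge[OF low])
  have lip1: "H k p \<le> H k p' + real k * dist p p'" for k p p'
  proof -
    have "H k p - real k * dist p p' \<le> H k p'"
    proof (rule ge)
      fix z
      have "real k * dist p z \<le> real k * dist p p' + real k * dist p' z"
        unfolding distrib_left[symmetric] by (intro mult_left_mono dist_triangle) simp
      then show "H k p - real k * dist p p' \<le> G z + real k * dist p' z" using le[of k p z] by linarith
    qed
    then show ?thesis by linarith
  qed
  show ?thesis
  proof (rule that[of H])
    show "\<bar>H k p\<bar> \<le> M" for k p using HM[of k p] HG[of k p] G(2)[of p] by (simp add: abs_le_iff)
    show "H k p \<le> G p" for k p by (rule HG)
    show "\<bar>H k p - H k p'\<bar> \<le> real k * dist p p'" for k p p'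
      using lip1[of k p p'] lip1[of k p' p] by (simp add: abs_le_iff dist_commute)
    fix p
    show "(\<lambda>k. H k p) \<longlonglongrightarrow> G p"
    proof (rule LIMSEQ_I)
      fix e :: real assume e: "0 < e"
      obtain d where d: "d > 0" "\<And>z. dist z p < d \<Longrightarrow> dist (G z) (G p) < e / 2"
        using G(1) e unfolding continuous_on_iff by (metis UNIV_I half_gt_zero)
      \<comment> \<open>Points at distance at least d from p carry a penalty of at least 2 * M and
        cannot undercut G p.\<close>
      obtain N :: nat where N: "2 * M / d \<le> real N" using real_arch_simple by blast
      have "norm (H k p - G p) < e" if k: "k \<ge> N" for k
      proof -
        have "G p - e / 2 \<le> H k p"
        proof (rule ge)
          fix z
          show "G p - e / 2 \<le> G z + real k * dist p z"
          proof (cases "dist z p < d")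
            case True
            have "0 \<le> real k * dist p z" by simp
            then show ?thesis using d(2)[OF True] unfolding dist_real_def abs_less_iff by linarith
          next
            case False
            have "2 * M \<le> real N * d" using N d(1) by (simp add: pos_divide_le_eq)
            also have "\<dots> \<le> real k * dist p z" using False k d(1) by (intro mult_mono) (auto simp: dist_commute)
            finally show ?thesis using G(2)[of z] G(2)[of p] e by (simp add: abs_le_iff)
          qed
        qed
        then show ?thesis using HG[of k p] e by simp
      qed
      then show "\<exists>N. \<forall>k\<ge>N. norm (H k p - G p) < e" by blast
    qed
  qed
qed

context ou_semigroup begin

text \<open>Truncated mean norm. Unlike the marginals it sees the whole vector, and it is the
  modulus of continuity in time in \<open>lipschitz_\<mu>\<close>.\<close>

definition \<omega> :: "real \<Rightarrow> real" where "\<omega> r = (\<integral>y. min (norm y) 1 \<partial>\<mu> r)"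

text \<open>If \<open>Y\<close> and \<open>Z\<close> are independent with laws \<open>\<mu> r\<close> and \<open>\<mu> (1 - r)\<close>, then \<open>Y + S r Z\<close> and
  \<open>Y - S r Z\<close> both have law \<open>\<mu> 1\<close>. Tightness of \<open>\<mu> 1\<close> thus keeps their mean \<open>Y\<close> close to a finite set
  not depending on \<open>r\<close>, and the one-dimensional projections of \<open>\<mu> r\<close> concentrate at \<open>0\<close>.\<close>

lemma \<omega>_tendsto_0: "(\<omega> \<longlongrightarrow> 0) (at_right 0)"
proof (rule tendstoI)
  fix e0 :: real assume e0: "0 < e0"
  \<comment> \<open>The final estimate adds 2 * e, the mass of B below 2 * e, and e from the
    marginals, hence 5 * e < e0.\<close>
  define e where "e = min (e0 / 6) (1 / 2)"
  have e: "0 < e" "e < 1" "5 * e < e0" using e0 by (auto simp: e_def min_def)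
  obtain F where F: "finite F" "measure (\<mu> 1) {y. \<forall>f\<in>F. e < norm (y - f)} < e"
    using tight_finite_net[OF prob[of 1] sets_\<mu>[of 1] e(1)] by auto
  define Kc where "Kc = {y. \<forall>f\<in>F. e < norm (y - f)}"
  \<comment> \<open>Midpoints: if Y + S r Z is within e of f and Y - S r Z within e of g, then Y is
    within e of (f + g) / 2.\<close>
  define F' where "F' = (\<lambda>(f, g). (f + g) /\<^sub>R 2) ` (F \<times> F)"
  define B where "B = {y. \<forall>f\<in>F'. e < norm (y - f)}"
  have F': "finite F'" using F(1) by (simp add: F'_def)
  have os: "{y. \<forall>f\<in>X. e < norm (y - f)} \<in> sets borel" if "finite X" for X :: "'a set"
  proof -
    have "{y. \<forall>f\<in>X. e < norm (y - f)} = (\<Inter>f\<in>X. {y. e < norm (y - f)})" by auto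
    moreover have "open (\<Inter>f\<in>X. {y. e < norm (y - f)})"
      using that by (intro open_INT) (auto intro!: open_Collect_less continuous_intros)
    ultimately show ?thesis by simp
  qed
  have [measurable]: "B \<in> sets borel" "Kc \<in> sets borel" unfolding B_def Kc_def using os F F' by auto
  have muB: "measure (\<mu> r) B < 2 * e" if r: "0 \<le> r" "r \<le> 1" for r
  proof -
    have r': "0 \<le> 1 - r" using r by simp
    note [measurable_cong] = sets_\<mu>[OF r(1)] sets_\<mu>[OF r']
    interpret pair_prob_space "\<mu> r" "\<mu> (1 - r)" by (rule pair_\<mu>[OF r(1) r'])
    let ?P = "\<mu> r \<Otimes>\<^sub>M \<mu> (1 - r)"
    define A where "A \<sigma> = {p \<in> space ?P. (case p of (y, z) \<Rightarrow> y + \<sigma> *\<^sub>R S r z) \<in> Kc}" for \<sigma>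
    have As: "A \<sigma> \<in> sets ?P" for \<sigma> unfolding A_def by measurable
    have sp: "space (\<mu> r) = UNIV" "space (\<mu> (1 - r)) = UNIV" "space ?P = UNIV"
      using sets_\<mu>[OF r(1)] sets_\<mu>[OF r'] by (auto simp: space_pair_measure dest!: sets_eq_imp_space_eq)
    have mA: "measure ?P (A \<sigma>) = measure (\<mu> 1) Kc" if "\<bar>\<sigma>\<bar> = 1" for \<sigma>
    proof -
      have "measure (\<mu> 1) Kc = measure (distr ?P borel (\<lambda>(y, z). y + \<sigma> *\<^sub>R S r z)) Kc"
        using \<mu>_convolution[OF r(1) r' that] by simp
      also have "\<dots> = measure ?P ((\<lambda>(y, z). y + \<sigma> *\<^sub>R S r z) -` Kc \<inter> space ?P)"
        by (rule measure_distr[OF measurable_pair_sum[OF r(1) r']]) simp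
      also have "\<dots> = measure ?P (A \<sigma>)" by (rule arg_cong[where f="measure ?P"]) (auto simp: A_def)
      finally show ?thesis ..
    qed
    have "measure (\<mu> r) B = measure ?P (B \<times> UNIV)"
    proof -
      have "emeasure ?P (B \<times> space (\<mu> (1 - r))) = emeasure (\<mu> r) B * emeasure (\<mu> (1 - r)) (space (\<mu> (1 - r)))"
        by (rule M2.emeasure_pair_measure_Times) measurable
      then show ?thesis using sp by (simp add: measure_def M2.emeasure_space_1[unfolded sp])
    qed
    also have "\<dots> \<le> measure ?P (A 1 \<union> A (-1))"
    proof (rule P.finite_measure_mono)
      show "B \<times> UNIV \<subseteq> A 1 \<union> A (-1)"
      proof
        fix p assume p: "p \<in> B \<times> (UNIV :: 'a set)"
        obtain y z where yz: "p = (y, z)" by (cases p)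
        show "p \<in> A 1 \<union> A (-1)"
        proof (rule ccontr)
          assume "p \<notin> A 1 \<union> A (-1)"
          then have "y + S r z \<notin> Kc" "y - S r z \<notin> Kc" using sp by (auto simp: A_def yz)
          then obtain f g where fg: "f \<in> F" "norm (y + S r z - f) \<le> e" "g \<in> F" "norm (y - S r z - g) \<le> e"
            unfolding Kc_def by (auto simp: not_less)
          have eq: "y - (f + g) /\<^sub>R 2 = ((y + S r z - f) + (y - S r z - g)) /\<^sub>R 2"
            by (simp add: algebra_simps flip: scaleR_add_left)
          have "norm (y - (f + g) /\<^sub>R 2) \<le> e"
            unfolding eq using norm_triangle_ineq[of "y + S r z - f" "y - S r z - g"] fg by simp
          moreover have "(f + g) /\<^sub>R 2 \<in> F'" using fg by (force simp: F'_def)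
          ultimately show False using p by (auto simp: B_def yz)
        qed
      qed
    qed (use As in auto)
    also have "\<dots> \<le> measure ?P (A 1) + measure ?P (A (-1))"
      by (rule measure_Un_le[OF As As])
    also have "\<dots> < 2 * e" using mA[of 1] mA[of "-1"] F(2) by (simp add: Kc_def)
    finally show ?thesis .
  qed
  \<comment> \<open>Outside B the point z is within e of some f in F'. If moreover norm z > 2 * e,
    then f \<bullet> z \<ge> norm z * (norm z - e) \<ge> e^2, so the marginal in the direction f
    detects z.\<close>
  have pt: "min (norm z) 1 \<le> 2 * e + indicator B z + (\<Sum>f\<in>F'. min \<bar>f \<bullet> z\<bar> 1 / e\<^sup>2)" for z
  proof -
    have s0: "0 \<le> (\<Sum>f\<in>F'. min \<bar>f \<bullet> z\<bar> 1 / e\<^sup>2)" by (intro sum_nonneg) simp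
    consider "norm z \<le> 2 * e" | "z \<in> B" | "2 * e < norm z" "z \<notin> B" by linarith
    then show ?thesis
    proof cases
      case 1
      have "0 \<le> (indicator B z :: real)" by simp
      then show ?thesis using 1 s0 by linarith
    next
      case 2 then show ?thesis using s0 e by simp
    next
      case 3
      then obtain f where f: "f \<in> F'" "norm (z - f) \<le> e" by (auto simp: B_def not_less)
      have "(norm z)\<^sup>2 = z \<bullet> (z - f) + f \<bullet> z" by (simp add: power2_norm_eq_inner inner_diff_right inner_commute)
      also have "z \<bullet> (z - f) \<le> norm z * e" using norm_cauchy_schwarz[of z "z - f"] mult_left_mono[OF f(2), of "norm z"] by simp
      finally have "norm z * (norm z - e) \<le> f \<bullet> z" by (simp add: power2_eq_square algebra_simps)
      moreover have "e * e \<le> norm z * (norm z - e)" using 3 e by (intro mult_mono) auto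
      ultimately have "e\<^sup>2 \<le> \<bar>f \<bullet> z\<bar>" by (simp add: power2_eq_square)
      moreover have "e\<^sup>2 \<le> 1" using e by (simp add: power_le_one)
      ultimately have "1 \<le> min \<bar>f \<bullet> z\<bar> 1 / e\<^sup>2" using e by (simp add: pos_le_divide_eq)
      also have "\<dots> \<le> (\<Sum>f\<in>F'. min \<bar>f \<bullet> z\<bar> 1 / e\<^sup>2)" using f F' by (intro member_le_sum) auto
      finally have "1 \<le> (\<Sum>f\<in>F'. min \<bar>f \<bullet> z\<bar> 1 / e\<^sup>2)" .
      moreover have "0 \<le> (indicator B z :: real)" "min (norm z) 1 \<le> 1" by simp_all
      ultimately show ?thesis using e by linarith
    qed
  qed
  have "((\<lambda>r. \<Sum>f\<in>F'. (\<integral>z. min \<bar>f \<bullet> z\<bar> 1 \<partial>\<mu> r) / e\<^sup>2) \<longlongrightarrow> (\<Sum>f\<in>F'. 0 / e\<^sup>2)) (at_right 0)"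
    using e by (intro tendsto_sum tendsto_divide tendsto_const proj_concentration) auto
  then have "\<forall>\<^sub>F r in at_right 0. (\<Sum>f\<in>F'. (\<integral>z. min \<bar>f \<bullet> z\<bar> 1 \<partial>\<mu> r) / e\<^sup>2) < e"
    using e by (intro order_tendstoD(2)) auto
  moreover have "\<forall>\<^sub>F r::real in at_right 0. 0 < r \<and> r < 1"
    unfolding eventually_at_right_field by (intro exI[of _ 1]) auto
  ultimately show "\<forall>\<^sub>F r in at_right 0. dist (\<omega> r) 0 < e0"
  proof eventually_elim
    case (elim r)
    then have r: "0 \<le> r" "r \<le> 1" by auto
    interpret prob_space "\<mu> r" by (rule prob[OF r(1)])
    have im: "integrable (\<mu> r) (\<lambda>z. min \<bar>f \<bullet> z\<bar> 1)" for f
      by (rule integrable_\<mu>[OF r(1), where M=1]) auto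
    have ib: "integrable (\<mu> r) (indicator B :: 'a \<Rightarrow> real)"
      by (rule integrable_\<mu>[OF r(1), where M=1]) (auto simp: indicator_def)
    have "\<omega> r \<le> (\<integral>z. 2 * e + indicator B z + (\<Sum>f\<in>F'. min \<bar>f \<bullet> z\<bar> 1 / e\<^sup>2) \<partial>\<mu> r)"
      unfolding \<omega>_def
    proof (rule integral_mono)
      show "integrable (\<mu> r) (\<lambda>z. min (norm z) 1)" by (rule integrable_\<mu>[OF r(1), where M=1]) auto
      show "integrable (\<mu> r) (\<lambda>z. 2 * e + indicator B z + (\<Sum>f\<in>F'. min \<bar>f \<bullet> z\<bar> 1 / e\<^sup>2))"
        using im ib by simp
    qed (rule pt)
    also have "\<dots> = 2 * e + measure (\<mu> r) B + (\<Sum>f\<in>F'. (\<integral>z. min \<bar>f \<bullet> z\<bar> 1 \<partial>\<mu> r) / e\<^sup>2)"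
    proof -
      have "space (\<mu> r) = UNIV" using sets_eq_imp_space_eq[OF sets_\<mu>[OF r(1)]] by simp
      then show ?thesis using im ib by (simp add: prob_space[unfolded \<open>space (\<mu> r) = UNIV\<close>])
    qed
    also have "\<dots> < 2 * e + 2 * e + e" using muB[OF r] elim by linarith
    finally have "\<omega> r < e0" using e by simp
    moreover have "0 \<le> \<omega> r" unfolding \<omega>_def by (intro Bochner_Integration.integral_nonneg) simp
    ultimately show ?case by simp
  qed
qed

text \<open>By the convolution law, passing from t to t + r adds an independent vector S t z with z
  of law \<mu> r, and S t is a contraction. The Lipschitz bound serves for norm z \<le> 1, the sup
  bound beyond.\<close>

lemma lipschitz_\<mu>:
  assumes t: "0 \<le> t" and r: "0 \<le> r" and f: "\<And>y. \<bar>f y\<bar> \<le> M" "\<And>y z. \<bar>f y - f z\<bar> \<le> L * norm (y - z)" and L: "0 \<le> L"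
  shows "\<bar>(\<integral>y. f y \<partial>\<mu> (t + r)) - (\<integral>y. f y \<partial>\<mu> t)\<bar> \<le> (L + 2 * M) * \<omega> r"
proof -
  have "L-lipschitz_on UNIV f" by (rule lipschitz_onI) (use f L in \<open>auto simp: dist_norm\<close>)
  then have fm: "f \<in> borel_measurable borel"
    by (intro borel_measurable_continuous_onI lipschitz_on_continuous_on)
  note [measurable] = fm
  interpret prob_space "\<mu> t" by (rule prob[OF t])
  interpret R: prob_space "\<mu> r" by (rule prob[OF r])
  have M: "0 \<le> M" using order_trans[OF abs_ge_zero f(1)] .
  note I = integral_\<mu>_add[OF t r fm f(1)]
  have b: "\<bar>(\<integral>y. f (y + S t z) \<partial>\<mu> t) - (\<integral>y. f y \<partial>\<mu> t)\<bar> \<le> (L + 2 * M) * min (norm z) 1" for z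
  proof -
    have i: "integrable (\<mu> t) (\<lambda>y. f (y + S t z))" "integrable (\<mu> t) f"
      by (rule integrable_\<mu>[OF t, where M=M]; use f in simp)+
    have "\<bar>(\<integral>y. f (y + S t z) \<partial>\<mu> t) - (\<integral>y. f y \<partial>\<mu> t)\<bar> = \<bar>\<integral>y. f (y + S t z) - f y \<partial>\<mu> t\<bar>" using i by simp
    also have "\<dots> \<le> (\<integral>y. \<bar>f (y + S t z) - f y\<bar> \<partial>\<mu> t)" by (rule integral_abs_bound)
    also have "\<dots> \<le> (\<integral>y. (L + 2 * M) * min (norm z) 1 \<partial>\<mu> t)"
    proof (rule integral_mono)
      show "integrable (\<mu> t) (\<lambda>y. \<bar>f (y + S t z) - f y\<bar>)" using i by (intro integrable_abs) simp
      fix y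
      have "\<bar>f (y + S t z) - f y\<bar> \<le> L * norm (S t z)" using f(2)[of "y + S t z" y] by simp
      also have "\<dots> \<le> L * norm z" using S_contraction[OF t] L by (intro mult_left_mono) auto
      finally have 1: "\<bar>f (y + S t z) - f y\<bar> \<le> L * norm z" .
      have 2: "\<bar>f (y + S t z) - f y\<bar> \<le> 2 * M" using f(1)[of y] f(1)[of "y + S t z"] by linarith
      show "\<bar>f (y + S t z) - f y\<bar> \<le> (L + 2 * M) * min (norm z) 1"
      proof (cases "norm z \<le> 1")
        case True
        have "0 \<le> 2 * M * norm z" using M by simp
        then show ?thesis using 1 True by (simp add: distrib_right)
      next
        case False then show ?thesis using 2 L by simp
      qed
    qed auto
    finally show ?thesis by (simp add: prob_space)
  qed
  have "\<bar>(\<integral>y. f y \<partial>\<mu> (t + r)) - (\<integral>y. f y \<partial>\<mu> t)\<bar> = \<bar>\<integral>z. (\<integral>y. f (y + S t z) \<partial>\<mu> t) - (\<integral>y. f y \<partial>\<mu> t) \<partial>\<mu> r\<bar>"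
    using I(2,3) by (simp add: R.prob_space)
  also have "\<dots> \<le> (\<integral>z. \<bar>(\<integral>y. f (y + S t z) \<partial>\<mu> t) - (\<integral>y. f y \<partial>\<mu> t)\<bar> \<partial>\<mu> r)" by (rule integral_abs_bound)
  also have "\<dots> \<le> (\<integral>z. (L + 2 * M) * min (norm z) 1 \<partial>\<mu> r)"
  proof (rule integral_mono)
    show "integrable (\<mu> r) (\<lambda>z. \<bar>(\<integral>y. f (y + S t z) \<partial>\<mu> t) - (\<integral>y. f y \<partial>\<mu> t)\<bar>)"
      using I(3) by (intro integrable_abs) simp
    show "integrable (\<mu> r) (\<lambda>z. (L + 2 * M) * min (norm z) 1)"
      by (intro integrable_mult_right integrable_\<mu>[OF r, where M=1]) auto
  qed (rule b)
  finally show ?thesis by (simp add: \<omega>_def)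
qed

section \<open>Continuity of averages in time, parameter and space\<close>

lemma S_joint_continuous: "continuous_on ({0..} \<times> UNIV) (\<lambda>(t, x). S t x)"
  unfolding continuous_on_sequentially
proof (intro allI ballI impI, elim conjE)
  fix u :: "nat \<Rightarrow> real \<times> 'a" and p assume p: "p \<in> {0..} \<times> UNIV" and u: "\<forall>n. u n \<in> {0..} \<times> UNIV" "u \<longlonglongrightarrow> p"
  obtain t x where tx: "p = (t, x)" by (cases p)
  have l: "(\<lambda>n. fst (u n)) \<longlonglongrightarrow> t" "(\<lambda>n. snd (u n)) \<longlonglongrightarrow> x" using tendsto_fst[OF u(2)] tendsto_snd[OF u(2)] by (simp_all add: tx)
  have f0: "0 \<le> fst (u n)" for n using u(1) by (metis SigmaD1 atLeast_iff prod.collapse)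
  have "(\<lambda>n. S (fst (u n)) x) \<longlonglongrightarrow> S t x"
    using S_continuous[of x] l(1) f0 p tx unfolding continuous_on_sequentially by (auto simp: o_def)
  moreover have "(\<lambda>n. S (fst (u n)) (snd (u n) - x)) \<longlonglongrightarrow> 0"
  proof (rule Lim_null_comparison)
    show "\<forall>\<^sub>F n in sequentially. norm (S (fst (u n)) (snd (u n) - x)) \<le> norm (snd (u n) - x)"
      using S_contraction[OF f0] by simp
    show "(\<lambda>n. norm (snd (u n) - x)) \<longlonglongrightarrow> 0" using l(2) by (intro tendsto_norm_zero LIM_zero)
  qed
  ultimately have "(\<lambda>n. S (fst (u n)) (snd (u n) - x) + S (fst (u n)) x) \<longlonglongrightarrow> 0 + S t x" by (rule tendsto_add[rotated])
  then show "((\<lambda>(t, x). S t x) \<circ> u) \<longlonglongrightarrow> (\<lambda>(t, x). S t x) p"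
    by (simp add: o_def case_prod_beta' tx blinfun.diff_right)
qed

text \<open>The time \<open>t\<close> of the semigroup and the parameter \<open>r\<close> of the integrand are kept separate, so that
  the integrand of the Duhamel formula and its directional derivatives are both instances of \<open>E\<close>.\<close>

definition E :: "(real \<times> 'a \<Rightarrow> real) \<Rightarrow> real \<times> real \<times> 'a \<Rightarrow> real" where
  "E G = (\<lambda>(t, r, x). \<integral>y. G (r, S t x + y) \<partial>\<mu> t)"

text \<open>The change of the argument is controlled by the Lipschitz constant under one measure,
  the change of the measure by \<open>lipschitz_\<mu>\<close>, based at the earlier of the two
  times.\<close>

lemma E_lipschitz_continuous:
  fixes G :: "real \<times> 'a \<Rightarrow> real"
  assumes G: "\<And>p. \<bar>G p\<bar> \<le> M" "\<And>p p'. \<bar>G p - G p'\<bar> \<le> L * dist p p'" and L: "0 \<le> L"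
  shows "continuous_on ({0..} \<times> UNIV) (E G)"
  unfolding continuous_on_sequentially
proof (intro allI ballI impI, elim conjE)
  fix u :: "nat \<Rightarrow> real \<times> real \<times> 'a" and p assume p: "p \<in> {0..} \<times> UNIV" and u: "\<forall>n. u n \<in> {0..} \<times> UNIV" "u \<longlonglongrightarrow> p"
  obtain t r x where tx: "p = (t, r, x)" by (cases p)
  define tn rn xn where "tn n = fst (u n)" and "rn n = fst (snd (u n))" and "xn n = snd (snd (u n))" for n
  have un: "u n = (tn n, rn n, xn n)" for n by (simp add: tn_def rn_def xn_def)
  have l: "tn \<longlonglongrightarrow> t" "rn \<longlonglongrightarrow> r" "xn \<longlonglongrightarrow> x"
    using tendsto_fst[OF u(2)] tendsto_fst[OF tendsto_snd[OF u(2)]] tendsto_snd[OF tendsto_snd[OF u(2)]]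
    by (simp_all add: tx tn_def[abs_def] rn_def[abs_def] xn_def[abs_def])
  have t0: "0 \<le> tn n" for n using u(1) un by (metis SigmaD1 atLeast_iff)
  have t: "0 \<le> t" using p tx by simp
  have M: "0 \<le> M" using order_trans[OF abs_ge_zero G(1)] .
  have "continuous_on UNIV G" by (rule lipschitz_on_continuous_on[of L], rule lipschitz_onI) (use G L in \<open>auto simp: dist_real_def\<close>)
  then have Gc: "continuous_on UNIV (\<lambda>y. G (a, b + y))" for a b
    by (rule continuous_on_compose2) (auto intro!: continuous_intros)
  note Gm = borel_measurable_continuous_onI[OF Gc]
  define g where "g y = G (r, S t x + y)" for y
  have Sn: "(\<lambda>n. S (tn n) (xn n)) \<longlonglongrightarrow> S t x"
    using S_joint_continuous unfolding continuous_on_sequentially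
    apply (elim allE[where x="\<lambda>n. (tn n, xn n)"] ballE[where x="(t, x)"])
    using l t t0 by (auto simp: o_def intro: tendsto_Pair)
  have 1: "\<bar>E G (u n) - (\<integral>y. g y \<partial>\<mu> (tn n))\<bar> \<le> L * (\<bar>rn n - r\<bar> + norm (S (tn n) (xn n) - S t x))" for n
  proof -
    interpret prob_space "\<mu> (tn n)" by (rule prob[OF t0])
    have i: "integrable (\<mu> (tn n)) (\<lambda>y. G (a, b + y))" for a b
      by (rule integrable_\<mu>[OF t0 Gm G(1)])
    have "\<bar>E G (u n) - (\<integral>y. g y \<partial>\<mu> (tn n))\<bar> = \<bar>\<integral>y. G (rn n, S (tn n) (xn n) + y) - g y \<partial>\<mu> (tn n)\<bar>"
      using i by (simp add: E_def un g_def)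
    also have "\<dots> \<le> (\<integral>y. \<bar>G (rn n, S (tn n) (xn n) + y) - g y\<bar> \<partial>\<mu> (tn n))" by (rule integral_abs_bound)
    also have "\<dots> \<le> (\<integral>y. L * (\<bar>rn n - r\<bar> + norm (S (tn n) (xn n) - S t x)) \<partial>\<mu> (tn n))"
    proof (rule integral_mono)
      show "integrable (\<mu> (tn n)) (\<lambda>y. \<bar>G (rn n, S (tn n) (xn n) + y) - g y\<bar>)"
        unfolding g_def using i by (intro integrable_abs) simp
      fix y
      have "\<bar>G (rn n, S (tn n) (xn n) + y) - g y\<bar> \<le> L * dist (rn n, S (tn n) (xn n) + y) (r, S t x + y)"
        unfolding g_def by (rule G(2))
      also have "\<dots> \<le> L * (\<bar>rn n - r\<bar> + norm (S (tn n) (xn n) - S t x))"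
        using L sqrt_sum_squares_le_sum[of "dist (rn n) r" "dist (S (tn n) (xn n) + y) (S t x + y)"]
        by (intro mult_left_mono) (simp_all add: dist_Pair_Pair, simp add: dist_norm)
      finally show "\<bar>G (rn n, S (tn n) (xn n) + y) - g y\<bar> \<le> L * (\<bar>rn n - r\<bar> + norm (S (tn n) (xn n) - S t x))" .
    qed auto
    finally show ?thesis by (simp add: prob_space)
  qed
  have gl: "\<bar>g y - g z\<bar> \<le> L * norm (y - z)" for y z
    using G(2)[of "(r, S t x + y)" "(r, S t x + z)"] by (simp add: g_def dist_Pair_Pair dist_norm)
  \<comment> \<open>Only the right limit of \<omega> at 0 is known, so the value at 0 is set by
    hand; equal times then contribute nothing.\<close>
  define w where "w d = (if d = 0 then 0 else \<omega> d)" for d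
  have 2: "\<bar>(\<integral>y. g y \<partial>\<mu> (tn n)) - (\<integral>y. g y \<partial>\<mu> t)\<bar> \<le> (L + 2 * M) * w \<bar>tn n - t\<bar>" for n
  proof (cases "tn n = t")
    case False
    have gM: "\<bar>g y\<bar> \<le> M" for y unfolding g_def by (rule G(1))
    show ?thesis
    proof (cases "tn n < t")
      case True
      then show ?thesis using lipschitz_\<mu>[OF t0, of "t - tn n" g M L n] gM gl L by (simp add: w_def abs_minus_commute)
    next
      case F: False
      then show ?thesis using False lipschitz_\<mu>[OF t, of "tn n - t" g M L] gM gl L by (simp add: w_def)
    qed
  qed (simp add: w_def)
  have wl: "(\<lambda>n. w \<bar>tn n - t\<bar>) \<longlonglongrightarrow> 0"
  proof -
    have "(w \<longlongrightarrow> w 0) (at 0 within {0..})"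
      unfolding at_within_Ici_at_right
    proof (rule Lim_transform_eventually[of \<omega>])
      show "\<forall>\<^sub>F d in at_right 0. \<omega> d = w d" using eventually_at_right_less[of 0] by eventually_elim (simp add: w_def)
    qed (simp add: w_def \<omega>_tendsto_0)
    then have "continuous (at 0 within {0..}) w" by (simp add: continuous_within)
    moreover have "(\<lambda>n. \<bar>tn n - t\<bar>) \<longlonglongrightarrow> 0" using l(1) by (intro tendsto_rabs_zero LIM_zero)
    ultimately have "(w \<circ> (\<lambda>n. \<bar>tn n - t\<bar>)) \<longlonglongrightarrow> w 0"
      unfolding continuous_within_sequentially by (auto elim!: allE[where x="\<lambda>n. \<bar>tn n - t\<bar>"])
    then show ?thesis by (simp add: o_def w_def)
  qed
  have "(\<lambda>n. E G (u n) - E G p) \<longlonglongrightarrow> 0"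
  proof (rule Lim_null_comparison)
    show "\<forall>\<^sub>F n in sequentially. norm (E G (u n) - E G p)
       \<le> L * (\<bar>rn n - r\<bar> + norm (S (tn n) (xn n) - S t x)) + (L + 2 * M) * w \<bar>tn n - t\<bar>"
    proof (rule always_eventually, rule allI)
      fix n
      have "E G p = (\<integral>y. g y \<partial>\<mu> t)" by (simp add: E_def tx g_def)
      then show "norm (E G (u n) - E G p) \<le> L * (\<bar>rn n - r\<bar> + norm (S (tn n) (xn n) - S t x)) + (L + 2 * M) * w \<bar>tn n - t\<bar>"
        using 1[of n] 2[of n] by simp
    qed
    have "(\<lambda>n. L * (\<bar>rn n - r\<bar> + norm (S (tn n) (xn n) - S t x)) + (L + 2 * M) * w \<bar>tn n - t\<bar>)
      \<longlonglongrightarrow> L * (\<bar>r - r\<bar> + norm (S t x - S t x)) + (L + 2 * M) * 0"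
      by (intro tendsto_intros l Sn wl)
    then show "(\<lambda>n. L * (\<bar>rn n - r\<bar> + norm (S (tn n) (xn n) - S t x)) + (L + 2 * M) * w \<bar>tn n - t\<bar>) \<longlonglongrightarrow> 0" by simp
  qed
  then show "(E G \<circ> u) \<longlonglongrightarrow> E G p" unfolding o_def by (rule LIM_zero_cancel)
qed

text \<open>\<open>E G\<close> is lower semicontinuous as the increasing limit of the continuous functions obtained from
  Lipschitz minorants of \<open>G\<close>; upper semicontinuity follows by passing to \<open>- G\<close>.\<close>

lemma E_lower:
  fixes G :: "real \<times> 'a \<Rightarrow> real"
  assumes G: "continuous_on UNIV G" "\<And>p. \<bar>G p\<bar> \<le> M" and p: "p \<in> {0..} \<times> UNIV" and a: "a < E G p"
  shows "\<forall>\<^sub>F p' in at p within {0..} \<times> UNIV. a < E G p'"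
proof -
  obtain H :: "nat \<Rightarrow> real \<times> 'a \<Rightarrow> real" where H: "\<And>k p. \<bar>H k p\<bar> \<le> M" "\<And>k p. H k p \<le> G p"
    "\<And>k p p'. \<bar>H k p - H k p'\<bar> \<le> real k * dist p p'" "\<And>p. (\<lambda>k. H k p) \<longlonglongrightarrow> G p"
    using inf_convolution_exists[OF G] by blast
  have Hc: "continuous_on UNIV (H k)" for k by (rule lipschitz_on_continuous_on[of "real k"], rule lipschitz_onI) (use H in \<open>auto simp: dist_real_def\<close>)
  have m: "(\<lambda>y. K (r, b + y)) \<in> borel_measurable borel" if "continuous_on UNIV K" for K :: "real \<times> 'a \<Rightarrow> real" and r b
    by (intro borel_measurable_continuous_onI continuous_on_compose2[OF that]) (auto intro!: continuous_intros)
  obtain t r x where tx: "p = (t, r, x)" by (cases p)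
  have t: "0 \<le> t" using p tx by simp
  have "(\<lambda>k. E (H k) p) \<longlonglongrightarrow> E G p"
    unfolding E_def tx prod.case
  proof (rule integral_dominated_convergence[where w="\<lambda>_. M"])
    show "integrable (\<mu> t) (\<lambda>_. M)" by (rule integrable_\<mu>[OF t, where M="\<bar>M\<bar>"]) auto
    show "(\<lambda>y. G (r, S t x + y)) \<in> borel_measurable (\<mu> t)" "(\<lambda>y. H k (r, S t x + y)) \<in> borel_measurable (\<mu> t)" for k
      by (simp_all only: measurable_\<mu>[OF t] m[OF G(1)] m[OF Hc])
  qed (use H in auto)
  from order_tendstoD(1)[OF this a] obtain k where k: "a < E (H k) p" by (auto simp: eventually_sequentially)
  have "continuous_on ({0..} \<times> UNIV) (E (H k))" by (rule E_lipschitz_continuous[OF H(1,3)]) simp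
  then have "(E (H k) \<longlongrightarrow> E (H k) p) (at p within {0..} \<times> UNIV)" unfolding continuous_on using p by (rule bspec)
  from order_tendstoD(1)[OF this k] have "\<forall>\<^sub>F p' in at p within {0..} \<times> UNIV. a < E (H k) p'" .
  moreover have "\<forall>\<^sub>F p' in at p within {0..} \<times> UNIV. p' \<in> {0..} \<times> UNIV" by (simp add: eventually_at_filter)
  ultimately show ?thesis
  proof eventually_elim
    case (elim p')
    obtain t' r' x' where tx': "p' = (t', r', x')" by (cases p')
    have t': "0 \<le> t'" using elim tx' by simp
    have "E (H k) p' \<le> E G p'"
      unfolding E_def tx' prod.case
      by (intro integral_mono integrable_\<mu>[OF t', where M=M] m G H Hc)
    then show ?case using elim by simp
  qed
qed

theorem E_continuous:
  fixes G :: "real \<times> 'a \<Rightarrow> real"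
  assumes G: "continuous_on UNIV G" "\<And>p. \<bar>G p\<bar> \<le> M"
  shows "continuous_on ({0..} \<times> UNIV) (E G)"
  unfolding continuous_on
proof (intro ballI order_tendstoI)
  fix p :: "real \<times> real \<times> 'a" and a assume p: "p \<in> {0..} \<times> UNIV"
  show "\<forall>\<^sub>F p' in at p within {0..} \<times> UNIV. a < E G p'" if "a < E G p"
    by (rule E_lower[OF G p that])
  have neg: "E (\<lambda>p. - G p) = (\<lambda>p. - E G p)" by (rule ext) (simp add: E_def case_prod_beta')
  show "\<forall>\<^sub>F p' in at p within {0..} \<times> UNIV. E G p' < a" if "E G p < a"
    using E_lower[of "\<lambda>p. - G p" M p "- a"] G p that by (simp add: neg continuous_on_minus)
qed

end

section \<open>Gateaux derivatives from differences\<close>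

lemma has_gateaux_derivative_unique:
  assumes "has_gateaux_derivative F A x" "has_gateaux_derivative F B x"
  shows "A = B"
proof (rule blinfun_eqI)
  fix h show "A h = B h" using assms unfolding has_gateaux_derivative_def
    by (metis vector_derivative_unique_at)
qed

lemma gateaux_deriv_eq: "has_gateaux_derivative F A x \<Longrightarrow> gateaux_deriv F x = A"
  unfolding gateaux_deriv_def by (rule the_equality) (auto intro: has_gateaux_derivative_unique)

lemma has_gateaux_derivative_gateaux_deriv: "gateaux_differentiable F x \<Longrightarrow> has_gateaux_derivative F (gateaux_deriv F x) x"
  unfolding gateaux_differentiable_def using gateaux_deriv_eq by blast

text \<open>Plays the role of a bound on the second derivative without presupposing one;
  \<open>lip_bound\<close> and \<open>tri_bound\<close> do the same for the first and the
  third.\<close>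

definition mixed_bound :: "real \<Rightarrow> ('a::real_normed_vector \<Rightarrow> 'b::real_normed_vector) \<Rightarrow> bool" where
  "mixed_bound C F \<longleftrightarrow> (\<forall>x h k. norm (F (x + h + k) - F (x + h) - F (x + k) + F x) \<le> C * norm h * norm k)"

definition lip_bound :: "real \<Rightarrow> ('a::real_normed_vector \<Rightarrow> 'b::real_normed_vector) \<Rightarrow> bool" where
  "lip_bound L F \<longleftrightarrow> (\<forall>x h. norm (F (x + h) - F x) \<le> L * norm h)"

lemma mixed_boundD: "mixed_bound C F \<Longrightarrow> norm (F (x + h + k) - F (x + h) - F (x + k) + F x) \<le> C * norm h * norm k"
  by (simp add: mixed_bound_def)

lemma lip_boundD: "lip_bound L F \<Longrightarrow> norm (F (x + h) - F x) \<le> L * norm h"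
  by (simp add: lip_bound_def)

text \<open>The dyadic difference quotients form a Cauchy sequence because halving the step changes them
  by at most a second difference.\<close>

lemma dyadic_quotients_converge:
  fixes F :: "'a::real_normed_vector \<Rightarrow> 'b::banach"
  assumes F: "mixed_bound C F" and C: "0 \<le> C"
  shows "\<exists>a. (\<lambda>n. (2 ^ n) *\<^sub>R (F (x + (1 / 2 ^ n) *\<^sub>R h) - F x)) \<longlonglongrightarrow> a \<and> norm (F (x + h) - F x - a) \<le> C / 2 * (norm h)\<^sup>2"
proof -
  define g where "g n = (2 ^ n) *\<^sub>R (F (x + (1 / 2 ^ n) *\<^sub>R h) - F x)" for n :: nat
  have d: "norm (g n - g (Suc n)) \<le> C * (norm h)\<^sup>2 / 4 * (1 / 2) ^ n" for n
  proof -
    define k where "k = (1 / 2 ^ Suc n) *\<^sub>R h"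
    have k2: "(1 / 2 ^ n) *\<^sub>R h = k + k" unfolding k_def scaleR_add_left[symmetric] by (rule arg_cong[where f="\<lambda>a. a *\<^sub>R h"]) simp
    have gn: "g n = (2 ^ n) *\<^sub>R (F (x + k + k) - F x)" unfolding g_def k2 by (simp add: add.assoc)
    have "g (Suc n) = (2 ^ n + 2 ^ n) *\<^sub>R (F (x + k) - F x)" by (simp add: g_def k_def)
    then have "g n - g (Suc n) = (2 ^ n) *\<^sub>R (F (x + k + k) - F (x + k) - F (x + k) + F x)"
      unfolding gn scaleR_add_left scaleR_add_right scaleR_diff_right by simp
    then have "norm (g n - g (Suc n)) \<le> 2 ^ n * (C * norm k * norm k)"
      using mixed_boundD[OF F, of x k k] by simp
    also have "\<dots> = C * (norm h)\<^sup>2 / 4 * (1 / 2) ^ n"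
      by (simp add: k_def power2_eq_square power_one_over field_simps)
    finally show ?thesis .
  qed
  have "(\<lambda>n. C * (norm h)\<^sup>2 / 4 * (1 / 2) ^ n) sums (C * (norm h)\<^sup>2 / 4 * (1 / (1 - 1 / 2)))"
    by (intro sums_mult geometric_sums) simp
  then have geo: "summable (\<lambda>n. C * (norm h)\<^sup>2 / 4 * (1 / 2) ^ n)" "(\<Sum>n. C * (norm h)\<^sup>2 / 4 * (1 / 2) ^ n) = C / 2 * (norm h)\<^sup>2"
    unfolding sums_iff by (blast, simp only:, simp)
  have sn: "summable (\<lambda>n. norm (g n - g (Suc n)))"
    by (rule summable_comparison_test'[OF geo(1)]) (use d in auto)
  then have "summable (\<lambda>n. g n - g (Suc n))" by (rule summable_norm_cancel)
  then obtain l where l: "(\<lambda>n. g n - g (Suc n)) sums l" by blast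
  have "(\<lambda>N. g 0 - (\<Sum>n<N. g n - g (Suc n))) \<longlonglongrightarrow> g 0 - l"
    using l unfolding sums_def by (intro tendsto_intros)
  moreover have "g 0 - (\<Sum>n<N. g n - g (Suc n)) = g N" for N
    by (induction N) (simp_all add: diff_diff_eq[symmetric])
  ultimately have "g \<longlonglongrightarrow> g 0 - l" by simp
  moreover have "norm l \<le> C / 2 * (norm h)\<^sup>2"
  proof -
    have "norm l \<le> (\<Sum>n. norm (g n - g (Suc n)))" using summable_norm[OF sn] l by (simp add: sums_iff)
    also have "\<dots> \<le> (\<Sum>n. C * (norm h)\<^sup>2 / 4 * (1 / 2) ^ n)" by (rule suminf_le[OF d sn geo(1)])
    finally show ?thesis using geo(2) by simp
  qed
  ultimately show ?thesis by (intro exI[of _ "g 0 - l"]) (simp add: g_def[abs_def])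
qed

text \<open>Additivity gives homogeneity over the integers. For real t the number n * t is within 1
  of an integer, so n times the defect of homogeneity stays bounded as n grows, and the defect
  vanishes.\<close>

lemma additive_bounded_imp_linear:
  fixes A :: "'a::real_normed_vector \<Rightarrow> 'b::real_normed_vector"
  assumes add: "\<And>h k. A (h + k) = A h + A k" and b: "\<And>h. norm (A h) \<le> L * norm h"
  shows "bounded_linear A"
proof (rule bounded_linear_intro[where K=L])
  show "norm (A h) \<le> norm h * L" for h using b[of h] by (simp add: mult.commute)
  fix t :: real and h
  have A0: "A 0 = 0" using add[of 0 0] by simp
  have An: "A (real n *\<^sub>R h) = real n *\<^sub>R A h" for n :: nat and h
    by (induction n) (auto simp: A0 add scaleR_add_left)
  have Am: "A (- h) = - A h" for h using add[of h "- h"] A0 by (simp add: eq_neg_iff_add_eq_0 add.commute)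
  have Ai: "A (of_int m *\<^sub>R h) = of_int m *\<^sub>R A h" for m and h
  proof (cases "0 \<le> m")
    case True
    then show ?thesis using An[of "nat m" h] by simp
  next
    case False
    define n where "n = nat (- m)"
    have m: "of_int m = - real n" using False by (simp add: n_def)
    have "A (of_int m *\<^sub>R h) = A (- (real n *\<^sub>R h))" unfolding m by simp
    also have "\<dots> = of_int m *\<^sub>R A h" unfolding Am An m by simp
    finally show ?thesis .
  qed
  have "real n * norm (A (t *\<^sub>R h) - t *\<^sub>R A h) \<le> 2 * L * norm h" for n
  proof -
    define m where "m = \<lfloor>real n * t\<rfloor>"
    have fr: "\<bar>real n * t - of_int m\<bar> \<le> 1" unfolding m_def by linarith
    have "A (real n *\<^sub>R (t *\<^sub>R h)) = A ((real n * t - of_int m) *\<^sub>R h) + A (of_int m *\<^sub>R h)"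
      unfolding add[symmetric] scaleR_add_left[symmetric] by simp
    then have e: "real n *\<^sub>R (A (t *\<^sub>R h) - t *\<^sub>R A h) = A ((real n * t - of_int m) *\<^sub>R h) - (real n * t - of_int m) *\<^sub>R A h"
      unfolding An Ai by (simp add: algebra_simps)
    have "real n * norm (A (t *\<^sub>R h) - t *\<^sub>R A h) = norm (A ((real n * t - of_int m) *\<^sub>R h) - (real n * t - of_int m) *\<^sub>R A h)"
      using arg_cong[OF e, of norm] by simp
    also have "\<dots> \<le> norm (A ((real n * t - of_int m) *\<^sub>R h)) + norm ((real n * t - of_int m) *\<^sub>R A h)"
      by (rule norm_triangle_ineq4)
    also have "\<dots> \<le> \<bar>real n * t - of_int m\<bar> * (L * norm h) + \<bar>real n * t - of_int m\<bar> * (L * norm h)"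
    proof (rule add_mono)
      show "norm (A ((real n * t - of_int m) *\<^sub>R h)) \<le> \<bar>real n * t - of_int m\<bar> * (L * norm h)"
        using b[of "(real n * t - of_int m) *\<^sub>R h"] by (simp add: mult_ac)
      show "norm ((real n * t - of_int m) *\<^sub>R A h) \<le> \<bar>real n * t - of_int m\<bar> * (L * norm h)"
        unfolding norm_scaleR by (rule mult_left_mono[OF b]) simp
    qed
    also have "\<dots> \<le> 1 * (L * norm h) + 1 * (L * norm h)"
      using fr order_trans[OF norm_ge_zero b[of h]] by (intro add_mono mult_right_mono) auto
    finally show ?thesis by simp
  qed
  then have "\<not> 0 < norm (A (t *\<^sub>R h) - t *\<^sub>R A h)" using reals_Archimedean3 not_less by blast
  then show "A (t *\<^sub>R h) = t *\<^sub>R A h" by simp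
qed (rule add)

text \<open>For steps scaled by 1 / 2^n the mixed difference is of order 1 / 4^n, so after
  multiplication by 2^n it still vanishes: the limits of the dyadic quotients are additive in the
  direction. The Lipschitz bound makes them bounded linear.\<close>

lemma mixed_bound_imp_derivative:
  fixes F :: "'a::real_normed_vector \<Rightarrow> 'b::banach"
  assumes F: "mixed_bound C F" and L: "lip_bound L F" and C: "0 \<le> C"
  shows "\<exists>A::'a \<Rightarrow>\<^sub>L 'b. \<forall>h. norm (F (x + h) - F x - A h) \<le> C / 2 * (norm h)\<^sup>2"
proof -
  have "\<forall>h. \<exists>a. (\<lambda>n. (2 ^ n) *\<^sub>R (F (x + (1 / 2 ^ n) *\<^sub>R h) - F x)) \<longlonglongrightarrow> a \<and> norm (F (x + h) - F x - a) \<le> C / 2 * (norm h)\<^sup>2"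
    using dyadic_quotients_converge[OF F C] by blast
  from choice[OF this] obtain A where "\<forall>h. (\<lambda>n. (2 ^ n) *\<^sub>R (F (x + (1 / 2 ^ n) *\<^sub>R h) - F x)) \<longlonglongrightarrow> A h \<and> norm (F (x + h) - F x - A h) \<le> C / 2 * (norm h)\<^sup>2" ..
  then have A: "\<And>h. (\<lambda>n. (2 ^ n) *\<^sub>R (F (x + (1 / 2 ^ n) *\<^sub>R h) - F x)) \<longlonglongrightarrow> A h"
    and Ab: "\<And>h. norm (F (x + h) - F x - A h) \<le> C / 2 * (norm h)\<^sup>2" by simp_all
  have "A (h + k) = A h + A k" for h k
  proof -
    have "(\<lambda>n. (2 ^ n) *\<^sub>R (F (x + (1 / 2 ^ n) *\<^sub>R (h + k)) - F x) - (2 ^ n) *\<^sub>R (F (x + (1 / 2 ^ n) *\<^sub>R h) - F x)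
       - (2 ^ n) *\<^sub>R (F (x + (1 / 2 ^ n) *\<^sub>R k) - F x)) \<longlonglongrightarrow> A (h + k) - A h - A k"
      by (intro tendsto_diff A)
    moreover have "(\<lambda>n. (2 ^ n) *\<^sub>R (F (x + (1 / 2 ^ n) *\<^sub>R (h + k)) - F x) - (2 ^ n) *\<^sub>R (F (x + (1 / 2 ^ n) *\<^sub>R h) - F x)
       - (2 ^ n) *\<^sub>R (F (x + (1 / 2 ^ n) *\<^sub>R k) - F x)) \<longlonglongrightarrow> 0"
    proof (rule Lim_null_comparison)
      show "\<forall>\<^sub>F n in sequentially. norm ((2 ^ n) *\<^sub>R (F (x + (1 / 2 ^ n) *\<^sub>R (h + k)) - F x) - (2 ^ n) *\<^sub>R (F (x + (1 / 2 ^ n) *\<^sub>R h) - F x)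
       - (2 ^ n) *\<^sub>R (F (x + (1 / 2 ^ n) *\<^sub>R k) - F x)) \<le> (C * norm h * norm k) * (1 / 2) ^ n"
      proof (rule always_eventually, rule allI)
        fix n :: nat
        define u v where "u = (1 / 2 ^ n) *\<^sub>R h" and "v = (1 / 2 ^ n) *\<^sub>R k"
        have "(2 ^ n) *\<^sub>R (F (x + (1 / 2 ^ n) *\<^sub>R (h + k)) - F x) - (2 ^ n) *\<^sub>R (F (x + u) - F x) - (2 ^ n) *\<^sub>R (F (x + v) - F x)
          = (2 ^ n) *\<^sub>R (F (x + u + v) - F (x + u) - F (x + v) + F x)"
          unfolding u_def v_def by (simp add: scaleR_add_right scaleR_diff_right add.assoc)
        then have "norm ((2 ^ n) *\<^sub>R (F (x + (1 / 2 ^ n) *\<^sub>R (h + k)) - F x) - (2 ^ n) *\<^sub>R (F (x + u) - F x) - (2 ^ n) *\<^sub>R (F (x + v) - F x))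
          \<le> 2 ^ n * (C * norm u * norm v)" using mixed_boundD[OF F, of x u v] by simp
        also have "\<dots> = (C * norm h * norm k) * (1 / 2) ^ n" by (simp add: u_def v_def power_one_over)
        finally show "norm ((2 ^ n) *\<^sub>R (F (x + (1 / 2 ^ n) *\<^sub>R (h + k)) - F x) - (2 ^ n) *\<^sub>R (F (x + (1 / 2 ^ n) *\<^sub>R h) - F x)
          - (2 ^ n) *\<^sub>R (F (x + (1 / 2 ^ n) *\<^sub>R k) - F x)) \<le> (C * norm h * norm k) * (1 / 2) ^ n"
          by (simp add: u_def v_def)
      qed
      show "(\<lambda>n. (C * norm h * norm k) * (1 / 2) ^ n) \<longlonglongrightarrow> 0"
        by (intro tendsto_mult_right_zero LIMSEQ_realpow_zero) auto
    qed
    ultimately have "A (h + k) - A h - A k = 0" by (rule LIMSEQ_unique)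
    then show ?thesis by (simp add: diff_diff_eq)
  qed
  moreover have "norm (A h) \<le> L * norm h" for h
  proof (rule LIMSEQ_le_const2[OF tendsto_norm[OF A]], rule exI[of _ 0], intro allI impI)
    fix n :: nat
    show "norm ((2 ^ n) *\<^sub>R (F (x + (1 / 2 ^ n) *\<^sub>R h) - F x)) \<le> L * norm h"
      using mult_left_mono[OF lip_boundD[OF L, of x "(1 / 2 ^ n) *\<^sub>R h"], of "2 ^ n"] by simp
  qed
  ultimately have "bounded_linear A" by (rule additive_bounded_imp_linear)
  then show ?thesis using Ab by (intro exI[of _ "Blinfun A"]) (simp add: bounded_linear_Blinfun_apply)
qed

lemma has_gateaux_derivativeI_remainder:
  fixes A :: "'a::real_normed_vector \<Rightarrow>\<^sub>L 'b::real_normed_vector"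
  assumes "\<And>h. norm (F (x + h) - F x - A h) \<le> C * (norm h)\<^sup>2"
  shows "has_gateaux_derivative F A x"
  unfolding has_gateaux_derivative_def
proof
  fix h
  show "((\<lambda>t. F (x + t *\<^sub>R h)) has_vector_derivative A h) (at 0)"
    unfolding has_vector_derivative_def has_derivative_iff_norm
  proof (intro conjI bounded_linear_scaleR_left)
    show "((\<lambda>t. norm (F (x + t *\<^sub>R h) - F (x + 0 *\<^sub>R h) - (t - 0) *\<^sub>R A h) / norm (t - 0)) \<longlongrightarrow> 0) (at 0)"
    proof (rule Lim_null_comparison)
      show "\<forall>\<^sub>F t in at 0. norm (norm (F (x + t *\<^sub>R h) - F (x + 0 *\<^sub>R h) - (t - 0) *\<^sub>R A h) / norm (t - 0)) \<le> C * (norm h)\<^sup>2 * \<bar>t\<bar>"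
        unfolding eventually_at_filter
      proof (rule always_eventually, intro allI impI)
        fix t :: real assume "t \<noteq> 0"
        then show "norm (norm (F (x + t *\<^sub>R h) - F (x + 0 *\<^sub>R h) - (t - 0) *\<^sub>R A h) / norm (t - 0)) \<le> C * (norm h)\<^sup>2 * \<bar>t\<bar>"
          using assms[of "t *\<^sub>R h"] by (simp add: blinfun.scaleR_right pos_divide_le_eq power_mult_distrib power2_eq_square mult_ac)
      qed
      show "((\<lambda>t. C * (norm h)\<^sup>2 * \<bar>t\<bar>) \<longlongrightarrow> 0) (at 0)" by (rule tendsto_eq_intros | simp)+
    qed
  qed
qed

lemma gateaux_quotient_tendsto:
  assumes "has_gateaux_derivative F A x"
  shows "(\<lambda>n. real (Suc n) *\<^sub>R (F (x + (1 / real (Suc n)) *\<^sub>R h) - F x)) \<longlonglongrightarrow> A h"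
proof -
  have "((\<lambda>t. F (x + t *\<^sub>R h)) has_vector_derivative A h) (at 0)" using assms by (simp add: has_gateaux_derivative_def)
  then have "((\<lambda>t. (F (x + t *\<^sub>R h) - F x) /\<^sub>R t) \<longlongrightarrow> A h) (at 0)"
    unfolding has_vector_derivative_iff_quotient by simp
  moreover have "filterlim (\<lambda>n. 1 / real (Suc n)) (at 0) sequentially"
    unfolding filterlim_at by (intro conjI LIMSEQ_Suc[OF lim_const_over_n]) auto
  ultimately have "(\<lambda>n. (F (x + (1 / real (Suc n)) *\<^sub>R h) - F x) /\<^sub>R (1 / real (Suc n))) \<longlonglongrightarrow> A h"
    by (rule filterlim_compose)
  then show ?thesis by simp
qed

definition tri_bound :: "real \<Rightarrow> ('a::real_normed_vector \<Rightarrow> 'b::real_normed_vector) \<Rightarrow> bool" where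
  "tri_bound C F \<longleftrightarrow> (\<forall>l. mixed_bound (C * norm l) (\<lambda>x. F (x + l) - F x))"

text \<open>Lets differences be taken one at a time: the inner difference becomes a new function, to
  which a first-order estimate applies.\<close>

lemma mixed_bound_iff: "mixed_bound C F \<longleftrightarrow> (\<forall>l. lip_bound (C * norm l) (\<lambda>x. F (x + l) - F x))"
proof -
  have e: "F (x + h + l) - F (x + h) - (F (x + l) - F x) = F (x + h + l) - F (x + h) - F (x + l) + F x" for x h l by simp
  show ?thesis unfolding mixed_bound_def lip_bound_def e by (metis mult.assoc mult.commute)
qed

text \<open>Bounds on differences survive the limit of the quotients, so the derivative inherits
  each bound with its order lowered by one. A second application, to the derivative, produces the
  second derivative.\<close>

lemma derivative_of_mixed_bound:
  fixes F :: "'a::real_normed_vector \<Rightarrow> 'b::banach"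
  assumes F: "mixed_bound C F" and L: "lip_bound L F" and C: "0 \<le> C" and L0: "0 \<le> L"
  shows "has_gateaux_derivative F (gateaux_deriv F x) x"
    "norm (F (x + h) - F x - gateaux_deriv F x h) \<le> C / 2 * (norm h)\<^sup>2"
    "norm (gateaux_deriv F x) \<le> L"
    "lip_bound C (gateaux_deriv F)"
    "0 \<le> C3 \<Longrightarrow> tri_bound C3 F \<Longrightarrow> mixed_bound C3 (gateaux_deriv F)"
proof -
  have ex: "\<exists>A. has_gateaux_derivative F A x \<and> (\<forall>h. norm (F (x + h) - F x - A h) \<le> C / 2 * (norm h)\<^sup>2)" for x
    using mixed_bound_imp_derivative[OF F L C, of x] has_gateaux_derivativeI_remainder by blast
  have D: "has_gateaux_derivative F (gateaux_deriv F x) x" for x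
    using ex[of x] gateaux_deriv_eq by metis
  show "has_gateaux_derivative F (gateaux_deriv F x) x" by (rule D)
  show "norm (F (x + h) - F x - gateaux_deriv F x h) \<le> C / 2 * (norm h)\<^sup>2"
    using ex[of x] gateaux_deriv_eq by metis
  note lim = gateaux_quotient_tendsto[OF D]
  show "norm (gateaux_deriv F x) \<le> L"
  proof (rule norm_blinfun_bound[OF L0])
    fix h
    show "norm (gateaux_deriv F x h) \<le> L * norm h"
    proof (rule LIMSEQ_le_const2[OF tendsto_norm[OF lim]], rule exI[of _ 0], intro allI impI)
      fix n :: nat
      show "norm (real (Suc n) *\<^sub>R (F (x + (1 / real (Suc n)) *\<^sub>R h) - F x)) \<le> L * norm h"
        using mult_left_mono[OF lip_boundD[OF L, of x "(1 / real (Suc n)) *\<^sub>R h"], of "real (Suc n)"] by simp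
    qed
  qed
  show "lip_bound C (gateaux_deriv F)"
    unfolding lip_bound_def
  proof (intro allI)
    fix x k
    show "norm (gateaux_deriv F (x + k) - gateaux_deriv F x) \<le> C * norm k"
    proof (rule norm_blinfun_bound)
      fix h
      have "(\<lambda>n. real (Suc n) *\<^sub>R (F (x + k + (1 / real (Suc n)) *\<^sub>R h) - F (x + k)) - real (Suc n) *\<^sub>R (F (x + (1 / real (Suc n)) *\<^sub>R h) - F x))
        \<longlonglongrightarrow> gateaux_deriv F (x + k) h - gateaux_deriv F x h" by (intro tendsto_diff lim)
      then have "norm (gateaux_deriv F (x + k) h - gateaux_deriv F x h) \<le> C * norm k * norm h"
      proof (rule LIMSEQ_le_const2[OF tendsto_norm], intro exI[of _ 0] allI impI)
        fix n :: nat
        define l where "l = (1 / real (Suc n)) *\<^sub>R h"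
        have "real (Suc n) *\<^sub>R (F (x + k + l) - F (x + k)) - real (Suc n) *\<^sub>R (F (x + l) - F x)
          = real (Suc n) *\<^sub>R (F (x + k + l) - F (x + k) - F (x + l) + F x)"
          unfolding scaleR_diff_right[symmetric] by simp
        then have "norm (real (Suc n) *\<^sub>R (F (x + k + l) - F (x + k)) - real (Suc n) *\<^sub>R (F (x + l) - F x))
          \<le> real (Suc n) * (C * norm k * norm l)" using mixed_boundD[OF F, of x k l] by (simp add: mult_left_mono)
        also have "\<dots> = C * norm k * norm h" by (simp add: l_def)
        finally show "norm (real (Suc n) *\<^sub>R (F (x + k + (1 / real (Suc n)) *\<^sub>R h) - F (x + k)) - real (Suc n) *\<^sub>R (F (x + (1 / real (Suc n)) *\<^sub>R h) - F x))
          \<le> C * norm k * norm h" by (simp add: l_def)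
      qed
      then show "norm ((gateaux_deriv F (x + k) - gateaux_deriv F x) h) \<le> C * norm k * norm h"
        by (simp add: blinfun.diff_left)
    qed (use C in simp)
  qed
  show "mixed_bound C3 (gateaux_deriv F)" if C3: "0 \<le> C3" and T: "tri_bound C3 F"
    unfolding mixed_bound_def
  proof (intro allI)
    fix x u v
    show "norm (gateaux_deriv F (x + u + v) - gateaux_deriv F (x + u) - gateaux_deriv F (x + v) + gateaux_deriv F x) \<le> C3 * norm u * norm v"
    proof (rule norm_blinfun_bound)
      fix h
      let ?q = "\<lambda>n x. real (Suc n) *\<^sub>R (F (x + (1 / real (Suc n)) *\<^sub>R h) - F x)"
      have "(\<lambda>n. ?q n (x + u + v) - ?q n (x + u) - ?q n (x + v) + ?q n x)
        \<longlonglongrightarrow> gateaux_deriv F (x + u + v) h - gateaux_deriv F (x + u) h - gateaux_deriv F (x + v) h + gateaux_deriv F x h"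
        by (intro tendsto_diff tendsto_add lim)
      then have "norm (gateaux_deriv F (x + u + v) h - gateaux_deriv F (x + u) h - gateaux_deriv F (x + v) h + gateaux_deriv F x h)
        \<le> C3 * norm u * norm v * norm h"
      proof (rule LIMSEQ_le_const2[OF tendsto_norm], intro exI[of _ 0] allI impI)
        fix n :: nat
        define l where "l = (1 / real (Suc n)) *\<^sub>R h"
        define d where "d x = F (x + l) - F x" for x
        have dm: "mixed_bound (C3 * norm l) d" using T unfolding tri_bound_def d_def[abs_def] by blast
        have "?q n (x + u + v) - ?q n (x + u) - ?q n (x + v) + ?q n x
          = real (Suc n) *\<^sub>R (d (x + u + v) - d (x + u) - d (x + v) + d x)"
          unfolding d_def l_def by (simp only: scaleR_diff_right scaleR_add_right)
        then have "norm (?q n (x + u + v) - ?q n (x + u) - ?q n (x + v) + ?q n x)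
          \<le> real (Suc n) * (C3 * norm l * norm u * norm v)" using mixed_boundD[OF dm, of x u v] by (simp add: mult_left_mono)
        also have "\<dots> = C3 * norm u * norm v * norm h" by (simp add: l_def)
        finally show "norm (?q n (x + u + v) - ?q n (x + u) - ?q n (x + v) + ?q n x) \<le> C3 * norm u * norm v * norm h" .
      qed
      then show "norm ((gateaux_deriv F (x + u + v) - gateaux_deriv F (x + u) - gateaux_deriv F (x + v) + gateaux_deriv F x) h) \<le> C3 * norm u * norm v * norm h"
        by (simp add: blinfun.diff_left blinfun.add_left)
    qed (use C3 in simp)
  qed
qed

section \<open>Smoothing by the transition semigroup\<close>

context ou_semigroup begin

definition cb :: "real \<Rightarrow> ('a \<Rightarrow> real) \<Rightarrow> bool" where
  "cb M f \<longleftrightarrow> continuous_on UNIV f \<and> (\<forall>x. \<bar>f x\<bar> \<le> M)"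

lemma cb_measurable: "cb M f \<Longrightarrow> f \<in> borel_measurable borel"
  by (auto simp: cb_def intro: borel_measurable_continuous_onI)

lemma cb_nonneg: "cb M f \<Longrightarrow> 0 \<le> M"
  using order_trans[OF abs_ge_zero] by (auto simp: cb_def)

lemma cb_shift: "cb M f \<Longrightarrow> cb M (\<lambda>y. f (x + y))"
  unfolding cb_def by (auto intro!: continuous_on_compose2[of UNIV f] continuous_intros)

lemma cb_shift': "cb M f \<Longrightarrow> cb M (\<lambda>y. f (y + x))"
  using cb_shift[of M f x] by (simp add: add.commute)

lemma cb_integrable: "0 \<le> t \<Longrightarrow> cb M f \<Longrightarrow> integrable (\<mu> t) f"
  by (rule integrable_\<mu>[OF _ cb_measurable]) (auto simp: cb_def)

lemma cb_integrable_shift: "0 \<le> t \<Longrightarrow> cb M f \<Longrightarrow> integrable (\<mu> t) (\<lambda>y. f (x + y))"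
  by (rule cb_integrable[OF _ cb_shift])

lemma integral_\<mu>_bound:
  fixes f :: "'a \<Rightarrow> real"
  assumes t: "0 \<le> t" and f: "f \<in> borel_measurable borel" "\<And>y. \<bar>f y\<bar> \<le> M"
  shows "\<bar>\<integral>y. f y \<partial>\<mu> t\<bar> \<le> M"
proof -
  interpret prob_space "\<mu> t" by (rule prob[OF t])
  have "\<bar>\<integral>y. f y \<partial>\<mu> t\<bar> \<le> (\<integral>y. \<bar>f y\<bar> \<partial>\<mu> t)" by (rule integral_abs_bound)
  also have "\<dots> \<le> (\<integral>y. M \<partial>\<mu> t)"
    using integrable_\<mu>[OF t f] f(2) by (intro integral_mono integrable_abs) auto
  finally show ?thesis by (simp add: prob_space)
qed

lemma mehler_bound: "0 \<le> t \<Longrightarrow> cb M f \<Longrightarrow> \<bar>mehler S \<mu> t f x\<bar> \<le> M"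
  unfolding mehler_def using cb_shift[of M f "S t x"]
  by (intro integral_\<mu>_bound) (auto simp: cb_def intro: borel_measurable_continuous_onI)

lemma mehler_continuous:
  assumes t: "0 \<le> t" and f: "cb M f"
  shows "continuous_on UNIV (mehler S \<mu> t f)"
proof -
  have "continuous_on UNIV (\<lambda>p :: real \<times> 'a. f (snd p))"
    using f by (intro continuous_on_compose2[of UNIV f _ snd]) (simp_all add: cb_def continuous_on_snd)
  then have "continuous_on ({0..} \<times> UNIV) (E (\<lambda>p. f (snd p)))"
    by (rule E_continuous[where M=M]) (use f in \<open>auto simp: cb_def\<close>)
  then have "continuous_on UNIV (\<lambda>x. E (\<lambda>p. f (snd p)) (t, 0, x))"
    by (rule continuous_on_compose2) (use t in \<open>auto intro!: continuous_intros\<close>)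
  moreover have "(\<lambda>x. E (\<lambda>p. f (snd p)) (t, 0, x)) = mehler S \<mu> t f"
    by (rule ext) (simp add: E_def mehler_def)
  ultimately show ?thesis by (simp only:)
qed

lemma cb_mehler: "0 \<le> t \<Longrightarrow> cb M f \<Longrightarrow> cb M (mehler S \<mu> t f)"
  using mehler_bound mehler_continuous by (simp add: cb_def)

lemma mehler_diff: "0 \<le> t \<Longrightarrow> cb M f \<Longrightarrow> cb N g \<Longrightarrow> mehler S \<mu> t (\<lambda>z. f z - g z) x = mehler S \<mu> t f x - mehler S \<mu> t g x"
  unfolding mehler_def by (rule Bochner_Integration.integral_diff) (rule cb_integrable_shift; assumption)+

lemma mehler_shift: "mehler S \<mu> t f (x + h) = mehler S \<mu> t (\<lambda>z. f (z + S t h)) x"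
  unfolding mehler_def by (simp add: blinfun.add_right add_ac)

lemma mehler_add:
  assumes a: "0 \<le> a" and b: "0 \<le> b" and f: "cb M f"
  shows "mehler S \<mu> (a + b) f = mehler S \<mu> a (mehler S \<mu> b f)"
proof
  fix x
  have "mehler S \<mu> (b + a) f x = (\<integral>z. \<integral>y. f (S (b + a) x + (y + S b z)) \<partial>\<mu> b \<partial>\<mu> a)"
    unfolding mehler_def
    by (rule integral_\<mu>_add(2)[OF b a]) (use cb_shift[OF f] in \<open>auto simp: cb_def intro: borel_measurable_continuous_onI\<close>)
  also have "\<dots> = mehler S \<mu> a (mehler S \<mu> b f) x"
    unfolding mehler_def S_add[OF b a] by (simp add: blinfun.add_right add_ac)
  finally show "mehler S \<mu> (a + b) f x = mehler S \<mu> a (mehler S \<mu> b f) x" by (simp add: add.commute)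
qed

lemma cb_diff_shift: "cb M f \<Longrightarrow> cb (2 * M) (\<lambda>z. f (z + k) - f z)"
proof -
  assume f: "cb M f"
  have "\<bar>f (z + k) - f z\<bar> \<le> 2 * M" for z
    using f unfolding cb_def by (metis abs_triangle_ineq4 add_mono order_trans mult_2)
  then show ?thesis using cb_shift[OF f, of k] f unfolding cb_def
    by (auto intro!: continuous_intros simp: add.commute)
qed

text \<open>Differences commute with the semigroup up to replacing h by S t h. Since S t is a
  contraction, bounds on differences can be fed back into the smoothing estimates.\<close>

lemma mehler_increment:
  "0 \<le> t \<Longrightarrow> cb M f \<Longrightarrow> mehler S \<mu> t f (x + h) - mehler S \<mu> t f x = mehler S \<mu> t (\<lambda>z. f (z + S t h) - f z) x"
  unfolding mehler_shift by (rule mehler_diff[symmetric, OF _ cb_shift'])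

lemma mehler_lipschitz:
  assumes t: "0 < t" and f: "cb M f"
  shows "lip_bound (3 * M / sqrt t) (mehler S \<mu> t f)"
  unfolding lip_bound_def
proof (intro allI)
  fix x h
  show "norm (mehler S \<mu> t f (x + h) - mehler S \<mu> t f x) \<le> 3 * M / sqrt t * norm h"
  proof (cases "M = 0")
    case True
    then have "f = (\<lambda>_. 0)" using f by (auto simp: cb_def)
    then show ?thesis using True by (simp add: mehler_def)
  next
    case False
    then have M: "0 < M" using cb_nonneg[OF f] by simp
    \<comment> \<open>The shift estimate is symmetric about a centre, here the midpoint of x and x +
      h; the half step turns the constant 6 into 3.\<close>
    define k where "k = h /\<^sub>R 2"
    define z where "z = x + k"
    have "k + k = h" unfolding k_def scaleR_add_left[symmetric] by simp
    then have e: "z + k = x + h" "z - k = x" by (simp_all add: z_def add.assoc)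
    have e1: "S t (z + k) + y = S t z + (y + S t k)" for y by (simp add: blinfun.add_right add_ac)
    have e2: "S t (z - k) + y = S t z + (y - S t k)" for y by (simp add: blinfun.diff_right algebra_simps)
    note fz = cb_shift[OF f, of "S t z"]
    have "\<bar>(\<integral>y. f (S t z + (y + S t k)) \<partial>\<mu> t) - (\<integral>y. f (S t z + (y - S t k)) \<partial>\<mu> t)\<bar> \<le> 6 * norm k / sqrt t * M"
      by (rule shift_bound[OF t cb_measurable[OF fz] _ M]) (use f in \<open>auto simp: cb_def\<close>)
    then have "norm (mehler S \<mu> t f (z + k) - mehler S \<mu> t f (z - k)) \<le> 6 * norm k / sqrt t * M"
      unfolding mehler_def e1 e2 by simp
    then show ?thesis unfolding e by (simp add: k_def mult_ac)
  qed
qed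

text \<open>All that the later estimates retain of the data: \<alpha> = 0 with N a sup bound, or
  \<alpha> > 0 with N a Hoelder constant. The factor 8 is dictated by the Hoelder case.\<close>

definition smoothing :: "real \<Rightarrow> real \<Rightarrow> ('a \<Rightarrow> real) \<Rightarrow> bool" where
  "smoothing \<alpha> N f \<longleftrightarrow> (\<exists>M. cb M f) \<and> (\<forall>t>0. lip_bound (8 * N * t powr ((\<alpha> - 1) / 2)) (mehler S \<mu> t f))"

lemma lip_bound_mono: "lip_bound L F \<Longrightarrow> L \<le> L' \<Longrightarrow> lip_bound L' F"
  unfolding lip_bound_def by (meson mult_right_mono norm_ge_zero order_trans)

lemma mixed_bound_mono: "mixed_bound L F \<Longrightarrow> L \<le> L' \<Longrightarrow> mixed_bound L' F"
  unfolding mixed_bound_def by (meson mult_right_mono norm_ge_zero order_trans)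

lemma smoothing_cb: "cb M f \<Longrightarrow> smoothing 0 M f"
  unfolding smoothing_def
proof (intro conjI exI[of _ M] allI impI)
  fix t :: real assume f: "cb M f" and t: "0 < t"
  have e: "((0::real) - 1) / 2 = - (1 / 2)" by simp
  have "t powr ((0 - 1) / 2) = 1 / sqrt t" unfolding e powr_minus_divide using t by (simp add: powr_half_sqrt)
  then show "lip_bound (8 * M * t powr ((0 - 1) / 2)) (mehler S \<mu> t f)"
    using mehler_lipschitz[OF t f] by (rule_tac lip_bound_mono) (use cb_nonneg[OF f] t in \<open>auto simp: divide_right_mono\<close>)
qed

text \<open>Averaging \<open>f\<close> over \<open>n\<close> equidistant points in the direction \<open>S t h\<close>, with \<open>n * norm h\<close> of order
  \<open>sqrt t\<close>, interpolates between the bounds for bounded and for Lipschitz functions.\<close>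

lemma smoothing_holder:
  assumes \<alpha>: "0 < \<alpha>" "\<alpha> < 1" and f: "cb M f" and H: "\<And>x h. \<bar>f (x + h) - f x\<bar> \<le> H * norm h powr \<alpha>" and H0: "0 \<le> H"
  shows "smoothing \<alpha> H f"
  unfolding smoothing_def lip_bound_def
proof (intro conjI exI[of _ M] allI impI)
  fix t :: real and x h :: 'a assume t: "0 < t"
  define \<theta> where "\<theta> = t powr ((\<alpha> - 1) / 2)"
  have t0: "0 \<le> t" using t by simp
  have st: "sqrt t powr (\<alpha> - 1) = \<theta>" using t by (simp add: \<theta>_def powr_half_sqrt[symmetric] powr_powr)
  have small: "norm (mehler S \<mu> t f (x + h) - mehler S \<mu> t f x) \<le> H * norm (S t h) powr \<alpha>"
    unfolding mehler_increment[OF t0 f] real_norm_def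
    by (rule mehler_bound[OF t0]) (use cb_diff_shift[OF f] H in \<open>auto simp: cb_def\<close>)
  show "norm (mehler S \<mu> t f (x + h) - mehler S \<mu> t f x) \<le> 8 * H * t powr ((\<alpha> - 1) / 2) * norm h"
  \<comment> \<open>For long steps the Hoelder bound already has the required form, because norm h
    powr (\<alpha> - 1) \<le> sqrt t powr (\<alpha> - 1). Averaging is needed for short steps
    only.\<close>
  proof (cases "sqrt t \<le> norm h")
    case True
    then have h0: "0 < norm h" using t by (meson less_le_trans real_sqrt_gt_zero)
    have "norm (S t h) powr \<alpha> \<le> norm h powr \<alpha>" using S_contraction[OF t0] \<alpha> by (intro powr_mono2) auto
    also have "\<dots> = norm h powr (\<alpha> - 1) * norm h" using h0 by (simp add: powr_diff)
    also have "norm h powr (\<alpha> - 1) \<le> sqrt t powr (\<alpha> - 1)" using True t \<alpha> by (intro powr_mono2') auto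
    finally have "norm (S t h) powr \<alpha> \<le> \<theta> * norm h" using st by (simp add: mult_right_mono)
    then have "H * norm (S t h) powr \<alpha> \<le> H * (\<theta> * norm h)" using H0 by (rule mult_left_mono)
    also have "\<dots> \<le> 8 * (H * (\<theta> * norm h))" using H0 by (simp add: \<theta>_def)
    finally show ?thesis using small by (simp add: \<theta>_def mult_ac)
  next
    case False
    show ?thesis
    proof (cases "h = 0")
      case h: False
      define k where "k = S t h"
      define n where "n = nat \<lceil>sqrt t / norm h\<rceil>"
      have h0: "0 < norm h" using h by simp
      have hn: "1 < sqrt t / norm h" using False h0 by (simp add: pos_less_divide_eq)
      have n: "sqrt t / norm h \<le> real n" "real n < sqrt t / norm h + 1" unfolding n_def using hn by linarith+
      have n0: "0 < n" using n hn by (metis gr0I less_le_trans not_one_less_zero of_nat_0 less_trans zero_less_one)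
      have nh: "sqrt t \<le> real n * norm h" "real n * norm h \<le> 2 * sqrt t"
      proof -
        show "sqrt t \<le> real n * norm h" using n(1) h0 by (simp add: pos_divide_le_eq)
        have "real n \<le> 2 * (sqrt t / norm h)" using n(2) hn by linarith
        then show "real n * norm h \<le> 2 * sqrt t" using h0 by (simp add: pos_le_divide_eq)
      qed
      \<comment> \<open>Bounds the oscillation of f along the averaged segment, whose length is at
        most 2 * sqrt t.\<close>
      define \<delta> where "\<delta> = H * (2 * sqrt t) powr \<alpha>"
      have \<delta>0: "0 \<le> \<delta>" using H0 by (simp add: \<delta>_def)
      have fk: "\<bar>f (z + real j *\<^sub>R k) - f z\<bar> \<le> \<delta>" if "j \<le> n" for j z
      proof -
        have "norm (real j *\<^sub>R k) \<le> real n * norm h"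
          unfolding k_def using that S_contraction[OF t0, of h] by (auto intro!: mult_mono)
        then have "norm (real j *\<^sub>R k) powr \<alpha> \<le> (2 * sqrt t) powr \<alpha>" using nh \<alpha> by (intro powr_mono2) auto
        then show ?thesis using H[of z "real j *\<^sub>R k"] H0 unfolding \<delta>_def by (meson mult_left_mono order_trans)
      qed
      define g where "g z = (\<Sum>j<n. f (z + real j *\<^sub>R k)) / n" for z
      have "continuous_on UNIV (\<lambda>z. f (z + real j *\<^sub>R k))" for j using cb_shift'[OF f] by (simp add: cb_def)
      then have gc: "continuous_on UNIV g" unfolding g_def
        by (intro continuous_on_divide continuous_on_sum continuous_on_const) (use n0 in auto)
      have gM: "\<bar>g z\<bar> \<le> M" for z
      proof -
        have "\<bar>\<Sum>j<n. f (z + real j *\<^sub>R k)\<bar> \<le> (\<Sum>j<n. M)"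
          using f by (intro order_trans[OF sum_abs] sum_mono) (auto simp: cb_def)
        then show ?thesis using n0 by (simp add: g_def pos_divide_le_eq mult.commute)
      qed
      have g: "cb M g" using gc gM by (simp add: cb_def)
      have fg: "cb \<delta> (\<lambda>z. f z - g z)"
        unfolding cb_def
      proof (intro conjI allI)
        show "continuous_on UNIV (\<lambda>z. f z - g z)" using f g by (auto simp: cb_def intro!: continuous_intros)
        fix z
        have "f z - g z = (\<Sum>j<n. f z - f (z + real j *\<^sub>R k)) / n" using n0 by (simp add: g_def sum_subtractf field_simps)
        moreover have "\<bar>\<Sum>j<n. f z - f (z + real j *\<^sub>R k)\<bar> \<le> (\<Sum>j<n. \<delta>)"
          using fk by (intro order_trans[OF sum_abs] sum_mono) (auto simp: abs_minus_commute)
        ultimately show "\<bar>f z - g z\<bar> \<le> \<delta>" using n0 by (simp add: pos_divide_le_eq mult.commute)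
      qed
      have gk: "cb (\<delta> / n) (\<lambda>z. g (z + S t h) - g z)"
        unfolding cb_def
      proof (intro conjI allI)
        show "continuous_on UNIV (\<lambda>z. g (z + S t h) - g z)" using cb_diff_shift[OF g] by (simp add: cb_def)
        fix z
        have "g (z + k) - g z = (\<Sum>j<n. f (z + real (Suc j) *\<^sub>R k) - f (z + real j *\<^sub>R k)) / n"
          by (simp add: g_def sum_subtractf diff_divide_distrib scaleR_add_left add_ac)
        \<comment> \<open>Neighbouring translates cancel, so a step of the average costs only the
          oscillation divided by n.\<close>
        also have "\<dots> = (f (z + real n *\<^sub>R k) - f z) / n"
          unfolding sum_lessThan_telescope[of "\<lambda>j. f (z + real j *\<^sub>R k)" n] by simp
        finally have "\<bar>g (z + k) - g z\<bar> = \<bar>f (z + real n *\<^sub>R k) - f z\<bar> / n" by simp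
        also have "\<dots> \<le> \<delta> / n" using fk[of n z] by (intro divide_right_mono) auto
        finally show "\<bar>g (z + S t h) - g z\<bar> \<le> \<delta> / n" by (simp add: k_def)
      qed
      have sp: "mehler S \<mu> t f w = mehler S \<mu> t (\<lambda>z. f z - g z) w + mehler S \<mu> t g w" for w
        using mehler_diff[OF t0 f g, of w] by simp
      have "norm (mehler S \<mu> t f (x + h) - mehler S \<mu> t f x)
        \<le> norm (mehler S \<mu> t (\<lambda>z. f z - g z) (x + h) - mehler S \<mu> t (\<lambda>z. f z - g z) x) + norm (mehler S \<mu> t g (x + h) - mehler S \<mu> t g x)"
        using sp[of "x + h"] sp[of x] unfolding real_norm_def by linarith
      also have "norm (mehler S \<mu> t (\<lambda>z. f z - g z) (x + h) - mehler S \<mu> t (\<lambda>z. f z - g z) x) \<le> 3 * \<delta> / sqrt t * norm h"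
        by (rule lip_boundD[OF mehler_lipschitz[OF t fg]])
      also have "norm (mehler S \<mu> t g (x + h) - mehler S \<mu> t g x) \<le> \<delta> / n"
        unfolding mehler_increment[OF t0 g] real_norm_def by (rule mehler_bound[OF t0 gk])
      also have "\<delta> / n \<le> \<delta> / sqrt t * norm h"
      proof -
        have "1 / real n \<le> norm h / sqrt t" using nh n0 t by (simp add: field_simps)
        from mult_left_mono[OF this \<delta>0] show ?thesis by simp
      qed
      \<comment> \<open>Three parts come from f - g, which is bounded by \<delta>, and one from g;
        with 2 powr \<alpha> \<le> 2 this gives the factor 8.\<close>
      also have "3 * \<delta> / sqrt t * norm h + \<delta> / sqrt t * norm h = 4 * (\<delta> / sqrt t) * norm h" by simp
      also have "\<dots> \<le> 4 * (2 * H * \<theta>) * norm h"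
      proof -
        have "(2 * sqrt t) powr \<alpha> = 2 powr \<alpha> * sqrt t powr \<alpha>" using t by (simp add: powr_mult)
        also have "\<dots> \<le> 2 powr 1 * sqrt t powr \<alpha>" using \<alpha> by (intro mult_right_mono powr_mono) auto
        finally have "\<delta> / sqrt t \<le> H * (2 * sqrt t powr \<alpha>) / sqrt t"
          unfolding \<delta>_def using H0 t by (intro divide_right_mono mult_left_mono) auto
        also have "\<dots> = 2 * H * \<theta>" using t by (simp add: st[symmetric] powr_diff)
        finally show ?thesis by (intro mult_right_mono mult_left_mono) auto
      qed
      finally show ?thesis by (simp add: \<theta>_def mult_ac)
    qed simp
  qed
qed (rule f)

text \<open>The cost of halving the time is 2 powr (- p), below 4 for every rate down to t powr (- 3
  / 2).\<close>

lemma half_powr_le: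
  assumes "0 < (t::real)" "- 3 \<le> 2 * p" "p \<le> 0"
  shows "(t / 2) powr p \<le> 4 * t powr p"
proof -
  have "2 powr p * 2 powr (- p) = (1::real)" unfolding powr_add[symmetric] by simp
  then have "(t / 2) powr p = t powr p * 2 powr (- p)" using assms(1) unfolding powr_divide by (simp add: field_simps)
  also have "2 powr (- p) \<le> 2 powr (2::real)" using assms by (intro powr_mono) auto
  finally show ?thesis using assms(1) by (simp add: mult.commute)
qed

text \<open>Over the first half of the time the difference in direction l becomes a function with
  sup norm proportional to norm l; over the second half this bounded function gains a Lipschitz
  bound. The constant is 96 = 8 * 3 * 4, the 4 coming from the half times.\<close>

lemma smoothing_mixed:
  assumes f: "smoothing \<alpha> N f" and \<alpha>: "0 \<le> \<alpha>" "\<alpha> < 1" and N: "0 \<le> N" and t: "0 < t"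
  shows "mixed_bound (96 * N * t powr ((\<alpha> - 2) / 2)) (mehler S \<mu> t f)"
  unfolding mixed_bound_iff
proof (intro allI)
  fix l
  define a where "a = t / 2"
  have a: "0 < a" "0 \<le> a" using t by (simp_all add: a_def)
  obtain M where M: "cb M f" using f by (auto simp: smoothing_def)
  note Pc = cb_mehler[OF a(2) M]
  have ta: "mehler S \<mu> t f = mehler S \<mu> a (mehler S \<mu> a f)" using mehler_add[OF a(2) a(2) M] by (simp add: a_def)
  define B where "B = 8 * N * a powr ((\<alpha> - 1) / 2)"
  define g where "g z = mehler S \<mu> a f (z + S a l) - mehler S \<mu> a f z" for z
  have lp: "lip_bound B (mehler S \<mu> a f)" using f a by (auto simp: smoothing_def B_def)
  have B0: "0 \<le> B" using N by (simp add: B_def)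
  have g: "cb (B * norm l) g"
    unfolding cb_def
  proof (intro conjI allI)
    show "continuous_on UNIV g" using cb_diff_shift[OF Pc] by (simp add: cb_def g_def[abs_def])
    fix z
    have "\<bar>g z\<bar> \<le> B * norm (S a l)" using lip_boundD[OF lp, of z "S a l"] by (simp add: g_def)
    also have "\<dots> \<le> B * norm l" using S_contraction[OF a(2)] B0 by (intro mult_left_mono)
    finally show "\<bar>g z\<bar> \<le> B * norm l" .
  qed
  have "(\<lambda>x. mehler S \<mu> t f (x + l) - mehler S \<mu> t f x) = mehler S \<mu> a g"
    unfolding ta g_def[abs_def] by (rule ext) (rule mehler_increment[OF a(2) Pc])
  then have "lip_bound (3 * (B * norm l) / sqrt a) (\<lambda>x. mehler S \<mu> t f (x + l) - mehler S \<mu> t f x)"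
    using mehler_lipschitz[OF a(1) g] by simp
  then show "lip_bound (96 * N * t powr ((\<alpha> - 2) / 2) * norm l) (\<lambda>x. mehler S \<mu> t f (x + l) - mehler S \<mu> t f x)"
  proof (rule lip_bound_mono)
    have e: "(\<alpha> - 1) / 2 - 1 / 2 = (\<alpha> - 2) / 2" by (simp add: field_simps)
    have "a powr ((\<alpha> - 1) / 2) / sqrt a = a powr ((\<alpha> - 2) / 2)"
      using a unfolding e[symmetric] powr_diff by (simp add: powr_half_sqrt)
    also have "\<dots> \<le> 4 * t powr ((\<alpha> - 2) / 2)"
      unfolding a_def using t \<alpha> by (intro half_powr_le) auto
    finally have "24 * N * norm l * (a powr ((\<alpha> - 1) / 2) / sqrt a) \<le> 24 * N * norm l * (4 * t powr ((\<alpha> - 2) / 2))"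
      using N by (intro mult_left_mono) auto
    then show "3 * (B * norm l) / sqrt a \<le> 96 * N * t powr ((\<alpha> - 2) / 2) * norm l"
      by (simp add: B_def mult_ac)
  qed
qed

text \<open>As for mixed differences, with the second half of the time now supplying two differences
  of the bounded function: 3072 = 8 * 96 * 4.\<close>

lemma smoothing_tri:
  assumes f: "smoothing \<alpha> N f" and \<alpha>: "0 \<le> \<alpha>" "\<alpha> < 1" and N: "0 \<le> N" and t: "0 < t"
  shows "tri_bound (3072 * N * t powr ((\<alpha> - 3) / 2)) (mehler S \<mu> t f)"
  unfolding tri_bound_def
proof (intro allI)
  fix l
  define a where "a = t / 2"
  have a: "0 < a" "0 \<le> a" using t by (simp_all add: a_def)
  obtain M where M: "cb M f" using f by (auto simp: smoothing_def)
  note Pc = cb_mehler[OF a(2) M]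
  have ta: "mehler S \<mu> t f = mehler S \<mu> a (mehler S \<mu> a f)" using mehler_add[OF a(2) a(2) M] by (simp add: a_def)
  define B where "B = 8 * N * a powr ((\<alpha> - 1) / 2)"
  define g where "g z = mehler S \<mu> a f (z + S a l) - mehler S \<mu> a f z" for z
  have lp: "lip_bound B (mehler S \<mu> a f)" using f a by (auto simp: smoothing_def B_def)
  have B0: "0 \<le> B" using N by (simp add: B_def)
  have g: "cb (B * norm l) g"
    unfolding cb_def
  proof (intro conjI allI)
    show "continuous_on UNIV g" using cb_diff_shift[OF Pc] by (simp add: cb_def g_def[abs_def])
    fix z
    have "\<bar>g z\<bar> \<le> B * norm (S a l)" using lip_boundD[OF lp, of z "S a l"] by (simp add: g_def)
    also have "\<dots> \<le> B * norm l" using S_contraction[OF a(2)] B0 by (intro mult_left_mono)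
    finally show "\<bar>g z\<bar> \<le> B * norm l" .
  qed
  have "(\<lambda>x. mehler S \<mu> t f (x + l) - mehler S \<mu> t f x) = mehler S \<mu> a g"
    unfolding ta g_def[abs_def] by (rule ext) (rule mehler_increment[OF a(2) Pc])
  then have "mixed_bound (96 * (B * norm l) * a powr ((0 - 2) / 2)) (\<lambda>x. mehler S \<mu> t f (x + l) - mehler S \<mu> t f x)"
    using smoothing_mixed[OF smoothing_cb[OF g] _ _ _ a(1)] B0 by simp
  then show "mixed_bound (3072 * N * t powr ((\<alpha> - 3) / 2) * norm l) (\<lambda>x. mehler S \<mu> t f (x + l) - mehler S \<mu> t f x)"
  proof (rule mixed_bound_mono)
    have e: "(\<alpha> - 1) / 2 + (0 - 2) / 2 = (\<alpha> - 3) / 2" by (simp add: field_simps)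
    have "a powr ((\<alpha> - 1) / 2) * a powr ((0 - 2) / 2) = a powr ((\<alpha> - 3) / 2)"
      unfolding e[symmetric] powr_add ..
    also have "\<dots> \<le> 4 * t powr ((\<alpha> - 3) / 2)"
      unfolding a_def using t \<alpha> by (intro half_powr_le) auto
    finally have "768 * N * norm l * (a powr ((\<alpha> - 1) / 2) * a powr ((0 - 2) / 2)) \<le> 768 * N * norm l * (4 * t powr ((\<alpha> - 3) / 2))"
      using N by (intro mult_left_mono) auto
    then show "96 * (B * norm l) * a powr ((0 - 2) / 2) \<le> 3072 * N * t powr ((\<alpha> - 3) / 2) * norm l"
      by (simp add: B_def mult_ac)
  qed
qed

end

section \<open>Differentiation under the integral sign\<close>

lemma has_gateaux_derivative_line:
  assumes "has_gateaux_derivative F A (x + r *\<^sub>R h)"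
  shows "((\<lambda>t. F (x + t *\<^sub>R h)) has_vector_derivative A h) (at r)"
proof -
  have "((\<lambda>t. F (x + r *\<^sub>R h + t *\<^sub>R h)) has_vector_derivative A h) (at (r - r))"
    using assms by (simp add: has_gateaux_derivative_def)
  then have "((\<lambda>t. F (x + r *\<^sub>R h + t *\<^sub>R h)) \<circ> (\<lambda>t. t - r) has_vector_derivative (1 *\<^sub>R A h)) (at r)"
    by (intro vector_diff_chain_at) (auto intro!: derivative_eq_intros)
  moreover have "(\<lambda>t. F (x + r *\<^sub>R h + t *\<^sub>R h)) \<circ> (\<lambda>t. t - r) = (\<lambda>t. F (x + t *\<^sub>R h))"
    by (rule ext) (simp add: algebra_simps)
  ultimately show ?thesis by simp
qed

lemma gateaux_lip_bound:
  assumes D: "\<And>x. has_gateaux_derivative F (D x) x" and L: "\<And>x. norm (D x) \<le> L"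
  shows "lip_bound L F"
  unfolding lip_bound_def
proof (intro allI)
  fix x h
  have "norm ((\<lambda>t. F (x + t *\<^sub>R h)) 1 - (\<lambda>t. F (x + t *\<^sub>R h)) 0) \<le> (L * norm h) * norm (1 - 0 :: real)"
  proof (rule differentiable_bound[where S="{0..1}"])
    fix t :: real
    show "((\<lambda>t. F (x + t *\<^sub>R h)) has_derivative (\<lambda>s. s *\<^sub>R D (x + t *\<^sub>R h) h)) (at t within {0..1})"
      using has_gateaux_derivative_line[where x=x and r=t and h=h, OF D] has_derivative_at_withinI
      unfolding has_vector_derivative_def by blast
    have "norm (D (x + t *\<^sub>R h) h) \<le> L * norm h"
      using norm_blinfun[of "D (x + t *\<^sub>R h)" h] L[of "x + t *\<^sub>R h"] by (meson mult_right_mono norm_ge_zero order_trans)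
    then show "onorm (\<lambda>s. s *\<^sub>R D (x + t *\<^sub>R h) h) \<le> L * norm h"
      by (intro onorm_le) (simp add: mult.commute mult_left_mono)
  qed auto
  then show "norm (F (x + h) - F x) \<le> L * norm h" by simp
qed

text \<open>\<open>A\<close> is the weak (Gelfand) integral of the functionals \<open>B \<omega>\<close>.\<close>

definition is_bint :: "'i measure \<Rightarrow> ('i \<Rightarrow> 'a::real_normed_vector \<Rightarrow>\<^sub>L real) \<Rightarrow> ('a \<Rightarrow>\<^sub>L real) \<Rightarrow> bool" where
  "is_bint M B A \<longleftrightarrow> (\<forall>h. integrable M (\<lambda>\<omega>. B \<omega> h) \<and> A h = (\<integral>\<omega>. B \<omega> h \<partial>M))"

lemma is_bint_diff: "is_bint M B A \<Longrightarrow> is_bint M B' A' \<Longrightarrow> is_bint M (\<lambda>\<omega>. B \<omega> - B' \<omega>) (A - A')"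
  unfolding is_bint_def by (simp add: blinfun.diff_left)

lemma is_bint_add: "is_bint M B A \<Longrightarrow> is_bint M B' A' \<Longrightarrow> is_bint M (\<lambda>\<omega>. B \<omega> + B' \<omega>) (A + A')"
  unfolding is_bint_def by (simp add: blinfun.add_left)

lemma is_bint_scale: "is_bint M B A \<Longrightarrow> is_bint M (\<lambda>\<omega>. r *\<^sub>R B \<omega>) (r *\<^sub>R A)"
  unfolding is_bint_def by (simp add: blinfun.scaleR_left)

text \<open>The norm is tested direction by direction, so only the majorant Z has to be integrable;
  the norm of B is not integrated itself.\<close>

lemma is_bint_norm:
  assumes A: "is_bint M B A" and Z: "integrable M Z" "\<And>\<omega>. \<omega> \<in> space M \<Longrightarrow> norm (B \<omega>) \<le> Z \<omega>"
  shows "norm A \<le> (\<integral>\<omega>. Z \<omega> \<partial>M)"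
proof (rule norm_blinfun_bound)
  have "0 \<le> Z \<omega>" if "\<omega> \<in> space M" for \<omega> using order_trans[OF norm_ge_zero Z(2)[OF that]] .
  then show "0 \<le> (\<integral>\<omega>. Z \<omega> \<partial>M)" by (rule integral_nonneg_AE[OF AE_I2])
  fix h
  have i: "integrable M (\<lambda>\<omega>. B \<omega> h)" using A by (simp add: is_bint_def)
  have "norm (A h) \<le> (\<integral>\<omega>. norm (B \<omega> h) \<partial>M)"
    using A by (simp add: is_bint_def integral_norm_bound[where f="\<lambda>\<omega>. B \<omega> h", simplified])
  also have "\<dots> \<le> (\<integral>\<omega>. Z \<omega> * norm h \<partial>M)"
  proof (rule integral_mono)
    show "integrable M (\<lambda>\<omega>. norm (B \<omega> h))" using i by (rule integrable_norm)
    show "integrable M (\<lambda>\<omega>. Z \<omega> * norm h)" using Z(1) by simp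
    fix \<omega> assume "\<omega> \<in> space M"
    then show "norm (B \<omega> h) \<le> Z \<omega> * norm h"
      using norm_blinfun[of "B \<omega>" h] Z(2) by (meson mult_right_mono norm_ge_zero order_trans)
  qed
  finally show "norm (A h) \<le> (\<integral>\<omega>. Z \<omega> \<partial>M) * norm h" by simp
qed

lemma is_bint_exists:
  fixes B :: "'i \<Rightarrow> 'a::real_normed_vector \<Rightarrow>\<^sub>L real"
  assumes m: "\<And>h. (\<lambda>\<omega>. B \<omega> h) \<in> borel_measurable M"
    and Z: "integrable M Z" "\<And>\<omega>. \<omega> \<in> space M \<Longrightarrow> norm (B \<omega>) \<le> Z \<omega>"
  shows "\<exists>A. is_bint M B A"
proof -
  have b: "norm (B \<omega> h) \<le> Z \<omega> * norm h" if "\<omega> \<in> space M" for \<omega> h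
    using norm_blinfun[of "B \<omega>" h] Z(2)[OF that] by (meson mult_right_mono norm_ge_zero order_trans)
  have i: "integrable M (\<lambda>\<omega>. B \<omega> h)" for h
  proof (rule Bochner_Integration.integrable_bound[OF _ m])
    show "integrable M (\<lambda>\<omega>. Z \<omega> * norm h)" using Z(1) by simp
    show "AE \<omega> in M. norm (B \<omega> h) \<le> norm (Z \<omega> * norm h)" using b by (intro AE_I2) (metis abs_ge_self order_trans real_norm_def)
  qed
  have "bounded_linear (\<lambda>h. \<integral>\<omega>. B \<omega> h \<partial>M)"
  proof (rule bounded_linear_intro[where K="\<integral>\<omega>. Z \<omega> \<partial>M"])
    show "(\<integral>\<omega>. B \<omega> (h + k) \<partial>M) = (\<integral>\<omega>. B \<omega> h \<partial>M) + (\<integral>\<omega>. B \<omega> k \<partial>M)" for h k using i by (simp add: blinfun.add_right)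
    show "(\<integral>\<omega>. B \<omega> (r *\<^sub>R h) \<partial>M) = r *\<^sub>R (\<integral>\<omega>. B \<omega> h \<partial>M)" for r h using i by (simp add: blinfun.scaleR_right)
    fix h
    have "norm (\<integral>\<omega>. B \<omega> h \<partial>M) \<le> (\<integral>\<omega>. Z \<omega> * norm h \<partial>M)"
      using i Z(1) b by (intro integral_norm_bound[THEN order_trans] integral_mono integrable_norm) auto
    then show "norm (\<integral>\<omega>. B \<omega> h \<partial>M) \<le> norm h * (\<integral>\<omega>. Z \<omega> \<partial>M)" by (simp add: mult.commute)
  qed
  then show ?thesis using i by (intro exI[of _ "Blinfun (\<lambda>h. \<integral>\<omega>. B \<omega> h \<partial>M)"]) (simp add: is_bint_def bounded_linear_Blinfun_apply)
qed

lemma gateaux_measurable: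
  fixes M :: "'i measure" and u :: "'i \<Rightarrow> 'a::real_normed_vector \<Rightarrow> real"
  assumes D: "\<And>\<omega>. \<omega> \<in> space M \<Longrightarrow> has_gateaux_derivative (u \<omega>) (D \<omega>) x"
    and u: "\<And>x. (\<lambda>\<omega>. u \<omega> x) \<in> borel_measurable M"
  shows "(\<lambda>\<omega>. D \<omega> h) \<in> borel_measurable M"
proof (rule borel_measurable_LIMSEQ_real)
  show "(\<lambda>n. real (Suc n) *\<^sub>R (u \<omega> (x + (1 / real (Suc n)) *\<^sub>R h) - u \<omega> x)) \<longlonglongrightarrow> D \<omega> h" if "\<omega> \<in> space M" for \<omega>
    by (rule gateaux_quotient_tendsto[OF D[OF that]])
  show "(\<lambda>\<omega>. real (Suc n) *\<^sub>R (u \<omega> (x + (1 / real (Suc n)) *\<^sub>R h) - u \<omega> x)) \<in> borel_measurable M" for n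
    using u by (intro borel_measurable_scaleR borel_measurable_const borel_measurable_diff)
qed

text \<open>The mean value inequality bounds every difference quotient by G \<omega> * norm h, so
  dominated convergence gives the derivative in each direction.\<close>

theorem gateaux_integral:
  fixes u :: "'i \<Rightarrow> 'a::real_normed_vector \<Rightarrow> real"
  assumes D: "\<And>\<omega> x. \<omega> \<in> space M \<Longrightarrow> has_gateaux_derivative (u \<omega>) (D \<omega> x) x"
    and G: "integrable M G" "\<And>\<omega> x. \<omega> \<in> space M \<Longrightarrow> norm (D \<omega> x) \<le> G \<omega>"
    and u: "\<And>x. integrable M (\<lambda>\<omega>. u \<omega> x)"
  shows "\<exists>A. \<forall>x. is_bint M (\<lambda>\<omega>. D \<omega> x) (A x) \<and> has_gateaux_derivative (\<lambda>x. \<integral>\<omega>. u \<omega> x \<partial>M) (A x) x"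
proof -
  have m: "(\<lambda>\<omega>. D \<omega> x h) \<in> borel_measurable M" for x h
    by (rule gateaux_measurable[where u=u and x=x]) (use D u in auto)
  have "\<forall>x. \<exists>A. is_bint M (\<lambda>\<omega>. D \<omega> x) A"
    using is_bint_exists[OF m G] by blast
  from choice[OF this] obtain A where A: "\<And>x. is_bint M (\<lambda>\<omega>. D \<omega> x) (A x)" by blast
  have "has_gateaux_derivative (\<lambda>x. \<integral>\<omega>. u \<omega> x \<partial>M) (A x) x" for x
    unfolding has_gateaux_derivative_def has_vector_derivative_iff_quotient tendsto_at_iff_sequentially o_def
  proof (intro allI impI)
    fix h and X :: "nat \<Rightarrow> real" assume X: "\<forall>i. X i \<in> UNIV - {0}" "X \<longlonglongrightarrow> 0"
    have X0: "X i \<noteq> 0" for i using X(1) by blast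
    have "(\<lambda>i. \<integral>\<omega>. (u \<omega> (x + X i *\<^sub>R h) - u \<omega> x) /\<^sub>R X i \<partial>M) \<longlonglongrightarrow> (\<integral>\<omega>. D \<omega> x h \<partial>M)"
    proof (rule integral_dominated_convergence[where w="\<lambda>\<omega>. G \<omega> * norm h"])
      show "(\<lambda>\<omega>. D \<omega> x h) \<in> borel_measurable M" by (rule m)
      show "(\<lambda>\<omega>. (u \<omega> (x + X i *\<^sub>R h) - u \<omega> x) /\<^sub>R X i) \<in> borel_measurable M" for i
        using u by (intro borel_measurable_scaleR borel_measurable_const borel_measurable_diff borel_measurable_integrable)
      show "integrable M (\<lambda>\<omega>. G \<omega> * norm h)" using G(1) by simp
      show "AE \<omega> in M. (\<lambda>i. (u \<omega> (x + X i *\<^sub>R h) - u \<omega> x) /\<^sub>R X i) \<longlonglongrightarrow> D \<omega> x h"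
      proof (rule AE_I2)
        fix \<omega> assume "\<omega> \<in> space M"
        from D[OF this, of x] have "((\<lambda>t. u \<omega> (x + t *\<^sub>R h)) has_vector_derivative D \<omega> x h) (at 0)"
          by (simp add: has_gateaux_derivative_def)
        then have "((\<lambda>t. (u \<omega> (x + t *\<^sub>R h) - u \<omega> x) /\<^sub>R t) \<longlongrightarrow> D \<omega> x h) (at 0)"
          unfolding has_vector_derivative_iff_quotient by simp
        then show "(\<lambda>i. (u \<omega> (x + X i *\<^sub>R h) - u \<omega> x) /\<^sub>R X i) \<longlonglongrightarrow> D \<omega> x h"
          by (rule filterlim_compose) (use X X0 in \<open>auto simp: filterlim_at\<close>)
      qed
      show "AE \<omega> in M. norm ((u \<omega> (x + X i *\<^sub>R h) - u \<omega> x) /\<^sub>R X i) \<le> G \<omega> * norm h" for i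
      proof (rule AE_I2)
        fix \<omega> assume w: "\<omega> \<in> space M"
        have "norm (u \<omega> (x + X i *\<^sub>R h) - u \<omega> x) \<le> G \<omega> * norm (X i *\<^sub>R h)"
          by (rule lip_boundD[OF gateaux_lip_bound[OF D[OF w] G(2)[OF w]]])
        then show "norm ((u \<omega> (x + X i *\<^sub>R h) - u \<omega> x) /\<^sub>R X i) \<le> G \<omega> * norm h"
          using X0[of i] by (simp add: field_simps)
      qed
    qed
    then show "(\<lambda>i. ((\<integral>\<omega>. u \<omega> (x + X i *\<^sub>R h) \<partial>M) - (\<integral>\<omega>. u \<omega> (x + 0 *\<^sub>R h) \<partial>M)) /\<^sub>R (X i - 0)) \<longlonglongrightarrow> A x h"
      using A u by (simp add: is_bint_def)
  qed
  then show ?thesis using A by blast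
qed

lemma has_gateaux_derivativeI_holder:
  fixes A :: "'a::real_normed_vector \<Rightarrow>\<^sub>L 'b::real_normed_vector"
  assumes b: "\<And>h. norm (F (x + h) - F x - A h) \<le> C * norm h powr (1 + \<gamma>)" and \<gamma>: "0 < \<gamma>"
  shows "has_gateaux_derivative F A x"
  unfolding has_gateaux_derivative_def
proof
  fix h
  show "((\<lambda>t. F (x + t *\<^sub>R h)) has_vector_derivative A h) (at 0)"
    unfolding has_vector_derivative_def has_derivative_iff_norm
  proof (intro conjI bounded_linear_scaleR_left)
    show "((\<lambda>t. norm (F (x + t *\<^sub>R h) - F (x + 0 *\<^sub>R h) - (t - 0) *\<^sub>R A h) / norm (t - 0)) \<longlongrightarrow> 0) (at 0)"
    proof (rule Lim_null_comparison)
      show "\<forall>\<^sub>F t in at 0. norm (norm (F (x + t *\<^sub>R h) - F (x + 0 *\<^sub>R h) - (t - 0) *\<^sub>R A h) / norm (t - 0)) \<le> C * norm h powr (1 + \<gamma>) * \<bar>t\<bar> powr \<gamma>"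
        unfolding eventually_at_filter
      proof (rule always_eventually, intro allI impI)
        fix t :: real assume t: "t \<noteq> 0"
        have "norm (F (x + t *\<^sub>R h) - F x - t *\<^sub>R A h) \<le> C * (\<bar>t\<bar> * norm h) powr (1 + \<gamma>)"
          using b[of "t *\<^sub>R h"] by (simp add: blinfun.scaleR_right)
        also have "\<dots> = C * norm h powr (1 + \<gamma>) * \<bar>t\<bar> powr \<gamma> * \<bar>t\<bar>"
          using t by (simp add: powr_mult powr_add mult_ac)
        finally show "norm (norm (F (x + t *\<^sub>R h) - F (x + 0 *\<^sub>R h) - (t - 0) *\<^sub>R A h) / norm (t - 0)) \<le> C * norm h powr (1 + \<gamma>) * \<bar>t\<bar> powr \<gamma>"
          using t by (simp add: pos_divide_le_eq)
      qed
      have "((\<lambda>t::real. \<bar>t\<bar> powr \<gamma>) \<longlongrightarrow> \<bar>0\<bar> powr \<gamma>) (at 0)"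
        using \<gamma> by (intro tendsto_powr' tendsto_rabs tendsto_ident_at tendsto_const) auto
      then show "((\<lambda>t. C * norm h powr (1 + \<gamma>) * \<bar>t\<bar> powr \<gamma>) \<longlongrightarrow> 0) (at 0)"
        using \<gamma> by (intro tendsto_mult_right_zero) simp
    qed
  qed
qed

text \<open>The second derivative is a limit in the norm of the dual space, whereas a weak integral
  sees one direction at a time. The way out is an integrable remainder bound of order 1 + \<gamma>,
  which \<open>is_bint_norm\<close> carries over to the integral.\<close>

theorem gateaux_integral2:
  fixes D :: "'i \<Rightarrow> 'a::real_normed_vector \<Rightarrow> 'a \<Rightarrow>\<^sub>L real" and D2 :: "'i \<Rightarrow> 'a \<Rightarrow> 'a \<Rightarrow>\<^sub>L 'a \<Rightarrow>\<^sub>L real"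
  assumes A: "\<And>x. is_bint M (\<lambda>\<omega>. D \<omega> x) (A x)"
    and R: "\<And>\<omega> x k. \<omega> \<in> space M \<Longrightarrow> norm (D \<omega> (x + k) - D \<omega> x - D2 \<omega> x k) \<le> H \<omega> * norm k powr (1 + \<gamma>)"
    and H: "integrable M H" and \<gamma>: "0 < \<gamma>"
    and G: "integrable M G" "\<And>\<omega> x. \<omega> \<in> space M \<Longrightarrow> norm (D2 \<omega> x) \<le> G \<omega>"
  shows "\<exists>A2 :: 'a \<Rightarrow> 'a \<Rightarrow>\<^sub>L 'a \<Rightarrow>\<^sub>L real. \<forall>x. (\<forall>k. is_bint M (\<lambda>\<omega>. D2 \<omega> x k) (blinfun_apply (A2 x) k)) \<and> has_gateaux_derivative A (A2 x) x"
proof -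
  have D2: "has_gateaux_derivative (D \<omega>) (D2 \<omega> x) x" if "\<omega> \<in> space M" for \<omega> x
    by (rule has_gateaux_derivativeI_holder[OF R[OF that] \<gamma>])
  have m: "(\<lambda>\<omega>. D2 \<omega> x k h) \<in> borel_measurable M" for x k h
  proof (rule borel_measurable_LIMSEQ_real)
    show "(\<lambda>n. (real (Suc n) *\<^sub>R (D \<omega> (x + (1 / real (Suc n)) *\<^sub>R k) - D \<omega> x)) h) \<longlonglongrightarrow> D2 \<omega> x k h" if "\<omega> \<in> space M" for \<omega>
      by (intro blinfun.tendsto gateaux_quotient_tendsto[OF D2[OF that]] tendsto_const)
    have "(\<lambda>\<omega>. D \<omega> y h) \<in> borel_measurable M" for y using A[of y] by (auto simp: is_bint_def)
    then show "(\<lambda>\<omega>. (real (Suc n) *\<^sub>R (D \<omega> (x + (1 / real (Suc n)) *\<^sub>R k) - D \<omega> x)) h) \<in> borel_measurable M" for n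
      unfolding blinfun.scaleR_left blinfun.diff_left
      by (intro borel_measurable_scaleR borel_measurable_const borel_measurable_diff)
  qed
  have b: "norm (D2 \<omega> x k) \<le> G \<omega> * norm k" if "\<omega> \<in> space M" for \<omega> x k
    using norm_blinfun[of "D2 \<omega> x" k] G(2)[OF that, of x] by (meson mult_right_mono norm_ge_zero order_trans)
  have Gk: "integrable M (\<lambda>\<omega>. G \<omega> * norm k)" for k :: 'a using G(1) by simp
  have "\<forall>x. \<exists>A2. \<forall>k. is_bint M (\<lambda>\<omega>. D2 \<omega> x k) (A2 k)"
    using is_bint_exists[OF m Gk b] by (intro allI choice) blast
  from choice[OF this] obtain A2' where A2': "\<And>x k. is_bint M (\<lambda>\<omega>. D2 \<omega> x k) (A2' x k)" by blast
  have bl: "bounded_linear (A2' x)" for x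
  proof (rule bounded_linear_intro[where K="\<integral>\<omega>. G \<omega> \<partial>M"])
    show "A2' x (h + k) = A2' x h + A2' x k" for h k
      by (rule blinfun_eqI) (use A2'[of x] in \<open>simp add: is_bint_def blinfun.add_right blinfun.add_left\<close>)
    show "A2' x (r *\<^sub>R h) = r *\<^sub>R A2' x h" for r h
      by (rule blinfun_eqI) (use A2'[of x] in \<open>simp add: is_bint_def blinfun.scaleR_right blinfun.scaleR_left\<close>)
    show "norm (A2' x h) \<le> norm h * (\<integral>\<omega>. G \<omega> \<partial>M)" for h
      using is_bint_norm[OF A2' Gk b, of x h] by (simp add: mult.commute)
  qed
  define A2 where "A2 x = Blinfun (A2' x)" for x
  have A2: "is_bint M (\<lambda>\<omega>. D2 \<omega> x k) (A2 x k)" for x k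
    using A2' bl by (simp add: A2_def bounded_linear_Blinfun_apply)
  have "has_gateaux_derivative A (A2 x) x" for x
  proof (rule has_gateaux_derivativeI_holder[OF _ \<gamma>])
    fix k
    have "norm (A (x + k) - A x - A2 x k) \<le> (\<integral>\<omega>. H \<omega> * norm k powr (1 + \<gamma>) \<partial>M)"
      by (rule is_bint_norm[OF is_bint_diff[OF is_bint_diff[OF A A] A2]]) (use H R in auto)
    then show "norm (A (x + k) - A x - A2 x k) \<le> (\<integral>\<omega>. H \<omega> \<partial>M) * norm k powr (1 + \<gamma>)" by simp
  qed
  then show ?thesis using A2 by blast
qed

section \<open>Integrals of powers and integrals with a parameter\<close>

lemma powr_integral_from_0:
  fixes p t :: real
  assumes p: "-1 < p" and t: "0 \<le> t"
  shows "integrable (restrict_space lborel {0<..<t}) (\<lambda>\<tau>. \<tau> powr p)"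
    "(\<integral>\<tau>. \<tau> powr p \<partial>restrict_space lborel {0<..<t}) = t powr (p + 1) / (p + 1)"
proof -
  have hi: "((\<lambda>\<tau>. \<tau> powr p) has_integral (t powr (p + 1) / (p + 1))) {0<..<t}"
    using has_integral_powr_from_0[OF p t] has_integral_Icc_iff_Ioo by blast
  have hb: "has_bochner_integral lborel (\<lambda>\<tau>. indicator {0<..<t} \<tau> *\<^sub>R \<tau> powr p) (t powr (p + 1) / (p + 1))"
  proof (rule has_bochner_integral_nn_integral)
    show "(\<lambda>\<tau>. indicator {0<..<t} \<tau> *\<^sub>R \<tau> powr p) \<in> borel_measurable lborel" by simp
    have "((\<lambda>\<tau>. indicator {0<..<t} \<tau> *\<^sub>R \<tau> powr p) has_integral (t powr (p + 1) / (p + 1))) UNIV"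
      proof -
      have "(\<lambda>\<tau>. indicator {0<..<t} \<tau> *\<^sub>R \<tau> powr p) = (\<lambda>\<tau>. if \<tau> \<in> {0<..<t} then \<tau> powr p else 0)" by (auto simp: indicator_def)
      then show ?thesis using hi by (simp only: has_integral_restrict_UNIV)
    qed
    then show "(\<integral>\<^sup>+\<tau>. ennreal (indicator {0<..<t} \<tau> *\<^sub>R \<tau> powr p) \<partial>lborel) = ennreal (t powr (p + 1) / (p + 1))"
      by (intro nn_integral_has_integral_lborel) auto
  qed (use p t in auto)
  show "integrable (restrict_space lborel {0<..<t}) (\<lambda>\<tau>. \<tau> powr p)"
    using hb by (subst integrable_restrict_space) (auto simp: has_bochner_integral_iff)
  show "(\<integral>\<tau>. \<tau> powr p \<partial>restrict_space lborel {0<..<t}) = t powr (p + 1) / (p + 1)"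
    using hb by (subst integral_restrict_space) (auto simp: has_bochner_integral_iff)
qed

lemma powr_integral_to_inf:
  fixes q r :: real
  assumes q: "q < -1" and r: "0 < r"
  shows "integrable (restrict_space lborel {r..}) (\<lambda>\<tau>. \<tau> powr q)"
    "(\<integral>\<tau>. \<tau> powr q \<partial>restrict_space lborel {r..}) = - (r powr (q + 1) / (q + 1))"
proof -
  have hi: "((\<lambda>\<tau>. \<tau> powr q) has_integral (- (r powr (q + 1)) / (q + 1))) {r..}"
    using has_integral_powr_to_inf[OF q r] by simp
  have hb: "has_bochner_integral lborel (\<lambda>\<tau>. indicator {r..} \<tau> *\<^sub>R \<tau> powr q) (- (r powr (q + 1)) / (q + 1))"
  proof (rule has_bochner_integral_nn_integral)
    show "(\<lambda>\<tau>. indicator {r..} \<tau> *\<^sub>R \<tau> powr q) \<in> borel_measurable lborel" by simp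
    have "((\<lambda>\<tau>. indicator {r..} \<tau> *\<^sub>R \<tau> powr q) has_integral (- (r powr (q + 1)) / (q + 1))) UNIV"
      proof -
      have "(\<lambda>\<tau>. indicator {r..} \<tau> *\<^sub>R \<tau> powr q) = (\<lambda>\<tau>. if \<tau> \<in> {r..} then \<tau> powr q else 0)" by (auto simp: indicator_def)
      then show ?thesis using hi by (simp only: has_integral_restrict_UNIV)
    qed
    then show "(\<integral>\<^sup>+\<tau>. ennreal (indicator {r..} \<tau> *\<^sub>R \<tau> powr q) \<partial>lborel) = ennreal (- (r powr (q + 1)) / (q + 1))"
      by (intro nn_integral_has_integral_lborel) auto
  qed (use q r in \<open>auto intro!: divide_nonneg_neg\<close>)
  show "integrable (restrict_space lborel {r..}) (\<lambda>\<tau>. \<tau> powr q)"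
    using hb by (subst integrable_restrict_space) (auto simp: has_bochner_integral_iff)
  show "(\<integral>\<tau>. \<tau> powr q \<partial>restrict_space lborel {r..}) = - (r powr (q + 1) / (q + 1))"
    using hb by (subst integral_restrict_space) (auto simp: has_bochner_integral_iff)
qed

text \<open>Below r the first power is integrated, above r the second; extending the upper part to
  infinity makes the bound independent of t.\<close>

lemma min_powr_integral:
  fixes p q r k t :: real
  assumes p: "-1 < p" and q: "q < -1" and r: "0 < r" and k: "0 \<le> k" and t: "0 \<le> t"
  shows "integrable (restrict_space lborel {0<..<t}) (\<lambda>\<tau>. min (\<tau> powr p) (k * \<tau> powr q))"
    "(\<integral>\<tau>. min (\<tau> powr p) (k * \<tau> powr q) \<partial>restrict_space lborel {0<..<t}) \<le> r powr (p + 1) / (p + 1) - k * (r powr (q + 1) / (q + 1))"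
proof -
  let ?m = "\<lambda>\<tau>. min (\<tau> powr p) (k * \<tau> powr q)"
  show i: "integrable (restrict_space lborel {0<..<t}) ?m"
  proof (rule Bochner_Integration.integrable_bound[OF powr_integral_from_0(1)[OF p t]])
    show "?m \<in> borel_measurable (restrict_space lborel {0<..<t})" by (rule measurable_restrict_space1) simp
    show "AE \<tau> in restrict_space lborel {0<..<t}. norm (?m \<tau>) \<le> norm (\<tau> powr p)"
      using k by (intro AE_I2) auto
  qed
  have i1: "integrable lborel (\<lambda>\<tau>. indicator {0<..<r} \<tau> *\<^sub>R \<tau> powr p)"
    using powr_integral_from_0(1)[OF p less_imp_le[OF r]] by (subst (asm) integrable_restrict_space) auto
  have i2: "integrable lborel (\<lambda>\<tau>. indicator {r..} \<tau> *\<^sub>R \<tau> powr q)"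
    using powr_integral_to_inf(1)[OF q r] by (subst (asm) integrable_restrict_space) auto
  have "(\<integral>\<tau>. ?m \<tau> \<partial>restrict_space lborel {0<..<t}) = (\<integral>\<tau>. indicator {0<..<t} \<tau> *\<^sub>R ?m \<tau> \<partial>lborel)"
    by (rule integral_restrict_space) simp
  also have "\<dots> \<le> (\<integral>\<tau>. indicator {0<..<r} \<tau> *\<^sub>R \<tau> powr p + k * (indicator {r..} \<tau> *\<^sub>R \<tau> powr q) \<partial>lborel)"
  proof (rule integral_mono)
    show "integrable lborel (\<lambda>\<tau>. indicator {0<..<t} \<tau> *\<^sub>R ?m \<tau>)"
      using i by (subst (asm) integrable_restrict_space) auto
    show "integrable lborel (\<lambda>\<tau>. indicator {0<..<r} \<tau> *\<^sub>R \<tau> powr p + k * (indicator {r..} \<tau> *\<^sub>R \<tau> powr q))"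
      using i1 i2 by simp
  qed (use k r in \<open>auto simp: indicator_def\<close>)
  also have "\<dots> = (\<integral>\<tau>. indicator {0<..<r} \<tau> *\<^sub>R \<tau> powr p \<partial>lborel) + k * (\<integral>\<tau>. indicator {r..} \<tau> *\<^sub>R \<tau> powr q \<partial>lborel)"
    using i1 i2 by simp
  also have "(\<integral>\<tau>. indicator {0<..<r} \<tau> *\<^sub>R \<tau> powr p \<partial>lborel) = r powr (p + 1) / (p + 1)"
    using powr_integral_from_0(2)[OF p less_imp_le[OF r]] by (subst (asm) integral_restrict_space) auto
  also have "(\<integral>\<tau>. indicator {r..} \<tau> *\<^sub>R \<tau> powr q \<partial>lborel) = - (r powr (q + 1) / (q + 1))"
    using powr_integral_to_inf(2)[OF q r] by (subst (asm) integral_restrict_space) auto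
  finally show "(\<integral>\<tau>. ?m \<tau> \<partial>restrict_space lborel {0<..<t}) \<le> r powr (p + 1) / (p + 1) - k * (r powr (q + 1) / (q + 1))" by simp
qed

lemma continuous_on_quotient_limit:
  fixes f :: "nat \<Rightarrow> 'b::metric_space \<Rightarrow> 'c::metric_space"
  assumes f: "\<And>n. continuous_on A (f n)" and b: "\<And>n p. p \<in> A \<Longrightarrow> dist (f n p) (l p) \<le> K / real (Suc n)"
  shows "continuous_on A l"
proof (rule uniform_limit_theorem[where f=f and F=sequentially])
  show "uniform_limit A f l sequentially"
  proof (rule uniform_limitI)
    fix e :: real assume e: "0 < e"
    have "(\<lambda>n. K / real (Suc n)) \<longlonglongrightarrow> 0" by (rule LIMSEQ_Suc[OF lim_const_over_n])
    from order_tendstoD(2)[OF this e] show "\<forall>\<^sub>F n in sequentially. \<forall>p\<in>A. dist (f n p) (l p) < e"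

    proof eventually_elim
      case (elim n)
      show ?case by (intro ballI le_less_trans[OF b elim])
    qed
  qed
qed (use f in auto)

text \<open>The domain varies with the parameter as well. Written with indicators over the whole
  line, the integrand converges except possibly at \<tau> = fst p, so dominated convergence
  applies.\<close>

lemma continuous_on_parametric_integral:
  fixes W :: "real \<Rightarrow> real \<times> 'a::metric_space \<Rightarrow> real"
  assumes W: "\<And>\<tau>. 0 < \<tau> \<Longrightarrow> continuous_on ({0..T} \<times> UNIV) (W \<tau>)"
    and m: "\<And>p. p \<in> {0..T} \<times> UNIV \<Longrightarrow> (\<lambda>\<tau>. W \<tau> p) \<in> borel_measurable (restrict_space lborel {0<..<fst p})"
    and G: "integrable (restrict_space lborel {0<..<T}) G" "\<And>\<tau> p. 0 < \<tau> \<Longrightarrow> p \<in> {0..T} \<times> UNIV \<Longrightarrow> \<bar>W \<tau> p\<bar> \<le> G \<tau>"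
  shows "continuous_on ({0..T} \<times> UNIV) (\<lambda>p. \<integral>\<tau>. W \<tau> p \<partial>restrict_space lborel {0<..<fst p})"
  unfolding continuous_on_sequentially
proof (intro allI ballI impI, elim conjE)
  fix u :: "nat \<Rightarrow> real \<times> 'a" and p assume p: "p \<in> {0..T} \<times> UNIV" and u: "\<forall>n. u n \<in> {0..T} \<times> UNIV" "u \<longlonglongrightarrow> p"
  have l: "(\<lambda>n. fst (u n)) \<longlonglongrightarrow> fst p" by (rule tendsto_fst[OF u(2)])
  have e: "(\<integral>\<tau>. W \<tau> z \<partial>restrict_space lborel {0<..<fst z}) = (\<integral>\<tau>. indicator {0<..<fst z} \<tau> *\<^sub>R W \<tau> z \<partial>lborel)" for z
    by (rule integral_restrict_space) simp
  have m': "(\<lambda>\<tau>. indicator {0<..<fst z} \<tau> *\<^sub>R W \<tau> z) \<in> borel_measurable lborel" if "z \<in> {0..T} \<times> UNIV" for z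
    using m[OF that] by (subst (asm) borel_measurable_restrict_space_iff) (auto simp: mult.commute)
  have "(\<lambda>n. \<integral>\<tau>. indicator {0<..<fst (u n)} \<tau> *\<^sub>R W \<tau> (u n) \<partial>lborel) \<longlonglongrightarrow> (\<integral>\<tau>. indicator {0<..<fst p} \<tau> *\<^sub>R W \<tau> p \<partial>lborel)"
  proof (rule integral_dominated_convergence[where w="\<lambda>\<tau>. indicator {0<..<T} \<tau> *\<^sub>R G \<tau>"])
    show "(\<lambda>\<tau>. indicator {0<..<fst p} \<tau> *\<^sub>R W \<tau> p) \<in> borel_measurable lborel" by (rule m'[OF p])
    show "(\<lambda>\<tau>. indicator {0<..<fst (u n)} \<tau> *\<^sub>R W \<tau> (u n)) \<in> borel_measurable lborel" for n using m' u(1) by blast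
    show "integrable lborel (\<lambda>\<tau>. indicator {0<..<T} \<tau> *\<^sub>R G \<tau>)" using G(1) by (subst (asm) integrable_restrict_space) auto
    have "AE \<tau> in lborel. \<tau> \<notin> {fst p}" by (rule AE_not_in) auto
    then show "AE \<tau> in lborel. (\<lambda>n. indicator {0<..<fst (u n)} \<tau> *\<^sub>R W \<tau> (u n)) \<longlonglongrightarrow> indicator {0<..<fst p} \<tau> *\<^sub>R W \<tau> p"
    proof eventually_elim
      case (elim \<tau>)
      show ?case
      proof (cases "0 < \<tau>")
        case True
        have "\<forall>\<^sub>F n in sequentially. (\<tau> < fst (u n)) = (\<tau> < fst p)"
        proof (cases "\<tau> < fst p")
          case True
          then show ?thesis using order_tendstoD(1)[OF l True] by simp
        next
          case False
          then have "fst p < \<tau>" using elim by simp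
          from order_tendstoD(2)[OF l this] False show ?thesis by (auto elim: eventually_mono)
        qed
        then have "(\<lambda>n. indicator {0<..<fst (u n)} \<tau> :: real) \<longlonglongrightarrow> indicator {0<..<fst p} \<tau>"
          by (intro tendsto_eventually) (auto elim!: eventually_mono simp: indicator_def)
        moreover have "(\<lambda>n. W \<tau> (u n)) \<longlonglongrightarrow> W \<tau> p"
          using W[OF True] p u unfolding continuous_on_sequentially by (auto simp: o_def)
        ultimately show ?thesis by (rule tendsto_scaleR)
      qed simp
    qed
    show "AE \<tau> in lborel. norm (indicator {0<..<fst (u n)} \<tau> *\<^sub>R W \<tau> (u n)) \<le> indicator {0<..<T} \<tau> *\<^sub>R G \<tau>" for n
    proof (rule AE_I2)
      fix \<tau>
      have "u n \<in> {0..T} \<times> UNIV" using u(1) by blast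
      then have "fst (u n) \<le> T" by auto
      then show "norm (indicator {0<..<fst (u n)} \<tau> *\<^sub>R W \<tau> (u n)) \<le> indicator {0<..<T} \<tau> *\<^sub>R G \<tau>"
        using G(2)[of \<tau> "u n"] \<open>u n \<in> {0..T} \<times> UNIV\<close> order_trans[OF abs_ge_zero G(2)[of \<tau> p]] p
        by (auto simp: indicator_def)
    qed
  qed
  then show "((\<lambda>p. \<integral>\<tau>. W \<tau> p \<partial>restrict_space lborel {0<..<fst p}) \<circ> u) \<longlonglongrightarrow> (\<integral>\<tau>. W \<tau> p \<partial>restrict_space lborel {0<..<fst p})"
    unfolding o_def e .
qed

section \<open>The inhomogeneous term\<close>

text \<open>With z = r / sqrt \<tau> the two entries of the minimum are the same quantity times 1
  and times z, and the smaller of 1 and z is at most z powr \<gamma>.\<close>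

lemma min_interpolation:
  fixes r \<tau> \<gamma> :: real
  assumes r: "0 \<le> r" and \<tau>: "0 < \<tau>" and \<gamma>: "0 \<le> \<gamma>" "\<gamma> \<le> 1"
  shows "min (\<tau> powr p * r) (\<tau> powr (p - 1 / 2) * r\<^sup>2) \<le> \<tau> powr (p - \<gamma> / 2) * r powr (1 + \<gamma>)"
proof (cases "r = 0")
  case False
  then have r: "0 < r" using r by simp
  have rhs: "\<tau> powr (p - \<gamma> / 2) * r powr (1 + \<gamma>) = \<tau> powr p * r * (r / sqrt \<tau>) powr \<gamma>"
    using r \<tau> by (simp add: powr_diff powr_add powr_divide powr_half_sqrt[symmetric] powr_powr)
  show ?thesis
  proof (cases "sqrt \<tau> \<le> r")
    case True
    then have "1 \<le> r / sqrt \<tau>" using \<tau> by simp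
    then have "1 \<le> (r / sqrt \<tau>) powr \<gamma>" using \<gamma> by (intro ge_one_powr_ge_zero)
    then have "\<tau> powr p * r * 1 \<le> \<tau> powr p * r * (r / sqrt \<tau>) powr \<gamma>" using r by (intro mult_left_mono) auto
    then show ?thesis unfolding rhs by simp
  next
    case False
    then have z: "0 < r / sqrt \<tau>" "r / sqrt \<tau> \<le> 1" using r \<tau> by (auto simp: pos_divide_le_eq)
    have "y \<le> y powr \<gamma>" if "0 < y" "y \<le> 1" for y :: real
      using powr_mono'[of \<gamma> 1 y] \<gamma> that by simp
    from this[OF z] have "\<tau> powr p * r * (r / sqrt \<tau>) \<le> \<tau> powr p * r * (r / sqrt \<tau>) powr \<gamma>"
      using r by (rule_tac mult_left_mono) auto
    moreover have "\<tau> powr (p - 1 / 2) * r\<^sup>2 = \<tau> powr p * r * (r / sqrt \<tau>)"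
      using \<tau> by (simp add: powr_diff powr_half_sqrt power2_eq_square)
    ultimately show ?thesis unfolding rhs by simp
  qed
qed simp

locale source_term = ou_semigroup S \<mu> c s
  for S :: "real \<Rightarrow> 'a::{real_inner, banach, second_countable_topology} \<Rightarrow>\<^sub>L 'a" and \<mu> c s +
  fixes T M \<alpha> N :: real and G :: "real \<times> 'a \<Rightarrow> real"
  assumes T: "0 < T" and G_cont: "continuous_on UNIV G" and G_bound: "\<And>p. \<bar>G p\<bar> \<le> M"
    and \<alpha>: "0 \<le> \<alpha>" "\<alpha> < 1" and N: "0 \<le> N" and G_smoothing: "\<And>r. smoothing \<alpha> N (\<lambda>x. G (r, x))"
begin

text \<open>Duhamel integrand in the elapsed time \<tau> = t - r, which places the singularity of
  the derivatives at \<tau> = 0 for every t.\<close>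

definition w :: "real \<Rightarrow> real \<Rightarrow> 'a \<Rightarrow> real" where "w \<tau> t = mehler S \<mu> \<tau> (\<lambda>z. G (t - \<tau>, z))"
definition V :: "real \<Rightarrow> 'a \<Rightarrow> real" where "V t x = (\<integral>\<tau>. w \<tau> t x \<partial>restrict_space lborel {0<..<t})"
abbreviation "Dw \<tau> t \<equiv> gateaux_deriv (w \<tau> t)"
abbreviation "DDw \<tau> t \<equiv> gateaux_deriv (gateaux_deriv (w \<tau> t))"

lemma M_nonneg: "0 \<le> M" using order_trans[OF abs_ge_zero G_bound] .

lemma cb_G: "cb M (\<lambda>x. G (r, x))"
  unfolding cb_def using G_bound by (auto intro!: continuous_on_compose2[OF G_cont] continuous_intros)

lemma w_E: "w \<tau> t x = E G (\<tau>, t - \<tau>, x)"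
  by (simp add: w_def E_def mehler_def)

lemma w_bound: "0 \<le> \<tau> \<Longrightarrow> \<bar>w \<tau> t x\<bar> \<le> M"
  unfolding w_def by (rule mehler_bound[OF _ cb_G])

lemma w_lip: "0 < \<tau> \<Longrightarrow> lip_bound (8 * N * \<tau> powr ((\<alpha> - 1) / 2)) (w \<tau> t)"
  using G_smoothing[of "t - \<tau>"] unfolding w_def smoothing_def by blast

lemma w_mixed: "0 < \<tau> \<Longrightarrow> mixed_bound (96 * N * \<tau> powr ((\<alpha> - 2) / 2)) (w \<tau> t)"
  unfolding w_def by (rule smoothing_mixed[OF G_smoothing \<alpha> N])

lemma w_tri: "0 < \<tau> \<Longrightarrow> tri_bound (3072 * N * \<tau> powr ((\<alpha> - 3) / 2)) (w \<tau> t)"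
  unfolding w_def by (rule smoothing_tri[OF G_smoothing \<alpha> N])

lemma Dw:
  assumes \<tau>: "0 < \<tau>"
  shows "has_gateaux_derivative (w \<tau> t) (Dw \<tau> t x) x"
    "norm (w \<tau> t (x + h) - w \<tau> t x - Dw \<tau> t x h) \<le> 96 * N * \<tau> powr ((\<alpha> - 2) / 2) / 2 * (norm h)\<^sup>2"
    "norm (Dw \<tau> t x) \<le> 8 * N * \<tau> powr ((\<alpha> - 1) / 2)"
    "lip_bound (96 * N * \<tau> powr ((\<alpha> - 2) / 2)) (Dw \<tau> t)"
    "mixed_bound (3072 * N * \<tau> powr ((\<alpha> - 3) / 2)) (Dw \<tau> t)"
  using derivative_of_mixed_bound[OF w_mixed[OF \<tau>] w_lip[OF \<tau>]] w_tri[OF \<tau>] N by simp_all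

lemma DDw:
  assumes \<tau>: "0 < \<tau>"
  shows "has_gateaux_derivative (Dw \<tau> t) (DDw \<tau> t x) x"
    "norm (Dw \<tau> t (x + h) - Dw \<tau> t x - DDw \<tau> t x h) \<le> 3072 * N * \<tau> powr ((\<alpha> - 3) / 2) / 2 * (norm h)\<^sup>2"
    "norm (DDw \<tau> t x) \<le> 96 * N * \<tau> powr ((\<alpha> - 2) / 2)"
    "lip_bound (3072 * N * \<tau> powr ((\<alpha> - 3) / 2)) (DDw \<tau> t)"
  using derivative_of_mixed_bound[OF Dw(5)[OF \<tau>] Dw(4)[OF \<tau>]] N by simp_all

lemma w_measurable: "(\<lambda>\<tau>. w \<tau> t x) \<in> borel_measurable (restrict_space lborel {0<..<t})"
proof -
  have "continuous_on {0<..<t} (\<lambda>\<tau>. E G (\<tau>, t - \<tau>, x))"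
    by (rule continuous_on_compose2[OF E_continuous[OF G_cont G_bound]]) (auto intro!: continuous_intros)
  then have "(\<lambda>\<tau>. w \<tau> t x) \<in> borel_measurable (restrict_space borel {0<..<t})"
    unfolding w_E by (rule borel_measurable_continuous_on_restrict)
  then show ?thesis by (simp cong: measurable_cong_sets sets_restrict_space_cong)
qed

lemma finite_measure_Ioo: "finite_measure (restrict_space lborel {0<..<t :: real})"
proof (rule finite_measureI)
  have "emeasure lborel {0<..<t} < \<infinity>" by (rule emeasure_bounded_finite) simp
  then show "emeasure (restrict_space lborel {0<..<t}) (space (restrict_space lborel {0<..<t})) \<noteq> \<infinity>"
    by (simp add: emeasure_restrict_space less_top)
qed

lemma w_integrable: "integrable (restrict_space lborel {0<..<t}) (\<lambda>\<tau>. w \<tau> t x)"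
  by (rule finite_measure.integrable_const_bound[OF finite_measure_Ioo, where B=M])
    (use w_measurable w_bound in auto)

lemma V_bound: assumes "0 \<le> t" "t \<le> T" shows "\<bar>V t x\<bar> \<le> T * M"
proof -
  have c: "integrable (restrict_space lborel {0<..<t}) (\<lambda>\<tau>. M)"
    by (rule finite_measure.integrable_const[OF finite_measure_Ioo])
  have "\<bar>V t x\<bar> \<le> (\<integral>\<tau>. M \<partial>restrict_space lborel {0<..<t})"
    unfolding V_def using w_bound
    by (intro integral_abs_bound[THEN order_trans] integral_mono integrable_abs w_integrable c) simp
  also have "\<dots> = t * M" using assms by (simp add: measure_restrict_space)
  also have "\<dots> \<le> T * M" using assms M_nonneg by (intro mult_right_mono)
  finally show ?thesis .
qed

lemma V_derivative:
  assumes t: "0 \<le> t"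
  shows "has_gateaux_derivative (V t) (gateaux_deriv (V t) x) x"
    "is_bint (restrict_space lborel {0<..<t}) (\<lambda>\<tau>. Dw \<tau> t x) (gateaux_deriv (V t) x)"
proof -
  have "\<exists>A. \<forall>x. is_bint (restrict_space lborel {0<..<t}) (\<lambda>\<tau>. Dw \<tau> t x) (A x) \<and>
    has_gateaux_derivative (\<lambda>x. \<integral>\<tau>. w \<tau> t x \<partial>restrict_space lborel {0<..<t}) (A x) x"
  proof (rule gateaux_integral)
    show "integrable (restrict_space lborel {0<..<t}) (\<lambda>\<tau>. 8 * N * \<tau> powr ((\<alpha> - 1) / 2))"
      using powr_integral_from_0(1)[OF _ t, of "(\<alpha> - 1) / 2"] \<alpha> by simp
  qed (use Dw w_integrable in auto)
  then obtain A where A: "\<And>x. is_bint (restrict_space lborel {0<..<t}) (\<lambda>\<tau>. Dw \<tau> t x) (A x)"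
    "\<And>x. has_gateaux_derivative (V t) (A x) x" unfolding V_def[abs_def] by blast
  then have "gateaux_deriv (V t) x = A x" for x using gateaux_deriv_eq by blast
  then show "has_gateaux_derivative (V t) (gateaux_deriv (V t) x) x"
    "is_bint (restrict_space lborel {0<..<t}) (\<lambda>\<tau>. Dw \<tau> t x) (gateaux_deriv (V t) x)" using A by simp_all
qed

lemma DV_bound:
  assumes t: "0 \<le> t" "t \<le> T"
  shows "norm (gateaux_deriv (V t) x) \<le> 16 * N * T powr ((\<alpha> + 1) / 2)"
proof -
  have p: "-1 < (\<alpha> - 1) / 2" using \<alpha> by simp
  have e: "(\<alpha> - 1) / 2 + 1 = (\<alpha> + 1) / 2" by (simp add: field_simps)
  have "norm (gateaux_deriv (V t) x) \<le> (\<integral>\<tau>. 8 * N * \<tau> powr ((\<alpha> - 1) / 2) \<partial>restrict_space lborel {0<..<t})"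
    by (rule is_bint_norm[OF V_derivative(2)[OF t(1)]]) (use Dw powr_integral_from_0(1)[OF p t(1)] in auto)
  also have "\<dots> = 8 * N * (t powr ((\<alpha> + 1) / 2) / ((\<alpha> + 1) / 2))"
    using powr_integral_from_0(2)[OF p t(1)] by (simp add: e)
  also have "\<dots> \<le> 8 * N * (2 * T powr ((\<alpha> + 1) / 2))"
  proof (intro mult_left_mono)
    \<comment> \<open>The divisor is at least 1/2, which turns 8 into 16 uniformly in
      \<alpha>.\<close>
    have "t powr ((\<alpha> + 1) / 2) / ((\<alpha> + 1) / 2) \<le> T powr ((\<alpha> + 1) / 2) / (1 / 2)"
      using t \<alpha> by (intro frac_le powr_mono2) auto
    then show "t powr ((\<alpha> + 1) / 2) / ((\<alpha> + 1) / 2) \<le> 2 * T powr ((\<alpha> + 1) / 2)" by simp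
  qed (use N in auto)
  finally show ?thesis by simp
qed

text \<open>For small \<tau> the three derivatives are bounded separately, for large \<tau> by the
  second difference of the derivative. The bounds cross at \<tau> = (norm h)^2; each side
  contributes 2 * norm h, and 12288 = 4 * 3072.\<close>

lemma DV_zygmund:
  assumes t: "0 \<le> t" and \<alpha>0: "\<alpha> = 0"
  shows "norm (gateaux_deriv (V t) (x + 2 *\<^sub>R h) - 2 *\<^sub>R gateaux_deriv (V t) (x + h) + gateaux_deriv (V t) x) \<le> 12288 * N * norm h"
proof (cases "h = 0")
  case True
  have "gateaux_deriv (V t) x - 2 *\<^sub>R gateaux_deriv (V t) x + gateaux_deriv (V t) x = 0"
    by (simp add: scaleR_2)
  then show ?thesis using True by simp
next
  case False
  then have h: "0 < norm h" by simp
  let ?m = "\<lambda>\<tau>. min (\<tau> powr (-1/2)) ((norm h)\<^sup>2 * \<tau> powr (-3/2))"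
  note B = V_derivative(2)[OF t]
  have mi: "integrable (restrict_space lborel {0<..<t}) ?m"
    "(\<integral>\<tau>. ?m \<tau> \<partial>restrict_space lborel {0<..<t}) \<le> (norm h)\<^sup>2 powr (-1/2 + 1) / (-1/2 + 1) - (norm h)\<^sup>2 * ((norm h)\<^sup>2 powr (-3/2 + 1) / (-3/2 + 1))"
    by (rule min_powr_integral[where r="(norm h)\<^sup>2"]; use h t in simp)+
  have "norm (gateaux_deriv (V t) (x + 2 *\<^sub>R h) - 2 *\<^sub>R gateaux_deriv (V t) (x + h) + gateaux_deriv (V t) x)
    \<le> (\<integral>\<tau>. 3072 * N * ?m \<tau> \<partial>restrict_space lborel {0<..<t})"
  proof (rule is_bint_norm[OF is_bint_add[OF is_bint_diff[OF B is_bint_scale[OF B]] B]])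
    show "integrable (restrict_space lborel {0<..<t}) (\<lambda>\<tau>. 3072 * N * ?m \<tau>)" using mi(1) by simp
    fix \<tau> assume "\<tau> \<in> space (restrict_space lborel {0<..<t})"
    then have \<tau>: "0 < \<tau>" by simp
    have "norm (Dw \<tau> t (x + 2 *\<^sub>R h) - 2 *\<^sub>R Dw \<tau> t (x + h) + Dw \<tau> t x)
      \<le> norm (Dw \<tau> t (x + 2 *\<^sub>R h)) + norm (2 *\<^sub>R Dw \<tau> t (x + h)) + norm (Dw \<tau> t x)"
      by (intro norm_triangle_le add_mono norm_triangle_ineq4 order_refl)
    also have "\<dots> \<le> 8 * N * \<tau> powr (-1/2) + 2 * (8 * N * \<tau> powr (-1/2)) + 8 * N * \<tau> powr (-1/2)"
    proof -
      have "norm (Dw \<tau> t y) \<le> 8 * N * \<tau> powr (-1/2)" for y using Dw(3)[OF \<tau>, of t y] \<alpha>0 by simp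
      from this[of "x + 2 *\<^sub>R h"] this[of "x + h"] this[of x] show ?thesis unfolding norm_scaleR by linarith
    qed
    also have "\<dots> \<le> 3072 * N * \<tau> powr (-1/2)" using N by (simp add: mult_right_mono)
    finally have 1: "norm (Dw \<tau> t (x + 2 *\<^sub>R h) - 2 *\<^sub>R Dw \<tau> t (x + h) + Dw \<tau> t x) \<le> 3072 * N * \<tau> powr (-1/2)" .
    have "Dw \<tau> t (x + 2 *\<^sub>R h) - 2 *\<^sub>R Dw \<tau> t (x + h) + Dw \<tau> t x = Dw \<tau> t (x + h + h) - Dw \<tau> t (x + h) - Dw \<tau> t (x + h) + Dw \<tau> t x"
      by (simp add: scaleR_2 add.assoc)
    then have 2: "norm (Dw \<tau> t (x + 2 *\<^sub>R h) - 2 *\<^sub>R Dw \<tau> t (x + h) + Dw \<tau> t x) \<le> 3072 * N * ((norm h)\<^sup>2 * \<tau> powr (-3/2))"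
      using mixed_boundD[OF Dw(5)[OF \<tau>], of t x h h] \<alpha>0 by (simp add: power2_eq_square mult_ac)
    show "norm (Dw \<tau> t (x + 2 *\<^sub>R h) - 2 *\<^sub>R Dw \<tau> t (x + h) + Dw \<tau> t x) \<le> 3072 * N * ?m \<tau>"
      using 1 2 by (simp add: min_def)
  qed
  also have "\<dots> \<le> 3072 * N * (4 * norm h)"
  proof -
    have "(norm h)\<^sup>2 powr (1/2) = norm h" using h by (simp add: powr_half_sqrt)
    moreover have "(norm h)\<^sup>2 powr (-1/2) = 1 / norm h" using h by (simp add: powr_minus_divide powr_half_sqrt flip: minus_divide_left)
    ultimately have "(norm h)\<^sup>2 powr (-1/2 + 1) / (-1/2 + 1) - (norm h)\<^sup>2 * ((norm h)\<^sup>2 powr (-3/2 + 1) / (-3/2 + 1)) = 4 * norm h"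
      using h by (simp add: power2_eq_square)
    with mi(2) have m4: "(\<integral>\<tau>. ?m \<tau> \<partial>restrict_space lborel {0<..<t}) \<le> 4 * norm h" by (simp only:)
    have "(\<integral>\<tau>. 3072 * N * ?m \<tau> \<partial>restrict_space lborel {0<..<t}) = 3072 * N * (\<integral>\<tau>. ?m \<tau> \<partial>restrict_space lborel {0<..<t})"
      by (rule integral_mult_right_zero)
    also have "\<dots> \<le> 3072 * N * (4 * norm h)" by (rule mult_left_mono[OF m4]) (use N in simp)
    finally show ?thesis .
  qed
  finally show ?thesis by simp
qed

lemma w_continuous:
  assumes "0 < \<tau>"
  shows "continuous_on ({0..T} \<times> UNIV) (\<lambda>(t, x). w \<tau> t x)"
proof -
  have "continuous_on ({0..T} \<times> UNIV) (\<lambda>p. E G (\<tau>, fst p - \<tau>, snd p))"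
    by (rule continuous_on_compose2[OF E_continuous[OF G_cont G_bound]]) (use assms in \<open>auto intro!: continuous_intros\<close>)
  then show ?thesis by (simp add: w_E case_prod_beta')
qed

text \<open>At fixed \<tau> the remainder bound involves neither t nor x, so the difference
  quotients converge uniformly and their joint continuity passes to the limit.\<close>

lemma Dw_continuous:
  assumes \<tau>: "0 < \<tau>"
  shows "continuous_on ({0..T} \<times> UNIV) (\<lambda>(t, x). Dw \<tau> t x h)"
proof (rule continuous_on_quotient_limit)
  fix n :: nat
  show "continuous_on ({0..T} \<times> UNIV) (\<lambda>(t, x). real (Suc n) * (w \<tau> t (x + (1 / real (Suc n)) *\<^sub>R h) - w \<tau> t x))"
    unfolding case_prod_beta'
    by (intro continuous_intros continuous_on_compose2[OF w_continuous[OF \<tau>, unfolded case_prod_beta'], where f="\<lambda>p. (fst p, snd p + k)" for k, simplified] w_continuous[OF \<tau>, unfolded case_prod_beta']) auto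
  fix p :: "real \<times> 'a"
  obtain t x where p: "p = (t, x)" by (cases p)
  define k where "k = (1 / real (Suc n)) *\<^sub>R h"
  have "norm (real (Suc n) * (w \<tau> t (x + k) - w \<tau> t x) - Dw \<tau> t x h) = real (Suc n) * norm (w \<tau> t (x + k) - w \<tau> t x - Dw \<tau> t x k)"
  proof -
    have "real (Suc n) * (w \<tau> t (x + k) - w \<tau> t x) - Dw \<tau> t x h = real (Suc n) * (w \<tau> t (x + k) - w \<tau> t x - Dw \<tau> t x k)"
      by (simp add: k_def blinfun.scaleR_right right_diff_distrib)
    then show ?thesis by (simp add: abs_mult)
  qed
  also have "\<dots> \<le> real (Suc n) * (96 * N * \<tau> powr ((\<alpha> - 2) / 2) / 2 * (norm k)\<^sup>2)"
    by (intro mult_left_mono Dw(2)[OF \<tau>]) simp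
  also have "\<dots> = (96 * N * \<tau> powr ((\<alpha> - 2) / 2) / 2 * (norm h)\<^sup>2) / real (Suc n)"
    by (simp add: k_def power2_eq_square)
  finally show "dist (case p of (t, x) \<Rightarrow> real (Suc n) * (w \<tau> t (x + (1 / real (Suc n)) *\<^sub>R h) - w \<tau> t x)) (case p of (t, x) \<Rightarrow> Dw \<tau> t x h)
    \<le> (96 * N * \<tau> powr ((\<alpha> - 2) / 2) / 2 * (norm h)\<^sup>2) / real (Suc n)"
    by (simp add: p dist_norm k_def)
qed

lemma DDw_continuous:
  assumes \<tau>: "0 < \<tau>"
  shows "continuous_on ({0..T} \<times> UNIV) (\<lambda>(t, x). DDw \<tau> t x h l)"
proof (rule continuous_on_quotient_limit)
  fix n :: nat
  show "continuous_on ({0..T} \<times> UNIV) (\<lambda>(t, x). real (Suc n) * (Dw \<tau> t (x + (1 / real (Suc n)) *\<^sub>R h) l - Dw \<tau> t x l))"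
    unfolding case_prod_beta'
    by (intro continuous_intros continuous_on_compose2[OF Dw_continuous[OF \<tau>, unfolded case_prod_beta'], where f="\<lambda>p. (fst p, snd p + k)" for k, simplified] Dw_continuous[OF \<tau>, unfolded case_prod_beta']) auto
  fix p :: "real \<times> 'a"
  obtain t x where p: "p = (t, x)" by (cases p)
  define k where "k = (1 / real (Suc n)) *\<^sub>R h"
  have "norm (real (Suc n) * (Dw \<tau> t (x + k) l - Dw \<tau> t x l) - DDw \<tau> t x h l) = real (Suc n) * norm ((Dw \<tau> t (x + k) - Dw \<tau> t x - DDw \<tau> t x k) l)"
  proof -
    have "real (Suc n) * (Dw \<tau> t (x + k) l - Dw \<tau> t x l) - DDw \<tau> t x h l = real (Suc n) * ((Dw \<tau> t (x + k) - Dw \<tau> t x - DDw \<tau> t x k) l)"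
      by (simp add: k_def blinfun.bilinear_simps right_diff_distrib)
    then show ?thesis by (simp add: abs_mult)
  qed
  also have "\<dots> \<le> real (Suc n) * (3072 * N * \<tau> powr ((\<alpha> - 3) / 2) / 2 * (norm k)\<^sup>2 * norm l)"
    by (intro mult_left_mono order_trans[OF norm_blinfun] mult_right_mono DDw(2)[OF \<tau>]) simp_all
  also have "\<dots> = (3072 * N * \<tau> powr ((\<alpha> - 3) / 2) / 2 * (norm h)\<^sup>2 * norm l) / real (Suc n)"
    by (simp add: k_def power2_eq_square)
  finally show "dist (case p of (t, x) \<Rightarrow> real (Suc n) * (Dw \<tau> t (x + (1 / real (Suc n)) *\<^sub>R h) l - Dw \<tau> t x l)) (case p of (t, x) \<Rightarrow> DDw \<tau> t x h l)
    \<le> (3072 * N * \<tau> powr ((\<alpha> - 3) / 2) / 2 * (norm h)\<^sup>2 * norm l) / real (Suc n)"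
    by (simp add: p dist_norm k_def)
qed

lemma V_continuous: "continuous_on ({0..T} \<times> UNIV) (\<lambda>(t, x). V t x)"
proof -
  have "continuous_on ({0..T} \<times> UNIV) (\<lambda>p. \<integral>\<tau>. (case p of (t, x) \<Rightarrow> w \<tau> t x) \<partial>restrict_space lborel {0<..<fst p})"
  proof (rule continuous_on_parametric_integral[where G="\<lambda>_. M"])
    show "integrable (restrict_space lborel {0<..<T}) (\<lambda>_. M)"
      by (rule finite_measure.integrable_const[OF finite_measure_Ioo])
  qed (use w_continuous w_measurable w_bound in auto)
  then show ?thesis by (simp add: V_def case_prod_beta')
qed

lemma DV_continuous: "continuous_on ({0..T} \<times> UNIV) (\<lambda>(t, x). gateaux_deriv (V t) x h)"
proof -
  have p: "-1 < (\<alpha> - 1) / 2" using \<alpha> by simp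
  have "continuous_on ({0..T} \<times> UNIV) (\<lambda>p. \<integral>\<tau>. (case p of (t, x) \<Rightarrow> Dw \<tau> t x h) \<partial>restrict_space lborel {0<..<fst p})"
  proof (rule continuous_on_parametric_integral[where G="\<lambda>\<tau>. 8 * N * \<tau> powr ((\<alpha> - 1) / 2) * norm h"])
    show "integrable (restrict_space lborel {0<..<T}) (\<lambda>\<tau>. 8 * N * \<tau> powr ((\<alpha> - 1) / 2) * norm h)"
      using powr_integral_from_0(1)[OF p, of T] T by simp
    fix z :: "real \<times> 'a" assume "z \<in> {0..T} \<times> UNIV"
    then have z: "0 \<le> fst z" by auto
    show "(\<lambda>\<tau>. case z of (t, x) \<Rightarrow> Dw \<tau> t x h) \<in> borel_measurable (restrict_space lborel {0<..<fst z})"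
      using V_derivative(2)[OF z, of "snd z"] unfolding is_bint_def case_prod_beta' by (blast intro: borel_measurable_integrable)
    fix \<tau> :: real assume \<tau>: "0 < \<tau>"
    show "\<bar>case z of (t, x) \<Rightarrow> Dw \<tau> t x h\<bar> \<le> 8 * N * \<tau> powr ((\<alpha> - 1) / 2) * norm h"
      using order_trans[OF norm_blinfun mult_right_mono[OF Dw(3)[OF \<tau>, of "fst z" "snd z"] norm_ge_zero[of h]]]
      by (simp add: case_prod_beta')
  qed (use Dw_continuous in auto)
  moreover have "(\<integral>\<tau>. (case p of (t, x) \<Rightarrow> Dw \<tau> t x h) \<partial>restrict_space lborel {0<..<fst p}) = (case p of (t, x) \<Rightarrow> gateaux_deriv (V t) x h)"
    if "p \<in> {0..T} \<times> UNIV" for p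
    using that V_derivative(2)[of "fst p" "snd p"] by (auto simp: is_bint_def case_prod_beta')
  ultimately show ?thesis by (simp cong: continuous_on_cong)
qed

text \<open>The choice \<gamma> = \<alpha> / 2 is a compromise: the interpolated remainder has rate
  \<tau> powr (\<alpha> / 4 - 1), still integrable at 0, whereas \<gamma> = \<alpha> would lead to
  the exponent -1.\<close>

lemma V_derivative2:
  assumes t: "0 \<le> t" and \<alpha>0: "0 < \<alpha>"
  shows "has_gateaux_derivative (gateaux_deriv (V t)) (gateaux_deriv2 (V t) x) x"
    "is_bint (restrict_space lborel {0<..<t}) (\<lambda>\<tau>. DDw \<tau> t x k) (gateaux_deriv2 (V t) x k)"
proof -
  have "\<exists>A2 :: 'a \<Rightarrow> 'a \<Rightarrow>\<^sub>L 'a \<Rightarrow>\<^sub>L real. \<forall>x. (\<forall>k. is_bint (restrict_space lborel {0<..<t}) (\<lambda>\<tau>. DDw \<tau> t x k) (blinfun_apply (A2 x) k)) \<and>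
     has_gateaux_derivative (gateaux_deriv (V t)) (A2 x) x"
  proof (rule gateaux_integral2[where \<gamma>="\<alpha> / 2"])
    show "is_bint (restrict_space lborel {0<..<t}) (\<lambda>\<tau>. Dw \<tau> t x) (gateaux_deriv (V t) x)" for x
      by (rule V_derivative(2)[OF t])
    show "integrable (restrict_space lborel {0<..<t}) (\<lambda>\<tau>. 3072 * N * \<tau> powr ((\<alpha> - 2) / 2 - \<alpha> / 2 / 2))"
    proof -
      have "-1 < (\<alpha> - 2) / 2 - \<alpha> / 2 / 2" using \<alpha>0 by (simp add: field_simps)
      from powr_integral_from_0(1)[OF this t] show ?thesis by simp
    qed
    show "integrable (restrict_space lborel {0<..<t}) (\<lambda>\<tau>. 96 * N * \<tau> powr ((\<alpha> - 2) / 2))"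
      using powr_integral_from_0(1)[OF _ t, of "(\<alpha> - 2) / 2"] \<alpha>0 by simp
    fix \<tau> and x k :: 'a assume "\<tau> \<in> space (restrict_space lborel {0<..<t})"
    then have \<tau>: "0 < \<tau>" by simp
    show "norm (DDw \<tau> t x) \<le> 96 * N * \<tau> powr ((\<alpha> - 2) / 2)" by (rule DDw(3)[OF \<tau>])
    have e: "(\<alpha> - 3) / 2 = (\<alpha> - 2) / 2 - 1 / 2" by (simp add: field_simps)
    have pos: "0 \<le> \<tau> powr ((\<alpha> - 2) / 2) * norm k" by simp
    have "norm (Dw \<tau> t (x + k) - Dw \<tau> t x - DDw \<tau> t x k) \<le> norm (Dw \<tau> t (x + k) - Dw \<tau> t x) + norm (DDw \<tau> t x k)"
      by (rule norm_triangle_ineq4)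
    also have "\<dots> \<le> 96 * N * \<tau> powr ((\<alpha> - 2) / 2) * norm k + 96 * N * \<tau> powr ((\<alpha> - 2) / 2) * norm k"
      by (intro add_mono lip_boundD[OF Dw(4)[OF \<tau>]] order_trans[OF norm_blinfun] mult_right_mono DDw(3)[OF \<tau>]) simp
    also have "\<dots> \<le> 3072 * N * (\<tau> powr ((\<alpha> - 2) / 2) * norm k)"
      using mult_nonneg_nonneg[OF N pos] by (simp add: mult_ac)
    finally have 1: "norm (Dw \<tau> t (x + k) - Dw \<tau> t x - DDw \<tau> t x k) \<le> 3072 * N * (\<tau> powr ((\<alpha> - 2) / 2) * norm k)" .
    have pos2: "0 \<le> \<tau> powr ((\<alpha> - 3) / 2) * (norm k)\<^sup>2" by simp
    have 2: "norm (Dw \<tau> t (x + k) - Dw \<tau> t x - DDw \<tau> t x k) \<le> 3072 * N * (\<tau> powr ((\<alpha> - 2) / 2 - 1 / 2) * (norm k)\<^sup>2)"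
      using DDw(2)[OF \<tau>, of t x k] mult_nonneg_nonneg[OF N pos2] unfolding e[symmetric] by simp
    have "norm (Dw \<tau> t (x + k) - Dw \<tau> t x - DDw \<tau> t x k)
      \<le> 3072 * N * min (\<tau> powr ((\<alpha> - 2) / 2) * norm k) (\<tau> powr ((\<alpha> - 2) / 2 - 1 / 2) * (norm k)\<^sup>2)"
      using 1 2 by (simp add: min_def)
    also have "\<dots> \<le> 3072 * N * (\<tau> powr ((\<alpha> - 2) / 2 - \<alpha> / 2 / 2) * norm k powr (1 + \<alpha> / 2))"
      using \<alpha> N \<tau> by (intro mult_left_mono min_interpolation) auto
    finally show "norm (Dw \<tau> t (x + k) - Dw \<tau> t x - DDw \<tau> t x k) \<le> 3072 * N * \<tau> powr ((\<alpha> - 2) / 2 - \<alpha> / 2 / 2) * norm k powr (1 + \<alpha> / 2)"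
      by simp
  qed (use \<alpha>0 in simp)
  then obtain A2 :: "'a \<Rightarrow> 'a \<Rightarrow>\<^sub>L 'a \<Rightarrow>\<^sub>L real" where A: "\<And>x k. is_bint (restrict_space lborel {0<..<t}) (\<lambda>\<tau>. DDw \<tau> t x k) (A2 x k)"
    "\<And>x. has_gateaux_derivative (gateaux_deriv (V t)) (A2 x) x" by blast
  then have "gateaux_deriv2 (V t) x = A2 x" for x using gateaux_deriv_eq by blast
  then show "has_gateaux_derivative (gateaux_deriv (V t)) (gateaux_deriv2 (V t) x) x"
    "is_bint (restrict_space lborel {0<..<t}) (\<lambda>\<tau>. DDw \<tau> t x k) (gateaux_deriv2 (V t) x k)" using A by simp_all
qed

lemma DDV_bound:
  assumes t: "0 \<le> t" "t \<le> T" and \<alpha>0: "0 < \<alpha>"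
  shows "norm (gateaux_deriv2 (V t) x) \<le> 192 * N * T powr (\<alpha> / 2) / \<alpha>"
proof (rule norm_blinfun_bound)
  fix k :: 'a
  have p: "-1 < (\<alpha> - 2) / 2" using \<alpha>0 by simp
  have e: "(\<alpha> - 2) / 2 + 1 = \<alpha> / 2" by (simp add: field_simps)
  have i: "integrable (restrict_space lborel {0<..<t}) (\<lambda>\<tau>. 96 * N * \<tau> powr ((\<alpha> - 2) / 2) * norm k)"
    using powr_integral_from_0(1)[OF p t(1)] by simp
  have "norm (gateaux_deriv2 (V t) x k) \<le> (\<integral>\<tau>. 96 * N * \<tau> powr ((\<alpha> - 2) / 2) * norm k \<partial>restrict_space lborel {0<..<t})"
    by (rule is_bint_norm[OF V_derivative2(2)[OF t(1) \<alpha>0] i])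
      (intro order_trans[OF norm_blinfun] mult_right_mono DDw(3); simp)
  also have "\<dots> = 96 * N * (t powr (\<alpha> / 2) / (\<alpha> / 2)) * norm k"
    using powr_integral_from_0(2)[OF p t(1)] by (simp add: e)
  also have "\<dots> \<le> 96 * N * (T powr (\<alpha> / 2) / (\<alpha> / 2)) * norm k"
    using t \<alpha>0 N by (intro mult_right_mono mult_left_mono divide_right_mono powr_mono2) auto
  finally show "norm (gateaux_deriv2 (V t) x k) \<le> 192 * N * T powr (\<alpha> / 2) / \<alpha> * norm k" using \<alpha>0 by (simp add: field_simps)
qed (use N \<alpha>0 in simp)

text \<open>Below (norm h)^2 the two second derivatives are bounded separately, above it their
  difference by the Lipschitz bound. The parts give 2 / \<alpha> and 2 / (1 - \<alpha>), so this
  constant blows up at both ends of the range of \<alpha>.\<close>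

lemma DDV_holder:
  assumes t: "0 \<le> t" and \<alpha>0: "0 < \<alpha>"
  shows "norm (gateaux_deriv2 (V t) (x + h) - gateaux_deriv2 (V t) x) \<le> 3072 * N * (2 / \<alpha> + 2 / (1 - \<alpha>)) * norm h powr \<alpha>"
proof (cases "h = 0")
  case False
  then have h: "0 < norm h" by simp
  let ?p = "(\<alpha> - 2) / 2" and ?q = "(\<alpha> - 3) / 2"
  let ?m = "\<lambda>\<tau>. min (\<tau> powr ?p) (norm h * \<tau> powr ?q)"
  have mi: "integrable (restrict_space lborel {0<..<t}) ?m"
    "(\<integral>\<tau>. ?m \<tau> \<partial>restrict_space lborel {0<..<t}) \<le> (norm h)\<^sup>2 powr (?p + 1) / (?p + 1) - norm h * ((norm h)\<^sup>2 powr (?q + 1) / (?q + 1))"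
    by (rule min_powr_integral[where r="(norm h)\<^sup>2"]; use h t \<alpha> \<alpha>0 in simp)+
  have hp: "(norm h)\<^sup>2 powr r = norm h powr (2 * r)" for r using h by (simp add: powr_powr flip: powr_numeral)
  have "(norm h)\<^sup>2 powr (?p + 1) / (?p + 1) - norm h * ((norm h)\<^sup>2 powr (?q + 1) / (?q + 1)) = (2 / \<alpha> + 2 / (1 - \<alpha>)) * norm h powr \<alpha>"
  proof -
    have e1: "?p + 1 = \<alpha> / 2" and e2: "?q + 1 = (\<alpha> - 1) / 2" by (simp_all add: field_simps)
    have e3: "2 * (\<alpha> / 2) = \<alpha>" and e4: "2 * ((\<alpha> - 1) / 2) = \<alpha> - 1" by simp_all
    have 1: "norm h * norm h powr (\<alpha> - 1) = norm h powr \<alpha>" using h by (simp add: powr_diff)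
    have "norm h * (norm h powr (\<alpha> - 1) / ((\<alpha> - 1) / 2)) = (norm h * norm h powr (\<alpha> - 1)) / ((\<alpha> - 1) / 2)" by simp
    also have "\<dots> = norm h powr \<alpha> / ((\<alpha> - 1) / 2)" unfolding 1 ..
    also have "\<dots> = - (2 / (1 - \<alpha>)) * norm h powr \<alpha>"
      using \<alpha> by (simp add: field_simps)
    finally have 2: "norm h * (norm h powr (\<alpha> - 1) / ((\<alpha> - 1) / 2)) = - (2 / (1 - \<alpha>)) * norm h powr \<alpha>" .
    have 3: "norm h powr \<alpha> / (\<alpha> / 2) = 2 / \<alpha> * norm h powr \<alpha>" by simp
    show ?thesis unfolding e1 e2 hp e3 e4 2 3 by (simp only: distrib_right minus_mult_left[symmetric] diff_minus_eq_add)
  qed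
  then have mb: "(\<integral>\<tau>. ?m \<tau> \<partial>restrict_space lborel {0<..<t}) \<le> (2 / \<alpha> + 2 / (1 - \<alpha>)) * norm h powr \<alpha>" using mi(2) by simp
  show ?thesis
  proof (rule norm_blinfun_bound)
    show "0 \<le> 3072 * N * (2 / \<alpha> + 2 / (1 - \<alpha>)) * norm h powr \<alpha>" using N \<alpha> \<alpha>0 by simp
    fix k :: 'a
    have "norm (gateaux_deriv2 (V t) (x + h) k - gateaux_deriv2 (V t) x k) \<le> (\<integral>\<tau>. 3072 * N * ?m \<tau> * norm k \<partial>restrict_space lborel {0<..<t})"
    proof (rule is_bint_norm[OF is_bint_diff[OF V_derivative2(2)[OF t \<alpha>0] V_derivative2(2)[OF t \<alpha>0]]])
      show "integrable (restrict_space lborel {0<..<t}) (\<lambda>\<tau>. 3072 * N * ?m \<tau> * norm k)" using mi(1) by simp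
      fix \<tau> assume "\<tau> \<in> space (restrict_space lborel {0<..<t})"
      then have \<tau>: "0 < \<tau>" by simp
      have "norm (DDw \<tau> t (x + h) - DDw \<tau> t x) \<le> norm (DDw \<tau> t (x + h)) + norm (DDw \<tau> t x)" by (rule norm_triangle_ineq4)
      also have "\<dots> \<le> 96 * N * \<tau> powr ?p + 96 * N * \<tau> powr ?p" by (intro add_mono DDw(3)[OF \<tau>])
      also have "\<dots> \<le> 3072 * N * \<tau> powr ?p" using N by (simp add: mult_right_mono)
      finally have 1: "norm (DDw \<tau> t (x + h) - DDw \<tau> t x) \<le> 3072 * N * \<tau> powr ?p" .
      have 2: "norm (DDw \<tau> t (x + h) - DDw \<tau> t x) \<le> 3072 * N * (norm h * \<tau> powr ?q)"
        using lip_boundD[OF DDw(4)[OF \<tau>], of t x h] by (simp add: mult_ac)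
      have "norm (DDw \<tau> t (x + h) - DDw \<tau> t x) \<le> 3072 * N * ?m \<tau>" using 1 2 by (simp add: min_def)
      then show "norm (DDw \<tau> t (x + h) k - DDw \<tau> t x k) \<le> 3072 * N * ?m \<tau> * norm k"
        unfolding blinfun.diff_left[symmetric] by (intro order_trans[OF norm_blinfun] mult_right_mono) auto
    qed
    also have "\<dots> = 3072 * N * (\<integral>\<tau>. ?m \<tau> \<partial>restrict_space lborel {0<..<t}) * norm k" by simp
    also have "\<dots> \<le> 3072 * N * ((2 / \<alpha> + 2 / (1 - \<alpha>)) * norm h powr \<alpha>) * norm k"
      using N by (intro mult_right_mono mult_left_mono mb) auto
    finally show "norm ((gateaux_deriv2 (V t) (x + h) - gateaux_deriv2 (V t) x) k) \<le> 3072 * N * (2 / \<alpha> + 2 / (1 - \<alpha>)) * norm h powr \<alpha> * norm k"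
      by (simp add: blinfun.diff_left mult_ac)
  qed
qed simp

lemma DDV_continuous:
  assumes \<alpha>0: "0 < \<alpha>"
  shows "continuous_on ({0..T} \<times> UNIV) (\<lambda>(t, x). gateaux_deriv2 (V t) x h l)"
proof -
  have p: "-1 < (\<alpha> - 2) / 2" using \<alpha>0 by simp
  have "continuous_on ({0..T} \<times> UNIV) (\<lambda>p. \<integral>\<tau>. (case p of (t, x) \<Rightarrow> DDw \<tau> t x h l) \<partial>restrict_space lborel {0<..<fst p})"
  proof (rule continuous_on_parametric_integral[where G="\<lambda>\<tau>. 96 * N * \<tau> powr ((\<alpha> - 2) / 2) * norm h * norm l"])
    show "integrable (restrict_space lborel {0<..<T}) (\<lambda>\<tau>. 96 * N * \<tau> powr ((\<alpha> - 2) / 2) * norm h * norm l)"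
      using powr_integral_from_0(1)[OF p, of T] T by simp
    fix z :: "real \<times> 'a" assume "z \<in> {0..T} \<times> UNIV"
    then have z: "0 \<le> fst z" by auto
    show "(\<lambda>\<tau>. case z of (t, x) \<Rightarrow> DDw \<tau> t x h l) \<in> borel_measurable (restrict_space lborel {0<..<fst z})"
      using V_derivative2(2)[OF z \<alpha>0, of "snd z" h] unfolding is_bint_def case_prod_beta' by (blast intro: borel_measurable_integrable)
    fix \<tau> :: real assume \<tau>: "0 < \<tau>"
    have "norm (DDw \<tau> (fst z) (snd z) h l) \<le> 96 * N * \<tau> powr ((\<alpha> - 2) / 2) * norm h * norm l"
      by (intro order_trans[OF norm_blinfun] mult_right_mono DDw(3)[OF \<tau>]) simp_all
    then show "\<bar>case z of (t, x) \<Rightarrow> DDw \<tau> t x h l\<bar> \<le> 96 * N * \<tau> powr ((\<alpha> - 2) / 2) * norm h * norm l"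
      by (simp add: case_prod_beta')
  qed (use DDw_continuous in auto)
  moreover have "(\<integral>\<tau>. (case p of (t, x) \<Rightarrow> DDw \<tau> t x h l) \<partial>restrict_space lborel {0<..<fst p}) = (case p of (t, x) \<Rightarrow> gateaux_deriv2 (V t) x h l)"
    if "p \<in> {0..T} \<times> UNIV" for p
    using that V_derivative2(2)[OF _ \<alpha>0, of "fst p" "snd p" h] by (auto simp: is_bint_def case_prod_beta')
  ultimately show ?thesis by (simp cong: continuous_on_cong)
qed

end

section \<open>The initial datum\<close>

lemma has_gateaux_derivative_affine:
  assumes "has_gateaux_derivative F A (blinfun_apply B x + y)"
  shows "has_gateaux_derivative (\<lambda>x. F (blinfun_apply B x + y)) (A o\<^sub>L B) x"
proof -
  have e: "B (x + t *\<^sub>R h) + y = B x + y + t *\<^sub>R B h" for t h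
    by (simp add: blinfun.add_right blinfun.scaleR_right)
  show ?thesis using assms unfolding has_gateaux_derivative_def e blinfun_apply_blinfun_compose by blast
qed

text \<open>The bilinear form A with B inserted in both arguments, as it arises from differentiating
  an affine substitution twice.\<close>

definition pullback :: "('b::real_normed_vector \<Rightarrow>\<^sub>L 'b \<Rightarrow>\<^sub>L real) \<Rightarrow> ('a::real_normed_vector \<Rightarrow>\<^sub>L 'b) \<Rightarrow> ('a \<Rightarrow>\<^sub>L 'a \<Rightarrow>\<^sub>L real)" where
  "pullback A B = Blinfun (\<lambda>k. A (B k) o\<^sub>L B)"

lemma pullback_apply: "pullback A B k = A (B k) o\<^sub>L B"
proof -
  have "bounded_linear (\<lambda>k. A (B k) o\<^sub>L B)"
    by (rule bounded_linear_compose[OF bounded_bilinear.bounded_linear_left[OF bounded_bilinear_blinfun_compose]])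
      (intro bounded_linear_compose[OF blinfun.bounded_linear_right] blinfun.bounded_linear_right)
  then show ?thesis by (simp add: pullback_def bounded_linear_Blinfun_apply)
qed

lemma pullback_diff: "pullback A B - pullback A' B = pullback (A - A') B"
  by (intro blinfun_eqI) (simp add: pullback_apply blinfun.diff_left)

lemma norm_compose_contraction: "norm B \<le> 1 \<Longrightarrow> norm (A o\<^sub>L B) \<le> norm A"
  using norm_blinfun_compose[of A B] mult_left_mono[of "norm B" 1 "norm A"] by simp

lemma norm_pullback_contraction:
  assumes "norm B \<le> 1"
  shows "norm (pullback A B) \<le> norm A"
proof (rule norm_blinfun_bound)
  fix k
  have "norm (pullback A B k) \<le> norm (A (B k))" unfolding pullback_apply by (rule norm_compose_contraction[OF assms])
  also have "\<dots> \<le> norm A * (norm B * norm k)"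
    by (intro order_trans[OF norm_blinfun] mult_left_mono norm_blinfun) simp
  also have "\<dots> \<le> norm A * (1 * norm k)" using assms by (intro mult_left_mono mult_right_mono) auto
  finally show "norm (pullback A B k) \<le> norm A * norm k" by simp
qed simp

text \<open>Mean value inequality along the segment for F minus its linear part at x; only Gateaux
  differentiability is required, since the segment has a single direction.\<close>

lemma gateaux_remainder_holder:
  fixes F :: "'a::real_normed_vector \<Rightarrow> 'b::real_normed_vector"
  assumes D: "\<And>x. has_gateaux_derivative F (D x) x"
    and H: "\<And>x h. norm (D (x + h) - D x) \<le> H * norm h powr \<alpha>" and H0: "0 \<le> H" and \<alpha>: "0 < \<alpha>"
  shows "norm (F (x + k) - F x - D x k) \<le> H * norm k powr (1 + \<alpha>)"
proof -
  let ?g = "\<lambda>r. F (x + r *\<^sub>R k) - r *\<^sub>R D x k"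
  have "norm (?g 1 - ?g 0) \<le> (H * norm k powr (1 + \<alpha>)) * norm (1 - 0 :: real)"
  proof (rule differentiable_bound[where S="{0..1}"])
    fix r :: real assume r: "r \<in> {0..1}"
    have "((\<lambda>r. F (x + r *\<^sub>R k)) has_vector_derivative D (x + r *\<^sub>R k) k) (at r within {0..1})"
      by (rule has_vector_derivative_at_within[OF has_gateaux_derivative_line[OF D]])
    then have "(?g has_vector_derivative D (x + r *\<^sub>R k) k - D x k) (at r within {0..1})"
      by (auto intro!: derivative_eq_intros)
    then show "(?g has_derivative (\<lambda>s. s *\<^sub>R (D (x + r *\<^sub>R k) k - D x k))) (at r within {0..1})"
      unfolding has_vector_derivative_def .
    have "norm ((D (x + r *\<^sub>R k) - D x) k) \<le> H * norm (r *\<^sub>R k) powr \<alpha> * norm k"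
      by (intro order_trans[OF norm_blinfun] mult_right_mono H) simp
    also have "\<dots> \<le> H * norm k powr \<alpha> * norm k"
      using r \<alpha> H0 by (intro mult_right_mono mult_left_mono powr_mono2) (auto intro: mult_left_le_one_le)
    also have "\<dots> = H * norm k powr (1 + \<alpha>)" by (cases "k = 0") (simp_all add: powr_add)
    finally have "norm (D (x + r *\<^sub>R k) k - D x k) \<le> H * norm k powr (1 + \<alpha>)" by (simp add: blinfun.diff_left)
    then show "onorm (\<lambda>s. s *\<^sub>R (D (x + r *\<^sub>R k) k - D x k)) \<le> H * norm k powr (1 + \<alpha>)"
      by (intro onorm_le) (simp add: mult.commute mult_left_mono)
  qed auto
  then show ?thesis by (simp add: algebra_simps)
qed

text \<open>Derivatives of \<open>C1b\<close> functions are continuous only direction by direction.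
  A uniform norm bound allows the direction to move as well, as it does in S t h.\<close>

lemma continuous_on_strong_apply:
  fixes A :: "'a::metric_space \<Rightarrow> 'b::real_normed_vector \<Rightarrow>\<^sub>L 'c::real_normed_vector"
  assumes A: "\<And>h. continuous_on U (\<lambda>x. A x h)" and B: "\<And>x. norm (A x) \<le> B"
    and v: "continuous_on U v"
  shows "continuous_on U (\<lambda>x. A x (v x))"
  unfolding continuous_on_def
proof
  fix x assume x: "x \<in> U"
  have v': "(v \<longlongrightarrow> v x) (at x within U)" using v x by (simp add: continuous_on_def)
  have "((\<lambda>y. A y (v y - v x)) \<longlongrightarrow> 0) (at x within U)"
  proof (rule Lim_null_comparison)
    show "\<forall>\<^sub>F y in at x within U. norm (A y (v y - v x)) \<le> B * norm (v y - v x)"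
      by (intro always_eventually allI order_trans[OF norm_blinfun] mult_right_mono B) simp
    show "((\<lambda>y. B * norm (v y - v x)) \<longlongrightarrow> 0) (at x within U)"
      by (rule tendsto_mult_right_zero, rule tendsto_norm_zero) (use v' in \<open>simp add: LIM_zero_iff\<close>)
  qed
  moreover have "((\<lambda>y. A y (v x)) \<longlongrightarrow> A x (v x)) (at x within U)" using A x by (simp add: continuous_on_def)
  ultimately have "((\<lambda>y. A y (v y - v x) + A y (v x)) \<longlongrightarrow> 0 + A x (v x)) (at x within U)" by (rule tendsto_add)
  then show "((\<lambda>y. A y (v y)) \<longlongrightarrow> A x (v x)) (at x within U)" by (simp add: blinfun.diff_right)
qed

context ou_semigroup
begin

lemma norm_S: "0 \<le> t \<Longrightarrow> norm (S t) \<le> 1"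
  by (rule norm_blinfun_bound) (use S_contraction in auto)

lemma integral_\<mu>_const: "0 \<le> t \<Longrightarrow> integrable (\<mu> t) (\<lambda>y. a :: real) \<and> (\<integral>y. a \<partial>\<mu> t) = a"
  using prob_space.prob_space[OF prob[of t]] prob_space.finite_measure[OF prob[of t]]
  by (simp add: finite_measure.integrable_const)

lemma mehler_time_continuous:
  assumes "cb M f" shows "continuous_on ({0..T} \<times> UNIV) (\<lambda>(t, x). mehler S \<mu> t f x)"
proof -
  have "continuous_on UNIV (\<lambda>p :: real \<times> 'a. f (snd p))"
    using assms by (intro continuous_on_compose2[of UNIV f _ snd]) (simp_all add: cb_def continuous_on_snd)
  then have "continuous_on ({0..} \<times> UNIV) (E (\<lambda>p. f (snd p)))"
    by (rule E_continuous[where M=M]) (use assms in \<open>simp add: cb_def\<close>)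
  then have "continuous_on ({0..T} \<times> UNIV) (\<lambda>p. E (\<lambda>p. f (snd p)) (fst p, 0, snd p))"
    by (rule continuous_on_compose2) (auto intro!: continuous_intros)
  then show ?thesis by (simp add: E_def mehler_def case_prod_beta')
qed

end

locale ou_initial = ou_semigroup S \<mu> c s
  for S :: "real \<Rightarrow> 'a::{real_inner, banach, second_countable_topology} \<Rightarrow>\<^sub>L 'a" and \<mu> c s +
  fixes f :: "'a \<Rightarrow> real" and M\<^sub>0 M\<^sub>1 :: real
  assumes f_cb: "cb M\<^sub>0 f" and f_diff: "\<And>x. gateaux_differentiable f x"
    and Df_cont: "\<And>h. continuous_on UNIV (\<lambda>x. gateaux_deriv f x h)" and Df_bound: "\<And>x. norm (gateaux_deriv f x) \<le> M\<^sub>1"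
begin

lemma Df: "has_gateaux_derivative f (gateaux_deriv f x) x"
  by (rule has_gateaux_derivative_gateaux_deriv[OF f_diff])

abbreviation "U t \<equiv> mehler S \<mu> t f"

lemma DU:
  assumes t: "0 \<le> t"
  shows "has_gateaux_derivative (U t) (gateaux_deriv (U t) x) x"
    "is_bint (\<mu> t) (\<lambda>y. gateaux_deriv f (S t x + y) o\<^sub>L S t) (gateaux_deriv (U t) x)"
proof -
  have "\<exists>A. \<forall>x. is_bint (\<mu> t) (\<lambda>y. gateaux_deriv f (S t x + y) o\<^sub>L S t) (A x) \<and>
    has_gateaux_derivative (\<lambda>x. \<integral>y. f (S t x + y) \<partial>\<mu> t) (A x) x"
  proof (rule gateaux_integral[where G="\<lambda>_. M\<^sub>1"])
    show "has_gateaux_derivative (\<lambda>x. f (S t x + y)) (gateaux_deriv f (S t x + y) o\<^sub>L S t) x" for x y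
      by (rule has_gateaux_derivative_affine[OF Df])
    show "norm (gateaux_deriv f (S t x + y) o\<^sub>L S t) \<le> M\<^sub>1" for x y
      by (rule order_trans[OF norm_compose_contraction[OF norm_S[OF t]] Df_bound])
  qed (use integral_\<mu>_const[OF t] cb_integrable_shift[OF t f_cb] in auto)
  then obtain A where A: "\<And>x. is_bint (\<mu> t) (\<lambda>y. gateaux_deriv f (S t x + y) o\<^sub>L S t) (A x)"
    "\<And>x. has_gateaux_derivative (U t) (A x) x" unfolding mehler_def[abs_def] by blast
  then have "gateaux_deriv (U t) x = A x" for x using gateaux_deriv_eq by blast
  then show "has_gateaux_derivative (U t) (gateaux_deriv (U t) x) x"
    "is_bint (\<mu> t) (\<lambda>y. gateaux_deriv f (S t x + y) o\<^sub>L S t) (gateaux_deriv (U t) x)" using A by simp_all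
qed

lemma DU_bound:
  assumes t: "0 \<le> t"
  shows "norm (gateaux_deriv (U t) x) \<le> M\<^sub>1"
proof -
  have "norm (gateaux_deriv (U t) x) \<le> (\<integral>y. M\<^sub>1 \<partial>\<mu> t)"
    using integral_\<mu>_const[OF t, of M\<^sub>1] order_trans[OF norm_compose_contraction[OF norm_S[OF t]] Df_bound]
    by (intro is_bint_norm[OF DU(2)[OF t]]) auto
  also have "\<dots> = M\<^sub>1" using integral_\<mu>_const[OF t, of M\<^sub>1] by (rule conjunct2)
  finally show ?thesis .
qed

lemma DU_zygmund:
  assumes t: "0 \<le> t" and Z: "\<And>x h. norm (gateaux_deriv f (x + 2 *\<^sub>R h) - 2 *\<^sub>R gateaux_deriv f (x + h) + gateaux_deriv f x) \<le> Z * norm h"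
    and Z0: "0 \<le> Z"
  shows "norm (gateaux_deriv (U t) (x + 2 *\<^sub>R h) - 2 *\<^sub>R gateaux_deriv (U t) (x + h) + gateaux_deriv (U t) x) \<le> Z * norm h"
proof -
  have b: "is_bint (\<mu> t) (\<lambda>y. (gateaux_deriv f (S t (x + 2 *\<^sub>R h) + y) o\<^sub>L S t) - 2 *\<^sub>R (gateaux_deriv f (S t (x + h) + y) o\<^sub>L S t) + (gateaux_deriv f (S t x + y) o\<^sub>L S t))
     (gateaux_deriv (U t) (x + 2 *\<^sub>R h) - 2 *\<^sub>R gateaux_deriv (U t) (x + h) + gateaux_deriv (U t) x)"
    by (intro is_bint_add is_bint_diff is_bint_scale DU(2) t)
  have "norm ((gateaux_deriv f (S t (x + 2 *\<^sub>R h) + y) o\<^sub>L S t) - 2 *\<^sub>R (gateaux_deriv f (S t (x + h) + y) o\<^sub>L S t) + (gateaux_deriv f (S t x + y) o\<^sub>L S t)) \<le> Z * norm h" for y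
  proof -
    let ?z = "S t x + y"
    have e: "S t (x + 2 *\<^sub>R h) + y = ?z + 2 *\<^sub>R S t h" "S t (x + h) + y = ?z + S t h"
      by (simp_all add: blinfun.add_right blinfun.scaleR_right)
    have "(gateaux_deriv f (S t (x + 2 *\<^sub>R h) + y) o\<^sub>L S t) - 2 *\<^sub>R (gateaux_deriv f (S t (x + h) + y) o\<^sub>L S t) + (gateaux_deriv f (S t x + y) o\<^sub>L S t)
      = (gateaux_deriv f (?z + 2 *\<^sub>R S t h) - 2 *\<^sub>R gateaux_deriv f (?z + S t h) + gateaux_deriv f ?z) o\<^sub>L S t"
      unfolding e by (rule blinfun_eqI) (simp add: blinfun.diff_left blinfun.add_left blinfun.scaleR_left)
    then have "norm ((gateaux_deriv f (S t (x + 2 *\<^sub>R h) + y) o\<^sub>L S t) - 2 *\<^sub>R (gateaux_deriv f (S t (x + h) + y) o\<^sub>L S t) + (gateaux_deriv f (S t x + y) o\<^sub>L S t))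
      \<le> norm (gateaux_deriv f (?z + 2 *\<^sub>R S t h) - 2 *\<^sub>R gateaux_deriv f (?z + S t h) + gateaux_deriv f ?z)"
      using norm_compose_contraction[OF norm_S[OF t]] by simp
    also have "\<dots> \<le> Z * norm (S t h)" by (rule Z)
    also have "\<dots> \<le> Z * norm h" using S_contraction[OF t] Z0 by (intro mult_left_mono)
    finally show ?thesis .
  qed
  then show ?thesis using is_bint_norm[OF b, of "\<lambda>_. Z * norm h"] integral_\<mu>_const[OF t, of "Z * norm h"] by auto
qed

lemma DU_continuous: "continuous_on ({0..T} \<times> UNIV) (\<lambda>(t, x). gateaux_deriv (U t) x h)"
proof -
  \<comment> \<open>The derivative is applied to the moving direction S t h, so the time enters
    twice, the second time through the parameter slot of \<open>E\<close>. The cut-off at 0 makes G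
    continuous everywhere, S being unconstrained at negative times.\<close>
  define G where "G p = gateaux_deriv f (snd p) (S (max 0 (fst p)) h)" for p :: "real \<times> 'a"
  have "continuous_on UNIV G" unfolding G_def
  proof (rule continuous_on_strong_apply[OF _ Df_bound])
    show "continuous_on UNIV (\<lambda>p :: real \<times> 'a. gateaux_deriv f (snd p) h)" for h
      by (rule continuous_on_compose2[OF Df_cont]) (auto intro!: continuous_intros)
    show "continuous_on UNIV (\<lambda>p :: real \<times> 'a. S (max 0 (fst p)) h)"
      by (rule continuous_on_compose2[OF S_continuous]) (auto intro!: continuous_intros)
  qed
  then have "continuous_on ({0..} \<times> UNIV) (E G)"
  proof (rule E_continuous)
    fix p
    have "norm (G p) \<le> M\<^sub>1 * norm (S (max 0 (fst p)) h)"
      unfolding G_def by (intro order_trans[OF norm_blinfun] mult_right_mono Df_bound) simp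
    also have "\<dots> \<le> M\<^sub>1 * norm h"
      using order_trans[OF norm_ge_zero Df_bound] by (intro mult_left_mono S_contraction) auto
    finally show "\<bar>G p\<bar> \<le> M\<^sub>1 * norm h" by simp
  qed
  then have "continuous_on ({0..T} \<times> UNIV) (\<lambda>p. E G (fst p, fst p, snd p))"
    by (rule continuous_on_compose2) (auto intro!: continuous_intros)
  moreover have "E G (t, t, x) = gateaux_deriv (U t) x h" if "0 \<le> t" for t x
    using DU(2)[OF that, of x] that by (simp add: E_def G_def is_bint_def)
  ultimately show ?thesis
    by (auto simp: case_prod_beta' intro: continuous_on_eq)
qed

end

locale ou_initial2 = ou_initial S \<mu> c s f M\<^sub>0 M\<^sub>1
  for S :: "real \<Rightarrow> 'a::{real_inner, banach, second_countable_topology} \<Rightarrow>\<^sub>L 'a" and \<mu> c s f M\<^sub>0 M\<^sub>1 +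
  fixes M\<^sub>2 H \<alpha> :: real
  assumes f_diff2: "\<And>x. gateaux_differentiable (gateaux_deriv f) x"
    and D2f_bound: "\<And>x. norm (gateaux_deriv2 f x) \<le> M\<^sub>2"
    and D2f_holder: "\<And>x h. norm (gateaux_deriv2 f (x + h) - gateaux_deriv2 f x) \<le> H * norm h powr \<alpha>"
    and H: "0 \<le> H" and \<alpha>: "0 < \<alpha>"
begin

lemma D2f: "has_gateaux_derivative (gateaux_deriv f) (gateaux_deriv2 f x) x"
  by (rule has_gateaux_derivative_gateaux_deriv[OF f_diff2])

lemma D2U:
  assumes t: "0 \<le> t"
  shows "has_gateaux_derivative (gateaux_deriv (U t)) (gateaux_deriv2 (U t) x) x"
    "is_bint (\<mu> t) (\<lambda>y. pullback (gateaux_deriv2 f (S t x + y)) (S t) k) (gateaux_deriv2 (U t) x k)"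
proof -
  have "\<exists>A2 :: 'a \<Rightarrow> 'a \<Rightarrow>\<^sub>L 'a \<Rightarrow>\<^sub>L real. \<forall>x. (\<forall>k. is_bint (\<mu> t) (\<lambda>y. pullback (gateaux_deriv2 f (S t x + y)) (S t) k) (blinfun_apply (A2 x) k)) \<and>
     has_gateaux_derivative (gateaux_deriv (U t)) (A2 x) x"
  \<comment> \<open>The full exponent \<alpha> is available here: the remainder is uniform in y, and
    a constant is integrable under a probability measure.\<close>
  proof (rule gateaux_integral2[where \<gamma>=\<alpha> and G="\<lambda>_. M\<^sub>2" and H="\<lambda>_. H"])
    show "is_bint (\<mu> t) (\<lambda>y. gateaux_deriv f (S t x + y) o\<^sub>L S t) (gateaux_deriv (U t) x)" for x
      by (rule DU(2)[OF t])
    show "norm (pullback (gateaux_deriv2 f (S t x + y)) (S t)) \<le> M\<^sub>2" for x y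
      by (rule order_trans[OF norm_pullback_contraction[OF norm_S[OF t]] D2f_bound])
    fix y x k :: 'a
    let ?z = "S t x + y"
    have "(gateaux_deriv f (S t (x + k) + y) o\<^sub>L S t) - (gateaux_deriv f ?z o\<^sub>L S t) - pullback (gateaux_deriv2 f ?z) (S t) k
      = (gateaux_deriv f (?z + S t k) - gateaux_deriv f ?z - gateaux_deriv2 f ?z (S t k)) o\<^sub>L S t"
      by (rule blinfun_eqI) (simp add: pullback_apply blinfun.diff_left blinfun.add_right add_ac)
    then have "norm ((gateaux_deriv f (S t (x + k) + y) o\<^sub>L S t) - (gateaux_deriv f ?z o\<^sub>L S t) - pullback (gateaux_deriv2 f ?z) (S t) k)
      \<le> norm (gateaux_deriv f (?z + S t k) - gateaux_deriv f ?z - gateaux_deriv2 f ?z (S t k))"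
      using norm_compose_contraction[OF norm_S[OF t]] by simp
    also have "\<dots> \<le> H * norm (S t k) powr (1 + \<alpha>)" by (rule gateaux_remainder_holder[OF D2f D2f_holder H \<alpha>])
    also have "\<dots> \<le> H * norm k powr (1 + \<alpha>)"
      using H \<alpha> S_contraction[OF t] by (intro mult_left_mono powr_mono2) auto
    finally show "norm ((gateaux_deriv f (S t (x + k) + y) o\<^sub>L S t) - (gateaux_deriv f ?z o\<^sub>L S t) - pullback (gateaux_deriv2 f ?z) (S t) k)
      \<le> H * norm k powr (1 + \<alpha>)" .
  qed (use integral_\<mu>_const[OF t] \<alpha> in auto)
  then obtain A2 :: "'a \<Rightarrow> 'a \<Rightarrow>\<^sub>L 'a \<Rightarrow>\<^sub>L real" where A: "\<And>x k. is_bint (\<mu> t) (\<lambda>y. pullback (gateaux_deriv2 f (S t x + y)) (S t) k) (A2 x k)"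
    "\<And>x. has_gateaux_derivative (gateaux_deriv (U t)) (A2 x) x" by blast
  then have "gateaux_deriv2 (U t) x = A2 x" for x using gateaux_deriv_eq by blast
  then show "has_gateaux_derivative (gateaux_deriv (U t)) (gateaux_deriv2 (U t) x) x"
    "is_bint (\<mu> t) (\<lambda>y. pullback (gateaux_deriv2 f (S t x + y)) (S t) k) (gateaux_deriv2 (U t) x k)" using A by simp_all
qed

lemma D2U_bound:
  assumes t: "0 \<le> t"
  shows "norm (gateaux_deriv2 (U t) x) \<le> M\<^sub>2"
proof (rule norm_blinfun_bound)
  show "0 \<le> M\<^sub>2" using order_trans[OF norm_ge_zero D2f_bound] .
  fix k :: 'a
  have "norm (pullback (gateaux_deriv2 f (S t x + y)) (S t) k) \<le> M\<^sub>2 * norm k" for y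
    by (intro order_trans[OF norm_blinfun] mult_right_mono order_trans[OF norm_pullback_contraction[OF norm_S[OF t]] D2f_bound]) simp
  then show "norm (gateaux_deriv2 (U t) x k) \<le> M\<^sub>2 * norm k"
    using is_bint_norm[OF D2U(2)[OF t], of "\<lambda>_. M\<^sub>2 * norm k"] integral_\<mu>_const[OF t, of "M\<^sub>2 * norm k"] by auto
qed

lemma D2U_holder:
  assumes t: "0 \<le> t"
  shows "norm (gateaux_deriv2 (U t) (x + h) - gateaux_deriv2 (U t) x) \<le> H * norm h powr \<alpha>"
proof (rule norm_blinfun_bound)
  show "0 \<le> H * norm h powr \<alpha>" using H by simp
  fix k :: 'a
  have "norm (pullback (gateaux_deriv2 f (S t (x + h) + y)) (S t) k - pullback (gateaux_deriv2 f (S t x + y)) (S t) k) \<le> H * norm h powr \<alpha> * norm k" for y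
  proof -
    have "norm (pullback (gateaux_deriv2 f (S t (x + h) + y) - gateaux_deriv2 f (S t x + y)) (S t)) \<le> norm (gateaux_deriv2 f (S t (x + h) + y) - gateaux_deriv2 f (S t x + y))"
      by (rule norm_pullback_contraction[OF norm_S[OF t]])
    also have "\<dots> \<le> H * norm (S t h) powr \<alpha>"
      using D2f_holder[of "S t x + y" "S t h"] by (simp add: blinfun.add_right add_ac)
    also have "\<dots> \<le> H * norm h powr \<alpha>"
      using H \<alpha> S_contraction[OF t] by (intro mult_left_mono powr_mono2) auto
    finally show ?thesis unfolding blinfun.diff_left[symmetric] pullback_diff
      by (intro order_trans[OF norm_blinfun] mult_right_mono) auto
  qed
  then show "norm ((gateaux_deriv2 (U t) (x + h) - gateaux_deriv2 (U t) x) k) \<le> H * norm h powr \<alpha> * norm k"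
    using is_bint_norm[OF is_bint_diff[OF D2U(2)[OF t] D2U(2)[OF t]], of "\<lambda>_. H * norm h powr \<alpha> * norm k" "x + h" k x k]
      integral_\<mu>_const[OF t, of "H * norm h powr \<alpha> * norm k"] by (auto simp: blinfun.diff_left)
qed

lemma D2f_continuous: "continuous_on UNIV (gateaux_deriv2 f)"
  unfolding continuous_on_def
proof
  fix x
  have "((\<lambda>y. gateaux_deriv2 f y - gateaux_deriv2 f x) \<longlongrightarrow> 0) (at x)"
  proof (rule Lim_null_comparison)
    show "\<forall>\<^sub>F y in at x. norm (gateaux_deriv2 f y - gateaux_deriv2 f x) \<le> H * norm (y - x) powr \<alpha>"
      using D2f_holder[of x "_ - x"] by simp
    have "((\<lambda>y. norm (y - x) powr \<alpha>) \<longlongrightarrow> 0 powr \<alpha>) (at x)"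
      using \<alpha> by (intro tendsto_powr' tendsto_norm_zero LIM_zero tendsto_ident_at tendsto_const) auto
    then show "((\<lambda>y. H * norm (y - x) powr \<alpha>) \<longlongrightarrow> 0) (at x)"
      using \<alpha> by (intro tendsto_mult_right_zero) simp
  qed
  then show "(gateaux_deriv2 f \<longlongrightarrow> gateaux_deriv2 f x) (at x)" by (rule LIM_zero_cancel)
qed

lemma D2U_continuous: "continuous_on ({0..T} \<times> UNIV) (\<lambda>(t, x). gateaux_deriv2 (U t) x k l)"
proof -
  define G where "G p = gateaux_deriv2 f (snd p) (S (max 0 (fst p)) k) (S (max 0 (fst p)) l)" for p :: "real \<times> 'a"
  have Sc: "continuous_on UNIV (\<lambda>p :: real \<times> 'a. S (max 0 (fst p)) h)" for h
    by (rule continuous_on_compose2[OF S_continuous]) (auto intro!: continuous_intros)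
  have "continuous_on UNIV G" unfolding G_def
    by (intro continuous_intros Sc continuous_on_compose2[OF D2f_continuous, of _ snd]) auto
  then have "continuous_on ({0..} \<times> UNIV) (E G)"
  proof (rule E_continuous)
    fix p
    have "norm (G p) \<le> norm (gateaux_deriv2 f (snd p) (S (max 0 (fst p)) k)) * norm (S (max 0 (fst p)) l)"
      unfolding G_def by (rule norm_blinfun)
    also have "\<dots> \<le> (M\<^sub>2 * norm k) * norm l"
    proof (intro mult_mono)
      have "norm (gateaux_deriv2 f (snd p) (S (max 0 (fst p)) k)) \<le> M\<^sub>2 * norm (S (max 0 (fst p)) k)"
        by (intro order_trans[OF norm_blinfun] mult_right_mono D2f_bound) simp
      also have "\<dots> \<le> M\<^sub>2 * norm k"
        using order_trans[OF norm_ge_zero D2f_bound] by (intro mult_left_mono S_contraction) auto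
      finally show "norm (gateaux_deriv2 f (snd p) (S (max 0 (fst p)) k)) \<le> M\<^sub>2 * norm k" .
    qed (use order_trans[OF norm_ge_zero D2f_bound] S_contraction in auto)
    finally show "\<bar>G p\<bar> \<le> (M\<^sub>2 * norm k) * norm l" by simp
  qed
  then have "continuous_on ({0..T} \<times> UNIV) (\<lambda>p. E G (fst p, fst p, snd p))"
    by (rule continuous_on_compose2) (auto intro!: continuous_intros)
  moreover have "E G (t, t, x) = gateaux_deriv2 (U t) x k l" if "0 \<le> t" for t x
    using D2U(2)[OF that, of x k] that by (simp add: E_def G_def is_bint_def pullback_apply)
  ultimately show ?thesis
    by (auto simp: case_prod_beta' intro: continuous_on_eq)
qed

end

section \<open>Membership in the function spaces\<close>

lemma sup_norm_leI: "(\<And>x. norm (F x) \<le> B) \<Longrightarrow> sup_norm F \<le> ennreal B"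
  unfolding sup_norm_def by (intro SUP_least ennreal_leI)

lemma sup_norm_upper: "ennreal (norm (F x)) \<le> sup_norm F"
  unfolding sup_norm_def by (rule SUP_upper) simp

lemma norm_le_enn2real: "ennreal r \<le> K \<Longrightarrow> K < \<infinity> \<Longrightarrow> r \<le> enn2real K"
  by (cases K; cases "0 \<le> r") (auto simp: ennreal_neg)

lemma sup_norm_bound: "sup_norm F < \<infinity> \<Longrightarrow> norm (F x) \<le> enn2real (sup_norm F)"
  by (rule norm_le_enn2real[OF sup_norm_upper])

lemma holder_seminorm_leI:
  assumes "\<And>x h. norm (F (x + h) - F x) \<le> B * norm h powr \<alpha>"
  shows "holder_seminorm \<alpha> F \<le> ennreal B"
  unfolding holder_seminorm_def using assms by (intro SUP_least ennreal_leI) (simp add: pos_divide_le_eq)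

lemma holder_seminorm_bound:
  assumes "holder_seminorm \<alpha> F < \<infinity>"
  shows "norm (F (x + h) - F x) \<le> enn2real (holder_seminorm \<alpha> F) * norm h powr \<alpha>"
proof (cases "h = 0")
  case False
  then have "ennreal (norm (F (x + h) - F x) / norm h powr \<alpha>) \<le> holder_seminorm \<alpha> F"
    unfolding holder_seminorm_def by (intro SUP_upper2[of x] SUP_upper2[of h]) auto
  from norm_le_enn2real[OF this assms] False show ?thesis by (simp add: pos_divide_le_eq)
qed simp

lemma zygmund_seminorm_leI:
  assumes "\<And>x h. norm (F (x + 2 *\<^sub>R h) - 2 *\<^sub>R F (x + h) + F x) \<le> B * norm h"
  shows "zygmund_seminorm F \<le> ennreal B"
  unfolding zygmund_seminorm_def using assms by (intro SUP_least ennreal_leI) (simp add: pos_divide_le_eq)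

lemma zygmund_seminorm_bound:
  assumes "zygmund_seminorm F < \<infinity>"
  shows "norm (F (x + 2 *\<^sub>R h) - 2 *\<^sub>R F (x + h) + F x) \<le> enn2real (zygmund_seminorm F) * norm h"
proof (cases "h = 0")
  case True
  then show ?thesis by (simp add: scaleR_2)
next
  case False
  then have "ennreal (norm (F (x + 2 *\<^sub>R h) - 2 *\<^sub>R F (x + h) + F x) / norm h) \<le> zygmund_seminorm F"
    unfolding zygmund_seminorm_def by (intro SUP_upper2[of x] SUP_upper2[of h]) auto
  from norm_le_enn2real[OF this assms] False show ?thesis by (simp add: pos_divide_le_eq)
qed

lemma bcontfun_realI:
  assumes "continuous_on UNIV (f :: 'a::topological_space \<Rightarrow> real)" "\<And>x. \<bar>f x\<bar> \<le> B"
  shows "f \<in> bcontfun"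
  unfolding bcontfun_def using assms by (auto intro!: boundedI[where B=B])

lemma bcontfun_bounded: "f \<in> bcontfun \<Longrightarrow> \<exists>B. \<forall>x. \<bar>f x :: real\<bar> \<le> B"
  unfolding bcontfun_def by (auto simp: bounded_iff)

lemma bcontfun_continuous: "f \<in> bcontfun \<Longrightarrow> continuous_on UNIV f"
  by (simp add: bcontfun_def)

lemma sup_norm_finite: "f \<in> bcontfun \<Longrightarrow> sup_norm (f :: 'a::topological_space \<Rightarrow> real) < \<infinity>"
proof -
  assume "f \<in> bcontfun"
  then obtain B where "\<And>x. \<bar>f x\<bar> \<le> B" using bcontfun_bounded by blast
  then show ?thesis by (intro le_less_trans[OF sup_norm_leI]) auto
qed

text \<open>Membership in \<open>C1b\<close> only demands boundedness in each direction; the uniform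
  boundedness principle makes the norm finite, so that its real value can serve as a bound.\<close>

lemma sup_norm_gateaux_deriv_finite:
  fixes f :: "'a::banach \<Rightarrow> real"
  assumes "f \<in> C1b" shows "sup_norm (gateaux_deriv f) < \<infinity>"
proof -
  have "\<exists>B. \<forall>x\<in>UNIV. norm (gateaux_deriv f x h) \<le> B" for h
    using assms unfolding C1b_def by (auto intro: bcontfun_bounded)
  then have "\<exists>B. \<forall>x\<in>UNIV. norm (gateaux_deriv f x) \<le> B" by (rule uniform_boundedness)
  then obtain B where "\<And>x. norm (gateaux_deriv f x) \<le> B" by blast
  then show ?thesis by (intro le_less_trans[OF sup_norm_leI]) auto
qed

lemma sup_norm_gateaux_deriv2_finite:
  fixes f :: "'a::banach \<Rightarrow> real"
  assumes "f \<in> C2b" shows "sup_norm (gateaux_deriv2 f) < \<infinity>"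
proof -
  have "\<exists>B. \<forall>x\<in>UNIV. norm (gateaux_deriv2 f x h k) \<le> B" for h k
    using assms unfolding C2b_def by (auto intro: bcontfun_bounded)
  then have "\<exists>B. \<forall>x\<in>UNIV. norm (gateaux_deriv2 f x h) \<le> B" for h by (rule uniform_boundedness)
  then have "\<exists>B. \<forall>x\<in>UNIV. norm (gateaux_deriv2 f x) \<le> B" by (rule uniform_boundedness)
  then obtain B where "\<And>x. norm (gateaux_deriv2 f x) \<le> B" by blast
  then show ?thesis by (intro le_less_trans[OF sup_norm_leI]) auto
qed

lemma continuous_on_slice:
  "continuous_on (I \<times> UNIV) (\<lambda>(t, x). F t x) \<Longrightarrow> t \<in> I \<Longrightarrow> continuous_on UNIV (F t)"
  by (drule continuous_on_compose2[where f="\<lambda>x. (t, x)" and s=UNIV]) (auto intro!: continuous_intros)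

lemma Cb_timeI:
  assumes "continuous_on ({0..T} \<times> UNIV) (\<lambda>(t, x). v t x)" "\<And>t x. t \<in> {0..T} \<Longrightarrow> \<bar>v t x\<bar> \<le> B"
  shows "v \<in> Cb_time T"
  unfolding Cb_time_def using assms by (auto intro!: boundedI[where B=B])

lemma C1bI:
  assumes c: "continuous_on UNIV f" and b: "\<And>x. \<bar>f x\<bar> \<le> B0"
    and D: "\<And>x. gateaux_differentiable f x" "\<And>h. continuous_on UNIV (\<lambda>x. gateaux_deriv f x h)" "\<And>x. norm (gateaux_deriv f x) \<le> B1"
  shows "f \<in> C1b"
proof -
  have "(\<lambda>x. gateaux_deriv f x h) \<in> bcontfun" for h
  proof (rule bcontfun_realI[OF D(2)])
    fix x
    have "norm (gateaux_deriv f x h) \<le> B1 * norm h" by (intro order_trans[OF norm_blinfun] mult_right_mono D) simp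
    then show "\<bar>gateaux_deriv f x h\<bar> \<le> B1 * norm h" by simp
  qed
  then show ?thesis unfolding C1b_def using bcontfun_realI[OF c b] D by auto
qed

lemma C2bI:
  assumes f: "f \<in> C1b"
    and D: "\<And>x. gateaux_differentiable (gateaux_deriv f) x" "\<And>h k. continuous_on UNIV (\<lambda>x. gateaux_deriv2 f x h k)" "\<And>x. norm (gateaux_deriv2 f x) \<le> B2"
  shows "f \<in> C2b"
proof -
  have "(\<lambda>x. gateaux_deriv2 f x h k) \<in> bcontfun" for h k
  proof (rule bcontfun_realI[OF D(2)])
    fix x
    have "norm (gateaux_deriv2 f x h k) \<le> B2 * norm h * norm k"
      by (intro order_trans[OF norm_blinfun] mult_right_mono D) simp_all
    then show "\<bar>gateaux_deriv2 f x h k\<bar> \<le> B2 * norm h * norm k" by simp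
  qed
  then show ?thesis unfolding C2b_def using f D by auto
qed

lemma time_sup_norm_leI: "(\<And>t. t \<in> {0..T} \<Longrightarrow> N (g t) \<le> ennreal B) \<Longrightarrow> time_sup_norm N T g \<le> ennreal B"
  unfolding time_sup_norm_def by (rule SUP_least)

lemma time_sup_norm_upper: "t \<in> {0..T} \<Longrightarrow> N (g t) \<le> time_sup_norm N T g"
  unfolding time_sup_norm_def by (rule SUP_upper)

lemma Z2b_timeI:
  fixes v :: "real \<Rightarrow> 'a::real_normed_vector \<Rightarrow> real"
  assumes v: "continuous_on ({0..T} \<times> UNIV) (\<lambda>(t, x). v t x)" "\<And>t x. t \<in> {0..T} \<Longrightarrow> \<bar>v t x\<bar> \<le> B0"
    and D: "\<And>t x. t \<in> {0..T} \<Longrightarrow> gateaux_differentiable (v t) x"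
      "\<And>h. continuous_on ({0..T} \<times> UNIV) (\<lambda>(t, x). gateaux_deriv (v t) x h)"
      "\<And>t x. t \<in> {0..T} \<Longrightarrow> norm (gateaux_deriv (v t) x) \<le> B1"
    and Z: "\<And>t x h. t \<in> {0..T} \<Longrightarrow> norm (gateaux_deriv (v t) (x + 2 *\<^sub>R h) - 2 *\<^sub>R gateaux_deriv (v t) (x + h) + gateaux_deriv (v t) x) \<le> B2 * norm h"
    and B: "0 \<le> B0" "0 \<le> B1" "0 \<le> B2"
  shows "v \<in> Z2b_time T \<and> time_sup_norm norm_Z2b T v \<le> ennreal (B0 + B1 + B2)"
proof -
  have 1: "norm_C1b (v t) \<le> ennreal (B0 + B1)" if "t \<in> {0..T}" for t
    unfolding norm_C1b_def using v(2) D(3) that B by (auto simp: ennreal_plus intro!: add_mono sup_norm_leI)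
  have 2: "zygmund_seminorm (gateaux_deriv (v t)) \<le> ennreal B2" if "t \<in> {0..T}" for t
    by (rule zygmund_seminorm_leI[OF Z[OF that]])
  have 3: "norm_Z2b (v t) \<le> ennreal (B0 + B1 + B2)" if "t \<in> {0..T}" for t
    unfolding norm_Z2b_def using add_mono[OF 1[OF that] 2[OF that]] B by (simp add: ennreal_plus)
  then have n: "time_sup_norm norm_Z2b T v \<le> ennreal (B0 + B1 + B2)" by (rule time_sup_norm_leI)
  have c: "v t \<in> C1b" if "t \<in> {0..T}" for t
    by (rule C1bI[OF continuous_on_slice[OF v(1) that] v(2)[OF that] D(1)[OF that] continuous_on_slice[OF D(2) that] D(3)[OF that]])
  have "time_sup_norm norm_C1b T v \<le> ennreal (B0 + B1)" using 1 by (rule time_sup_norm_leI)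
  from le_less_trans[OF this] have "v \<in> C1b_time T"
    unfolding C1b_time_def using Cb_timeI[OF v] c D(2) by auto
  then have "v \<in> Z2b_time T"
    unfolding Z2b_time_def Z2b_def using c le_less_trans[OF 2] le_less_trans[OF n] by auto
  with n show ?thesis by blast
qed

lemma C2_holder_timeI:
  fixes v :: "real \<Rightarrow> 'a::real_normed_vector \<Rightarrow> real"
  assumes v: "continuous_on ({0..T} \<times> UNIV) (\<lambda>(t, x). v t x)" "\<And>t x. t \<in> {0..T} \<Longrightarrow> \<bar>v t x\<bar> \<le> B0"
    and D: "\<And>t x. t \<in> {0..T} \<Longrightarrow> gateaux_differentiable (v t) x"
      "\<And>h. continuous_on ({0..T} \<times> UNIV) (\<lambda>(t, x). gateaux_deriv (v t) x h)"
      "\<And>t x. t \<in> {0..T} \<Longrightarrow> norm (gateaux_deriv (v t) x) \<le> B1"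
    and D2: "\<And>t x. t \<in> {0..T} \<Longrightarrow> gateaux_differentiable (gateaux_deriv (v t)) x"
      "\<And>h k. continuous_on ({0..T} \<times> UNIV) (\<lambda>(t, x). gateaux_deriv2 (v t) x h k)"
      "\<And>t x. t \<in> {0..T} \<Longrightarrow> norm (gateaux_deriv2 (v t) x) \<le> B2"
    and H: "\<And>t x h. t \<in> {0..T} \<Longrightarrow> norm (gateaux_deriv2 (v t) (x + h) - gateaux_deriv2 (v t) x) \<le> B3 * norm h powr \<alpha>"
    and B: "0 \<le> B0" "0 \<le> B1" "0 \<le> B2" "0 \<le> B3"
  shows "v \<in> C2_holder_time \<alpha> T \<and> time_sup_norm (norm_C2_holder \<alpha>) T v \<le> ennreal (B0 + B1 + B2 + B3)"
proof -
  have 1: "norm_C2b (v t) \<le> ennreal (B0 + B1 + B2)" if "t \<in> {0..T}" for t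
    unfolding norm_C2b_def using v(2) D(3) D2(3) that B by (auto simp: ennreal_plus intro!: add_mono sup_norm_leI)
  have 2: "holder_seminorm \<alpha> (gateaux_deriv2 (v t)) \<le> ennreal B3" if "t \<in> {0..T}" for t
    by (rule holder_seminorm_leI[OF H[OF that]])
  have 3: "norm_C2_holder \<alpha> (v t) \<le> ennreal (B0 + B1 + B2 + B3)" if "t \<in> {0..T}" for t
    unfolding norm_C2_holder_def using add_mono[OF 1[OF that] 2[OF that]] B by (simp add: ennreal_plus)
  then have n: "time_sup_norm (norm_C2_holder \<alpha>) T v \<le> ennreal (B0 + B1 + B2 + B3)" by (rule time_sup_norm_leI)
  have c: "v t \<in> C1b" if "t \<in> {0..T}" for t
    by (rule C1bI[OF continuous_on_slice[OF v(1) that] v(2)[OF that] D(1)[OF that] continuous_on_slice[OF D(2) that] D(3)[OF that]])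
  have "v t \<in> C2b" if "t \<in> {0..T}" for t
    by (rule C2bI[OF c[OF that] D2(1)[OF that] continuous_on_slice[OF D2(2) that] D2(3)[OF that]])
  then have "v \<in> C2_holder_time \<alpha> T"
    unfolding C2_holder_time_def C2_holder_space_def using Cb_timeI[OF v] D(2) D2(2) le_less_trans[OF 2] le_less_trans[OF n] by auto
  with n show ?thesis by blast
qed

lemma has_gateaux_derivative_add:
  "has_gateaux_derivative F A x \<Longrightarrow> has_gateaux_derivative G B x \<Longrightarrow> has_gateaux_derivative (\<lambda>x. F x + G x) (A + B) x"
  unfolding has_gateaux_derivative_def by (auto simp: blinfun.add_left intro: has_vector_derivative_add)

section \<open>Mild solutions\<close>

text \<open>Reflection \<tau> = t - r; the closed and the open interval differ in two points, a null
  set.\<close>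

lemma (in source_term) duhamel_integral:
  assumes t: "t \<in> {0..T}" and g: "\<And>r. r \<in> {0..T} \<Longrightarrow> g r = (\<lambda>x. G (r, x))"
  shows "(LINT r:{0..t}|lborel. mehler S \<mu> (t - r) (g r) x) = V t x"
proof -
  let ?f = "\<lambda>r. indicator {0..t} r *\<^sub>R mehler S \<mu> (t - r) (g r) x"
  have "(\<integral>r. ?f r \<partial>lborel) = (\<integral>\<tau>. ?f (t + (-1) * \<tau>) \<partial>lborel)"
    using lborel_integral_real_affine[of "-1" ?f t] by simp
  also have "\<dots> = (\<integral>\<tau>. indicator {0<..<t} \<tau> *\<^sub>R w \<tau> t x \<partial>lborel)"
  proof (rule integral_discrete_difference[where X="{0, t}"])
    fix \<tau> assume "\<tau> \<notin> {0, t}"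
    then show "?f (t + (-1) * \<tau>) = indicator {0<..<t} \<tau> *\<^sub>R w \<tau> t x"
      using t g[of "t - \<tau>"] by (auto simp: indicator_def w_def)
  qed auto
  also have "\<dots> = V t x" unfolding V_def by (subst integral_restrict_space) auto
  finally show ?thesis unfolding set_lebesgue_integral_def .
qed

text \<open>Freezing the time outside [0, T] yields a continuous function on the whole space with
  the same bounds, as \<open>E_continuous\<close> requires.\<close>

lemma Cb_time_extend:
  assumes g: "g \<in> Cb_time T" and T: "0 < T"
  shows "continuous_on UNIV (\<lambda>(r, x). g (max 0 (min T r)) x)"
proof -
  have "continuous_on UNIV (\<lambda>p. (\<lambda>(t, x). g t x) (max 0 (min T (fst p)), snd p))"
    by (rule continuous_on_compose2[where s="UNIV" and t="{0..T} \<times> UNIV"])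
      (use g T in \<open>auto simp: Cb_time_def intro!: continuous_intros\<close>)
  then show ?thesis by (simp add: case_prod_beta')
qed

lemma Cb_time_sup_norm_finite:
  assumes "g \<in> Cb_time T"
  shows "time_sup_norm sup_norm T g < \<infinity>"
proof -
  obtain B where "\<And>t x. t \<in> {0..T} \<Longrightarrow> norm (g t x) \<le> B"
    using assms unfolding Cb_time_def bounded_iff by fastforce
  then have "time_sup_norm sup_norm T g \<le> ennreal B" by (intro time_sup_norm_leI sup_norm_leI)
  then show ?thesis by (rule le_less_trans) simp
qed

lemma ennreal_le_constant_mult:
  assumes "a \<le> C * b" "0 \<le> C" "0 \<le> b" "ennreal b \<le> K"
  shows "ennreal a \<le> ennreal C * K"
proof -
  have "ennreal a \<le> ennreal C * ennreal b" using assms by (simp add: ennreal_mult[symmetric] ennreal_leI)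
  also have "\<dots> \<le> ennreal C * K" using assms by (intro mult_left_mono) auto
  finally show ?thesis .
qed

context ou_semigroup
begin

text \<open>The initial datum contributes the constant 1, since averaging and contractions increase
  none of its seminorms. The source contributes T, 16 * T powr (1 / 2) and 12288 to the function,
  its derivative and the Zygmund seminorm.\<close>

lemma mild_solution_Z2b:
  assumes T: "0 < T" and f: "f \<in> Z2b" and g: "g \<in> Cb_time T" and v: "mild_solution (mehler S \<mu>) T f g v"
  shows "v \<in> Z2b_time T \<and> time_sup_norm norm_Z2b T v
    \<le> ennreal (12289 + T + 16 * T powr (1 / 2)) * (norm_Z2b f + time_sup_norm sup_norm T g)"
proof -
  define A0 where "A0 = enn2real (sup_norm f)"
  define A1 where "A1 = enn2real (sup_norm (gateaux_deriv f))"
  define Z where "Z = enn2real (zygmund_seminorm (gateaux_deriv f))"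
  define M where "M = enn2real (time_sup_norm sup_norm T g)"
  have nonneg: "0 \<le> A0" "0 \<le> A1" "0 \<le> Z" "0 \<le> M" by (simp_all add: A0_def A1_def Z_def M_def)
  have f1: "f \<in> C1b" and fz: "zygmund_seminorm (gateaux_deriv f) < \<infinity>" using f by (auto simp: Z2b_def)
  have fb: "f \<in> bcontfun" "\<And>x. gateaux_differentiable f x" "\<And>h. (\<lambda>x. gateaux_deriv f x h) \<in> bcontfun"
    using f1 by (auto simp: C1b_def)
  note fin = sup_norm_finite[OF fb(1)] sup_norm_gateaux_deriv_finite[OF f1] fz Cb_time_sup_norm_finite[OF g]
  have gM: "\<bar>g r x\<bar> \<le> M" if "r \<in> {0..T}" for r x
    using norm_le_enn2real[OF order_trans[OF sup_norm_upper[of "g r" x] time_sup_norm_upper[OF that, of sup_norm g]] fin(4)] by (simp add: M_def)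
  define G where "G = (\<lambda>(r, x). g (max 0 (min T r)) x)"
  have Gb: "\<bar>G p\<bar> \<le> M" for p using gM[of "max 0 (min T (fst p))"] T by (auto simp: G_def case_prod_beta)
  have Gc: "continuous_on UNIV G" unfolding G_def by (rule Cb_time_extend[OF g T])
  have Gcb: "cb M (\<lambda>x. G (r, x))" for r
    unfolding cb_def using Gb by (auto intro!: continuous_on_compose2[OF Gc] continuous_intros)
  \<comment> \<open>Bounded sources are the case \<alpha> = 0, with N the sup bound M.\<close>
  interpret source_term S \<mu> c s T M 0 M G
    by unfold_locales (use T Gc Gb nonneg smoothing_cb[OF Gcb] in auto)
  interpret ou_initial S \<mu> c s f A0 A1
  proof unfold_locales
    show "cb A0 f" using sup_norm_bound[OF fin(1)] bcontfun_continuous[OF fb(1)] by (auto simp: cb_def A0_def)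
    show "norm (gateaux_deriv f x) \<le> A1" for x unfolding A1_def by (rule sup_norm_bound[OF fin(2)])
    show "continuous_on UNIV (\<lambda>x. gateaux_deriv f x h)" for h by (rule bcontfun_continuous[OF fb(3)])
  qed (rule fb)
  have Zb: "norm (gateaux_deriv f (x + 2 *\<^sub>R h) - 2 *\<^sub>R gateaux_deriv f (x + h) + gateaux_deriv f x) \<le> Z * norm h" for x h
    unfolding Z_def by (rule zygmund_seminorm_bound[OF fin(3)])
  have gG: "g r = (\<lambda>x. G (r, x))" if "r \<in> {0..T}" for r using that by (simp add: G_def)
  have vt: "v t = (\<lambda>x. U t x + V t x)" if "t \<in> {0..T}" for t
    using v that duhamel_integral[OF that gG] by (auto simp: mild_solution_def)
  have d: "has_gateaux_derivative (v t) (gateaux_deriv (U t) x + gateaux_deriv (V t) x) x" if "t \<in> {0..T}" for t x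
    unfolding vt[OF that] using that by (intro has_gateaux_derivative_add DU V_derivative) auto
  have dv: "gateaux_deriv (v t) x = gateaux_deriv (U t) x + gateaux_deriv (V t) x" if "t \<in> {0..T}" for t x
    by (rule gateaux_deriv_eq[OF d[OF that]])
  have pb: "0 \<le> 16 * M * T powr (1 / 2)" "0 \<le> T * M" using nonneg T by auto
  have "v \<in> Z2b_time T \<and> time_sup_norm norm_Z2b T v \<le> ennreal ((A0 + T * M) + (A1 + 16 * M * T powr (1 / 2)) + (Z + 12288 * M))"
  proof (rule Z2b_timeI)
    show "continuous_on ({0..T} \<times> UNIV) (\<lambda>(t, x). v t x)"
      using continuous_on_add[OF mehler_time_continuous[OF f_cb, of T] V_continuous]
      by (rule continuous_on_eq) (auto simp: vt)
    show "continuous_on ({0..T} \<times> UNIV) (\<lambda>(t, x). gateaux_deriv (v t) x h)" for h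
      using continuous_on_add[OF DU_continuous[of T h] DV_continuous[of h]]
      by (rule continuous_on_eq) (auto simp: dv blinfun.add_left)
    fix t x and h :: 'a assume t: "t \<in> {0..T}"
    then have t': "0 \<le> t" "t \<le> T" by auto
    show "\<bar>v t x\<bar> \<le> A0 + T * M"
      unfolding vt[OF t] by (intro order_trans[OF abs_triangle_ineq] add_mono mehler_bound[OF _ f_cb] V_bound t')
    show "gateaux_differentiable (v t) x" using d[OF t] by (auto simp: gateaux_differentiable_def)
    show "norm (gateaux_deriv (v t) x) \<le> A1 + 16 * M * T powr (1 / 2)"
      unfolding dv[OF t] using DV_bound[OF t', of x] by (intro norm_triangle_mono DU_bound[OF t'(1)]) simp
    have "gateaux_deriv (v t) (x + 2 *\<^sub>R h) - 2 *\<^sub>R gateaux_deriv (v t) (x + h) + gateaux_deriv (v t) x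
      = (gateaux_deriv (U t) (x + 2 *\<^sub>R h) - 2 *\<^sub>R gateaux_deriv (U t) (x + h) + gateaux_deriv (U t) x)
      + (gateaux_deriv (V t) (x + 2 *\<^sub>R h) - 2 *\<^sub>R gateaux_deriv (V t) (x + h) + gateaux_deriv (V t) x)"
      unfolding dv[OF t] scaleR_add_right by simp
    also have "norm \<dots> \<le> Z * norm h + 12288 * M * norm h"
      by (intro norm_triangle_mono DU_zygmund[OF t'(1) Zb nonneg(3)] DV_zygmund[OF t'(1) refl])
    finally show "norm (gateaux_deriv (v t) (x + 2 *\<^sub>R h) - 2 *\<^sub>R gateaux_deriv (v t) (x + h) + gateaux_deriv (v t) x) \<le> (Z + 12288 * M) * norm h"
      by (simp add: distrib_right)
  qed (use nonneg pb in auto)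
  moreover have "ennreal ((A0 + T * M) + (A1 + 16 * M * T powr (1 / 2)) + (Z + 12288 * M))
    \<le> ennreal (12289 + T + 16 * T powr (1 / 2)) * (norm_Z2b f + time_sup_norm sup_norm T g)"
  proof (rule ennreal_le_constant_mult[where b="A0 + A1 + Z + M"])
    \<comment> \<open>The quantity is the right side minus the left side of the next
      inequality.\<close>
    have "0 \<le> (12288 + T + 16 * T powr (1 / 2)) * (A0 + A1 + Z) + M" using nonneg T by simp
    then show "(A0 + T * M) + (A1 + 16 * M * T powr (1 / 2)) + (Z + 12288 * M) \<le> (12289 + T + 16 * T powr (1 / 2)) * (A0 + A1 + Z + M)"
      by (simp add: algebra_simps)
    show "ennreal (A0 + A1 + Z + M) \<le> norm_Z2b f + time_sup_norm sup_norm T g"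
      unfolding norm_Z2b_def norm_C1b_def using nonneg fin by (simp add: A0_def A1_def Z_def M_def ennreal_plus)
  qed (use T nonneg in auto)
  ultimately show ?thesis using order_trans by blast
qed

text \<open>The same bookkeeping with N the Hoelder norm of the source: the added constants belong
  to the function, its first and second derivative and the Hoelder seminorm of the latter, in this
  order.\<close>

lemma mild_solution_C2_holder:
  assumes T: "0 < T" and \<alpha>01: "0 < \<alpha>" "\<alpha> < 1" and f: "f \<in> C2_holder_space \<alpha>" and g: "g \<in> holder_time \<alpha> T"
    and v: "mild_solution (mehler S \<mu>) T f g v"
  shows "v \<in> C2_holder_time \<alpha> T \<and> time_sup_norm (norm_C2_holder \<alpha>) T v
    \<le> ennreal (1 + T + 16 * T powr ((\<alpha> + 1) / 2) + 192 * T powr (\<alpha> / 2) / \<alpha> + 3072 * (2 / \<alpha> + 2 / (1 - \<alpha>)))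
      * (norm_C2_holder \<alpha> f + time_sup_norm (norm_holder \<alpha>) T g)"
proof -
  define A0 where "A0 = enn2real (sup_norm f)"
  define A1 where "A1 = enn2real (sup_norm (gateaux_deriv f))"
  define A2 where "A2 = enn2real (sup_norm (gateaux_deriv2 f))"
  define Z where "Z = enn2real (holder_seminorm \<alpha> (gateaux_deriv2 f))"
  define M where "M = enn2real (time_sup_norm (norm_holder \<alpha>) T g)"
  have nonneg: "0 \<le> A0" "0 \<le> A1" "0 \<le> A2" "0 \<le> Z" "0 \<le> M" by (simp_all add: A0_def A1_def A2_def Z_def M_def)
  have f2: "f \<in> C2b" and fz: "holder_seminorm \<alpha> (gateaux_deriv2 f) < \<infinity>" using f by (auto simp: C2_holder_space_def)
  have f1: "f \<in> C1b" and fd2: "\<And>x. gateaux_differentiable (gateaux_deriv f) x" using f2 by (auto simp: C2b_def)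
  have fb: "f \<in> bcontfun" "\<And>x. gateaux_differentiable f x" "\<And>h. (\<lambda>x. gateaux_deriv f x h) \<in> bcontfun"
    using f1 by (auto simp: C1b_def)
  have gc: "g \<in> Cb_time T" and gfin: "time_sup_norm (norm_holder \<alpha>) T g < \<infinity>"
    using g by (auto simp: holder_time_def)
  note fin = sup_norm_finite[OF fb(1)] sup_norm_gateaux_deriv_finite[OF f1] sup_norm_gateaux_deriv2_finite[OF f2] fz gfin
  have gh: "norm_holder \<alpha> (g r) \<le> time_sup_norm (norm_holder \<alpha>) T g" if "r \<in> {0..T}" for r
    by (rule time_sup_norm_upper[OF that])
  have gM: "\<bar>g r x\<bar> \<le> M" if "r \<in> {0..T}" for r x
  proof -
    have "ennreal (norm (g r x)) \<le> norm_holder \<alpha> (g r)"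
      unfolding norm_holder_def by (rule order_trans[OF sup_norm_upper]) simp
    from norm_le_enn2real[OF order_trans[OF this gh[OF that]] gfin] show ?thesis by (simp add: M_def)
  qed
  have gN: "\<bar>g r (x + h) - g r x\<bar> \<le> M * norm h powr \<alpha>" if "r \<in> {0..T}" for r x h
  proof -
    have l: "holder_seminorm \<alpha> (g r) \<le> time_sup_norm (norm_holder \<alpha>) T g"
      by (rule order_trans[OF _ gh[OF that]]) (simp add: norm_holder_def)
    have "norm (g r (x + h) - g r x) \<le> enn2real (holder_seminorm \<alpha> (g r)) * norm h powr \<alpha>"
      by (rule holder_seminorm_bound[OF le_less_trans[OF l gfin]])
    also have "\<dots> \<le> M * norm h powr \<alpha>"
      unfolding M_def using l gfin by (intro mult_right_mono enn2real_mono) auto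
    finally show ?thesis by simp
  qed
  define G where "G = (\<lambda>(r, x). g (max 0 (min T r)) x)"
  have cl: "max 0 (min T r) \<in> {0..T}" for r using T by auto
  have Gb: "\<bar>G p\<bar> \<le> M" for p using gM[OF cl] by (simp add: G_def case_prod_beta)
  have Gc: "continuous_on UNIV G" unfolding G_def by (rule Cb_time_extend[OF gc T])
  have Gcb: "cb M (\<lambda>x. G (r, x))" for r
    unfolding cb_def using Gb by (auto intro!: continuous_on_compose2[OF Gc] continuous_intros)
  have Gs: "smoothing \<alpha> M (\<lambda>x. G (r, x))" for r
    by (rule smoothing_holder[OF \<alpha>01 Gcb _ nonneg(5)]) (use gN[OF cl] in \<open>simp add: G_def\<close>)
  interpret source_term S \<mu> c s T M \<alpha> M G
    by unfold_locales (use T \<alpha>01 Gc Gb nonneg Gs in auto)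
  interpret ou_initial2 S \<mu> c s f A0 A1 A2 Z \<alpha>
  proof unfold_locales
    show "cb A0 f" using sup_norm_bound[OF fin(1)] bcontfun_continuous[OF fb(1)] by (auto simp: cb_def A0_def)
    show "norm (gateaux_deriv f x) \<le> A1" for x unfolding A1_def by (rule sup_norm_bound[OF fin(2)])
    show "norm (gateaux_deriv2 f x) \<le> A2" for x unfolding A2_def by (rule sup_norm_bound[OF fin(3)])
    show "continuous_on UNIV (\<lambda>x. gateaux_deriv f x h)" for h by (rule bcontfun_continuous[OF fb(3)])
    show "norm (gateaux_deriv2 f (x + h) - gateaux_deriv2 f x) \<le> Z * norm h powr \<alpha>" for x h
      unfolding Z_def by (rule holder_seminorm_bound[OF fin(4)])
  qed (rule fb fd2 \<alpha>01 nonneg)+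
  have gG: "g r = (\<lambda>x. G (r, x))" if "r \<in> {0..T}" for r using that by (simp add: G_def)
  have vt: "v t = (\<lambda>x. U t x + V t x)" if "t \<in> {0..T}" for t
    using v that duhamel_integral[OF that gG] by (auto simp: mild_solution_def)
  have d: "has_gateaux_derivative (v t) (gateaux_deriv (U t) x + gateaux_deriv (V t) x) x" if "t \<in> {0..T}" for t x
    unfolding vt[OF that] using that by (intro has_gateaux_derivative_add DU V_derivative) auto
  have dv: "gateaux_deriv (v t) = (\<lambda>x. gateaux_deriv (U t) x + gateaux_deriv (V t) x)" if "t \<in> {0..T}" for t
    by (rule ext, rule gateaux_deriv_eq[OF d[OF that]])
  have d2: "has_gateaux_derivative (gateaux_deriv (v t)) (gateaux_deriv2 (U t) x + gateaux_deriv2 (V t) x) x" if "t \<in> {0..T}" for t x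
    unfolding dv[OF that] using that \<alpha>01 by (intro has_gateaux_derivative_add D2U V_derivative2) auto
  have d2v: "gateaux_deriv2 (v t) x = gateaux_deriv2 (U t) x + gateaux_deriv2 (V t) x" if "t \<in> {0..T}" for t x
    by (rule gateaux_deriv_eq[OF d2[OF that]])
  define K1 where "K1 = 16 * T powr ((\<alpha> + 1) / 2)"
  define K2 where "K2 = 192 * T powr (\<alpha> / 2) / \<alpha>"
  define K3 where "K3 = 3072 * (2 / \<alpha> + 2 / (1 - \<alpha>))"
  have K: "0 \<le> K1" "0 \<le> K2" "0 \<le> K3" using \<alpha>01 by (simp_all add: K1_def K2_def K3_def)
  have pb: "0 \<le> K1 * M" "0 \<le> K2 * M" "0 \<le> K3 * M" "0 \<le> T * M" using nonneg T K by auto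
  have "v \<in> C2_holder_time \<alpha> T \<and> time_sup_norm (norm_C2_holder \<alpha>) T v
    \<le> ennreal ((A0 + T * M) + (A1 + K1 * M) + (A2 + K2 * M) + (Z + K3 * M))"
  proof (rule C2_holder_timeI)
    show "continuous_on ({0..T} \<times> UNIV) (\<lambda>(t, x). v t x)"
      using continuous_on_add[OF mehler_time_continuous[OF f_cb, of T] V_continuous]
      by (rule continuous_on_eq) (auto simp: vt)
    show "continuous_on ({0..T} \<times> UNIV) (\<lambda>(t, x). gateaux_deriv (v t) x h)" for h
      using continuous_on_add[OF DU_continuous[of T h] DV_continuous[of h]]
      by (rule continuous_on_eq) (auto simp: dv blinfun.add_left)
    show "continuous_on ({0..T} \<times> UNIV) (\<lambda>(t, x). gateaux_deriv2 (v t) x h k)" for h k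
      using continuous_on_add[OF D2U_continuous[of T h k] DDV_continuous[OF \<alpha>01(1), of h k]]
      by (rule continuous_on_eq) (auto simp: d2v blinfun.add_left)
    fix t x and h :: 'a assume t: "t \<in> {0..T}"
    then have t': "0 \<le> t" "t \<le> T" by auto
    show "\<bar>v t x\<bar> \<le> A0 + T * M"
      unfolding vt[OF t] by (intro order_trans[OF abs_triangle_ineq] add_mono mehler_bound[OF _ f_cb] V_bound t')
    show "gateaux_differentiable (v t) x" using d[OF t] by (auto simp: gateaux_differentiable_def)
    show "gateaux_differentiable (gateaux_deriv (v t)) x" using d2[OF t] by (auto simp: gateaux_differentiable_def)
    show "norm (gateaux_deriv (v t) x) \<le> A1 + K1 * M"
      unfolding dv[OF t] using DV_bound[OF t', of x] by (intro norm_triangle_mono DU_bound[OF t'(1)]) (simp add: K1_def mult_ac)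
    show "norm (gateaux_deriv2 (v t) x) \<le> A2 + K2 * M"
      unfolding d2v[OF t] using DDV_bound[OF t' \<alpha>01(1), of x] by (intro norm_triangle_mono D2U_bound[OF t'(1)]) (simp add: K2_def mult_ac)
    have "gateaux_deriv2 (v t) (x + h) - gateaux_deriv2 (v t) x
      = (gateaux_deriv2 (U t) (x + h) - gateaux_deriv2 (U t) x) + (gateaux_deriv2 (V t) (x + h) - gateaux_deriv2 (V t) x)"
      unfolding d2v[OF t] by simp
    also have "norm \<dots> \<le> Z * norm h powr \<alpha> + 3072 * M * (2 / \<alpha> + 2 / (1 - \<alpha>)) * norm h powr \<alpha>"
      by (intro norm_triangle_mono D2U_holder[OF t'(1)] DDV_holder[OF t'(1) \<alpha>01(1)])
    also have "\<dots> = (Z + K3 * M) * norm h powr \<alpha>"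
      unfolding K3_def distrib_right[of Z] by (simp add: mult_ac)
    finally show "norm (gateaux_deriv2 (v t) (x + h) - gateaux_deriv2 (v t) x) \<le> (Z + K3 * M) * norm h powr \<alpha>" .
  qed (use nonneg pb in auto)
  moreover have "ennreal ((A0 + T * M) + (A1 + K1 * M) + (A2 + K2 * M) + (Z + K3 * M))
    \<le> ennreal (1 + T + K1 + K2 + K3) * (norm_C2_holder \<alpha> f + time_sup_norm (norm_holder \<alpha>) T g)"
  proof (rule ennreal_le_constant_mult[where b="A0 + A1 + A2 + Z + M"])
    have "0 \<le> (T + K1 + K2 + K3) * (A0 + A1 + A2 + Z) + M" using nonneg K T by simp
    then show "(A0 + T * M) + (A1 + K1 * M) + (A2 + K2 * M) + (Z + K3 * M) \<le> (1 + T + K1 + K2 + K3) * (A0 + A1 + A2 + Z + M)"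
      by (simp add: algebra_simps)
    show "ennreal (A0 + A1 + A2 + Z + M) \<le> norm_C2_holder \<alpha> f + time_sup_norm (norm_holder \<alpha>) T g"
      unfolding norm_C2_holder_def norm_C2b_def using nonneg fin by (simp add: A0_def A1_def A2_def Z_def M_def ennreal_plus)
  qed (use T nonneg K in auto)
  ultimately show ?thesis unfolding K1_def K2_def K3_def using order_trans by blast
qed

end

theorem theorem5p7:
  fixes c s T :: real
    and S :: "real \<Rightarrow> L2 \<Rightarrow>\<^sub>L L2"
    and \<mu> :: "real \<Rightarrow> L2 measure"
    and L :: "((L2 \<Rightarrow>\<^sub>C real) \<times> (L2 \<Rightarrow>\<^sub>C real)) set"
  assumes "0 \<le> c" and "0 < s" and "s < 1" and "0 < T"
    and "C0_semigroup S" and "semigroup_generator S = dirichlet_laplacian"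
    and "\<forall>t\<ge>0. prob_space (\<mu> t) \<and> sets (\<mu> t) = sets borel"
    and "\<forall>t\<ge>0. \<forall>x. (\<integral>y. iexp (x \<bullet> y) \<partial>\<mu> t) =
           of_real (exp (- (LINT r:{0..t}|lborel.
             (norm (S r x))\<^sup>2 + c * norm (S r x) powr (2 * s))))"
    and "is_generator (mehler S \<mu>) L"
  shows "(\<exists>C>0. \<forall>f\<in>Z2b. \<forall>g\<in>Cb_time T. \<forall>v. mild_solution (mehler S \<mu>) T f g v \<longrightarrow>
           v \<in> Z2b_time T \<and>
           time_sup_norm norm_Z2b T v
             \<le> ennreal C * (norm_Z2b f + time_sup_norm sup_norm T g)) \<and>
         (\<forall>\<alpha>. 0 < \<alpha> \<and> \<alpha> < 1 \<longrightarrow>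
           (\<exists>C>0. \<forall>f\<in>C2_holder_space \<alpha>. \<forall>g\<in>holder_time \<alpha> T. \<forall>v.
              mild_solution (mehler S \<mu>) T f g v \<longrightarrow>
              v \<in> C2_holder_time \<alpha> T \<and>
              time_sup_norm (norm_C2_holder \<alpha>) T v
                \<le> ennreal C * (norm_C2_holder \<alpha> f + time_sup_norm (norm_holder \<alpha>) T g)))"
proof -
  \<comment> \<open>Here the concrete Laplacian enters, through the symmetry and the sign of its
    Dirichlet form.\<close>
  interpret heat: heat_semigroup S
  proof
    show "C0_semigroup S" by (rule assms(5))
    show "w \<bullet> v = u \<bullet> z" if "(u, w) \<in> semigroup_generator S" "(v, z) \<in> semigroup_generator S" for u w v z
      using that unfolding assms(6) by (rule dirichlet_laplacian_symmetric)
    show "w \<bullet> u \<le> 0" if "(u, w) \<in> semigroup_generator S" for u w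
      using that unfolding assms(6) by (rule dirichlet_laplacian_dissipative)
  qed
  interpret ou_semigroup S \<mu> c s
    by (intro ou_semigroup.intro heat.heat_semigroup_axioms ou_semigroup_axioms.intro; (simp add: assms)?)
  show ?thesis
  proof (intro conjI allI impI)
    have "0 < 12289 + T + 16 * T powr (1 / 2)" using \<open>0 < T\<close> by (simp add: add_pos_nonneg)
    then show "\<exists>C>0. \<forall>f\<in>Z2b. \<forall>g\<in>Cb_time T. \<forall>v. mild_solution (mehler S \<mu>) T f g v \<longrightarrow>
           v \<in> Z2b_time T \<and> time_sup_norm norm_Z2b T v \<le> ennreal C * (norm_Z2b f + time_sup_norm sup_norm T g)"
      using mild_solution_Z2b[OF \<open>0 < T\<close>] by blast
  next
    fix \<alpha> :: real assume \<alpha>: "0 < \<alpha> \<and> \<alpha> < 1"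
    have "0 < 1 + T + 16 * T powr ((\<alpha> + 1) / 2) + 192 * T powr (\<alpha> / 2) / \<alpha> + 3072 * (2 / \<alpha> + 2 / (1 - \<alpha>))"
      using \<open>0 < T\<close> \<alpha> by (intro add_pos_nonneg) auto
    then show "\<exists>C>0. \<forall>f\<in>C2_holder_space \<alpha>. \<forall>g\<in>holder_time \<alpha> T. \<forall>v. mild_solution (mehler S \<mu>) T f g v \<longrightarrow>
        v \<in> C2_holder_time \<alpha> T \<and> time_sup_norm (norm_C2_holder \<alpha>) T v
          \<le> ennreal C * (norm_C2_holder \<alpha> f + time_sup_norm (norm_holder \<alpha>) T g)"
      using mild_solution_C2_holder[OF \<open>0 < T\<close>] \<alpha> by blast
  qed
qed

end
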